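(* Let $k$ be a field of characteristic zero, let $a\in k^{\times}$ with $a\notin k^2$, and let $m\in k$ with $m\ne 0,4a$. Let $U\subset\mathbb{A}^3_k$ be the affine variety defined by $$ax^2+y^2+z^2-xyz=m.$$ If $[k(\sqrt a,\sqrt m,\sqrt{m-4a}):k]=4$ and $\dfrac{\sqrt{m-4a}}{\sqrt{ma}}\in k$, then $$H^1(k,\mathrm{Pic}(\overline U))\cong \mathbb{Z}/2\oplus\mathbb{Z}/4 .$$
   Context: $\overline k$ is a separable closure of $k$, $\overline U=U\times_k\overline k$, $\mathrm{Pic}$ denotes the Picard group, and $H^1(k,-)$ is Galois cohomology of $\mathrm{Gal}(\overline k/k)$. *)

theory Defs
  imports
    "HOL-Algebra.Algebraic_Closure_Type"
    "HOL-Algebra.Generated_Fields"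
    "HOL-Algebra.Embedded_Algebras"
    "HOL-Algebra.Elementary_Groups"
    "HOL-Algebra.Module"
    "HOL-Analysis.Abstract_Topology"
begin

section \<open>The Picard group of a commutative ring\<close>

definition linear_maps ::
  "('r, 'a) ring_scheme \<Rightarrow> ('r, 'm, 'b) module_scheme \<Rightarrow> ('r, 'n, 'c) module_scheme \<Rightarrow> ('m \<Rightarrow> 'n) set"
  where "linear_maps R M N =
    {h \<in> carrier M \<rightarrow> carrier N.
       (\<forall>x\<in>carrier M. \<forall>y\<in>carrier M. h (x \<oplus>\<^bsub>M\<^esub> y) = h x \<oplus>\<^bsub>N\<^esub> h y) \<and>
       (\<forall>r\<in>carrier R. \<forall>x\<in>carrier M. h (r \<odot>\<^bsub>M\<^esub> x) = r \<odot>\<^bsub>N\<^esub> h x)}"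

definition module_iso ::
  "('r, 'a) ring_scheme \<Rightarrow> ('r, 'm, 'b) module_scheme \<Rightarrow> ('r, 'n, 'c) module_scheme \<Rightarrow> bool"
  where "module_iso R M N \<longleftrightarrow>
    (\<exists>h\<in>linear_maps R M N. bij_betw h (carrier M) (carrier N))"

definition bilinear_maps ::
  "('r, 'a) ring_scheme \<Rightarrow> ('r, 'm, 'b) module_scheme \<Rightarrow> ('r, 'n, 'c) module_scheme \<Rightarrow>
   ('r, 'p, 'd) module_scheme \<Rightarrow> ('m \<Rightarrow> 'n \<Rightarrow> 'p) set"
  where "bilinear_maps R M N P =
    {t. (\<forall>x\<in>carrier M. t x \<in> linear_maps R N P) \<and>
        (\<forall>y\<in>carrier N. (\<lambda>x. t x y) \<in> linear_maps R M P)}"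

text \<open>
  \<open>is_tensor R M N P\<close>: the module \<open>P\<close> is a tensor product of \<open>M\<close> and \<open>N\<close> over \<open>R\<close>, i.e. it
  carries a universal bilinear map.  All modules have their elements in the type \<open>'r list\<close>,
  whose cardinality is that of the countable direct sum of copies of \<open>'r\<close> if \<open>'r\<close> is infinite
  (and countably infinite otherwise).  Hence the usual tensor product of two such modules is
  again isomorphic to a module of this kind, and testing the universal property against such
  modules only determines \<open>P\<close> up to isomorphism as the usual tensor product.
\<close>

definition is_tensor ::
  "('r, 'a) ring_scheme \<Rightarrow> ('r, 'r list) module \<Rightarrow> ('r, 'r list) module \<Rightarrow> ('r, 'r list) module \<Rightarrow> bool"
  where "is_tensor R M N P \<longleftrightarrow>
    (\<exists>t\<in>bilinear_maps R M N P.
       \<forall>Q :: ('r, 'r list) module. module R Q \<longrightarrow>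
         (\<forall>s\<in>bilinear_maps R M N Q.
            \<exists>!h. h \<in> linear_maps R P Q \<and> h \<in> extensional (carrier P) \<and>
                 (\<forall>x\<in>carrier M. \<forall>y\<in>carrier N. h (t x y) = s x y)))"

text \<open>
  The multiplicative part of a module record has no meaning for a module; here it is the
  multiplication of \<open>R\<close>.
\<close>

definition regular_module :: "('r, 'a) ring_scheme \<Rightarrow> ('r, 'r) module"
  where "regular_module R =
    \<lparr>carrier = carrier R, monoid.mult = monoid.mult R, one = one R, zero = zero R, add = add R,
     module.smult = monoid.mult R\<rparr>"

definition iso_class ::
  "('r, 'a) ring_scheme \<Rightarrow> ('r, 'm, 'b) module_scheme \<Rightarrow> ('r, 'r list) module set"
  where "iso_class R M = {N. module R N \<and> module_iso R M N}"

definition module_class_monoid :: "('r, 'a) ring_scheme \<Rightarrow> ('r, 'r list) module set monoid"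
  where "module_class_monoid R =
    \<lparr>carrier = iso_class R ` {M :: ('r, 'r list) module. module R M},
     monoid.mult = (\<lambda>A B. {P. module R P \<and> (\<exists>M\<in>A. \<exists>N\<in>B. is_tensor R M N P)}),
     one = iso_class R (regular_module R)\<rparr>"

text \<open>
  The Picard group is the group of isomorphism classes of invertible modules, i.e. those with an
  inverse for the tensor product.  Invertible modules are finitely generated, so up to
  isomorphism all of them have their elements in \<open>'r list\<close>.  For an affine scheme this
  is the Picard group of the scheme, invertible sheaves corresponding to invertible modules over
  the coordinate ring.
\<close>

definition Pic :: "('r, 'a) ring_scheme \<Rightarrow> ('r, 'r list) module set monoid"
  where "Pic R = units_of (module_class_monoid R)"

definition restrict_scalars :: "('r \<Rightarrow> 'r) \<Rightarrow> ('r, 'm) module \<Rightarrow> ('r, 'm) module"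
  where "restrict_scalars u M = M\<lparr>module.smult := (\<lambda>r. module.smult M (u r))\<rparr>"

section \<open>First cohomology of a topological group with discrete coefficients\<close>

text \<open>
  The group \<open>A\<close> is abelian (written multiplicatively), discrete, and the group \<open>G\<close>, with topology
  \<open>T\<close>, acts on it by \<open>act\<close>.
\<close>

definition cocycles ::
  "('g, 'x) monoid_scheme \<Rightarrow> 'g topology \<Rightarrow> ('a, 'y) monoid_scheme \<Rightarrow> ('g \<Rightarrow> 'a \<Rightarrow> 'a) \<Rightarrow> ('g \<Rightarrow> 'a) monoid"
  where "cocycles G T A act =
    \<lparr>carrier = {f \<in> carrier G \<rightarrow>\<^sub>E carrier A.
        continuous_map T (discrete_topology (carrier A)) f \<and>
        (\<forall>g\<in>carrier G. \<forall>h\<in>carrier G. f (g \<otimes>\<^bsub>G\<^esub> h) = f g \<otimes>\<^bsub>A\<^esub> act g (f h))},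
     monoid.mult = (\<lambda>f f'. \<lambda>g\<in>carrier G. f g \<otimes>\<^bsub>A\<^esub> f' g),
     one = (\<lambda>g\<in>carrier G. \<one>\<^bsub>A\<^esub>)\<rparr>"

definition coboundaries ::
  "('g, 'x) monoid_scheme \<Rightarrow> ('a, 'y) monoid_scheme \<Rightarrow> ('g \<Rightarrow> 'a \<Rightarrow> 'a) \<Rightarrow> ('g \<Rightarrow> 'a) set"
  where "coboundaries G A act =
    (\<lambda>a. \<lambda>g\<in>carrier G. act g a \<otimes>\<^bsub>A\<^esub> inv\<^bsub>A\<^esub> a) ` carrier A"

definition H1 ::
  "('g, 'x) monoid_scheme \<Rightarrow> 'g topology \<Rightarrow> ('a, 'y) monoid_scheme \<Rightarrow> ('g \<Rightarrow> 'a \<Rightarrow> 'a) \<Rightarrow>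
   ('g \<Rightarrow> 'a) set monoid"
  where "H1 G T A act = cocycles G T A act Mod coboundaries G A act"

section \<open>The absolute Galois group\<close>

text \<open>
  The base field is \<open>'k\<close>, of characteristic zero in the application, so that its algebraic
  closure \<open>'k alg_closure\<close> is a separable closure.
\<close>

definition absolute_galois_group :: "('k::field alg_closure \<Rightarrow> 'k alg_closure) monoid"
  where "absolute_galois_group =
    \<lparr>carrier = {\<sigma> \<in> ring_iso ring_of_type_algebra ring_of_type_algebra. \<forall>c. \<sigma> (to_ac c) = to_ac c},
     monoid.mult = (\<circ>), one = id\<rparr>"

text \<open>
  The basic open sets are the cosets \<open>\<sigma> Gal(L)\<close> for the subextensions \<open>L\<close> generated by a finite
  set \<open>F\<close>, that is, for the finite subextensions.
\<close>

definition krull_topology :: "('k::field alg_closure \<Rightarrow> 'k alg_closure) topology"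
  where "krull_topology = topology_generated_by
    {{\<tau> \<in> carrier absolute_galois_group. \<forall>x\<in>F. \<tau> x = \<sigma> x} | \<sigma> F.
       \<sigma> \<in> carrier absolute_galois_group \<and> finite F}"

section \<open>The affine surface\<close>

text \<open>The ring \<open>'c[x,y,z]\<close> is rendered as \<open>'c poly poly poly\<close>.\<close>

definition surface_poly :: "'c::field \<Rightarrow> 'c \<Rightarrow> 'c poly poly poly"
  where "surface_poly a m =
    (let C = (\<lambda>c. [:[:[:c:]:]:]); x = [:[:[:0, 1:]:]:]; y = [:[:0, 1:]:]; z = [:0, 1:]
     in C a * x^2 + y^2 + z^2 - x * y * z - C m)"

definition coordinate_ring :: "'c::field \<Rightarrow> 'c \<Rightarrow> 'c poly poly poly set ring"
  where "coordinate_ring a m =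
    ring_of_type_algebra Quot (PIdl\<^bsub>ring_of_type_algebra\<^esub> (surface_poly a m))"

text \<open>
  The automorphism of the coordinate ring (whose elements are cosets) over the algebraic closure
  induced by \<open>\<sigma>\<close>, which fixes \<open>x\<close>, \<open>y\<close>, \<open>z\<close> and acts on the constants by \<open>\<sigma>\<close>.
\<close>

definition galois_coordinate_ring ::
  "('c \<Rightarrow> 'c::field) \<Rightarrow> 'c poly poly poly set \<Rightarrow> 'c poly poly poly set"
  where "galois_coordinate_ring \<sigma> = image (map_poly (map_poly (map_poly \<sigma>)))"

text \<open>
  \<open>\<sigma>\<close> sends the class of \<open>M\<close> to that of its base change along the automorphism of the coordinate
  ring induced by \<open>\<sigma>\<close>, which is \<open>M\<close> with scalars acting through the inverse automorphism.
  This is a left action; for an ideal \<open>I\<close> the result is isomorphic to \<open>\<sigma>(I)\<close>.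
\<close>

definition galois_Pic ::
  "('c \<Rightarrow> 'c::field) \<Rightarrow>
   ('c poly poly poly set, 'c poly poly poly set list) module set \<Rightarrow>
   ('c poly poly poly set, 'c poly poly poly set list) module set"
  where "galois_Pic \<sigma> A = restrict_scalars (galois_coordinate_ring (inv_into UNIV \<sigma>)) ` A"

definition H1_Pic_surface ::
  "'k::field \<Rightarrow> 'k \<Rightarrow>
   (('k alg_closure \<Rightarrow> 'k alg_closure) \<Rightarrow>
     ('k alg_closure poly poly poly set, 'k alg_closure poly poly poly set list) module set) set monoid"
  where "H1_Pic_surface a m =
    H1 absolute_galois_group krull_topology (Pic (coordinate_ring (to_ac a) (to_ac m))) galois_Pic"

end

theory Submission
  imports Defs "HOL-Library.Product_Plus"
begin

text \<open>
  Put \<open>\<alpha> = \<surd>a\<close>, \<open>\<mu> = \<surd>m\<close>, \<open>\<delta> = \<surd>(m - 4a)\<close>, so that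
  \<open>\<delta>\<^sup>2 = \<mu>\<^sup>2 - 4\<alpha>\<^sup>2\<close>, and let \<open>K\<close> be the algebraic closure. The
  proof computes the Picard group of the surface over \<open>K\<close> as a Galois module, a lattice of rank four on which
  the Galois group acts through a Klein four-group, and then the cohomology of this lattice.

  The Picard group. For a domain \<open>S\<close> inside a field, \<open>Pic S\<close> is the group of invertible fractional
  ideals modulo the principal ones (\<open>tensor_iprod\<close>, \<open>invertible_module_rep\<close>,
  \<open>Pic_carrier\<close>). With \<open>\<rho>\<^sub>1 = (\<mu> + \<delta>)/2\<close> and
  \<open>\<rho>\<^sub>2 = (\<mu> - \<delta>)/2\<close>, so that
  \<open>\<rho>\<^sub>1\<rho>\<^sub>2 = \<alpha>\<^sup>2\<close>, the surface contains the line
  \<open>z = \<mu>, y = \<rho>\<^sub>1x\<close>. For fixed \<open>x\<close> the equation is that of a conic through the point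
  of this line over \<open>x\<close>, and a line through this point meets the conic in one further point: putting
  \<open>Z = z - \<mu>\<close> and \<open>y = \<rho>\<^sub>1x + sZ\<close> makes the equation linear in \<open>Z\<close>, and
  \<open>Z = -L/q\<close> with \<open>q = s\<^sup>2 - xs + 1\<close> and
  \<open>L = \<delta>xs + 2\<mu> - \<rho>\<^sub>1x\<^sup>2\<close>. So the coordinate ring is a subring of
  \<open>K(x,s)\<close> (\<open>phi3_eq_0_iff\<close>). If \<open>Q = qZ\<^sup>2\<close> and \<open>G = ZQ\<close>, then
  inverting \<open>G\<close> gives the factorial ring \<open>K[x,s,1/(qL)]\<close> (\<open>TT_eq_TP\<close>), whose units are
  the \<open>c q\<^sup>iL\<^sup>j\<close>. Hence every invertible ideal is, up to scaling, a divisor of a power of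
  \<open>G\<close>, and the prime divisors of \<open>G\<close> are lines: \<open>(Z) = P\<^sub>0P\<^sub>1\<close> and
  \<open>(Q) = P\<^sub>0\<^sup>2 A B C D\<close> (\<open>rel_Z\<close>, \<open>rel_Q\<close>). The Picard group is thus
  generated by six lines with these two relations, and it is free on \<open>P\<^sub>0, A, B, C\<close>
  (\<open>lattice_class_bij\<close>).

  The action. As \<open>\<delta> = c\<alpha>\<mu>\<close> with \<open>c\<close> in the base field, the signs by which an
  automorphism multiplies \<open>\<alpha>\<close> and \<open>\<mu>\<close> determine the images of the lines, hence the
  action on the lattice (\<open>galois_lattice_class\<close>). The hypotheses make \<open>a\<close>, \<open>m\<close>
  and \<open>am\<close> nonsquares, and then all pairs of signs occur (\<open>degree_four_nonsquare\<close>,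
  \<open>sign_automorphism\<close>).

  The cohomology. An automorphism fixing \<open>\<alpha>\<close> and \<open>\<mu>\<close> acts trivially, and some power of
  it lies in any given neighbourhood of the identity; since the lattice is torsion-free, continuous cocycles vanish on such
  automorphisms (\<open>cocycle_trivial\<close>). A cocycle is therefore given by its values at two automorphisms
  \<open>s\<close> and \<open>t\<close> that change the sign of \<open>\<alpha>\<close> only and of \<open>\<mu>\<close>
  only. These values are subject to the relations of the four-group, which leaves four integers \<open>P, A, B, d\<close>
  (\<open>klein_cocycle_relations\<close>), and the coboundaries are those with \<open>A + B\<close> even and
  \<open>P + 2A + 2d\<close> divisible by \<open>4\<close> (\<open>klein_coboundary_iff\<close>). The classes of these two
  integers modulo \<open>2\<close> and \<open>4\<close> identify the first cohomology with
  \<open>\<int>/2 \<oplus> \<int>/4\<close>.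
\<close>

section \<open>Invertible fractional ideals\<close>

locale subring_of_field =
  fixes S :: "'f::field set"
  assumes S_one [simp]: "1 \<in> S"
    and S_add [intro]: "x \<in> S \<Longrightarrow> y \<in> S \<Longrightarrow> x + y \<in> S"
    and S_mult [intro]: "x \<in> S \<Longrightarrow> y \<in> S \<Longrightarrow> x * y \<in> S"
    and S_uminus [intro]: "x \<in> S \<Longrightarrow> - x \<in> S"
begin

lemma S_zero [simp]: "0 \<in> S"
  using S_add[of 1 "-1"] S_uminus[of 1] by simp

lemma S_diff [intro]: "x \<in> S \<Longrightarrow> y \<in> S \<Longrightarrow> x - y \<in> S"
  using S_add[of x "-y"] by auto

lemma S_power [intro]: "x \<in> S \<Longrightarrow> x ^ n \<in> S"
  by (induction n) auto

definition submod :: "'f set \<Rightarrow> bool" where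
  "submod I \<longleftrightarrow> 0 \<in> I \<and> (\<forall>x\<in>I. \<forall>y\<in>I. x + y \<in> I) \<and> (\<forall>r\<in>S. \<forall>x\<in>I. r * x \<in> I)"

lemma submodI: "0 \<in> I \<Longrightarrow> (\<And>x y. x \<in> I \<Longrightarrow> y \<in> I \<Longrightarrow> x + y \<in> I) \<Longrightarrow>
   (\<And>r x. r \<in> S \<Longrightarrow> x \<in> I \<Longrightarrow> r * x \<in> I) \<Longrightarrow> submod I"
  by (auto simp: submod_def)

lemma submod_0 [simp]: "submod I \<Longrightarrow> 0 \<in> I"
  and submod_add: "submod I \<Longrightarrow> x \<in> I \<Longrightarrow> y \<in> I \<Longrightarrow> x + y \<in> I"
  and submod_smult: "submod I \<Longrightarrow> r \<in> S \<Longrightarrow> x \<in> I \<Longrightarrow> r * x \<in> I"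
  by (auto simp: submod_def)

lemma submod_smult': "submod I \<Longrightarrow> r \<in> S \<Longrightarrow> x \<in> I \<Longrightarrow> x * r \<in> I"
  using submod_smult[of I r x] by (simp add: mult.commute)

lemma submod_uminus: "submod I \<Longrightarrow> x \<in> I \<Longrightarrow> - x \<in> I"
  using submod_smult[of I "-1" x] S_uminus[of 1] by simp

lemma submod_S [simp]: "submod S"
  by (auto intro: submodI)

inductive_set iprod :: "'f set \<Rightarrow> 'f set \<Rightarrow> 'f set" for I J where
  iprod_zero: "0 \<in> iprod I J"
| iprod_step: "x \<in> I \<Longrightarrow> y \<in> J \<Longrightarrow> z \<in> iprod I J \<Longrightarrow> x * y + z \<in> iprod I J"

lemma iprod_mult: "x \<in> I \<Longrightarrow> y \<in> J \<Longrightarrow> x * y \<in> iprod I J"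
  using iprod_step[of x I y J 0] iprod_zero by simp

lemma iprod_add: "x \<in> iprod I J \<Longrightarrow> y \<in> iprod I J \<Longrightarrow> x + y \<in> iprod I J"
  by (induction rule: iprod.induct) (auto simp: add.assoc intro: iprod_step)

lemma iprod_submod [intro]:
  assumes "submod I" shows "submod (iprod I J)"
proof (rule submodI)
  fix r x assume r: "r \<in> S" and "x \<in> iprod I J"
  from this(2) show "r * x \<in> iprod I J"
  proof induction
    case (iprod_step x y z)
    have "(r * x) * y + r * z \<in> iprod I J"
      using iprod_step r assms by (intro iprod.intros) (auto intro: submod_smult)
    thus ?case by (simp add: algebra_simps)
  qed (auto intro: iprod_zero)
qed (auto intro: iprod_zero iprod_add)

lemma iprod_least:
  assumes "submod K" "\<And>x y. x \<in> I \<Longrightarrow> y \<in> J \<Longrightarrow> x * y \<in> K"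
  shows "iprod I J \<subseteq> K"
proof
  fix z assume "z \<in> iprod I J" thus "z \<in> K"
    by induction (use assms in \<open>auto intro: submod_add\<close>)
qed

lemma iprod_mono: "I \<subseteq> I' \<Longrightarrow> J \<subseteq> J' \<Longrightarrow> iprod I J \<subseteq> iprod I' J'"
proof
  fix z assume "I \<subseteq> I'" "J \<subseteq> J'" "z \<in> iprod I J"
  from this(3,1,2) show "z \<in> iprod I' J'"
    by induction (auto intro: iprod.intros)
qed

lemma iprod_commute: "iprod I J = iprod J I"
proof -
  have "z \<in> iprod J I" if "z \<in> iprod I J" for z and I J :: "'f set"
    using that
  proof induction
    case (iprod_step x y z)
    thus ?case using iprod.iprod_step[of y J x I z] by (simp add: mult.commute)
  qed (rule iprod_zero)
  thus ?thesis by blast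
qed

lemma iprod_assoc:
  assumes "submod I" "submod K"
  shows "iprod (iprod I J) K = iprod I (iprod J K)"
proof -
  have sub: "submod (iprod I (iprod J K))" "submod (iprod (iprod I J) K)"
    using assms by auto
  have 1: "x * y \<in> iprod I (iprod J K)" if "x \<in> iprod I J" "y \<in> K" for x y
    using that(1)
  proof induction
    case (iprod_step u v z)
    have "u * (v * y) \<in> iprod I (iprod J K)"
      using iprod_step that by (intro iprod_mult)
    with iprod_step show ?case by (simp add: algebra_simps iprod_add)
  qed (auto intro: iprod_zero)
  have 2: "x * y \<in> iprod (iprod I J) K" if "x \<in> I" "y \<in> iprod J K" for x y
    using that(2)
  proof induction
    case (iprod_step u v z)
    have "(x * u) * v \<in> iprod (iprod I J) K"
      using iprod_step that by (intro iprod_mult)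
    with iprod_step show ?case by (simp add: algebra_simps iprod_add)
  qed (auto intro: iprod_zero)
  show ?thesis
    by (intro equalityI iprod_least sub 1 2)
qed

lemma iprod_S: assumes "submod I" shows "iprod S I = I" "iprod I S = I"
proof -
  have "iprod S I \<subseteq> I" using assms by (intro iprod_least) (auto intro: submod_smult)
  moreover have "I \<subseteq> iprod S I" using iprod_mult[of 1 S _ I] by auto
  ultimately show "iprod S I = I" by blast
  thus "iprod I S = I" by (simp add: iprod_commute)
qed

definition scale :: "'f \<Rightarrow> 'f set \<Rightarrow> 'f set" where "scale u I = (*) u ` I"

lemma submod_scale [intro]: "submod I \<Longrightarrow> submod (scale u I)"
proof (rule submodI)
  assume I: "submod I"
  show "0 \<in> scale u I" using I by (auto simp: scale_def intro: image_eqI[of _ _ 0])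
  show "x + y \<in> scale u I" if "x \<in> scale u I" "y \<in> scale u I" for x y
    using that submod_add[OF I] by (auto simp: scale_def simp flip: distrib_left)
  show "r * x \<in> scale u I" if "r \<in> S" "x \<in> scale u I" for r x
    using that submod_smult[OF I] by (auto simp: scale_def mult.left_commute[of r])
qed

lemma scale_scale: "scale u (scale v I) = scale (u * v) I"
  by (auto simp: scale_def image_image mult.assoc)

lemma scale_1 [simp]: "scale 1 I = I"
  by (auto simp: scale_def)

lemma scale_mem_iff: "u \<noteq> 0 \<Longrightarrow> x \<in> scale u I \<longleftrightarrow> x / u \<in> I"
  by (auto simp: scale_def intro: image_eqI[of _ _ "x / u"])

lemma scale_prod1: "iprod (scale u I) J = scale u (iprod I J)"
proof
  show "iprod (scale u I) J \<subseteq> scale u (iprod I J)"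
  proof
    fix z assume "z \<in> iprod (scale u I) J"
    thus "z \<in> scale u (iprod I J)"
    proof induction
      case iprod_zero thus ?case
        unfolding scale_def by (rule image_eqI[of _ _ 0]) (auto intro: iprod.iprod_zero)
    next
      case (iprod_step x y z)
      then obtain x' z' where "x = u * x'" "x' \<in> I" "z = u * z'" "z' \<in> iprod I J"
        by (auto simp: scale_def)
      thus ?case using iprod_step unfolding scale_def
        by (intro image_eqI[of _ _ "x' * y + z'"]) (auto simp: distrib_left mult.assoc intro: iprod.iprod_step)
    qed
  qed
  show "scale u (iprod I J) \<subseteq> iprod (scale u I) J"
  proof -
    have "u * z \<in> iprod (scale u I) J" if "z \<in> iprod I J" for z
      using that
    proof induction
      case (iprod_step x y z)
      have "(u * x) * y + u * z \<in> iprod (scale u I) J"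
        using iprod_step by (intro iprod.intros) (auto simp: scale_def)
      thus ?case by (simp add: algebra_simps)
    qed (auto intro: iprod_zero)
    thus ?thesis by (auto simp: scale_def)
  qed
qed

lemma scale_prod2: "iprod I (scale u J) = scale u (iprod I J)"
  by (metis iprod_commute scale_prod1)

definition Inv :: "'f set monoid" where
  "Inv = \<lparr>carrier = {I. submod I \<and> (\<exists>J. submod J \<and> iprod I J = S)}, monoid.mult = iprod, one = S\<rparr>"

lemma Inv_simps [simp]: "monoid.mult Inv = iprod" "one Inv = S"
  by (simp_all add: Inv_def)

lemma InvI: "submod I \<Longrightarrow> submod J \<Longrightarrow> iprod I J = S \<Longrightarrow> I \<in> carrier Inv"
  by (auto simp: Inv_def)

lemma InvD: "I \<in> carrier Inv \<Longrightarrow> submod I"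
  by (auto simp: Inv_def)

lemma Inv_obtain:
  assumes "I \<in> carrier Inv" obtains J where "J \<in> carrier Inv" "iprod I J = S"
  using assms by (auto simp: Inv_def iprod_commute)

sublocale Inv: comm_group Inv
proof (rule comm_groupI)
  fix x y assume "x \<in> carrier Inv" "y \<in> carrier Inv"
  then obtain x' y' where *: "submod x" "submod y" "submod x'" "submod y'"
    "iprod x x' = S" "iprod y y' = S" by (auto simp: Inv_def)
  have "iprod (iprod x y) (iprod y' x') = iprod x (iprod y (iprod y' x'))"
    using *(1,2,3,4) iprod_submod[of y' x'] by (intro iprod_assoc)
  also have "iprod y (iprod y' x') = iprod (iprod y y') x'"
    using *(1,2,3,4) by (intro iprod_assoc[symmetric])
  also have "iprod x \<dots> = S" unfolding *(6) using *(3,5) by (simp only: iprod_S)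
  finally show "x \<otimes>\<^bsub>Inv\<^esub> y \<in> carrier Inv"
    using * InvI[of "iprod x y" "iprod y' x'"] iprod_submod by (simp only: Inv_simps)
next
  show "\<one>\<^bsub>Inv\<^esub> \<in> carrier Inv" by (auto intro: InvI[of _ S] simp: iprod_S)
next
  fix x assume "x \<in> carrier Inv"
  thus "\<exists>y\<in>carrier Inv. y \<otimes>\<^bsub>Inv\<^esub> x = \<one>\<^bsub>Inv\<^esub>"
    by (auto simp: Inv_def iprod_commute)
next
  fix x y assume "x \<in> carrier Inv" "y \<in> carrier Inv"
  show "x \<otimes>\<^bsub>Inv\<^esub> y = y \<otimes>\<^bsub>Inv\<^esub> x" by (simp add: iprod_commute[of x])
qed (simp_all add: iprod_assoc iprod_S InvD)

lemma Inv_nonzero: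
  assumes "I \<in> carrier Inv" obtains x where "x \<in> I" "x \<noteq> 0"
proof (cases "I \<subseteq> {0}")
  case True
  obtain J where J: "iprod I J = S" using assms by (auto simp: Inv_def)
  have "iprod I J \<subseteq> {0}" using True by (intro iprod_least) (auto intro: submodI)
  hence "(1::'f) \<in> {0}" using S_one unfolding J by blast
  hence False by simp
  thus ?thesis ..
qed (use that in auto)

lemma scale_Inv [intro]:
  assumes "I \<in> carrier Inv" "u \<noteq> 0" shows "scale u I \<in> carrier Inv"
proof -
  obtain J where J: "submod J" "iprod I J = S" using assms by (auto simp: Inv_def)
  have "iprod (scale u I) (scale (1/u) J) = S"
    using J assms(2) by (simp add: scale_prod1 scale_prod2 scale_scale)
  thus ?thesis using J(1) InvD[OF assms(1)] by (intro InvI[of _ "scale (1/u) J"] submod_scale)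
qed

lemma S_Inv [simp]: "S \<in> carrier Inv"
  using Inv.one_closed by simp

lemma prin_Inv [intro]: "u \<noteq> 0 \<Longrightarrow> scale u S \<in> carrier Inv"
  by auto

lemma prin_prod: "submod I \<Longrightarrow> iprod (scale u S) I = scale u I"
  by (simp add: scale_prod1 iprod_S)

lemma prin_mult: "iprod (scale u S) (scale v S) = scale (u * v) S"
  by (simp add: scale_prod1 scale_prod2 scale_scale iprod_S mult.commute)

lemma prin_mem: "u \<in> scale u S"
  by (auto simp: scale_def intro: image_eqI[of _ _ 1])

lemma prin_least: "submod I \<Longrightarrow> u \<in> I \<Longrightarrow> scale u S \<subseteq> I"
  by (auto simp: scale_def intro: submod_smult')

lemma Inv_cancel: "I \<in> carrier Inv \<Longrightarrow> J \<in> carrier Inv \<Longrightarrow> K \<in> carrier Inv \<Longrightarrow>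
    iprod I J = iprod I K \<longleftrightarrow> J = K"
  using Inv.l_cancel[of I J K] by auto

text \<open>
  A nonzero element of the inverse ideal multiplies \<open>I\<close> into \<open>S\<close>.
\<close>

lemma Inv_integral:
  assumes "I \<in> carrier Inv" obtains u where "u \<noteq> 0" "scale u I \<subseteq> S"
proof -
  obtain J where J: "J \<in> carrier Inv" "iprod I J = S" using assms Inv_obtain by blast
  obtain u where "u \<in> J" "u \<noteq> 0" using J Inv_nonzero by blast
  moreover from this have "scale u I \<subseteq> S"
    using J iprod_mult[of _ I u J] by (auto simp: scale_def mult.commute)
  ultimately show ?thesis using that by blast
qed

subsection \<open>Factorisation into invertible primes\<close>

definition iprime :: "'f set \<Rightarrow> bool" where
  "iprime P \<longleftrightarrow> P \<in> carrier Inv \<and> P \<subseteq> S \<and> P \<noteq> S \<and> (\<forall>x\<in>S. \<forall>y\<in>S. x * y \<in> P \<longrightarrow> x \<in> P \<or> y \<in> P)"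

lemma iprimeD: "iprime P \<Longrightarrow> P \<in> carrier Inv" "iprime P \<Longrightarrow> P \<subseteq> S" "iprime P \<Longrightarrow> submod P"
  by (auto simp: iprime_def dest: InvD)

lemma iprod_subset: "submod J \<Longrightarrow> I \<subseteq> S \<Longrightarrow> iprod I J \<subseteq> J"
  by (intro iprod_least) (auto intro: submod_smult)

lemma iprod_subset': "submod I \<Longrightarrow> J \<subseteq> S \<Longrightarrow> iprod I J \<subseteq> I"
  using iprod_subset[of I J] by (simp add: iprod_commute)

lemma iprime_prod:
  assumes "iprime P" "I \<subseteq> S" "J \<subseteq> S" "iprod I J \<subseteq> P"
  shows "I \<subseteq> P \<or> J \<subseteq> P"
proof (rule ccontr)
  assume "\<not> ?thesis"
  then obtain x y where "x \<in> I" "x \<notin> P" "y \<in> J" "y \<notin> P" by auto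
  moreover have "x * y \<in> P" using assms iprod_mult[of x I y J] calculation by auto
  ultimately show False using assms unfolding iprime_def by blast
qed

text \<open>
  The cofactor is \<open>I P\<^sup>-\<^sup>1\<close>, which lies in \<open>P P\<^sup>-\<^sup>1 = S\<close>.
\<close>

lemma Inv_divide:
  assumes "P \<in> carrier Inv" "I \<in> carrier Inv" "I \<subseteq> P"
  obtains I' where "I' \<in> carrier Inv" "I' \<subseteq> S" "I = iprod P I'"
proof -
  obtain P' where P': "P' \<in> carrier Inv" "iprod P P' = S" using assms Inv_obtain by blast
  have "iprod I P' \<subseteq> iprod P P'" using assms by (intro iprod_mono) auto
  moreover have "iprod P (iprod I P') = I"
    using P' assms Inv.m_lcomm[of P I P'] InvD[of I] by (simp add: iprod_S)
  moreover have "iprod I P' \<in> carrier Inv" using Inv.m_closed[of I P'] P' assms by simp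
  ultimately show ?thesis using that P' by blast
qed

definition lprod :: "'f set list \<Rightarrow> 'f set" where "lprod Ps = foldr iprod Ps S"

lemma lprod_simps [simp]: "lprod [] = S" "lprod (P # Ps) = iprod P (lprod Ps)"
  by (auto simp: lprod_def)

lemma lprod_Inv [intro]: "set Ps \<subseteq> carrier Inv \<Longrightarrow> lprod Ps \<in> carrier Inv"
proof (induction Ps)
  case (Cons P Ps)
  thus ?case using Inv.m_closed[of P "lprod Ps"] by simp
qed auto

lemma lprod_append: "set Ps \<subseteq> carrier Inv \<Longrightarrow> set Qs \<subseteq> carrier Inv \<Longrightarrow>
   lprod (Ps @ Qs) = iprod (lprod Ps) (lprod Qs)"
proof (induction Ps)
  case (Cons P Ps)
  thus ?case using Inv.m_assoc[of P "lprod Ps" "lprod Qs"] by auto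
qed (auto simp: iprod_S lprod_Inv InvD)

lemma lprod_integral: "\<forall>P\<in>set Ps. submod P \<and> P \<subseteq> S \<Longrightarrow> lprod Ps \<subseteq> S"
proof (induction Ps)
  case (Cons P Ps)
  thus ?case using iprod_subset'[of P "lprod Ps"] by auto
qed auto

lemma lprod_subset: "P \<in> set Ps \<Longrightarrow> \<forall>P\<in>set Ps. P \<in> carrier Inv \<and> P \<subseteq> S \<Longrightarrow> lprod Ps \<subseteq> P"
proof (induction Ps)
  case (Cons Q Ps)
  have *: "lprod Ps \<subseteq> S" "lprod Ps \<in> carrier Inv" "Q \<in> carrier Inv" "Q \<subseteq> S"
    using Cons.prems by (auto intro!: lprod_integral dest: InvD)
  show ?case
  proof (cases "P = Q")
    case True thus ?thesis using * iprod_subset'[of Q "lprod Ps"] InvD by auto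
  next
    case False
    thus ?thesis using * iprod_subset[of "lprod Ps" Q] InvD Cons by auto
  qed
qed auto

text \<open>
  Each prime of the list contains \<open>I J\<close>, hence contains \<open>I\<close> or \<open>J\<close>, divides it and can
  be cancelled.
\<close>

lemma divisor_of_primes:
  assumes "\<forall>P\<in>set Ps. iprime P" "I \<in> carrier Inv" "I \<subseteq> S" "J \<in> carrier Inv" "J \<subseteq> S"
    "iprod I J = lprod Ps"
  shows "\<exists>Qs. set Qs \<subseteq> set Ps \<and> I = lprod Qs"
  using assms
proof (induction Ps arbitrary: I J)
  case Nil
  have "S \<subseteq> I" using Nil iprod_subset'[of I J] InvD by auto
  hence "I = S" using Nil by blast
  thus ?case by (intro exI[of _ "[]"]) (simp del: S_one)
next
  case (Cons P Ps)
  have "\<forall>Q\<in>set Ps. submod Q \<and> Q \<subseteq> S" "set Ps \<subseteq> carrier Inv"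
    using Cons.prems(1) iprimeD(1)[of "_::'f set"] iprimeD(2)[of "_::'f set"] iprimeD(3)[of "_::'f set"] by simp_all blast+
  hence P: "iprime P" "P \<in> carrier Inv" "lprod Ps \<in> carrier Inv" "lprod Ps \<subseteq> S"
    using Cons.prems(1) lprod_Inv[of Ps] lprod_integral[of Ps] iprimeD(1)[of P] by simp_all
  have "iprod I J \<subseteq> P" using Cons.prems P iprod_subset'[of P "lprod Ps"] InvD by auto
  then consider "I \<subseteq> P" | "J \<subseteq> P" using iprime_prod P Cons.prems by blast
  thus ?case
  proof cases
    case 1
    then obtain I' where I': "I' \<in> carrier Inv" "I' \<subseteq> S" "I = iprod P I'"
      using Inv_divide[of P I] P Cons.prems by blast
    have "iprod P (iprod I' J) = iprod P (lprod Ps)"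
      using Cons.prems I' P Inv.m_assoc[of P I' J] by simp
    hence "iprod I' J = lprod Ps"
      using Inv_cancel[of P "iprod I' J" "lprod Ps"] I' P Cons.prems Inv.m_closed[of I' J] by simp
    then obtain Qs where "set Qs \<subseteq> set Ps" "I' = lprod Qs"
      using Cons.IH[of I' J] Cons.prems I' by (auto dest: iprimeD)
    thus ?thesis using I' by (intro exI[of _ "P # Qs"]) auto
  next
    case 2
    then obtain J' where J': "J' \<in> carrier Inv" "J' \<subseteq> S" "J = iprod P J'"
      using Inv_divide[of P J] P Cons.prems by blast
    have "iprod P (iprod I J') = iprod P (lprod Ps)"
      using Cons.prems J' P Inv.m_lcomm[of P I J'] by simp
    hence "iprod I J' = lprod Ps"
      using Inv_cancel[of P "iprod I J'" "lprod Ps"] J' P Cons.prems Inv.m_closed[of I J'] by simp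
    then obtain Qs where "set Qs \<subseteq> set Ps" "I = lprod Qs"
      using Cons.IH[of I J'] Cons.prems J' by auto
    thus ?thesis by (intro exI[of _ Qs]) auto
  qed
qed

text \<open>
  The cancellation of the primes from \<open>I J\<close> is forced if none of them contains both factors. For a product of
  two functions whose divisor consists of known lines this reduces the divisor of each function to the question on which
  lines the other one vanishes.
\<close>

lemma split_primes:
  assumes "\<forall>P\<in>set Ps. iprime P" "I \<in> carrier Inv" "I \<subseteq> S" "J \<in> carrier Inv" "J \<subseteq> S"
    "iprod I J = lprod Ps" "\<forall>P\<in>set Ps. \<not> I \<subseteq> P \<or> \<not> J \<subseteq> P"
  shows "I = lprod (filter (\<lambda>P. \<not> J \<subseteq> P) Ps)"
  using assms
proof (induction Ps arbitrary: I J)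
  case Nil
  have "S \<subseteq> I" using Nil iprod_subset'[of I J] InvD by auto
  hence "I = S" using Nil by blast
  thus ?case by simp
next
  case (Cons P Ps)
  have "\<forall>Q\<in>set Ps. submod Q \<and> Q \<subseteq> S" "set Ps \<subseteq> carrier Inv"
    using Cons.prems(1) iprimeD(1)[of "_::'f set"] iprimeD(2)[of "_::'f set"] iprimeD(3)[of "_::'f set"] by simp_all blast+
  hence P: "iprime P" "P \<in> carrier Inv" "lprod Ps \<in> carrier Inv" "lprod Ps \<subseteq> S"
    using Cons.prems(1) lprod_Inv[of Ps] lprod_integral[of Ps] iprimeD(1)[of P] by simp_all
  have IJP: "iprod I J \<subseteq> P" using Cons.prems P iprod_subset'[of P "lprod Ps"] InvD by auto
  show ?case
  proof (cases "J \<subseteq> P")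
    case False
    hence "I \<subseteq> P" using iprime_prod[OF P(1) _ _ IJP] Cons.prems by blast
    then obtain I' where I': "I' \<in> carrier Inv" "I' \<subseteq> S" "I = iprod P I'"
      using Inv_divide[of P I] P Cons.prems by blast
    have "iprod P (iprod I' J) = iprod P (lprod Ps)"
      using Cons.prems I' P Inv.m_assoc[of P I' J] by simp
    hence eq: "iprod I' J = lprod Ps"
      using Inv_cancel[of P "iprod I' J" "lprod Ps"] I' P Cons.prems Inv.m_closed[of I' J] by simp
    have "I \<subseteq> I'" using I' iprod_subset[of I' P] P InvD iprimeD(2) by auto
    hence "\<forall>Q\<in>set Ps. \<not> I' \<subseteq> Q \<or> \<not> J \<subseteq> Q" using Cons.prems(7) by (meson list.set_intros(2) subset_trans)
    moreover have "\<forall>Q\<in>set Ps. iprime Q" using Cons.prems(1) by simp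
    ultimately have "I' = lprod (filter (\<lambda>P. \<not> J \<subseteq> P) Ps)"
      using Cons.IH[OF _ I'(1,2) Cons.prems(4,5) eq] by blast
    thus ?thesis using I' False by simp
  next
    case True
    then obtain J' where J': "J' \<in> carrier Inv" "J' \<subseteq> S" "J = iprod P J'"
      using Inv_divide[of P J] P Cons.prems by blast
    have "iprod P (iprod I J') = iprod P (lprod Ps)"
      using Cons.prems J' P Inv.m_lcomm[of P I J'] by simp
    hence eq: "iprod I J' = lprod Ps"
      using Inv_cancel[of P "iprod I J'" "lprod Ps"] J' P Cons.prems Inv.m_closed[of I J'] by simp
    have JJ': "J \<subseteq> J'" using J' iprod_subset[of J' P] P InvD iprimeD(2) by auto
    have iff: "J' \<subseteq> Q \<longleftrightarrow> J \<subseteq> Q" if "Q \<in> set Ps" for Q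
    proof
      assume "J \<subseteq> Q"
      hence "\<not> I \<subseteq> Q" using Cons.prems that by auto
      moreover have "iprod I J' \<subseteq> Q"
        unfolding eq using that Cons.prems(1) iprimeD(1,2) by (intro lprod_subset) (simp, simp)
      ultimately show "J' \<subseteq> Q" using iprime_prod[of Q I J'] that Cons.prems J' by auto
    qed (use JJ' in auto)
    have "I = lprod (filter (\<lambda>P. \<not> J' \<subseteq> P) Ps)"
      using Cons.prems J'(1,2) eq iff by (intro Cons.IH[of I J']) auto
    also have "filter (\<lambda>P. \<not> J' \<subseteq> P) Ps = filter (\<lambda>P. \<not> J \<subseteq> P) Ps"
      using iff by (intro filter_cong) auto
    finally show ?thesis using True by simp
  qed
qed

text \<open>
  If the positive powers are separated from the negative ones, two products of primes are equal. A prime occurring in one of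
  them contains the other one, hence contains one of its prime factors; as there are no inclusions between distinct primes,
  it would occur on both sides.
\<close>

lemma prime_powers_independent:
  fixes n :: "'f set \<Rightarrow> int"
  assumes fin: "finite A" and pr: "\<And>P. P \<in> A \<Longrightarrow> iprime P"
    and inc: "\<And>P Q. P \<in> A \<Longrightarrow> Q \<in> A \<Longrightarrow> P \<subseteq> Q \<Longrightarrow> P = Q"
    and eq: "finprod Inv (\<lambda>P. P [^]\<^bsub>Inv\<^esub> n P) A = S" and "P \<in> A"
  shows "n P = 0"
proof -
  have cl: "A \<subseteq> carrier Inv" using pr iprimeD by auto
  define pos where "pos m = finprod Inv (\<lambda>P. P [^]\<^bsub>Inv\<^esub> nat (m P)) A" for m :: "'f set \<Rightarrow> int"
  have pos_cl: "pos m \<in> carrier Inv" for m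
    unfolding pos_def using cl by (intro Inv.finprod_closed) auto
  have split: "finprod Inv (\<lambda>P. P [^]\<^bsub>Inv\<^esub> m P) A = pos m \<otimes>\<^bsub>Inv\<^esub> inv\<^bsub>Inv\<^esub> (pos (\<lambda>P. - m P))" for m
  proof -
    have inv: "inv\<^bsub>Inv\<^esub> (pos (\<lambda>P. - m P)) = finprod Inv (\<lambda>P. inv\<^bsub>Inv\<^esub> (P [^]\<^bsub>Inv\<^esub> nat (- m P))) A"
      unfolding pos_def using fin cl
      by (induction rule: finite_induct) (auto simp: Inv.inv_mult_group Inv.m_comm Pi_def subset_iff simp del: Inv_simps)
    have c1: "(\<lambda>P. P [^]\<^bsub>Inv\<^esub> nat (m P)) \<in> A \<rightarrow> carrier Inv"
      using cl by (intro Pi_I Inv.nat_pow_closed) blast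
    have c2: "(\<lambda>P. inv\<^bsub>Inv\<^esub> (P [^]\<^bsub>Inv\<^esub> nat (- m P))) \<in> A \<rightarrow> carrier Inv"
      using cl by (intro Pi_I Inv.inv_closed Inv.nat_pow_closed) blast
    have c3: "(\<lambda>P. P [^]\<^bsub>Inv\<^esub> m P) \<in> A \<rightarrow> carrier Inv"
      using cl by (intro Pi_I Inv.int_pow_closed) blast
    have "pos m \<otimes>\<^bsub>Inv\<^esub> inv\<^bsub>Inv\<^esub> (pos (\<lambda>P. - m P)) = finprod Inv (\<lambda>P. P [^]\<^bsub>Inv\<^esub> nat (m P) \<otimes>\<^bsub>Inv\<^esub> inv\<^bsub>Inv\<^esub> (P [^]\<^bsub>Inv\<^esub> nat (- m P))) A"
      unfolding inv unfolding pos_def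
      by (intro Inv.finprod_multf [symmetric] c1 c2)
    also have "\<dots> = finprod Inv (\<lambda>P. P [^]\<^bsub>Inv\<^esub> m P) A"
    proof (intro Inv.finprod_cong' refl)
      fix P assume "P \<in> A"
      hence "P \<in> carrier Inv" using cl by blast
      hence cP: "P [^]\<^bsub>Inv\<^esub> k \<in> carrier Inv" for k :: nat by (rule Inv.nat_pow_closed)
      show "P [^]\<^bsub>Inv\<^esub> nat (m P) \<otimes>\<^bsub>Inv\<^esub> inv\<^bsub>Inv\<^esub> (P [^]\<^bsub>Inv\<^esub> nat (- m P)) = P [^]\<^bsub>Inv\<^esub> m P"
      proof (cases "m P < 0")
        case True
        hence "nat (m P) = 0" by simp
        thus ?thesis using True Inv.l_one[OF Inv.inv_closed[OF cP]]
          by (simp only: int_pow_def2 if_True Inv.nat_pow_0)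
      next
        case False
        hence "nat (- m P) = 0" by simp
        thus ?thesis using False Inv.r_one[OF cP]
          by (simp only: int_pow_def2 if_False Inv.nat_pow_0 Inv.inv_one)
      qed
    qed (rule c3)
    finally show ?thesis by (rule sym)
  qed
  \<comment> \<open>Applied to \<open>n\<close> and to \<open>- n\<close>, this gives the claim.\<close>
  have key: "n P \<le> 0" if eq: "pos n = pos (\<lambda>P. - n P)" and "P \<in> A" for n P
  proof (rule ccontr)
    assume "\<not> n P \<le> 0"
    hence n: "n P > 0" by simp
    have powint: "Q [^]\<^bsub>Inv\<^esub> k \<subseteq> S" if "Q \<in> A" for Q and k :: nat
      using that
    proof (induction k)
      case (Suc k)
      have "submod (Q [^]\<^bsub>Inv\<^esub> k)" using Inv.nat_pow_closed[of Q k] cl Suc.prems InvD by auto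
      thus ?case using Suc iprod_subset'[of "Q [^]\<^bsub>Inv\<^esub> k" Q] pr[of Q] iprimeD(2)[of Q] by auto
    qed auto
    have fpint: "finprod Inv (\<lambda>P. P [^]\<^bsub>Inv\<^esub> (k P::nat)) B \<subseteq> S" if "B \<subseteq> A" for B k
    proof -
      have "finite B" using fin that finite_subset by auto
      thus ?thesis using that
      proof (induction rule: finite_induct)
        case (insert Q B)
        have cB: "Q [^]\<^bsub>Inv\<^esub> k Q \<in> carrier Inv" using insert cl by (auto intro: Inv.nat_pow_closed)
        have "finprod Inv (\<lambda>P. P [^]\<^bsub>Inv\<^esub> (k P::nat)) (insert Q B)
           = iprod (Q [^]\<^bsub>Inv\<^esub> k Q) (finprod Inv (\<lambda>P. P [^]\<^bsub>Inv\<^esub> (k P::nat)) B)"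
          using insert cl cB by (subst Inv.finprod_insert) (auto simp: subset_iff)
        also have "\<dots> \<subseteq> Q [^]\<^bsub>Inv\<^esub> k Q"
          using insert cB by (intro iprod_subset') (auto dest: InvD)
        finally show ?case using powint[of Q "k Q"] insert by auto
      qed auto
    qed
    have prP: "iprime P" using that pr by auto
    have "pos n \<subseteq> P"
    proof -
      have "pos n = P [^]\<^bsub>Inv\<^esub> nat (n P) \<otimes>\<^bsub>Inv\<^esub> finprod Inv (\<lambda>P. P [^]\<^bsub>Inv\<^esub> nat (n P)) (A - {P})"
        unfolding pos_def using fin that cl
        by (subst insert_Diff[OF \<open>P \<in> A\<close>, symmetric], subst Inv.finprod_insert) auto
      also have "\<dots> \<subseteq> P [^]\<^bsub>Inv\<^esub> nat (n P)"
      proof -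
        have "P [^]\<^bsub>Inv\<^esub> nat (n P) \<in> carrier Inv" using cl that by (intro Inv.nat_pow_closed) auto
        thus ?thesis
          using fpint[of "A - {P}" "\<lambda>P. nat (n P)"] InvD
            iprod_subset'[of "P [^]\<^bsub>Inv\<^esub> nat (n P)" "finprod Inv (\<lambda>P. P [^]\<^bsub>Inv\<^esub> nat (n P)) (A - {P})"]
          by simp
      qed
      also have "\<dots> = P [^]\<^bsub>Inv\<^esub> Suc (nat (n P) - 1)" using n by simp
      also have "\<dots> \<subseteq> P"
      proof -
        have "iprod (P [^]\<^bsub>Inv\<^esub> (nat (n P) - 1)) P \<subseteq> P"
          using powint[OF \<open>P \<in> A\<close>] prP iprimeD by (intro iprod_subset) auto
        thus ?thesis by simp
      qed
      finally show ?thesis .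
    qed
    hence sub: "pos (\<lambda>P. - n P) \<subseteq> P" using eq by simp
    have "\<exists>Q\<in>A. nat (- n Q) > 0 \<and> Q \<subseteq> P"
    proof -
      have powP: "Q \<subseteq> P \<and> k > 0" if "Q [^]\<^bsub>Inv\<^esub> (k::nat) \<subseteq> P" "Q \<in> A" for Q k
        using that
      proof (induction k)
        case 0 thus ?case using prP by (auto simp: iprime_def)
      next
        case (Suc k)
        thus ?case using iprime_prod[OF prP powint[OF \<open>Q \<in> A\<close>, of k], of Q] pr iprimeD by auto
      qed
      have key2: "\<exists>Q\<in>B. k Q > 0 \<and> Q \<subseteq> P" if "B \<subseteq> A" "finprod Inv (\<lambda>P. P [^]\<^bsub>Inv\<^esub> (k P::nat)) B \<subseteq> P" for B k
      proof -
        have "finite B" using fin that finite_subset by auto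
        thus ?thesis using that
        proof (induction rule: finite_induct)
          case empty thus ?case using prP by (auto simp: iprime_def)
        next
          case (insert Q B)
          have cB: "Q [^]\<^bsub>Inv\<^esub> k Q \<in> carrier Inv" using insert cl by (auto intro: Inv.nat_pow_closed)
          have "finprod Inv (\<lambda>P. P [^]\<^bsub>Inv\<^esub> (k P::nat)) (insert Q B)
             = iprod (Q [^]\<^bsub>Inv\<^esub> k Q) (finprod Inv (\<lambda>P. P [^]\<^bsub>Inv\<^esub> (k P::nat)) B)"
            using insert cl cB by (subst Inv.finprod_insert) (auto simp: subset_iff)
          hence "Q [^]\<^bsub>Inv\<^esub> k Q \<subseteq> P \<or> finprod Inv (\<lambda>P. P [^]\<^bsub>Inv\<^esub> (k P::nat)) B \<subseteq> P"
            using iprime_prod[OF prP powint[of Q "k Q"] fpint[of B k]] insert by auto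
          thus ?case using powP[of Q "k Q"] insert by auto
        qed
      qed
      show ?thesis using key2[OF subset_refl sub[unfolded pos_def]] .
    qed
    then obtain Q where Q: "Q \<in> A" "n Q < 0" "Q \<subseteq> P" by (meson zero_less_nat_eq neg_0_less_iff_less)
    have "Q = P" by (rule inc[OF Q(1) \<open>P \<in> A\<close> Q(3)])
    with Q(2) n show False by simp
  qed
  have "pos n \<otimes>\<^bsub>Inv\<^esub> inv\<^bsub>Inv\<^esub> (pos (\<lambda>P. - n P)) = \<one>\<^bsub>Inv\<^esub>"
    using split[of n] eq by (simp only: Inv_simps(2))
  from Inv.inv_equality[OF this Inv.inv_closed[OF pos_cl] pos_cl]
  have sym: "pos n = pos (\<lambda>P. - n P)"
    by (simp only: Inv.inv_inv[OF pos_cl])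
  have "n P \<le> 0" by (rule key[OF sym \<open>P \<in> A\<close>])
  moreover have "- n P \<le> 0"
  proof (rule key[OF _ \<open>P \<in> A\<close>])
    show "pos (\<lambda>P. - n P) = pos (\<lambda>P. - (- n P))"
      unfolding sym[symmetric] by (simp only: minus_minus)
  qed
  ultimately show ?thesis by simp
qed

end

section \<open>The Picard group of a domain\<close>

lemma linear_mapsI:
  assumes "\<And>x. x \<in> carrier M \<Longrightarrow> h x \<in> carrier N"
    "\<And>x y. x \<in> carrier M \<Longrightarrow> y \<in> carrier M \<Longrightarrow> h (x \<oplus>\<^bsub>M\<^esub> y) = h x \<oplus>\<^bsub>N\<^esub> h y"
    "\<And>r x. r \<in> carrier R \<Longrightarrow> x \<in> carrier M \<Longrightarrow> h (r \<odot>\<^bsub>M\<^esub> x) = r \<odot>\<^bsub>N\<^esub> h x"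
  shows "h \<in> linear_maps R M N"
  using assms by (auto simp: linear_maps_def)

lemma linear_mapsD:
  assumes "h \<in> linear_maps R M N"
  shows "x \<in> carrier M \<Longrightarrow> h x \<in> carrier N"
    "x \<in> carrier M \<Longrightarrow> y \<in> carrier M \<Longrightarrow> h (x \<oplus>\<^bsub>M\<^esub> y) = h x \<oplus>\<^bsub>N\<^esub> h y"
    "r \<in> carrier R \<Longrightarrow> x \<in> carrier M \<Longrightarrow> h (r \<odot>\<^bsub>M\<^esub> x) = r \<odot>\<^bsub>N\<^esub> h x"
  using assms by (auto simp: linear_maps_def)

lemma bilinear_mapsI:
  assumes "\<And>x y. x \<in> carrier M \<Longrightarrow> y \<in> carrier N \<Longrightarrow> t x y \<in> carrier P"
    "\<And>x x' y. x \<in> carrier M \<Longrightarrow> x' \<in> carrier M \<Longrightarrow> y \<in> carrier N \<Longrightarrow> t (x \<oplus>\<^bsub>M\<^esub> x') y = t x y \<oplus>\<^bsub>P\<^esub> t x' y"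
    "\<And>x y y'. x \<in> carrier M \<Longrightarrow> y \<in> carrier N \<Longrightarrow> y' \<in> carrier N \<Longrightarrow> t x (y \<oplus>\<^bsub>N\<^esub> y') = t x y \<oplus>\<^bsub>P\<^esub> t x y'"
    "\<And>r x y. r \<in> carrier R \<Longrightarrow> x \<in> carrier M \<Longrightarrow> y \<in> carrier N \<Longrightarrow> t (r \<odot>\<^bsub>M\<^esub> x) y = r \<odot>\<^bsub>P\<^esub> t x y"
    "\<And>r x y. r \<in> carrier R \<Longrightarrow> x \<in> carrier M \<Longrightarrow> y \<in> carrier N \<Longrightarrow> t x (r \<odot>\<^bsub>N\<^esub> y) = r \<odot>\<^bsub>P\<^esub> t x y"
  shows "t \<in> bilinear_maps R M N P"
  using assms by (auto simp: bilinear_maps_def linear_maps_def)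

lemma bilinear_mapsD:
  assumes "t \<in> bilinear_maps R M N P"
  shows "x \<in> carrier M \<Longrightarrow> y \<in> carrier N \<Longrightarrow> t x y \<in> carrier P"
    "x \<in> carrier M \<Longrightarrow> x' \<in> carrier M \<Longrightarrow> y \<in> carrier N \<Longrightarrow> t (x \<oplus>\<^bsub>M\<^esub> x') y = t x y \<oplus>\<^bsub>P\<^esub> t x' y"
    "x \<in> carrier M \<Longrightarrow> y \<in> carrier N \<Longrightarrow> y' \<in> carrier N \<Longrightarrow> t x (y \<oplus>\<^bsub>N\<^esub> y') = t x y \<oplus>\<^bsub>P\<^esub> t x y'"
    "r \<in> carrier R \<Longrightarrow> x \<in> carrier M \<Longrightarrow> y \<in> carrier N \<Longrightarrow> t (r \<odot>\<^bsub>M\<^esub> x) y = r \<odot>\<^bsub>P\<^esub> t x y"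
    "r \<in> carrier R \<Longrightarrow> x \<in> carrier M \<Longrightarrow> y \<in> carrier N \<Longrightarrow> t x (r \<odot>\<^bsub>N\<^esub> y) = r \<odot>\<^bsub>P\<^esub> t x y"
  using assms by (auto simp: bilinear_maps_def linear_maps_def)

text \<open>
  A tensor product together with its universal bilinear map; naming the map lets the universal property be used several times
  for the same map.
\<close>

definition universal_bilinear ::
  "('r, 'a) ring_scheme \<Rightarrow> ('r, 'r list) module \<Rightarrow> ('r, 'r list) module \<Rightarrow> ('r, 'r list) module \<Rightarrow>
   ('r list \<Rightarrow> 'r list \<Rightarrow> 'r list) \<Rightarrow> bool"
  where "universal_bilinear R M N P t \<longleftrightarrow> t \<in> bilinear_maps R M N P \<and>
    (\<forall>Q :: ('r, 'r list) module. module R Q \<longrightarrow>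
         (\<forall>s\<in>bilinear_maps R M N Q.
            \<exists>!h. h \<in> linear_maps R P Q \<and> h \<in> extensional (carrier P) \<and>
                 (\<forall>x\<in>carrier M. \<forall>y\<in>carrier N. h (t x y) = s x y)))"

lemma is_tensor_iff_universal: "is_tensor R M N P \<longleftrightarrow> (\<exists>t. universal_bilinear R M N P t)"
  unfolding is_tensor_def universal_bilinear_def Bex_def ..

lemma universal_bilinear_ex:
  fixes Q :: "('r, 'r list) module"
  assumes "universal_bilinear R M N P t" "module R Q" "s \<in> bilinear_maps R M N Q"
  obtains h where "h \<in> linear_maps R P Q" "\<And>x y. x \<in> carrier M \<Longrightarrow> y \<in> carrier N \<Longrightarrow> h (t x y) = s x y"
proof -
  have "\<exists>!h. h \<in> linear_maps R P Q \<and> h \<in> extensional (carrier P) \<and>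
                 (\<forall>x\<in>carrier M. \<forall>y\<in>carrier N. h (t x y) = s x y)"
    by (rule assms(1)[unfolded universal_bilinear_def, THEN conjunct2, rule_format, OF assms(2,3)])
  then obtain h where "h \<in> linear_maps R P Q" "\<forall>x\<in>carrier M. \<forall>y\<in>carrier N. h (t x y) = s x y"
    by (elim ex1E) blast
  thus ?thesis by (intro that[of h]) simp_all
qed

text \<open>
  Both maps solve the universal problem for the bilinear map \<open>h \<circ> t\<close>; the restriction to the carrier
  accounts for the extensionality of the solutions.
\<close>

lemma universal_bilinear_eq:
  fixes Q :: "('r, 'r list) module"
  assumes t: "universal_bilinear R M N P t" and Q: "module R Q" and P: "module R P"
    and h: "h \<in> linear_maps R P Q" and h': "h' \<in> linear_maps R P Q"
    and eq: "\<And>x y. x \<in> carrier M \<Longrightarrow> y \<in> carrier N \<Longrightarrow> h (t x y) = h' (t x y)" and z: "z \<in> carrier P"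
  shows "h z = h' z"
proof -
  interpret P: module R P by fact
  have tb: "t \<in> bilinear_maps R M N P" using t by (simp add: universal_bilinear_def)
  have s: "(\<lambda>x y. h (t x y)) \<in> bilinear_maps R M N Q"
    by (rule bilinear_mapsI) (auto simp: bilinear_mapsD[OF tb] linear_mapsD[OF h])
  have ex1: "\<exists>!k. k \<in> linear_maps R P Q \<and> k \<in> extensional (carrier P) \<and>
                 (\<forall>x\<in>carrier M. \<forall>y\<in>carrier N. k (t x y) = h (t x y))"
    by (rule t[unfolded universal_bilinear_def, THEN conjunct2, rule_format, OF Q s])
  have r: "restrict f (carrier P) \<in> linear_maps R P Q" if "f \<in> linear_maps R P Q" for f
    by (rule linear_mapsI) (auto simp: linear_mapsD[OF that])
  have 1: "restrict h (carrier P) \<in> linear_maps R P Q \<and> restrict h (carrier P) \<in> extensional (carrier P) \<and>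
     (\<forall>x\<in>carrier M. \<forall>y\<in>carrier N. restrict h (carrier P) (t x y) = h (t x y))"
    using r[OF h] bilinear_mapsD(1)[OF tb] by simp
  have 2: "restrict h' (carrier P) \<in> linear_maps R P Q \<and> restrict h' (carrier P) \<in> extensional (carrier P) \<and>
     (\<forall>x\<in>carrier M. \<forall>y\<in>carrier N. restrict h' (carrier P) (t x y) = h (t x y))"
    using r[OF h'] bilinear_mapsD(1)[OF tb] eq by simp
  have "restrict h (carrier P) = restrict h' (carrier P)"
    by (rule ex1E[OF ex1]) (metis (no_types, lifting) 1 2)
  from fun_cong[OF this, of z] show "h z = h' z" using z by simp
qed

lemma tensor_unique:
  fixes P P' :: "('r, 'r list) module"
  assumes "is_tensor R M N P" "is_tensor R M N P'" "module R P" "module R P'"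
  shows "module_iso R P P'"
proof -
  obtain t where t: "universal_bilinear R M N P t" using assms by (auto simp: is_tensor_iff_universal)
  obtain t' where t': "universal_bilinear R M N P' t'" using assms by (auto simp: is_tensor_iff_universal)
  have tb: "t \<in> bilinear_maps R M N P" "t' \<in> bilinear_maps R M N P'"
    using t t' by (simp_all add: universal_bilinear_def)
  obtain h where h: "h \<in> linear_maps R P P'" "\<And>x y. x \<in> carrier M \<Longrightarrow> y \<in> carrier N \<Longrightarrow> h (t x y) = t' x y"
    using universal_bilinear_ex[OF t assms(4) tb(2)] by metis
  obtain k where k: "k \<in> linear_maps R P' P" "\<And>x y. x \<in> carrier M \<Longrightarrow> y \<in> carrier N \<Longrightarrow> k (t' x y) = t x y"
    using universal_bilinear_ex[OF t' assms(3) tb(1)] by metis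
  have id: "(\<lambda>x. x) \<in> linear_maps R A A" for A :: "('r, 'r list) module"
    by (rule linear_mapsI) auto
  have kh: "(\<lambda>x. k (h x)) \<in> linear_maps R P P" "(\<lambda>x. h (k x)) \<in> linear_maps R P' P'"
    by (rule linear_mapsI; simp add: linear_mapsD[OF h(1)] linear_mapsD[OF k(1)])+
  have 1: "k (h z) = z" if "z \<in> carrier P" for z
    by (rule universal_bilinear_eq[OF t assms(3) assms(3) kh(1) id _ that]) (simp add: h k)
  have 2: "h (k z) = z" if "z \<in> carrier P'" for z
    by (rule universal_bilinear_eq[OF t' assms(4) assms(4) kh(2) id _ that]) (simp add: h k)
  have "bij_betw h (carrier P) (carrier P')"
    using 1 2 linear_mapsD(1)[OF h(1)] linear_mapsD(1)[OF k(1)]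
    by (intro bij_betw_byWitness[where f' = k]) auto
  thus ?thesis using h(1) unfolding module_iso_def by blast
qed

lemma (in abelian_group) eq_of_minus_zero:
  "x \<in> carrier G \<Longrightarrow> y \<in> carrier G \<Longrightarrow> x \<ominus> y = \<zero> \<Longrightarrow> x = y"
  by (metis a_minus_def a_inv_closed minus_equality minus_minus)

locale ring_in_field = cring R for R (structure) +
  fixes \<psi> :: "'a \<Rightarrow> 'f::field"
  assumes psi_inj: "inj_on \<psi> (carrier R)"
    and psi_add [simp]: "x \<in> carrier R \<Longrightarrow> y \<in> carrier R \<Longrightarrow> \<psi> (x \<oplus> y) = \<psi> x + \<psi> y"
    and psi_mult [simp]: "x \<in> carrier R \<Longrightarrow> y \<in> carrier R \<Longrightarrow> \<psi> (x \<otimes> y) = \<psi> x * \<psi> y"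
    and psi_one [simp]: "\<psi> \<one> = 1"
begin

abbreviation S where "S \<equiv> \<psi> ` carrier R"

lemma psi_zero [simp]: "\<psi> \<zero> = 0"
  using psi_add[of \<zero> \<zero>] by (metis add_cancel_right_right l_zero zero_closed)

lemma psi_uminus [simp]: "x \<in> carrier R \<Longrightarrow> \<psi> (\<ominus> x) = - \<psi> x"
  using psi_add[of x "\<ominus> x"] by (simp add: r_neg add_eq_0_iff)

sublocale subring_of_field S
proof
  show "1 \<in> S" using psi_one one_closed by (metis image_eqI)
  show "x + y \<in> S" if "x \<in> S" "y \<in> S" for x y
    using that by (auto simp flip: psi_add)
  show "x * y \<in> S" if "x \<in> S" "y \<in> S" for x y
    using that by (auto simp flip: psi_mult)
  show "- x \<in> S" if "x \<in> S" for x
    using that by (auto simp flip: psi_uminus)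
qed

definition \<rho> :: "'f \<Rightarrow> 'a" where "\<rho> = the_inv_into (carrier R) \<psi>"

lemma rho_closed [simp]: "u \<in> S \<Longrightarrow> \<rho> u \<in> carrier R"
  unfolding \<rho>_def using the_inv_into_into[OF psi_inj] by blast

lemma psi_rho [simp]: "u \<in> S \<Longrightarrow> \<psi> (\<rho> u) = u"
  unfolding \<rho>_def using f_the_inv_into_f[OF psi_inj] by blast

lemma rho_psi [simp]: "r \<in> carrier R \<Longrightarrow> \<rho> (\<psi> r) = r"
  unfolding \<rho>_def using the_inv_into_f_f[OF psi_inj] by blast

lemma rho_1 [simp]: "\<rho> 1 = \<one>" and rho_0 [simp]: "\<rho> 0 = \<zero>"
  using rho_psi[OF one_closed] rho_psi[OF zero_closed] by simp_all

lemma rho_add: "u \<in> S \<Longrightarrow> v \<in> S \<Longrightarrow> \<rho> (u + v) = \<rho> u \<oplus> \<rho> v"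
  using rho_psi[of "\<rho> u \<oplus> \<rho> v"] by simp

lemma rho_mult: "u \<in> S \<Longrightarrow> v \<in> S \<Longrightarrow> \<rho> (u * v) = \<rho> u \<otimes> \<rho> v"
  using rho_psi[of "\<rho> u \<otimes> \<rho> v"] by simp

text \<open>
  The module \<open>M\<close> is isomorphic to the ideal \<open>I\<close>, which is not itself a module record over
  \<open>R\<close>.
\<close>

definition rep :: "('a, 'm, 'z) module_scheme \<Rightarrow> 'f set \<Rightarrow> bool" where
  "rep M I \<longleftrightarrow> (\<exists>h. bij_betw h (carrier M) I \<and>
     (\<forall>x\<in>carrier M. \<forall>y\<in>carrier M. h (x \<oplus>\<^bsub>M\<^esub> y) = h x + h y) \<and>
     (\<forall>r\<in>carrier R. \<forall>x\<in>carrier M. h (r \<odot>\<^bsub>M\<^esub> x) = \<psi> r * h x))"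

lemma repI:
  assumes "bij_betw h (carrier M) I"
     "\<And>x y. x \<in> carrier M \<Longrightarrow> y \<in> carrier M \<Longrightarrow> h (x \<oplus>\<^bsub>M\<^esub> y) = h x + h y"
     "\<And>r x. r \<in> carrier R \<Longrightarrow> x \<in> carrier M \<Longrightarrow> h (r \<odot>\<^bsub>M\<^esub> x) = \<psi> r * h x"
  shows "rep M I"
  using assms unfolding rep_def by blast

text \<open>
  An isomorphism with its inverse, listing everything that is used of the pair.
\<close>

definition rep_via :: "('a, 'm, 'z) module_scheme \<Rightarrow> 'f set \<Rightarrow> ('m \<Rightarrow> 'f) \<Rightarrow> ('f \<Rightarrow> 'm) \<Rightarrow> bool" where
  "rep_via M I h g \<longleftrightarrow>
    (\<forall>x\<in>carrier M. h x \<in> I \<and> g (h x) = x) \<and> (\<forall>x\<in>I. g x \<in> carrier M \<and> h (g x) = x) \<and>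
    (\<forall>x\<in>carrier M. \<forall>y\<in>carrier M. h (x \<oplus>\<^bsub>M\<^esub> y) = h x + h y) \<and>
    (\<forall>r\<in>carrier R. \<forall>x\<in>carrier M. h (r \<odot>\<^bsub>M\<^esub> x) = \<psi> r * h x) \<and>
    (\<forall>x\<in>I. \<forall>y\<in>I. g (x + y) = g x \<oplus>\<^bsub>M\<^esub> g y) \<and>
    (\<forall>r\<in>carrier R. \<forall>x\<in>I. g (\<psi> r * x) = r \<odot>\<^bsub>M\<^esub> g x) \<and>
    h \<zero>\<^bsub>M\<^esub> = 0 \<and> g 0 = \<zero>\<^bsub>M\<^esub>"

lemma rep_viaD:
  assumes "rep_via M I h g"
  shows "x \<in> carrier M \<Longrightarrow> h x \<in> I" "u \<in> I \<Longrightarrow> g u \<in> carrier M"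
    "x \<in> carrier M \<Longrightarrow> g (h x) = x" "u \<in> I \<Longrightarrow> h (g u) = u"
    "x \<in> carrier M \<Longrightarrow> y \<in> carrier M \<Longrightarrow> h (x \<oplus>\<^bsub>M\<^esub> y) = h x + h y"
    "r \<in> carrier R \<Longrightarrow> x \<in> carrier M \<Longrightarrow> h (r \<odot>\<^bsub>M\<^esub> x) = \<psi> r * h x"
    "u \<in> I \<Longrightarrow> v \<in> I \<Longrightarrow> g (u + v) = g u \<oplus>\<^bsub>M\<^esub> g v"
    "r \<in> carrier R \<Longrightarrow> u \<in> I \<Longrightarrow> g (\<psi> r * u) = r \<odot>\<^bsub>M\<^esub> g u"
    "h \<zero>\<^bsub>M\<^esub> = 0" "g 0 = \<zero>\<^bsub>M\<^esub>"
  using assms unfolding rep_via_def by blast+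

lemma repE:
  assumes "rep M I" "module R M" obtains h g where "rep_via M I h g"
proof -
  interpret M: module R M by fact
  obtain h where h: "bij_betw h (carrier M) I"
     "\<forall>x\<in>carrier M. \<forall>y\<in>carrier M. h (x \<oplus>\<^bsub>M\<^esub> y) = h x + h y"
     "\<forall>r\<in>carrier R. \<forall>x\<in>carrier M. h (r \<odot>\<^bsub>M\<^esub> x) = \<psi> r * h x"
    using assms unfolding rep_def by blast
  define g where "g = the_inv_into (carrier M) h"
  have inj: "inj_on h (carrier M)" and im: "h ` carrier M = I" using h by (auto simp: bij_betw_def)
  have gh: "\<And>x. x \<in> carrier M \<Longrightarrow> g (h x) = x" unfolding g_def using the_inv_into_f_f[OF inj] .
  have hg: "\<And>x. x \<in> I \<Longrightarrow> h (g x) = x" unfolding g_def using f_the_inv_into_f[OF inj] im by blast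
  have gc: "\<And>x. x \<in> I \<Longrightarrow> g x \<in> carrier M" using im gh by auto
  have h0: "h \<zero>\<^bsub>M\<^esub> = 0"
    using h(2)[rule_format, of "\<zero>\<^bsub>M\<^esub>" "\<zero>\<^bsub>M\<^esub>"] by (metis add_cancel_right_right M.M.l_zero M.M.zero_closed)
  have "g (x + y) = g x \<oplus>\<^bsub>M\<^esub> g y" if "x \<in> I" "y \<in> I" for x y
    using gh[of "g x \<oplus>\<^bsub>M\<^esub> g y"] that by (simp add: h hg gc)
  moreover have "g (\<psi> r * x) = r \<odot>\<^bsub>M\<^esub> g x" if "r \<in> carrier R" "x \<in> I" for r x
    using gh[of "r \<odot>\<^bsub>M\<^esub> g x"] that by (simp add: h hg gc)
  moreover have "g 0 = \<zero>\<^bsub>M\<^esub>" using gh[of "\<zero>\<^bsub>M\<^esub>"] by (simp add: h0)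
  ultimately have "rep_via M I h g"
    unfolding rep_via_def using h(2,3) gh hg gc h0 im by auto
  thus ?thesis by (rule that)
qed

text \<open>
  The one-element lists over the integral ideal \<open>u I\<close> form a module with elements in the required type.
\<close>

lemma exists_rep:
  assumes "submod I" "u \<noteq> 0" "scale u I \<subseteq> S"
  shows "\<exists>M :: ('a, 'a list) module. module R M \<and> rep M I"
proof -
  define M :: "('a, 'a list) module" where
    "M = \<lparr>carrier = {[r] | r. r \<in> carrier R \<and> \<psi> r \<in> scale u I},
      monoid.mult = undefined, one = undefined, zero = [\<zero>], add = (\<lambda>x y. [hd x \<oplus> hd y]),
      module.smult = (\<lambda>r x. [r \<otimes> hd x])\<rparr>"
  have su: "submod (scale u I)" using assms by auto
  have "module R M"
  proof (rule moduleI)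
    show "cring R" by (rule is_cring)
    show "abelian_group M"
    proof (rule abelian_groupI)
      fix x assume "x \<in> carrier M"
      then obtain r where r: "x = [r]" "r \<in> carrier R" "\<psi> r \<in> scale u I" by (auto simp: M_def)
      show "\<exists>y\<in>carrier M. y \<oplus>\<^bsub>M\<^esub> x = \<zero>\<^bsub>M\<^esub>"
        using r submod_uminus[OF su] by (intro bexI[of _ "[\<ominus> r]"]) (auto simp: M_def l_neg)
    qed (use su in \<open>auto simp: M_def a_ac submod_add\<close>)
  qed (use su in \<open>auto simp: M_def l_distr r_distr m_assoc submod_smult\<close>)
  moreover have "rep M I"
  proof (rule repI)
    have "bij_betw (\<lambda>x. \<psi> (hd x)) (carrier M) (scale u I)"
      using assms(3) psi_inj
      by (intro bij_betw_byWitness[where f' = "\<lambda>x. [\<rho> x]"]) (auto simp: M_def)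
    moreover have "bij_betw (\<lambda>x. x / u) (scale u I) I"
      using assms(2) by (intro bij_betw_byWitness[where f' = "\<lambda>x. u * x"]) (auto simp: scale_def)
    ultimately show "bij_betw (\<lambda>x. \<psi> (hd x) / u) (carrier M) I"
      using bij_betw_trans[of "\<lambda>x. \<psi> (hd x)" "carrier M" "scale u I" "\<lambda>x. x / u" I] by (simp add: o_def)
  qed (auto simp: M_def add_divide_distrib)
  ultimately show ?thesis by blast
qed

lemma rep_pull: "rep N I \<Longrightarrow> module_iso R M N \<Longrightarrow> rep M I"
proof -
  assume "rep N I" "module_iso R M N"
  then obtain k h where k: "bij_betw k (carrier N) I"
     "\<And>x y. x \<in> carrier N \<Longrightarrow> y \<in> carrier N \<Longrightarrow> k (x \<oplus>\<^bsub>N\<^esub> y) = k x + k y"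
     "\<And>r x. r \<in> carrier R \<Longrightarrow> x \<in> carrier N \<Longrightarrow> k (r \<odot>\<^bsub>N\<^esub> x) = \<psi> r * k x"
    and h: "h \<in> linear_maps R M N" "bij_betw h (carrier M) (carrier N)"
    unfolding rep_def module_iso_def by blast
  show ?thesis
    using bij_betw_trans[OF h(2) k(1)] by (intro repI[of "k \<circ> h"]) (auto simp: k linear_mapsD[OF h(1)])
qed

lemma rep_iso:
  assumes "rep M I" "rep N I" "module R M" "module R N" shows "module_iso R M N"
proof -
  obtain h g where h_via: "rep_via M I h g"
    using repE[OF assms(1,3)] by blast
  note h = rep_viaD[OF h_via]
  obtain k l where k_via: "rep_via N I k l"
    using repE[OF assms(2,4)] by blast
  note k = rep_viaD[OF k_via]
  have "(\<lambda>x. l (h x)) \<in> linear_maps R M N"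
    by (rule linear_mapsI) (auto simp: h k)
  moreover have "bij_betw (\<lambda>x. l (h x)) (carrier M) (carrier N)"
    by (intro bij_betw_byWitness[where f' = "\<lambda>x. g (k x)"]) (auto simp: h k)
  ultimately show ?thesis unfolding module_iso_def by blast
qed

lemma rep_push:
  assumes "rep M I" "module_iso R M N" "module R M"
  shows "rep N I"
proof -
  interpret M: module R M by fact
  obtain k where k: "bij_betw k (carrier M) I"
     "\<And>x y. x \<in> carrier M \<Longrightarrow> y \<in> carrier M \<Longrightarrow> k (x \<oplus>\<^bsub>M\<^esub> y) = k x + k y"
     "\<And>r x. r \<in> carrier R \<Longrightarrow> x \<in> carrier M \<Longrightarrow> k (r \<odot>\<^bsub>M\<^esub> x) = \<psi> r * k x"
    using assms(1) unfolding rep_def by blast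
  obtain h where h: "h \<in> linear_maps R M N" "bij_betw h (carrier M) (carrier N)"
    using assms(2) unfolding module_iso_def by blast
  define g where "g = the_inv_into (carrier M) h"
  have inj: "inj_on h (carrier M)" and im: "h ` carrier M = carrier N" using h by (auto simp: bij_betw_def)
  have gh: "\<And>x. x \<in> carrier M \<Longrightarrow> g (h x) = x" unfolding g_def using the_inv_into_f_f[OF inj] .
  have "bij_betw g (carrier N) (carrier M)" unfolding g_def using bij_betw_the_inv_into[OF h(2)] .
  from bij_betw_trans[OF this k(1)] show ?thesis
  proof (rule repI)
    fix x y assume "x \<in> carrier N" "y \<in> carrier N"
    then obtain x' y' where "x = h x'" "y = h y'" "x' \<in> carrier M" "y' \<in> carrier M" using im by (metis imageE)
    thus "(k \<circ> g) (x \<oplus>\<^bsub>N\<^esub> y) = (k \<circ> g) x + (k \<circ> g) y"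
      by (simp add: gh k flip: linear_mapsD(2)[OF h(1)])
  next
    fix r x assume "r \<in> carrier R" "x \<in> carrier N"
    moreover from this obtain x' where "x = h x'" "x' \<in> carrier M" using im by auto
    ultimately show "(k \<circ> g) (r \<odot>\<^bsub>N\<^esub> x) = \<psi> r * (k \<circ> g) x"
      by (simp add: gh k flip: linear_mapsD(3)[OF h(1)])
  qed
qed

lemma rep_scale:
  assumes "rep M I" "u \<noteq> 0" shows "rep M (scale u I)"
proof -
  obtain k where k: "bij_betw k (carrier M) I"
     "\<And>x y. x \<in> carrier M \<Longrightarrow> y \<in> carrier M \<Longrightarrow> k (x \<oplus>\<^bsub>M\<^esub> y) = k x + k y"
     "\<And>r x. r \<in> carrier R \<Longrightarrow> x \<in> carrier M \<Longrightarrow> k (r \<odot>\<^bsub>M\<^esub> x) = \<psi> r * k x"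
    using assms(1) unfolding rep_def by blast
  have "bij_betw ((*) u) I (scale u I)"
    using assms(2) by (auto simp: scale_def bij_betw_def inj_on_def)
  from bij_betw_trans[OF k(1) this] show ?thesis
    by (rule repI) (auto simp: k distrib_left)
qed

text \<open>
  An isomorphism between two nonzero submodules of a field is multiplication by a constant: \<open>x f(y) = y f(x)\<close>
  after clearing denominators.
\<close>

lemma rep_unique:
  assumes "I \<in> carrier Inv" "J \<in> carrier Inv" "rep M I" "rep M J" "module R M"
  shows "\<exists>u. u \<noteq> 0 \<and> J = scale u I"
proof -
  interpret M: module R M by fact
  obtain h g where h_via: "rep_via M I h g"
    using repE[OF assms(3,5)] by blast
  note h = rep_viaD[OF h_via]
  obtain k l where k_via: "rep_via M J k l"
    using repE[OF assms(4,5)] by blast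
  note k = rep_viaD[OF k_via]
  define f where "f x = k (g x)" for x
  have f_smult: "f (r * x) = r * f x" if "r \<in> S" "x \<in> I" for r x
    using that h k by (auto simp: f_def)
  obtain w where w: "w \<noteq> 0" "scale w I \<subseteq> S" using Inv_integral[OF assms(1)] .
  obtain x0 where x0: "x0 \<in> I" "x0 \<noteq> 0" using Inv_nonzero[OF assms(1)] .
  define u where "u = f x0 / x0"
  have f_eq: "f x = u * x" if "x \<in> I" for x
  proof -
    have "w * x \<in> S" "w * x0 \<in> S" using w that x0 by (auto simp: scale_def)
    hence "(w * x) * f x0 = (w * x0) * f x"
      using f_smult[of "w * x" x0] f_smult[of "w * x0" x] x0 that by (simp add: mult_ac)
    thus ?thesis using w x0 by (simp add: u_def field_simps)
  qed
  have "J = f ` I"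
    using h k by (auto simp: f_def image_iff) (metis h k)
  hence J: "J = scale u I" using f_eq by (auto simp: scale_def)
  have "u \<noteq> 0"
  proof
    assume "u = 0"
    hence "J \<subseteq> {0}" using J by (auto simp: scale_def)
    thus False using Inv_nonzero[OF assms(2)] by blast
  qed
  thus ?thesis using J by blast
qed

definition Phi :: "'f set \<Rightarrow> ('a, 'a list) module set" where
  "Phi I = {M. module R M \<and> rep M I}"

lemma Inv_rep:
  assumes "I \<in> carrier Inv"
  obtains M :: "('a, 'a list) module" where "module R M" "rep M I"
  using exists_rep[OF InvD[OF assms]] Inv_integral[OF assms] by metis

lemma Phi_eq_iff:
  assumes "I \<in> carrier Inv" "J \<in> carrier Inv"
  shows "Phi I = Phi J \<longleftrightarrow> (\<exists>u. u \<noteq> 0 \<and> J = scale u I)"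
proof
  assume eq: "Phi I = Phi J"
  obtain M :: "('a, 'a list) module" where M: "module R M" "rep M I" using Inv_rep[OF assms(1)] .
  hence "rep M J" using eq by (auto simp: Phi_def)
  thus "\<exists>u. u \<noteq> 0 \<and> J = scale u I" using rep_unique assms M by blast
next
  assume "\<exists>u. u \<noteq> 0 \<and> J = scale u I"
  then obtain u where u: "u \<noteq> 0" "J = scale u I" by blast
  hence "I = scale (1 / u) J" by (simp add: scale_scale)
  thus "Phi I = Phi J" using u rep_scale[of _ I u] rep_scale[of _ J "1/u"] by (auto simp: Phi_def)
qed

lemma Phi_iso_class: "module R M \<Longrightarrow> rep M I \<Longrightarrow> Phi I = iso_class R M"
  using rep_iso rep_push by (auto simp: Phi_def iso_class_def)

text \<open>
  Let \<open>1 = \<Sum> x\<^sub>i x'\<^sub>i\<close> with \<open>x\<^sub>i \<in> I\<close> and \<open>x'\<^sub>i\<close> in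
  the inverse of \<open>I\<close>. A bilinear map \<open>s\<close> on \<open>I \<times> J\<close> factors through the product
  by \<open>z \<mapsto> \<Sum> s(x\<^sub>i, x'\<^sub>i z)\<close>, because \<open>x'\<^sub>i x \<in> S\<close> can be moved
  across \<open>s\<close>.
\<close>

lemma tensor_iprod:
  fixes M N P :: "('a, 'a list) module"
  assumes I: "I \<in> carrier Inv" and J: "submod J"
    and mods: "module R M" "module R N" "module R P"
    and reps: "rep M I" "rep N J" "rep P (iprod I J)"
  shows "is_tensor R M N P"
proof -
  interpret M: module R M by fact
  interpret N: module R N by fact
  interpret P: module R P by fact
  obtain hM gM where M_via: "rep_via M I hM gM"
    using repE[OF reps(1) mods(1)] by blast
  note M = rep_viaD[OF M_via]
  obtain hN gN where N_via: "rep_via N J hN gN"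
    using repE[OF reps(2) mods(2)] by blast
  note N = rep_viaD[OF N_via]
  obtain hP gP where P_via: "rep_via P (iprod I J) hP gP"
    using repE[OF reps(3) mods(3)] by blast
  note P = rep_viaD[OF P_via]
  have sI: "submod I" using I InvD by auto
  obtain I' where I': "I' \<in> carrier Inv" "iprod I I' = S" using Inv_obtain[OF I] .
  have prodS: "x * y \<in> S" if "x \<in> I" "y \<in> I'" for x y
    using iprod_mult[OF that] I' by simp
  define t where "t x y = gP (hM x * hN y)" for x y
  have t: "t \<in> bilinear_maps R M N P"
  proof (rule bilinear_mapsI)
    fix r x y assume *: "r \<in> carrier R" "x \<in> carrier M" "y \<in> carrier N"
    show "t x (r \<odot>\<^bsub>N\<^esub> y) = r \<odot>\<^bsub>P\<^esub> t x y"
      using * P(8)[of r "hM x * hN y"] by (simp add: t_def M N P iprod_mult mult_ac)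
  qed (auto simp: t_def M N P iprod_mult distrib_left distrib_right mult.assoc)
  show ?thesis unfolding is_tensor_def
  proof (intro bexI[OF _ t] allI impI ballI)
    fix Q :: "('a, 'a list) module" and s
    assume "module R Q" and s: "s \<in> bilinear_maps R M N Q"
    then interpret Q: module R Q by simp
    note sD = bilinear_mapsD[OF s]
    have ex: "\<exists>H. (\<forall>z\<in>iprod I J. H z \<in> carrier Q) \<and>
        (\<forall>z\<in>iprod I J. \<forall>z'\<in>iprod I J. H (z + z') = H z \<oplus>\<^bsub>Q\<^esub> H z') \<and>
        (\<forall>r\<in>carrier R. \<forall>z\<in>iprod I J. H (\<psi> r * z) = r \<odot>\<^bsub>Q\<^esub> H z) \<and>
        (\<forall>x\<in>I. \<forall>y\<in>J. H (x * y) = \<rho> w \<odot>\<^bsub>Q\<^esub> s (gM x) (gN y))" if "w \<in> iprod I I'" for w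
      using that
    proof induction
      case iprod_zero
      show ?case by (rule exI[of _ "\<lambda>_. \<zero>\<^bsub>Q\<^esub>"]) (auto simp: sD M N)
    next
      case (iprod_step u v w)
      then obtain H where H: "\<And>z. z \<in> iprod I J \<Longrightarrow> H z \<in> carrier Q"
        "\<And>z z'. z \<in> iprod I J \<Longrightarrow> z' \<in> iprod I J \<Longrightarrow> H (z + z') = H z \<oplus>\<^bsub>Q\<^esub> H z'"
        "\<And>r z. r \<in> carrier R \<Longrightarrow> z \<in> iprod I J \<Longrightarrow> H (\<psi> r * z) = r \<odot>\<^bsub>Q\<^esub> H z"
        "\<And>x y. x \<in> I \<Longrightarrow> y \<in> J \<Longrightarrow> H (x * y) = \<rho> w \<odot>\<^bsub>Q\<^esub> s (gM x) (gN y)"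
        by blast
      have w: "w \<in> S" "u * v \<in> S" using iprod_step I' prodS by auto
      have vz: "v * z \<in> J" if "z \<in> iprod I J" for z
      proof -
        have "iprod I J \<subseteq> {z. v * z \<in> J}"
        proof (rule iprod_least)
          show "submod {z. v * z \<in> J}"
            using J by (auto intro!: submodI simp: distrib_left submod_add mult.left_commute[of v] submod_smult)
          fix x y assume "x \<in> I" "y \<in> J"
          hence "(x * v) * y \<in> J" using prodS[OF _ iprod_step(2), of x] by (intro submod_smult[OF J])
          thus "x * y \<in> {z. v * z \<in> J}" by (simp add: mult_ac)
        qed
        thus ?thesis using that by auto
      qed
      have gu: "gM u \<in> carrier M" using M iprod_step by auto
      show ?case
      proof (intro exI[of _ "\<lambda>z. s (gM u) (gN (v * z)) \<oplus>\<^bsub>Q\<^esub> H z"] conjI ballI)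
        fix z z' assume z: "z \<in> iprod I J" "z' \<in> iprod I J"
        have [simp]: "s (gM u) (gN (v * z)) \<in> carrier Q" "s (gM u) (gN (v * z')) \<in> carrier Q"
          "H z \<in> carrier Q" "H z' \<in> carrier Q"
          using z gu N vz sD H by auto
        show "s (gM u) (gN (v * z)) \<oplus>\<^bsub>Q\<^esub> H z \<in> carrier Q" by simp
        show "s (gM u) (gN (v * (z + z'))) \<oplus>\<^bsub>Q\<^esub> H (z + z') =
            s (gM u) (gN (v * z)) \<oplus>\<^bsub>Q\<^esub> H z \<oplus>\<^bsub>Q\<^esub> (s (gM u) (gN (v * z')) \<oplus>\<^bsub>Q\<^esub> H z')"
          using z gu by (simp add: distrib_left N vz sD H Q.a_ac)
        fix r assume r: "r \<in> carrier R"
        show "s (gM u) (gN (v * (\<psi> r * z))) \<oplus>\<^bsub>Q\<^esub> H (\<psi> r * z) = r \<odot>\<^bsub>Q\<^esub> (s (gM u) (gN (v * z)) \<oplus>\<^bsub>Q\<^esub> H z)"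
          using z r gu by (simp add: mult.left_commute[of v] N vz sD H Q.smult_r_distr)
      next
        fix x y assume xy: "x \<in> I" "y \<in> J"
        define r where "r = \<rho> (x * v)"
        have r: "r \<in> carrier R" "\<psi> r = x * v" using prodS[OF xy(1) iprod_step(2)] by (auto simp: r_def)
        have "gN (v * (x * y)) = r \<odot>\<^bsub>N\<^esub> gN y"
          using N(8)[OF r(1) xy(2)] r by (simp add: mult_ac)
        hence "s (gM u) (gN (v * (x * y))) = s (r \<odot>\<^bsub>M\<^esub> gM u) (gN y)"
          using gu r xy by (simp add: N sD)
        also have "r \<odot>\<^bsub>M\<^esub> gM u = gM (\<psi> r * u)" by (rule M(8)[OF r(1) iprod_step(1), symmetric])
        also have "\<psi> r * u = \<psi> (\<rho> (u * v)) * x" using w r by (simp add: mult_ac)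
        also have "gM \<dots> = \<rho> (u * v) \<odot>\<^bsub>M\<^esub> gM x" by (rule M(8)[OF rho_closed[OF w(2)] xy(1)])
        also have "s \<dots> (gN y) = \<rho> (u * v) \<odot>\<^bsub>Q\<^esub> s (gM x) (gN y)"
          using w xy by (simp add: M N sD)
        finally show "s (gM u) (gN (v * (x * y))) \<oplus>\<^bsub>Q\<^esub> H (x * y) = \<rho> (u * v + w) \<odot>\<^bsub>Q\<^esub> s (gM x) (gN y)"
          using w xy by (simp add: H rho_add Q.smult_l_distr sD M N)
      qed
    qed
    have "1 \<in> iprod I I'" using I' S_one by simp
    from ex[OF this] obtain H where H: "\<And>z. z \<in> iprod I J \<Longrightarrow> H z \<in> carrier Q"
        "\<And>z z'. z \<in> iprod I J \<Longrightarrow> z' \<in> iprod I J \<Longrightarrow> H (z + z') = H z \<oplus>\<^bsub>Q\<^esub> H z'"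
        "\<And>r z. r \<in> carrier R \<Longrightarrow> z \<in> iprod I J \<Longrightarrow> H (\<psi> r * z) = r \<odot>\<^bsub>Q\<^esub> H z"
        "\<And>x y. x \<in> I \<Longrightarrow> y \<in> J \<Longrightarrow> H (x * y) = \<rho> 1 \<odot>\<^bsub>Q\<^esub> s (gM x) (gN y)"
      by blast
    show "\<exists>!h. h \<in> linear_maps R P Q \<and> h \<in> extensional (carrier P) \<and>
                 (\<forall>x\<in>carrier M. \<forall>y\<in>carrier N. h (t x y) = s x y)"
    proof (rule ex1I[of _ "restrict (\<lambda>p. H (hP p)) (carrier P)"], intro conjI ballI)
      show "restrict (\<lambda>p. H (hP p)) (carrier P) \<in> linear_maps R P Q"
        by (rule linear_mapsI) (auto simp: P H)
      fix x y assume "x \<in> carrier M" "y \<in> carrier N"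
      thus "restrict (\<lambda>p. H (hP p)) (carrier P) (t x y) = s x y"
        using H(4)[of "hM x" "hN y"] by (simp add: t_def P iprod_mult M N sD)
    next
      fix h assume h: "h \<in> linear_maps R P Q \<and> h \<in> extensional (carrier P) \<and>
                 (\<forall>x\<in>carrier M. \<forall>y\<in>carrier N. h (t x y) = s x y)"
      hence hl: "h \<in> linear_maps R P Q" by simp
      note hD = linear_mapsD[OF hl]
      have "h (gP z) = H z" if "z \<in> iprod I J" for z
        using that
      proof induction
        case iprod_zero
        have "h \<zero>\<^bsub>P\<^esub> = \<zero> \<odot>\<^bsub>Q\<^esub> h \<zero>\<^bsub>P\<^esub>" using hD(3)[of \<zero> "\<zero>\<^bsub>P\<^esub>"] by simp
        also have "\<dots> = \<zero>\<^bsub>Q\<^esub>" using hD(1)[of "\<zero>\<^bsub>P\<^esub>"] by simp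
        finally have "h \<zero>\<^bsub>P\<^esub> = \<zero>\<^bsub>Q\<^esub>" .
        moreover have "H 0 = \<zero>\<^bsub>Q\<^esub>"
          using H(3)[of \<zero> 0] H(1)[of 0] iprod.iprod_zero[of I J] by simp
        ultimately show ?case by (simp add: P)
      next
        case (iprod_step x y z)
        have "gP (x * y) = t (gM x) (gN y)" using iprod_step by (simp add: t_def M N)
        hence "h (gP (x * y)) = H (x * y)" using h iprod_step M N H(4)[of x y] sD by simp
        thus ?case using iprod_step by (simp add: iprod_mult P hD H)
      qed
      hence "h p = H (hP p)" if "p \<in> carrier P" for p using that P by metis
      thus "h = restrict (\<lambda>p. H (hP p)) (carrier P)"
        using h by (intro extensionalityI[of _ "carrier P"]) auto
    qed auto
  qed
qed


text \<open>
  The universal bilinear map is a pairing \<open>T\<close> of \<open>M\<close> and \<open>N\<close> with values in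
  \<open>S\<close>. Its values generate the unit ideal, since the pairing, as a map into the ideal generated by them, factors
  through \<open>S\<close>. The bilinear maps \<open>(p, q) \<mapsto> T(p',q) p\<close> with values in \<open>M\<close> show
  that \<open>T\<close> is nondegenerate and of rank one, \<open>c T(p,q) = T(p,q\<^sub>1) T(p\<^sub>1,q)\<close> with
  \<open>c = T(p\<^sub>1,q\<^sub>1) \<noteq> 0\<close>. So \<open>p \<mapsto> T(p,q\<^sub>1)\<close> embeds \<open>M\<close>
  as an ideal, with inverse the ideal of all \<open>T(p\<^sub>1,q)/c\<close>.
\<close>

lemma invertible_module_rep:
  fixes M N W :: "('a, 'a list) module"
  assumes tens: "is_tensor R M N W" and mods: "module R M" "module R N" "module R W"
    and W: "rep W S"
  shows "\<exists>I\<in>carrier Inv. rep M I"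
proof -
  interpret M: module R M by fact
  interpret N: module R N by fact
  interpret W: module R W by fact
  obtain hW gW where W_via: "rep_via W S hW gW" using repE[OF W mods(3)] by blast
  note W = rep_viaD[OF W_via]
  obtain t where t: "universal_bilinear R M N W t" using tens by (auto simp: is_tensor_iff_universal)
  hence tb: "t \<in> bilinear_maps R M N W" by (simp add: universal_bilinear_def)
  note tD = bilinear_mapsD[OF tb]
  define T where "T p q = hW (t p q)" for p q
  have T_S: "T p q \<in> S" if "p \<in> carrier M" "q \<in> carrier N" for p q
    unfolding T_def by (rule W(1)[OF tD(1)[OF that]])
  have T_add1: "T (p \<oplus>\<^bsub>M\<^esub> p') q = T p q + T p' q" if "p \<in> carrier M" "p' \<in> carrier M" "q \<in> carrier N" for p p' q
    using that by (simp add: T_def tD W)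
  have T_add2: "T p (q \<oplus>\<^bsub>N\<^esub> q') = T p q + T p q'" if "p \<in> carrier M" "q \<in> carrier N" "q' \<in> carrier N" for p q q'
    using that by (simp add: T_def tD W)
  have T_smult1: "T (r \<odot>\<^bsub>M\<^esub> p) q = \<psi> r * T p q" if "p \<in> carrier M" "r \<in> carrier R" "q \<in> carrier N" for p r q
    using that by (simp add: T_def tD W)
  have T_smult2: "T p (r \<odot>\<^bsub>N\<^esub> q) = \<psi> r * T p q" if "p \<in> carrier M" "r \<in> carrier R" "q \<in> carrier N" for p r q
    using that by (simp add: T_def tD W)
  have t_T: "t p q = gW (T p q)" if "p \<in> carrier M" "q \<in> carrier N" for p q
    using that by (simp add: T_def tD W)
  \<comment> \<open>As \<open>W\<close> is free of rank one, a linear map out of it is known from its value at the element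
      corresponding to \<open>1\<close>.\<close>
  have lin_W: "h (t p q) = \<rho> (T p q) \<odot>\<^bsub>Q\<^esub> h (gW 1)"
    if "h \<in> linear_maps R W Q" "p \<in> carrier M" "q \<in> carrier N" for h p q and Q :: "('a, 'a list) module"
  proof -
    have "t p q = gW (\<psi> (\<rho> (T p q)) * 1)" using t_T that T_S by simp
    also have "\<dots> = \<rho> (T p q) \<odot>\<^bsub>W\<^esub> gW 1" using T_S[OF that(2,3)] by (intro W(8)) simp_all
    finally show ?thesis using linear_mapsD(3)[OF that(1)] T_S[OF that(2,3)] W(2)[OF S_one] by simp
  qed
  \<comment> \<open>The ideal generated by the values of the pairing; it will turn out to be the unit ideal.\<close>
  define b where "b = \<Inter>{K. submod K \<and> (\<forall>p\<in>carrier M. \<forall>q\<in>carrier N. T p q \<in> K)}"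
  have b: "submod b" unfolding b_def
    by (rule submodI) (auto simp: submod_add submod_smult)
  have b_T: "T p q \<in> b" if "p \<in> carrier M" "q \<in> carrier N" for p q
    using that unfolding b_def by blast
  have b_least: "b \<subseteq> K" if "submod K" "\<And>p q. p \<in> carrier M \<Longrightarrow> q \<in> carrier N \<Longrightarrow> T p q \<in> K" for K
    using that unfolding b_def by blast
  have "\<exists>p\<in>carrier M. \<exists>q\<in>carrier N. T p q \<noteq> 0"
  proof (rule ccontr)
    assume "\<not> ?thesis"
    hence t0: "t p q = \<zero>\<^bsub>W\<^esub>" if "p \<in> carrier M" "q \<in> carrier N" for p q
      using that W(10) by (simp add: t_T)
    have "(\<lambda>x. x) \<in> linear_maps R W W" "(\<lambda>x. \<zero>\<^bsub>W\<^esub>) \<in> linear_maps R W W"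
      by (rule linear_mapsI; simp)+
    from universal_bilinear_eq[OF t mods(3) mods(3) this]
    have "gW 1 = \<zero>\<^bsub>W\<^esub>" using t0 W(2)[OF S_one] by simp
    hence "hW (gW 1) = 0" by (simp add: W(9))
    thus False using W(4)[OF S_one] by simp
  qed
  then obtain p1 q1 where p1: "p1 \<in> carrier M" and q1: "q1 \<in> carrier N" and c_nz: "T p1 q1 \<noteq> 0" by blast
  define c where "c = T p1 q1"
  have one_b: "1 \<in> b"
  proof -
    have "scale 1 b \<subseteq> S" using b_least[OF submod_S T_S] by simp
    then obtain B :: "('a, 'a list) module" where B: "module R B" "rep B b"
      using exists_rep[OF b, of 1] by auto
    interpret B: module R B by fact
    obtain hB gB where B_via: "rep_via B b hB gB" using repE[OF B(2,1)] by blast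
    note B = rep_viaD[OF B_via]
    have s: "(\<lambda>p q. gB (T p q)) \<in> bilinear_maps R M N B"
      by (rule bilinear_mapsI) (simp_all add: B b_T T_add1 T_add2 T_smult1 T_smult2)
    obtain h where h: "h \<in> linear_maps R W B" "\<And>p q. p \<in> carrier M \<Longrightarrow> q \<in> carrier N \<Longrightarrow> h (t p q) = gB (T p q)"
      using universal_bilinear_ex[OF t \<open>module R B\<close> s] by blast
    define e where "e = hB (h (gW 1))"
    have hc: "h (gW 1) \<in> carrier B" using linear_mapsD(1)[OF h(1)] W(2)[OF S_one] by blast
    hence e: "e \<in> b" unfolding e_def by (rule B(1))
    have "c = hB (gB (T p1 q1))" using B(4)[OF b_T[OF p1 q1]] by (simp add: c_def)
    also have "gB (T p1 q1) = \<rho> (T p1 q1) \<odot>\<^bsub>B\<^esub> h (gW 1)" using h(2)[OF p1 q1] lin_W[OF h(1) p1 q1] by simp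
    also have "hB \<dots> = c * e" using B(6)[OF _ hc] T_S[OF p1 q1] by (simp add: c_def e_def)
    finally have "e = 1" using c_nz by (simp add: c_def)
    thus ?thesis using e by simp
  qed
  \<comment> \<open>A linear map on \<open>W\<close> is multiplication of one element by the value in \<open>S\<close>, so each bilinear map
      \<open>(p, q) \<mapsto> T(p',q) p\<close> yields an element \<open>g(p')\<close>.\<close>
  have "\<exists>g. g \<in> carrier M \<and> (\<forall>p\<in>carrier M. \<forall>q\<in>carrier N. \<rho> (T p' q) \<odot>\<^bsub>M\<^esub> p = \<rho> (T p q) \<odot>\<^bsub>M\<^esub> g)"
    if p': "p' \<in> carrier M" for p'
  proof -
    have s: "(\<lambda>p q. \<rho> (T p' q) \<odot>\<^bsub>M\<^esub> p) \<in> bilinear_maps R M N M"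
    proof (rule bilinear_mapsI)
      fix r p q assume *: "r \<in> carrier R" "p \<in> carrier M" "q \<in> carrier N"
      show "\<rho> (T p' q) \<odot>\<^bsub>M\<^esub> (r \<odot>\<^bsub>M\<^esub> p) = r \<odot>\<^bsub>M\<^esub> (\<rho> (T p' q) \<odot>\<^bsub>M\<^esub> p)"
        using * T_S[OF p' *(3)] by (simp add: m_comm flip: M.smult_assoc1)
      show "\<rho> (T p' (r \<odot>\<^bsub>N\<^esub> q)) \<odot>\<^bsub>M\<^esub> p = r \<odot>\<^bsub>M\<^esub> (\<rho> (T p' q) \<odot>\<^bsub>M\<^esub> p)"
        using * T_S[OF p' *(3)] p' by (simp add: T_smult2 rho_mult M.smult_assoc1)
    qed (use p' T_S in \<open>simp_all add: T_add2 rho_add M.smult_l_distr M.smult_r_distr\<close>)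
    obtain h where h: "h \<in> linear_maps R W M" "\<And>p q. p \<in> carrier M \<Longrightarrow> q \<in> carrier N \<Longrightarrow> h (t p q) = \<rho> (T p' q) \<odot>\<^bsub>M\<^esub> p"
      using universal_bilinear_ex[OF t mods(1) s] by blast
    have "h (gW 1) \<in> carrier M" using linear_mapsD(1)[OF h(1)] W(2)[OF S_one] by blast
    thus ?thesis using h(2) lin_W[OF h(1)] by (intro exI[of _ "h (gW 1)"]) simp
  qed
  then obtain g where g: "\<And>p. p \<in> carrier M \<Longrightarrow> g p \<in> carrier M"
    "\<And>p' p q. p' \<in> carrier M \<Longrightarrow> p \<in> carrier M \<Longrightarrow> q \<in> carrier N \<Longrightarrow>
       \<rho> (T p' q) \<odot>\<^bsub>M\<^esub> p = \<rho> (T p q) \<odot>\<^bsub>M\<^esub> g p'"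
    by metis
  have nondeg: "p0 = \<zero>\<^bsub>M\<^esub>" if p0: "p0 \<in> carrier M" and T0: "\<And>q. q \<in> carrier N \<Longrightarrow> T p0 q = 0" for p0
  proof -
    have "submod {u \<in> S. \<rho> u \<odot>\<^bsub>M\<^esub> p0 = \<zero>\<^bsub>M\<^esub>}"
    proof (rule submodI)
      show "x + y \<in> {u \<in> S. \<rho> u \<odot>\<^bsub>M\<^esub> p0 = \<zero>\<^bsub>M\<^esub>}"
        if "x \<in> {u \<in> S. \<rho> u \<odot>\<^bsub>M\<^esub> p0 = \<zero>\<^bsub>M\<^esub>}" "y \<in> {u \<in> S. \<rho> u \<odot>\<^bsub>M\<^esub> p0 = \<zero>\<^bsub>M\<^esub>}" for x y
        using that p0 S_add[of x y] by (simp add: rho_add M.smult_l_distr)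
      show "r * x \<in> {u \<in> S. \<rho> u \<odot>\<^bsub>M\<^esub> p0 = \<zero>\<^bsub>M\<^esub>}"
        if "r \<in> S" "x \<in> {u \<in> S. \<rho> u \<odot>\<^bsub>M\<^esub> p0 = \<zero>\<^bsub>M\<^esub>}" for r x
        using that p0 S_mult[of r x] by (simp add: rho_mult M.smult_assoc1)
    qed (use p0 in simp)
    moreover have "T p q \<in> {u \<in> S. \<rho> u \<odot>\<^bsub>M\<^esub> p0 = \<zero>\<^bsub>M\<^esub>}" if "p \<in> carrier M" "q \<in> carrier N" for p q
      using g(2)[OF that(1) p0 that(2)] T0[OF that(2)] g(1)[OF that(1)] T_S[OF that] by simp
    ultimately have "b \<subseteq> {u \<in> S. \<rho> u \<odot>\<^bsub>M\<^esub> p0 = \<zero>\<^bsub>M\<^esub>}" by (rule b_least)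
    thus ?thesis using one_b p0 by auto
  qed
  have torsion_free: "p = \<zero>\<^bsub>M\<^esub>" if "r \<in> carrier R" "\<psi> r \<noteq> 0" "p \<in> carrier M" "r \<odot>\<^bsub>M\<^esub> p = \<zero>\<^bsub>M\<^esub>" for r p
  proof (rule nondeg[OF that(3)])
    fix q assume q: "q \<in> carrier N"
    have "T \<zero>\<^bsub>M\<^esub> q = 0" using T_smult1[of "\<zero>\<^bsub>M\<^esub>" \<zero> q] q by simp
    thus "T p q = 0" using T_smult1[OF that(3,1) q] that by simp
  qed
  have c_S: "c \<in> S" "c \<noteq> 0" using T_S[OF p1 q1] c_nz by (auto simp: c_def)
  have gp1: "g p1 = p1"
  proof -
    have "\<rho> c \<odot>\<^bsub>M\<^esub> (p1 \<ominus>\<^bsub>M\<^esub> g p1) = \<zero>\<^bsub>M\<^esub>"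
      using g(2)[OF p1 p1 q1] c_S g(1)[OF p1] p1
      by (simp add: c_def a_minus_def M.smult_r_distr M.smult_r_minus M.M.r_neg)
    hence "p1 \<ominus>\<^bsub>M\<^esub> g p1 = \<zero>\<^bsub>M\<^esub>"
      using torsion_free[of "\<rho> c"] c_S g(1)[OF p1] p1 by simp
    thus ?thesis using M.M.eq_of_minus_zero[OF p1 g(1)[OF p1]] by simp
  qed
  have key: "\<rho> c \<odot>\<^bsub>M\<^esub> p = \<rho> (T p q1) \<odot>\<^bsub>M\<^esub> p1" if "p \<in> carrier M" for p
    using g(2)[OF p1 that q1] by (simp add: gp1 c_def)
  have T_rank1: "c * T p q = T p q1 * T p1 q" if "p \<in> carrier M" "q \<in> carrier N" for p q
    using arg_cong[OF key[OF that(1)], of "\<lambda>x. T x q"] T_smult1 that p1 q1 c_S T_S by simp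
  define I where "I = (\<lambda>p. T p q1) ` carrier M"
  define J where "J = (\<lambda>q. T p1 q / c) ` carrier N"
  have T0: "T \<zero>\<^bsub>M\<^esub> q = 0" if "q \<in> carrier N" for q
    using T_smult1[of "\<zero>\<^bsub>M\<^esub>" \<zero> q] that by simp
  have inj: "inj_on (\<lambda>p. T p q1) (carrier M)"
  proof (rule inj_onI)
    fix p p' assume *: "p \<in> carrier M" "p' \<in> carrier M" "T p q1 = T p' q1"
    have "\<rho> c \<odot>\<^bsub>M\<^esub> p = \<rho> c \<odot>\<^bsub>M\<^esub> p'" using key * by simp
    hence "\<rho> c \<odot>\<^bsub>M\<^esub> (p \<ominus>\<^bsub>M\<^esub> p') = \<zero>\<^bsub>M\<^esub>"
      using * c_S by (simp add: a_minus_def M.smult_r_distr M.smult_r_minus M.M.r_neg)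
    hence "p \<ominus>\<^bsub>M\<^esub> p' = \<zero>\<^bsub>M\<^esub>"
      using torsion_free[of "\<rho> c"] c_S * by simp
    thus "p = p'" using M.M.eq_of_minus_zero[OF *(1,2)] by simp
  qed
  have repM: "rep M I"
    using inj unfolding I_def
    by (intro repI[of "\<lambda>p. T p q1"]) (simp_all add: inj_on_imp_bij_betw T_add1 T_smult1 q1)
  have sI: "submod I" unfolding I_def
  proof (rule submodI)
    show "0 \<in> (\<lambda>p. T p q1) ` carrier M" using T0[OF q1] by (intro image_eqI[of _ _ "\<zero>\<^bsub>M\<^esub>"]) simp_all
    show "x + y \<in> (\<lambda>p. T p q1) ` carrier M" if "x \<in> (\<lambda>p. T p q1) ` carrier M" "y \<in> (\<lambda>p. T p q1) ` carrier M" for x y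
      using that q1 by (auto simp flip: T_add1)
    show "r * x \<in> (\<lambda>p. T p q1) ` carrier M" if "r \<in> S" "x \<in> (\<lambda>p. T p q1) ` carrier M" for r x
      using that q1 by (auto simp flip: T_smult1)
  qed
  have sJ: "submod J" unfolding J_def
  proof (rule submodI)
    have "T p1 \<zero>\<^bsub>N\<^esub> = 0" using T_smult2[of p1 \<zero> "\<zero>\<^bsub>N\<^esub>"] p1 by simp
    thus "0 \<in> (\<lambda>q. T p1 q / c) ` carrier N" by (intro image_eqI[of _ _ "\<zero>\<^bsub>N\<^esub>"]) simp_all
    show "x + y \<in> (\<lambda>q. T p1 q / c) ` carrier N" if "x \<in> (\<lambda>q. T p1 q / c) ` carrier N" "y \<in> (\<lambda>q. T p1 q / c) ` carrier N" for x y
      using that p1 by (auto simp flip: T_add2 add_divide_distrib)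
    show "r * x \<in> (\<lambda>q. T p1 q / c) ` carrier N" if "r \<in> S" "x \<in> (\<lambda>q. T p1 q / c) ` carrier N" for r x
      using that p1 by (auto simp flip: T_smult2)
  qed
  have prod: "T p q1 * (T p1 q / c) = T p q" if "p \<in> carrier M" "q \<in> carrier N" for p q
    using T_rank1[OF that] c_S by (simp add: field_simps)
  have "iprod I J \<subseteq> S"
    using prod T_S by (intro iprod_least submod_S) (auto simp: I_def J_def)
  moreover have "b \<subseteq> iprod I J"
  proof (rule b_least)
    show "submod (iprod I J)" using sI by auto
    show "T p q \<in> iprod I J" if "p \<in> carrier M" "q \<in> carrier N" for p q
      unfolding prod[OF that, symmetric] using that by (intro iprod_mult) (auto simp: I_def J_def)
  qed
  moreover have "S \<subseteq> iprod I J"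
  proof
    fix x assume "x \<in> S"
    moreover have "1 \<in> iprod I J" using \<open>b \<subseteq> iprod I J\<close> one_b by blast
    ultimately show "x \<in> iprod I J" using submod_smult[OF iprod_submod[OF sI], of x 1] by simp
  qed
  ultimately have "iprod I J = S" by blast
  hence "I \<in> carrier Inv" using sI sJ by (intro InvI)
  thus ?thesis using repM by blast
qed


end

context ring_in_field begin

lemma regular_module: "module R (regular_module R)"
proof (rule moduleI)
  show "abelian_group (regular_module R)"
    by (rule abelian_groupI) (auto simp: regular_module_def a_ac intro: l_neg a_inv_closed bexI[of _ "\<ominus> _"])
qed (auto simp: regular_module_def l_distr r_distr m_assoc intro: is_cring)

lemma rep_regular: "rep (regular_module R) S"
  by (rule repI[of \<psi>]) (use psi_inj in \<open>auto simp: regular_module_def inj_on_imp_bij_betw\<close>)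

lemma Phi_S: "Phi S = iso_class R (regular_module R)"
  using Phi_iso_class[OF regular_module rep_regular] .

lemma class_mult:
  assumes "I \<in> carrier Inv" "J \<in> carrier Inv"
  shows "Phi I \<otimes>\<^bsub>module_class_monoid R\<^esub> Phi J = Phi (iprod I J)"
proof -
  obtain M :: "('a, 'a list) module" where M: "module R M" "rep M I" using Inv_rep[OF assms(1)] .
  obtain N :: "('a, 'a list) module" where N: "module R N" "rep N J" using Inv_rep[OF assms(2)] .
  have "iprod I J \<in> carrier Inv" using Inv.m_closed assms by simp
  then obtain P :: "('a, 'a list) module" where P: "module R P" "rep P (iprod I J)" using Inv_rep by blast
  have sJ: "submod J" using assms InvD by blast
  have tens: "is_tensor R M' N' P'" if "module R M'" "rep M' I" "module R N'" "rep N' J" "module R P'" "rep P' (iprod I J)"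
    for M' N' P' :: "('a, 'a list) module"
    using tensor_iprod[OF assms(1) sJ that(1,3,5,2,4,6)] .
  have "P' \<in> Phi (iprod I J)"
    if "module R P'" "M' \<in> Phi I" "N' \<in> Phi J" "is_tensor R M' N' P'" for M' N' P'
  proof -
    have "is_tensor R M' N' P" using tens[of M' N' P] that P by (simp add: Phi_def)
    hence "module_iso R P' P" using tensor_unique[OF that(4) _ that(1) P(1)] by blast
    thus ?thesis using rep_pull[OF P(2)] that by (simp add: Phi_def)
  qed
  moreover have "\<exists>M'\<in>Phi I. \<exists>N'\<in>Phi J. is_tensor R M' N' P'" if "P' \<in> Phi (iprod I J)" for P'
    using tens[OF M N, of P'] M N that by (auto simp: Phi_def)
  moreover have "module R P'" if "P' \<in> Phi (iprod I J)" for P' using that by (simp add: Phi_def)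
  ultimately show ?thesis
    unfolding module_class_monoid_def by (auto simp del: Inv_simps)
qed

lemma Phi_class: "I \<in> carrier Inv \<Longrightarrow> Phi I \<in> carrier (module_class_monoid R)"
proof -
  assume "I \<in> carrier Inv"
  then obtain M :: "('a, 'a list) module" where M: "module R M" "rep M I" using Inv_rep by blast
  have "Phi I = iso_class R M" by (rule Phi_iso_class[OF M])
  thus ?thesis using M by (simp add: module_class_monoid_def)
qed

lemma class_one: "\<one>\<^bsub>module_class_monoid R\<^esub> = Phi S"
  by (simp add: module_class_monoid_def Phi_S)

lemma Pic_carrier: "carrier (Pic R) = Phi ` carrier Inv"
proof
  show "Phi ` carrier Inv \<subseteq> carrier (Pic R)"
  proof
    fix c assume "c \<in> Phi ` carrier Inv"
    then obtain I where I: "I \<in> carrier Inv" "c = Phi I" by blast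
    obtain J where J: "J \<in> carrier Inv" "iprod I J = S" using Inv_obtain[OF I(1)] .
    have JI: "iprod J I = S" using iprod_commute J(2) by metis
    have "Phi J \<otimes>\<^bsub>module_class_monoid R\<^esub> Phi I = \<one>\<^bsub>module_class_monoid R\<^esub>"
      unfolding class_mult[OF J(1) I(1)] JI class_one ..
    moreover have "Phi I \<otimes>\<^bsub>module_class_monoid R\<^esub> Phi J = \<one>\<^bsub>module_class_monoid R\<^esub>"
      unfolding class_mult[OF I(1) J(1)] J(2) class_one ..
    ultimately show "c \<in> carrier (Pic R)"
      using Phi_class I J by (auto simp: Pic_def units_of_def Units_def)
  qed
  show "carrier (Pic R) \<subseteq> Phi ` carrier Inv"
  proof
    fix c assume "c \<in> carrier (Pic R)"
    then obtain Y where c: "c \<in> carrier (module_class_monoid R)" and Y: "Y \<in> carrier (module_class_monoid R)"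
      and cY: "c \<otimes>\<^bsub>module_class_monoid R\<^esub> Y = \<one>\<^bsub>module_class_monoid R\<^esub>"
      by (auto simp: Pic_def units_of_def Units_def)
    obtain M :: "('a, 'a list) module" where M: "module R M" "c = iso_class R M"
      using c unfolding module_class_monoid_def by (simp add: image_iff) metis
    obtain N :: "('a, 'a list) module" where N: "module R N" "Y = iso_class R N"
      using Y unfolding module_class_monoid_def by (simp add: image_iff) metis
    obtain W :: "('a, 'a list) module" where W: "module R W" "rep W S" using Inv_rep[OF S_Inv] .
    have "W \<in> c \<otimes>\<^bsub>module_class_monoid R\<^esub> Y" unfolding cY class_one using W by (simp add: Phi_def)
    then obtain M' N' where M': "M' \<in> c" "N' \<in> Y" "is_tensor R M' N' W"
      by (auto simp: module_class_monoid_def)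
    have mods: "module R M'" "module R N'" using M' M N by (auto simp: iso_class_def)
    obtain I where I: "I \<in> carrier Inv" "rep M' I"
      using invertible_module_rep[OF M'(3) mods W] by blast
    have "module_iso R M M'" using M' M by (simp add: iso_class_def)
    hence "rep M I" using rep_pull I(2) by blast
    hence "c = Phi I" unfolding M(2) by (rule Phi_iso_class[OF M(1), symmetric])
    thus "c \<in> Phi ` carrier Inv" using I by blast
  qed
qed

lemma Pic_one: "\<one>\<^bsub>Pic R\<^esub> = Phi S"
  by (simp add: Pic_def units_of_def class_one)

lemma Pic_mult: "I \<in> carrier Inv \<Longrightarrow> J \<in> carrier Inv \<Longrightarrow> Phi I \<otimes>\<^bsub>Pic R\<^esub> Phi J = Phi (iprod I J)"
  by (simp add: Pic_def units_of_def class_mult)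

lemma Pic_comm_group: "comm_group (Pic R)"
proof (rule comm_groupI)
  show "x \<otimes>\<^bsub>Pic R\<^esub> y \<in> carrier (Pic R)" if "x \<in> carrier (Pic R)" "y \<in> carrier (Pic R)" for x y
    using that Inv.m_closed unfolding Pic_carrier by (auto simp: Pic_mult)
  show "\<one>\<^bsub>Pic R\<^esub> \<in> carrier (Pic R)" unfolding Pic_carrier Pic_one by auto
  show "x \<otimes>\<^bsub>Pic R\<^esub> y \<otimes>\<^bsub>Pic R\<^esub> z = x \<otimes>\<^bsub>Pic R\<^esub> (y \<otimes>\<^bsub>Pic R\<^esub> z)"
    if "x \<in> carrier (Pic R)" "y \<in> carrier (Pic R)" "z \<in> carrier (Pic R)" for x y z
    using that Inv.m_closed Inv.m_assoc unfolding Pic_carrier by (auto simp: Pic_mult)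
  show "x \<otimes>\<^bsub>Pic R\<^esub> y = y \<otimes>\<^bsub>Pic R\<^esub> x" if "x \<in> carrier (Pic R)" "y \<in> carrier (Pic R)" for x y
    using that Inv.m_comm unfolding Pic_carrier by (auto simp: Pic_mult)
  show "\<one>\<^bsub>Pic R\<^esub> \<otimes>\<^bsub>Pic R\<^esub> x = x" if "x \<in> carrier (Pic R)" for x
    using that Inv.l_one unfolding Pic_carrier Pic_one by (auto simp: Pic_mult)
  show "\<exists>y\<in>carrier (Pic R). y \<otimes>\<^bsub>Pic R\<^esub> x = \<one>\<^bsub>Pic R\<^esub>" if "x \<in> carrier (Pic R)" for x
  proof -
    obtain I where I: "I \<in> carrier Inv" "x = Phi I" using \<open>x \<in> carrier (Pic R)\<close> unfolding Pic_carrier by blast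
    obtain J where J: "J \<in> carrier Inv" "iprod I J = S" using Inv_obtain[OF I(1)] .
    have JI: "iprod J I = S" using iprod_commute J(2) by metis
    show ?thesis unfolding Pic_carrier Pic_one I(2)
      by (rule bexI[of _ "Phi J"]) (simp_all add: Pic_mult I J JI)
  qed
qed

subsection \<open>The action of an automorphism of the ring\<close>

text \<open>
  The image of an integral ideal under an automorphism of the ring; the automorphism is not extended to the fraction field,
  so only the part of \<open>I\<close> inside \<open>S\<close> is seen.
\<close>

definition conj_ideal :: "('a \<Rightarrow> 'a) \<Rightarrow> 'f set \<Rightarrow> 'f set" where
  "conj_ideal sg I = {\<psi> (sg r) | r. r \<in> carrier R \<and> \<psi> r \<in> I}"

end

text \<open>
  The inverse \<open>th\<close> is a parameter, with \<open>sg\<close> and \<open>th\<close> mutually inverse on the whole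
  type. Restriction of scalars along \<open>th\<close> is then a bijection of module records, not only of isomorphism
  classes.
\<close>

locale ring_in_field_auto = ring_in_field +
  fixes sg th :: "'a \<Rightarrow> 'a"
  assumes sg_closed [simp]: "x \<in> carrier R \<Longrightarrow> sg x \<in> carrier R"
    and sigma_add [simp]: "x \<in> carrier R \<Longrightarrow> y \<in> carrier R \<Longrightarrow> sg (x \<oplus> y) = sg x \<oplus> sg y"
    and sigma_mult [simp]: "x \<in> carrier R \<Longrightarrow> y \<in> carrier R \<Longrightarrow> sg (x \<otimes> y) = sg x \<otimes> sg y"
    and sigma_one [simp]: "sg \<one> = \<one>"
    and theta_closed [simp]: "x \<in> carrier R \<Longrightarrow> th x \<in> carrier R"
    and sigma_theta [simp]: "sg (th x) = x"
    and theta_sigma [simp]: "th (sg x) = x"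
begin

lemma theta_add [simp]: "x \<in> carrier R \<Longrightarrow> y \<in> carrier R \<Longrightarrow> th (x \<oplus> y) = th x \<oplus> th y"
  using sigma_add[of "th x" "th y"] theta_sigma by (metis sigma_theta theta_closed)

lemma theta_mult [simp]: "x \<in> carrier R \<Longrightarrow> y \<in> carrier R \<Longrightarrow> th (x \<otimes> y) = th x \<otimes> th y"
  using sigma_mult[of "th x" "th y"] theta_sigma by (metis sigma_theta theta_closed)

lemma theta_one [simp]: "th \<one> = \<one>"
  using theta_sigma[of \<one>] by simp

lemma sigma_zero [simp]: "sg \<zero> = \<zero>"
  using sigma_add[of \<zero> \<zero>] by (metis add.r_cancel_one' sg_closed zero_closed r_zero)

lemma mem_conj_ideal: "x \<in> conj_ideal sg I \<longleftrightarrow> (\<exists>r\<in>carrier R. x = \<psi> (sg r) \<and> \<psi> r \<in> I)"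
  by (auto simp: conj_ideal_def)

lemma conj_idealI: "r \<in> carrier R \<Longrightarrow> \<psi> r \<in> I \<Longrightarrow> x = \<psi> (sg r) \<Longrightarrow> x \<in> conj_ideal sg I"
  unfolding conj_ideal_def by blast

lemma conj_idealE:
  assumes "x \<in> conj_ideal sg I" obtains r where "r \<in> carrier R" "x = \<psi> (sg r)" "\<psi> r \<in> I"
  using assms unfolding conj_ideal_def by blast

lemma conj_ideal_subset: "conj_ideal sg I \<subseteq> S"
  by (auto simp: conj_ideal_def)

lemma submod_conj: assumes "submod I" shows "submod (conj_ideal sg I)"
proof (rule submodI)
  have "0 = \<psi> (sg \<zero>)" "\<psi> \<zero> \<in> I" using assms by simp_all
  thus "0 \<in> conj_ideal sg I" by (intro conj_idealI[OF zero_closed])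
  show "x + y \<in> conj_ideal sg I" if xy: "x \<in> conj_ideal sg I" "y \<in> conj_ideal sg I" for x y
  proof -
    obtain r where r: "r \<in> carrier R" "x = \<psi> (sg r)" "\<psi> r \<in> I" using xy(1) by (rule conj_idealE)
    obtain s where s: "s \<in> carrier R" "y = \<psi> (sg s)" "\<psi> s \<in> I" using xy(2) by (rule conj_idealE)
    have "x + y = \<psi> (sg (r \<oplus> s))" using r(1) s(1) by (simp add: r(2) s(2))
    moreover have "\<psi> (r \<oplus> s) \<in> I" using submod_add[OF assms r(3) s(3)] r(1) s(1) by simp
    ultimately show ?thesis by (intro conj_idealI[OF a_closed[OF r(1) s(1)]])
  qed
  show "z * x \<in> conj_ideal sg I" if zx: "z \<in> S" "x \<in> conj_ideal sg I" for z x
  proof -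
    obtain r where r: "r \<in> carrier R" "x = \<psi> (sg r)" "\<psi> r \<in> I"
      using zx(2) by (rule conj_idealE)
    have c: "th (\<rho> z) \<in> carrier R" using that by simp
    have "z * x = \<psi> (sg (th (\<rho> z) \<otimes> r))" using r c that(1) by simp
    moreover have "\<psi> (th (\<rho> z) \<otimes> r) \<in> I" using r c submod_smult[OF assms, of "\<psi> (th (\<rho> z))"] by simp
    ultimately show ?thesis by (intro conj_idealI[OF m_closed[OF c r(1)]])
  qed
qed

lemma conj_iprod:
  assumes "I \<subseteq> S" "J \<subseteq> S" "submod I" "submod J"
  shows "conj_ideal sg (iprod I J) = iprod (conj_ideal sg I) (conj_ideal sg J)"
proof
  have IJ: "iprod I J \<subseteq> S" using iprod_subset'[of I J] assms by blast
  have "\<psi> (sg (\<rho> z)) \<in> iprod (conj_ideal sg I) (conj_ideal sg J)" if "z \<in> iprod I J" for z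
    using that
  proof induction
    case iprod_zero thus ?case by (simp add: iprod.iprod_zero)
  next
    case (iprod_step x y z)
    have S: "x \<in> S" "y \<in> S" "z \<in> S" "x * y \<in> S" using iprod_step assms(1,2) IJ iprod_mult[OF iprod_step(1,2)] by blast+
    have "\<psi> (sg (\<rho> x)) \<in> conj_ideal sg I" "\<psi> (sg (\<rho> y)) \<in> conj_ideal sg J"
      unfolding mem_conj_ideal using S(1,2) iprod_step(1,2) rho_closed psi_rho by metis+
    from iprod.iprod_step[OF this iprod_step.IH] show ?case
      using S by (simp add: rho_add rho_mult)
  qed
  note * = this
  show "conj_ideal sg (iprod I J) \<subseteq> iprod (conj_ideal sg I) (conj_ideal sg J)"
  proof
    fix x assume "x \<in> conj_ideal sg (iprod I J)"
    then obtain r where r: "r \<in> carrier R" "x = \<psi> (sg r)" "\<psi> r \<in> iprod I J"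
      unfolding mem_conj_ideal by blast
    thus "x \<in> iprod (conj_ideal sg I) (conj_ideal sg J)" using *[OF r(3)] by simp
  qed
  show "iprod (conj_ideal sg I) (conj_ideal sg J) \<subseteq> conj_ideal sg (iprod I J)"
  proof (rule iprod_least)
    show "submod (conj_ideal sg (iprod I J))" using assms by (intro submod_conj iprod_submod)
    fix x y assume "x \<in> conj_ideal sg I" "y \<in> conj_ideal sg J"
    then obtain r s where "r \<in> carrier R" "x = \<psi> (sg r)" "\<psi> r \<in> I" "s \<in> carrier R" "y = \<psi> (sg s)" "\<psi> s \<in> J"
      unfolding mem_conj_ideal by blast
    hence "x * y = \<psi> (sg (r \<otimes> s))" "\<psi> (r \<otimes> s) \<in> iprod I J" "r \<otimes> s \<in> carrier R"
      by (simp_all add: iprod_mult)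
    thus "x * y \<in> conj_ideal sg (iprod I J)"
      unfolding mem_conj_ideal by blast
  qed
qed

lemma conj_scale: assumes "u \<in> S" shows "conj_ideal sg (scale u S) = scale (\<psi> (sg (\<rho> u))) S"
proof (intro equalityI subsetI)
  fix x assume "x \<in> conj_ideal sg (scale u S)"
  then obtain r s where r: "r \<in> carrier R" "x = \<psi> (sg r)" "\<psi> r = u * \<psi> s" "s \<in> carrier R"
    unfolding mem_conj_ideal scale_def by blast
  hence "r = \<rho> u \<otimes> s" using rho_psi[OF r(1)] assms by (simp add: rho_mult)
  thus "x \<in> scale (\<psi> (sg (\<rho> u))) S" using r assms by (auto simp: scale_def)
next
  fix x assume "x \<in> scale (\<psi> (sg (\<rho> u))) S"
  then obtain s where s: "x = \<psi> (sg (\<rho> u)) * \<psi> s" "s \<in> carrier R" unfolding scale_def by blast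
  hence "x = \<psi> (sg (\<rho> u \<otimes> th s))" "\<psi> (\<rho> u \<otimes> th s) = u * \<psi> (th s)" "\<rho> u \<otimes> th s \<in> carrier R" "th s \<in> carrier R"
    using assms by simp_all
  thus "x \<in> conj_ideal sg (scale u S)"
    unfolding mem_conj_ideal scale_def by blast
qed

lemma conj_Inv: assumes "I \<in> carrier Inv" "I \<subseteq> S" shows "conj_ideal sg I \<in> carrier Inv"
proof -
  obtain J where J: "J \<in> carrier Inv" "iprod I J = S" using Inv_obtain[OF assms(1)] .
  obtain u where u: "u \<noteq> 0" "scale u J \<subseteq> S" using Inv_integral[OF J(1)] .
  have IJ: "iprod I (scale u J) = scale u S" using J by (simp add: scale_prod2)
  have "scale u S \<subseteq> S" unfolding IJ[symmetric]
    using iprod_subset'[of I "scale u J"] u assms InvD by blast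
  hence uS: "u \<in> S" using prin_mem by blast
  define v where "v = \<psi> (sg (\<rho> u))"
  have "v \<noteq> 0"
  proof
    assume "v = 0"
    hence "\<rho> v = \<zero>" by simp
    hence "sg (\<rho> u) = \<zero>" using uS by (simp add: v_def)
    hence "th (sg (\<rho> u)) = th (sg \<zero>)" by simp
    hence "\<rho> u = \<zero>" by (simp only: theta_sigma)
    hence "\<psi> (\<rho> u) = 0" by simp
    thus False using u uS by simp
  qed
  have sJ: "submod (scale u J)" using J InvD by auto
  have eq: "iprod (conj_ideal sg I) (conj_ideal sg (scale u J)) = scale v S"
    using conj_iprod[OF assms(2) u(2) InvD[OF assms(1)] sJ] IJ conj_scale[OF uS] by (simp add: v_def)
  show ?thesis
  proof (rule InvI[of _ "scale (1 / v) (conj_ideal sg (scale u J))"])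
    show "iprod (conj_ideal sg I) (scale (1 / v) (conj_ideal sg (scale u J))) = S"
      using eq \<open>v \<noteq> 0\<close> by (simp add: scale_prod2 scale_scale)
  qed (use InvD[OF assms(1)] sJ in \<open>auto intro: submod_conj\<close>)
qed

text \<open>
  If \<open>h\<close> identifies \<open>M\<close> with \<open>I\<close>, then applying \<open>sg\<close> to the values of
  \<open>h\<close> identifies the module with scalars acting through \<open>th\<close> with the conjugate ideal.
\<close>

lemma restrict_rep:
  fixes M :: "('a, 'a list) module"
  assumes "module R M" "rep M I" "I \<subseteq> S"
  shows "module R (restrict_scalars th M)" "rep (restrict_scalars th M) (conj_ideal sg I)"
proof -
  interpret M: module R M by fact
  have [simp]: "carrier (restrict_scalars th M) = carrier M" "add (restrict_scalars th M) = add M"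
     "zero (restrict_scalars th M) = zero M" "module.smult (restrict_scalars th M) r = module.smult M (th r)" for r
    by (simp_all add: restrict_scalars_def)
  show "module R (restrict_scalars th M)"
  proof (rule moduleI)
    show "abelian_group (restrict_scalars th M)"
    proof (rule abelian_groupI)
      show "\<exists>y\<in>carrier (restrict_scalars th M). y \<oplus>\<^bsub>restrict_scalars th M\<^esub> x = \<zero>\<^bsub>restrict_scalars th M\<^esub>"
        if "x \<in> carrier (restrict_scalars th M)" for x
        using that by (intro bexI[of _ "\<ominus>\<^bsub>M\<^esub> x"]) (auto simp: M.M.l_neg)
    qed (auto simp: M.M.a_assoc intro: M.M.a_comm)
  qed (auto simp: is_cring M.smult_l_distr M.smult_r_distr M.smult_assoc1)
  obtain h g where h_via: "rep_via M I h g" using repE[OF assms(2,1)] by blast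
  note h = rep_viaD[OF h_via]
  have hS: "h x \<in> S" if "x \<in> carrier M" for x using h(1)[OF that] assms(3) by blast
  show "rep (restrict_scalars th M) (conj_ideal sg I)"
  proof (rule repI[of "\<lambda>x. \<psi> (sg (\<rho> (h x)))"])
    show "bij_betw (\<lambda>x. \<psi> (sg (\<rho> (h x)))) (carrier (restrict_scalars th M)) (conj_ideal sg I)"
    proof (intro bij_betw_byWitness[where f' = "\<lambda>y. g (\<psi> (th (\<rho> y)))"] ballI subsetI)
      fix x assume x: "x \<in> carrier (restrict_scalars th M)"
      thus "g (\<psi> (th (\<rho> (\<psi> (sg (\<rho> (h x))))))) = x" using hS h(3) by simp
    next
      fix y assume "y \<in> conj_ideal sg I"
      then obtain r where r: "r \<in> carrier R" "y = \<psi> (sg r)" "\<psi> r \<in> I" unfolding mem_conj_ideal by blast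
      thus "\<psi> (sg (\<rho> (h (g (\<psi> (th (\<rho> y))))))) = y" using h(4) by simp
    next
      fix y assume "y \<in> (\<lambda>x. \<psi> (sg (\<rho> (h x)))) ` carrier (restrict_scalars th M)"
      then obtain x where "x \<in> carrier (restrict_scalars th M)" "y = \<psi> (sg (\<rho> (h x)))" by blast
      thus "y \<in> conj_ideal sg I" using hS h(1) by (intro conj_idealI[of "\<rho> (h x)"]) simp_all
    next
      fix x assume "x \<in> (\<lambda>y. g (\<psi> (th (\<rho> y)))) ` conj_ideal sg I"
      then obtain y where y: "y \<in> conj_ideal sg I" "x = g (\<psi> (th (\<rho> y)))" by blast
      obtain r where r: "r \<in> carrier R" "y = \<psi> (sg r)" "\<psi> r \<in> I" using y(1) by (rule conj_idealE)
      thus "x \<in> carrier (restrict_scalars th M)" using h(2)[OF r(3)] y(2) by simp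
    qed
  next
    fix x y assume "x \<in> carrier (restrict_scalars th M)" "y \<in> carrier (restrict_scalars th M)"
    thus "\<psi> (sg (\<rho> (h (x \<oplus>\<^bsub>restrict_scalars th M\<^esub> y)))) = \<psi> (sg (\<rho> (h x))) + \<psi> (sg (\<rho> (h y)))"
      using hS by (simp add: h rho_add)
  next
    fix r x assume "r \<in> carrier R" "x \<in> carrier (restrict_scalars th M)"
    thus "\<psi> (sg (\<rho> (h (r \<odot>\<^bsub>restrict_scalars th M\<^esub> x)))) = \<psi> r * \<psi> (sg (\<rho> (h x)))"
      using hS by (simp add: h rho_mult)
  qed
qed


lemma conj_conj: assumes "I \<subseteq> S" shows "conj_ideal th (conj_ideal sg I) = I"
proof (intro equalityI subsetI)
  fix x assume "x \<in> conj_ideal th (conj_ideal sg I)"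
  then obtain r where r: "r \<in> carrier R" "x = \<psi> (th r)" "\<psi> r \<in> conj_ideal sg I"
    unfolding conj_ideal_def by blast
  obtain s where s: "s \<in> carrier R" "\<psi> r = \<psi> (sg s)" "\<psi> s \<in> I" using r(3) by (rule conj_idealE)
  have "r = sg s" using s r(1) psi_inj sg_closed by (meson inj_onD)
  thus "x \<in> I" using r s by simp
next
  fix x assume x: "x \<in> I"
  hence xS: "x \<in> S" using assms by blast
  have "\<psi> (sg (\<rho> x)) \<in> conj_ideal sg I" using x xS by (intro conj_idealI[of "\<rho> x"]) simp_all
  moreover have "x = \<psi> (th (sg (\<rho> x)))" "sg (\<rho> x) \<in> carrier R" using xS by simp_all
  ultimately show "x \<in> conj_ideal th (conj_ideal sg I)" unfolding conj_ideal_def by blast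
qed

lemma restrict_Phi:
  assumes "I \<in> carrier Inv" "I \<subseteq> S"
  shows "restrict_scalars th ` Phi I = Phi (conj_ideal sg I)"
proof
  show "restrict_scalars th ` Phi I \<subseteq> Phi (conj_ideal sg I)"
    using restrict_rep assms by (auto simp: Phi_def)
  interpret sw: ring_in_field_auto R \<psi> th sg
    by unfold_locales simp_all
  show "Phi (conj_ideal sg I) \<subseteq> restrict_scalars th ` Phi I"
  proof
    fix M assume "M \<in> Phi (conj_ideal sg I)"
    hence M: "module R M" "rep M (conj_ideal sg I)" by (simp_all add: Phi_def)
    have "restrict_scalars sg M \<in> Phi I"
      using sw.restrict_rep[OF M conj_ideal_subset] conj_conj[OF assms(2)] by (simp add: Phi_def)
    moreover have "M = restrict_scalars th (restrict_scalars sg M)" by (simp add: restrict_scalars_def)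
    ultimately show "M \<in> restrict_scalars th ` Phi I" by blast
  qed
qed

end

section \<open>Evaluation of polynomials\<close>

definition ringhom :: "('a::comm_ring_1 \<Rightarrow> 'b::comm_ring_1) \<Rightarrow> bool" where
  "ringhom f \<longleftrightarrow> f 1 = 1 \<and> (\<forall>x y. f (x + y) = f x + f y) \<and> (\<forall>x y. f (x * y) = f x * f y)"

lemma ringhomD:
  assumes "ringhom f"
  shows "f 1 = 1" "f (x + y) = f x + f y" "f (x * y) = f x * f y" "f 0 = 0" "f (- x) = - f x"
    "f (x - y) = f x - f y" "f (x ^ n) = f x ^ n" "f (numeral k) = numeral k"
proof -
  show 1: "f 1 = 1" and 2: "f (x + y) = f x + f y" and 3: "f (x * y) = f x * f y" for x y
    using assms by (auto simp: ringhom_def)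
  show 4: "f 0 = 0" using 2[of 0 0] by (metis add_cancel_right_right add_0)
  show 5: "f (- x) = - f x" for x using 2[of x "- x"] 4 by (simp add: eq_neg_iff_add_eq_0 add.commute)
  show "f (x - y) = f x - f y" using 2[of x "- y"] 5 by simp
  show "f (x ^ n) = f x ^ n" by (induction n) (auto simp: 1 3)
  have "f (of_nat n) = of_nat n" for n by (induction n) (auto simp: 1 2 4)
  from this[of "numeral k"] show "f (numeral k) = numeral k" by simp
qed

lemma ringhom_comp: "ringhom f \<Longrightarrow> ringhom g \<Longrightarrow> ringhom (\<lambda>x. g (f x))"
  by (auto simp: ringhom_def)

lemma ringhom_const: "ringhom (\<lambda>c. [:c:])"
  by (auto simp: ringhom_def one_pCons)

lemma ringhom_to_fract: "ringhom to_fract"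
  by (auto simp: ringhom_def)

definition ev1 :: "('a::comm_ring_1 \<Rightarrow> 'b::comm_ring_1) \<Rightarrow> 'b \<Rightarrow> 'a poly \<Rightarrow> 'b" where
  "ev1 f x p = poly (map_poly f p) x"

lemma ev1_pCons: "ringhom f \<Longrightarrow> ev1 f x (pCons a p) = f a + x * ev1 f x p"
  by (simp add: ev1_def map_poly_pCons ringhomD)

lemma ev1_0 [simp]: "ev1 f x 0 = 0"
  by (simp add: ev1_def)

lemma ringhom_ev1: assumes "ringhom f" shows "ringhom (ev1 f x)"
proof -
  note f = ev1_pCons[OF assms] ringhomD[OF assms]
  have add: "ev1 f x (p + q) = ev1 f x p + ev1 f x q" for p q
    by (induction p q rule: poly_induct2) (auto simp: f algebra_simps)
  have smult: "ev1 f x (smult a p) = f a * ev1 f x p" for a p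
    by (induction p) (auto simp: f algebra_simps)
  have "ev1 f x (p * q) = ev1 f x p * ev1 f x q" for p q
    by (induction p) (auto simp: f add smult algebra_simps)
  thus ?thesis using add f by (auto simp: ringhom_def one_pCons)
qed

lemma ev1_const: "ringhom f \<Longrightarrow> ev1 f x [:a:] = f a"
  by (simp add: ev1_pCons)

lemma ev1_X: "ringhom f \<Longrightarrow> ev1 f x [:0, 1:] = x"
  by (simp add: ev1_pCons ringhomD)

lemma poly_gen_induct:
  assumes "\<And>a. P [:a:]" "P [:0, 1:]" "\<And>p q. P p \<Longrightarrow> P q \<Longrightarrow> P (p + q)" "\<And>p q. P p \<Longrightarrow> P q \<Longrightarrow> P (p * q)"
  shows "P (p :: 'a::comm_ring_1 poly)"
proof (induction p)
  case 0
  show ?case using assms(1)[of 0] by simp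
next
  case (pCons a p)
  have "P ([:a:] + [:0, 1:] * p)" by (intro assms pCons)
  thus ?case by simp
qed

text \<open>The coordinates of the polynomial ring \<open>c[x,y,z]\<close>, \<open>x\<close> being the innermost variable.\<close>

definition ev3 :: "('a::comm_ring_1 \<Rightarrow> 'b::comm_ring_1) \<Rightarrow> 'b \<Rightarrow> 'b \<Rightarrow> 'b \<Rightarrow> 'a poly poly poly \<Rightarrow> 'b" where
  "ev3 f x y z = ev1 (ev1 (ev1 f x) y) z"

abbreviation "C3 c \<equiv> [:[:[:c:]:]:]"
abbreviation X3 :: "'a::comm_ring_1 poly poly poly" where "X3 \<equiv> [:[:[:0, 1:]:]:]"
abbreviation Y3 :: "'a::comm_ring_1 poly poly poly" where "Y3 \<equiv> [:[:0, 1:]:]"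
abbreviation Z3 :: "'a::comm_ring_1 poly poly poly" where "Z3 \<equiv> [:0, 1:]"

lemma ringhom_ev3: "ringhom f \<Longrightarrow> ringhom (ev3 f x y z)"
  unfolding ev3_def by (intro ringhom_ev1)

lemma ev3_gens:
  assumes "ringhom f"
  shows "ev3 f x y z (C3 c) = f c" "ev3 f x y z X3 = x" "ev3 f x y z Y3 = y" "ev3 f x y z Z3 = z"
  unfolding ev3_def using assms by (simp_all add: ev1_const ev1_X ringhom_ev1)

lemma poly3_induct [case_names const x y z add mult]:
  assumes "\<And>c. P (C3 c)" "P X3" "P Y3" "P Z3" "\<And>p q. P p \<Longrightarrow> P q \<Longrightarrow> P (p + q)"
    "\<And>p q. P p \<Longrightarrow> P q \<Longrightarrow> P (p * q)"
  shows "P (p :: 'a::comm_ring_1 poly poly poly)"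
proof (rule poly_gen_induct[of P])
  fix a :: "'a poly poly"
  show "P [:a:]"
  proof (induction a rule: poly_gen_induct)
    case (1 a)
    show ?case
    proof (induction a rule: poly_gen_induct)
      case (3 p q) thus ?case using assms(5)[of "[:[:p:]:]" "[:[:q:]:]"] by simp
    next
      case (4 p q) thus ?case using assms(6)[of "[:[:p:]:]" "[:[:q:]:]"] by (simp add: mult.commute)
    qed (use assms in auto)
  next
    case (3 p q) thus ?case using assms(5)[of "[:p:]" "[:q:]"] by simp
  next
    case (4 p q) thus ?case using assms(6)[of "[:p:]" "[:q:]"] by (simp add: mult.commute)
  qed (use assms in auto)
qed (use assms in auto)

lemma ringhom_unique3:
  assumes "ringhom f" "ringhom g" "\<And>c. f (C3 c) = g (C3 c)" "f X3 = g X3" "f Y3 = g Y3" "f Z3 = g Z3"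
  shows "f p = g p"
  by (induction p rule: poly3_induct) (simp_all add: assms ringhomD[OF assms(1)] ringhomD[OF assms(2)])

lemma degree_oneE:
  assumes "Polynomial.degree p = 1" obtains a b where "p = [:a, b:]"
proof
  show "p = [:Polynomial.coeff p 0, Polynomial.coeff p 1:]"
    using assms by (intro poly_eqI) (auto simp: coeff_pCons coeff_eq_0 split: nat.split)
qed

text \<open>
  Only the two primes occur in a divisor; this determines the units of a polynomial ring localised at two primes.
\<close>

lemma dvd_prime_powers:
  fixes p q r :: "'a::{idom_divide,algebraic_semidom}"
  assumes "prime_elem q" "prime_elem l" "p dvd q ^ a * l ^ b"
  shows "\<exists>u i j. is_unit u \<and> p = u * q ^ i * l ^ j"
proof -
  have base: "\<exists>u j. is_unit u \<and> p = u * l ^ j" if "p dvd l ^ b" for p b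
    using that
  proof (induction b arbitrary: p)
    case 0 thus ?case by (intro exI[of _ p] exI[of _ 0]) auto
  next
    case (Suc b)
    obtain r where "l ^ Suc b = p * r" using Suc.prems by (rule dvdE)
    hence r: "l * l ^ b = p * r" by simp
    hence "l dvd p * r" by (metis dvd_triv_left)
    hence "l dvd p \<or> l dvd r" using assms(2) prime_elem_dvd_mult_iff by blast
    thus ?case
    proof
      assume "l dvd p"
      then obtain p' where p': "p = l * p'" by auto
      have "l ^ b = p' * r" using r assms(2) by (simp add: p' mult.assoc)
      then obtain u j where "is_unit u" "p' = u * l ^ j" using Suc.IH[of p'] by auto
      thus ?thesis using p' by (intro exI[of _ u] exI[of _ "Suc j"]) (auto simp: mult_ac)
    next
      assume "l dvd r"
      then obtain r' where r': "r = l * r'" by auto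
      have "l ^ b = p * r'" using r assms(2) by (simp add: r' mult.left_commute)
      thus ?thesis using Suc.IH[of p] by auto
    qed
  qed
  show ?thesis using assms(3)
  proof (induction a arbitrary: p)
    case 0
    then obtain u j where "is_unit u" "p = u * l ^ j" using base[of p b] by auto
    thus ?case by (intro exI[of _ u] exI[of _ 0] exI[of _ j]) auto
  next
    case (Suc a)
    obtain r where "q ^ Suc a * l ^ b = p * r" using Suc.prems by (rule dvdE)
    hence r: "q * (q ^ a * l ^ b) = p * r" by (simp add: mult.assoc)
    hence "q dvd p * r" by (metis dvd_triv_left)
    hence "q dvd p \<or> q dvd r" using assms(1) prime_elem_dvd_mult_iff by blast
    thus ?case
    proof
      assume "q dvd p"
      then obtain p' where p': "p = q * p'" by auto
      have "q ^ a * l ^ b = p' * r" using r assms(1) by (simp add: p' mult.assoc)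
      then obtain u i j where "is_unit u" "p' = u * q ^ i * l ^ j" using Suc.IH[of p'] by auto
      thus ?thesis using p' by (intro exI[of _ u] exI[of _ "Suc i"] exI[of _ j]) (auto simp: mult_ac)
    next
      assume "q dvd r"
      then obtain r' where r': "r = q * r'" by auto
      have "q ^ a * l ^ b = p * r'" using r assms(1) by (simp add: r' mult.left_commute)
      thus ?thesis using Suc.IH[of p] by auto
    qed
  qed
qed

lemma dvd_power_of_primes:
  fixes g h :: "'a::factorial_semiring"
  assumes "g \<noteq> 0" "\<And>p. prime p \<Longrightarrow> p dvd g \<Longrightarrow> p dvd h"
  shows "\<exists>n. g dvd h ^ n"
  using assms
proof (induction g rule: prime_divisors_induct)
  case (unit x) thus ?case by (intro exI[of _ 0]) auto
next
  case (factor p x)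
  have "\<exists>n. x dvd h ^ n" using factor by (intro factor.IH) auto
  then obtain n where "x dvd h ^ n" by blast
  moreover have "p dvd h" using factor by auto
  ultimately have "p * x dvd h ^ Suc n" by (simp add: mult_dvd_mono)
  thus ?case by blast
qed auto

section \<open>A parametrisation of the surface\<close>

text \<open>
  The constants \<open>al\<close>, \<open>mu\<close>, \<open>de\<close> stand for \<open>\<alpha>\<close>,
  \<open>\<mu>\<close>, \<open>\<delta>\<close>, and \<open>r1\<close>, \<open>r2\<close> for \<open>\<rho>\<^sub>1\<close>,
  \<open>\<rho>\<^sub>2\<close>. The sort is that of a field of characteristic zero over which the polynomial rings are
  equipped with greatest common divisors.
\<close>

locale markoff =
  fixes al mu de :: "'c::{field_char_0,factorial_ring_gcd,semiring_gcd_mult_normalize}"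
  assumes al: "al \<noteq> 0" and mu: "mu \<noteq> 0" and de: "de \<noteq> 0" and de2: "de^2 = mu^2 - 4 * al^2"
begin

definition r1 :: 'c where "r1 = (mu + de) / 2"
definition r2 :: 'c where "r2 = (mu - de) / 2"

lemma r_sum: "r1 + r2 = mu" and r_diff: "r1 - r2 = de" and r_prod: "r1 * r2 = al^2"
  using de2 by (auto simp: r1_def r2_def field_simps power2_eq_square)

text \<open>
  The polynomials \<open>q = s\<^sup>2 - xs + 1\<close> and \<open>L = \<delta>xs + 2\<mu> - \<rho>\<^sub>1x\<^sup>2\<close>
  in the variable \<open>s\<close> over \<open>c[x]\<close>.
\<close>

definition qp :: "'c poly poly" where "qp = [:1, [:0, -1:], 1:]"
definition lp :: "'c poly poly" where "lp = [:[:2 * mu, 0, - r1:], [:0, de:]:]"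

lemma deg_qp: "Polynomial.degree qp = 2" by (simp add: qp_def)

lemma qp_nz [simp]: "qp \<noteq> 0" and lp_nz [simp]: "lp \<noteq> 0"
  using de by (auto simp: qp_def lp_def)

text \<open>
  In a factorisation into two linear factors the outer coefficients would be units, hence constants, but the middle
  coefficient is \<open>-x\<close>.
\<close>

lemma irreducible_qp: "irreducible qp"
proof (rule irreducibleI)
  show "qp \<noteq> 0" by simp
  show "\<not> is_unit qp" using deg_qp by (metis degree_pCons_0 is_unit_poly_iff zero_neq_numeral)
  fix p r assume pr: "qp = p * r"
  have nz: "p \<noteq> 0" "r \<noteq> 0" using pr qp_nz by auto
  have deg: "Polynomial.degree p + Polynomial.degree r = 2"
    using degree_mult_eq[OF nz] deg_qp pr by simp
  have lc: "Polynomial.lead_coeff p * Polynomial.lead_coeff r = 1"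
    using lead_coeff_mult[of p r] by (simp add: pr[symmetric] deg_qp) (simp add: qp_def numeral_2_eq_2)
  have unit0: "is_unit p" if p0: "Polynomial.degree p = 0" "Polynomial.lead_coeff p * u = 1" for p :: "'c poly poly" and u
  proof -
    obtain c where c: "p = [:c:]" using p0(1) degree_eq_zeroE by blast
    hence "is_unit c" using p0(2) by (metis dvdI lead_coeff_pCons(2))
    thus ?thesis using c by (simp add: is_unit_const_poly_iff)
  qed
  consider "Polynomial.degree p = 0" | "Polynomial.degree r = 0" | "Polynomial.degree p = 1" "Polynomial.degree r = 1"
    using deg by linarith
  thus "is_unit p \<or> is_unit r"
  proof cases
    case 1
    thus ?thesis using unit0[of p "Polynomial.lead_coeff r"] lc by blast
  next
    case 2
    thus ?thesis using unit0[of r "Polynomial.lead_coeff p"] lc by (simp add: mult.commute)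
  next
    case 3
    obtain a0 a1 where p: "p = [:a0, a1:]" using 3(1) degree_oneE by blast
    obtain b0 b1 where r: "r = [:b0, b1:]" using 3(2) degree_oneE by blast
    have eqs: "a0 * b0 = 1" "a0 * b1 + a1 * b0 = [:0, -1:]" "a1 * b1 = 1"
      using pr unfolding p r qp_def by (auto simp: algebra_simps)
    have "Polynomial.degree a0 = 0" "Polynomial.degree b0 = 0" "Polynomial.degree a1 = 0" "Polynomial.degree b1 = 0"
      using eqs by (metis dvd_triv_left dvd_triv_right is_unit_poly_iff degree_pCons_0)+
    hence "Polynomial.degree (a0 * b1 + a1 * b0) \<le> 0"
      by (intro degree_add_le order.trans[OF degree_mult_le]) auto
    thus ?thesis using eqs by simp
  qed
qed

text \<open>
  The polynomial is linear in \<open>s\<close>, with coefficients \<open>\<delta>x\<close> and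
  \<open>2\<mu> - \<rho>\<^sub>1x\<^sup>2\<close> that have no common factor since \<open>\<mu> \<noteq> 0\<close>.
\<close>

lemma irreducible_lp: "irreducible lp"
proof (rule irreducibleI)
  show "lp \<noteq> 0" by simp
  have deg_lp: "Polynomial.degree lp = 1" using de by (simp add: lp_def)
  show "\<not> is_unit lp" using deg_lp by (metis degree_pCons_0 is_unit_poly_iff zero_neq_one)
  have key: "is_unit [:c:]" if "[:c:] dvd lp" for c :: "'c poly"
  proof -
    obtain w where w: "lp = [:c:] * w" using \<open>[:c:] dvd lp\<close> by auto
    have "c dvd Polynomial.coeff lp i" for i unfolding w by simp
    from this[of 0] this[of 1] have c: "c dvd [:2 * mu, 0, - r1:]" "c dvd [:0, de:]" by (simp_all add: lp_def)
    have "[:2 * mu:] = [:2 * mu, 0, - r1:] + [:0, r1 / de:] * [:0, de:]" using de by simp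
    hence "c dvd [:2 * mu:]" using c by (metis dvd_add dvd_mult)
    moreover have "is_unit [:2 * mu:]" using mu by (simp add: is_unit_const_poly_iff dvd_field_iff)
    ultimately have "is_unit c" by (rule dvd_trans)
    thus ?thesis by (simp add: is_unit_const_poly_iff)
  qed
  fix p r assume pr: "lp = p * r"
  have nz: "p \<noteq> 0" "r \<noteq> 0" using pr lp_nz by auto
  have "Polynomial.degree p + Polynomial.degree r = 1"
    using degree_mult_eq[OF nz] deg_lp pr by simp
  hence "Polynomial.degree p = 0 \<or> Polynomial.degree r = 0" by linarith
  thus "is_unit p \<or> is_unit r"
  proof
    assume "Polynomial.degree p = 0"
    then obtain c where "p = [:c:]" using degree_eq_zeroE by blast
    thus ?thesis using key[of c] pr by (metis dvd_triv_left)
  next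
    assume "Polynomial.degree r = 0"
    then obtain c where "r = [:c:]" using degree_eq_zeroE by blast
    thus ?thesis using key[of c] pr by (metis dvd_triv_right)
  qed
qed

lemma prime_qp: "prime_elem qp" and prime_lp: "prime_elem lp"
  using irreducible_qp irreducible_lp by (simp_all add: prime_elem_iff_irreducible)

lemma qp_dvd_small: "qp dvd p \<Longrightarrow> Polynomial.degree p < 2 \<Longrightarrow> p = 0"
  using dvd_imp_degree_le[of qp p] deg_qp by auto

text \<open>
  Constants and functions on the surface as elements of the field \<open>c(x,s)\<close>. The functions \<open>x, y, z\<close>
  are \<open>xx, yy, zz\<close>; \<open>YY = y - \<rho>\<^sub>1x\<close> and \<open>ZZ = z - \<mu>\<close> vanish on the line
  from which the surface is parametrised, and \<open>s = YY/ZZ\<close>.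
\<close>

definition kap :: "'c \<Rightarrow> 'c poly poly fract" where "kap c = to_fract [:[:c:]:]"
definition xx :: "'c poly poly fract" where "xx = to_fract [:[:0, 1:]:]"
definition ss :: "'c poly poly fract" where "ss = to_fract [:0, 1:]"
definition qq :: "'c poly poly fract" where "qq = to_fract qp"
definition ll :: "'c poly poly fract" where "ll = to_fract lp"
definition ZZ :: "'c poly poly fract" where "ZZ = - ll / qq"
definition YY :: "'c poly poly fract" where "YY = ss * ZZ"
definition yy :: "'c poly poly fract" where "yy = kap r1 * xx + YY"
definition zz :: "'c poly poly fract" where "zz = kap mu + ZZ"

lemma ringhom_kap: "ringhom kap"
  unfolding kap_def by (intro ringhom_comp[OF ringhom_const] ringhom_comp[OF ringhom_const] ringhom_to_fract)

lemmas kap_simps [simp] = ringhomD[OF ringhom_kap]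

lemma kap_eq_iff [simp]: "kap c = kap d \<longleftrightarrow> c = d"
  by (simp add: kap_def)

lemma kap_eq_0_iff [simp]: "kap c = 0 \<longleftrightarrow> c = 0"
  by (simp add: kap_def)

lemma qq_nz [simp]: "qq \<noteq> 0" and ll_nz [simp]: "ll \<noteq> 0"
  by (simp_all add: qq_def ll_def)

lemma ZZ_nz [simp]: "ZZ \<noteq> 0" by (simp add: ZZ_def)

lemma qq_eq: "qq = ss^2 - xx * ss + 1"
proof -
  have "qp = [:0, 1:]^2 - [:[:0,1:]:] * [:0,1:] + 1"
    by (simp add: qp_def power2_eq_square one_pCons)
  thus ?thesis by (simp add: qq_def ss_def xx_def power2_eq_square flip: to_fract_mult to_fract_add to_fract_diff to_fract_1)
qed

lemma ll_eq: "ll = kap de * xx * ss + 2 * kap mu - kap r1 * xx^2"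
proof -
  have "lp = [:[:de:]:] * [:[:0,1:]:] * [:0,1:] + [:[:2 * mu:]:] - [:[:r1:]:] * [:[:0,1:]:]^2"
    by (simp add: lp_def power2_eq_square)
  hence "ll = kap de * xx * ss + kap (2 * mu) - kap r1 * xx^2"
    by (simp add: ll_def ss_def xx_def kap_def power2_eq_square flip: to_fract_mult to_fract_add to_fract_diff to_fract_1)
  thus ?thesis by simp
qed

lemma kap_rel: "kap r1 + kap r2 = kap mu" "kap r1 * kap r2 = kap al ^ 2" "kap r1 - kap r2 = kap de"
  using arg_cong[OF r_sum, of kap] arg_cong[OF r_prod, of kap] arg_cong[OF r_diff, of kap] by simp_all

lemma surface_eq: "kap al ^ 2 * xx^2 + yy^2 + zz^2 - xx * yy * zz = kap mu ^ 2"
proof -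
  have "ZZ * qq = - ll" by (simp add: ZZ_def)
  hence "ZZ * (ss^2 - xx * ss + 1) + (kap de * xx * ss + 2 * kap mu - kap r1 * xx^2) = 0"
    by (simp add: qq_eq ll_eq)
  moreover have "kap al ^ 2 * xx^2 + yy^2 + zz^2 - xx * yy * zz - kap mu ^ 2 =
      ZZ * (ZZ * (ss^2 - xx * ss + 1) + (kap de * xx * ss + 2 * kap mu - kap r1 * xx^2))"
    unfolding yy_def zz_def YY_def kap_rel[symmetric] by (simp add: power2_eq_square algebra_simps)
  ultimately show ?thesis by simp
qed

definition phi3 :: "'c poly poly poly \<Rightarrow> 'c poly poly fract" where
  "phi3 = ev3 kap xx yy zz"

lemma ringhom_phi3: "ringhom phi3"
  unfolding phi3_def by (intro ringhom_ev3 ringhom_kap)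

lemmas phi3_hom = ringhomD[OF ringhom_phi3]
lemmas phi3_gens = ev3_gens[OF ringhom_kap, of xx yy zz, folded phi3_def]

definition fpoly :: "'c poly poly poly" where "fpoly = surface_poly (al^2) (mu^2)"

lemma fpoly_eq: "fpoly = C3 (al^2) * X3^2 + Y3^2 + Z3^2 - X3 * Y3 * Z3 - C3 (mu^2)"
  by (simp only: fpoly_def surface_poly_def Let_def)

lemma phi3_fpoly: "phi3 fpoly = 0"
  unfolding fpoly_eq using surface_eq by (simp only: phi3_hom phi3_gens kap_simps diff_self)

subsection \<open>The kernel of the parametrisation\<close>

text \<open>
  The equation is monic of degree two in \<open>z\<close>.
\<close>

lemma divide_by_fpoly: "\<exists>H g0 g1. G = fpoly * H + [:g0, g1:]"
proof (induction G)
  case 0 show ?case by (intro exI[of _ 0]) simp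
next
  case (pCons b G)
  then obtain H g0 g1 where G: "G = fpoly * H + [:g0, g1:]" by blast
  define f0 :: "'c poly poly" where "f0 = [:[:al^2:]:] * [:[:0,1:]:]^2 + [:0,1:]^2 - [:[:mu^2:]:]"
  define f1 :: "'c poly poly" where "f1 = - ([:[:0,1:]:] * [:0,1:])"
  have f: "fpoly = [:f0, f1, 1:]"
    unfolding fpoly_eq f0_def f1_def by (simp add: power2_eq_square mult_pCons_left one_pCons)
  have "pCons b G = [:b:] + [:0,1:] * (fpoly * H + [:g0, g1:])" by (simp add: G)
  also have "\<dots> = fpoly * ([:0,1:] * H + [:g1:]) + [:b - g1 * f0, g0 - g1 * f1:]"
    unfolding f by (simp add: algebra_simps)
  finally show ?case by blast
qed

abbreviation xi1 :: "'c poly \<Rightarrow> 'c poly poly fract" where "xi1 p \<equiv> to_fract [:p:]"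

lemma ringhom_xi1: "ringhom xi1"
  by (intro ringhom_comp[OF ringhom_const] ringhom_to_fract)

lemma ev1_kap: "ev1 kap xx = xi1"
proof
  fix p show "ev1 kap xx p = xi1 p"
  proof (induction p)
    case (pCons a p)
    have "xi1 (pCons a p) = kap a + xx * xi1 p"
      by (simp add: kap_def xx_def flip: to_fract_mult to_fract_add)
    thus ?case by (simp add: ev1_pCons[OF ringhom_kap] pCons)
  qed simp
qed

text \<open>
  Numerators of \<open>y\<close> and \<open>z\<close> over the common denominator \<open>q\<close>.
\<close>

definition np :: "'c poly poly" where "np = [:[:0, r1:]:] * qp - [:0,1:] * lp"
definition mp :: "'c poly poly" where "mp = [:[:mu:]:] * qp - lp"

lemma yy_np: "yy = to_fract np / qq"
proof -
  have "to_fract np = kap r1 * xx * qq - ss * ll"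
    by (simp add: np_def qq_def ll_def ss_def kap_def xx_def flip: to_fract_mult)
  thus ?thesis by (simp add: yy_def YY_def ZZ_def field_simps)
qed

lemma zz_mp: "zz = to_fract mp / qq"
proof -
  have "to_fract mp = kap mu * qq - ll"
    by (simp only: mp_def qq_def ll_def kap_def to_fract_diff to_fract_mult)
  thus ?thesis by (simp add: zz_def ZZ_def field_simps)
qed

text \<open>
  Modulo \<open>q\<close> only the leading coefficient survives when the denominators of a polynomial in \<open>y\<close> of
  degree \<open>n\<close> are cleared by \<open>q\<^sup>n\<close>.
\<close>

lemma homogenise:
  assumes "Polynomial.degree g \<le> n"
  shows "\<exists>w. ev1 xi1 yy g * qq ^ n = to_fract ([:Polynomial.coeff g n:] * np ^ n + qp * w)"
proof -
  have "ev1 xi1 yy g = (\<Sum>i\<le>n. xi1 (Polynomial.coeff g i) * yy ^ i)"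
  proof -
    have "ev1 xi1 yy g = (\<Sum>i\<le>Polynomial.degree g. xi1 (Polynomial.coeff g i) * yy ^ i)"
    proof -
      have "Polynomial.degree (map_poly xi1 g) = Polynomial.degree g" by (intro degree_map_poly) simp
      thus ?thesis by (simp add: ev1_def poly_altdef coeff_map_poly)
    qed
    also have "\<dots> = (\<Sum>i\<le>n. xi1 (Polynomial.coeff g i) * yy ^ i)"
      using assms by (intro sum.mono_neutral_left) (auto simp: coeff_eq_0)
    finally show ?thesis .
  qed
  hence "ev1 xi1 yy g * qq ^ n = (\<Sum>i\<le>n. xi1 (Polynomial.coeff g i) * yy ^ i * qq ^ n)"
    by (simp add: sum_distrib_right)
  also have "\<dots> = (\<Sum>i\<le>n. to_fract ([:Polynomial.coeff g i:] * np ^ i * qp ^ (n - i)))"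
  proof (intro sum.cong refl)
    fix i assume i: "i \<in> {..n}"
    have pw: "to_fract (p ^ k) = to_fract p ^ k" for p :: "'c poly poly" and k by (induction k) auto
    have "qq ^ n = qq ^ i * qq ^ (n - i)" using i by (simp flip: power_add)
    thus "xi1 (Polynomial.coeff g i) * yy ^ i * qq ^ n = to_fract ([:Polynomial.coeff g i:] * np ^ i * qp ^ (n - i))"
      by (simp add: yy_np power_divide pw qq_def del: mult_pCons_left)
  qed
  also have "\<dots> = to_fract (\<Sum>i\<le>n. [:Polynomial.coeff g i:] * np ^ i * qp ^ (n - i))"
    using sum_comp_morphism[of to_fract "\<lambda>i. [:Polynomial.coeff g i:] * np ^ i * qp ^ (n - i)" "{..n}"]
    by (simp add: o_def)
  also have "(\<Sum>i\<le>n. [:Polynomial.coeff g i:] * np ^ i * qp ^ (n - i)) =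
      [:Polynomial.coeff g n:] * np ^ n + (\<Sum>i<n. [:Polynomial.coeff g i:] * np ^ i * qp ^ (n - i))"
    by (simp add: lessThan_Suc_atMost[symmetric] add.commute)
  also have "(\<Sum>i<n. [:Polynomial.coeff g i:] * np ^ i * qp ^ (n - i)) =
      qp * (\<Sum>i<n. [:Polynomial.coeff g i:] * np ^ i * qp ^ (n - i - 1))"
    unfolding sum_distrib_left
  proof (intro sum.cong refl)
    fix i assume "i \<in> {..<n}"
    hence "n - i = Suc (n - i - 1)" by simp
    hence "qp ^ (n - i) = qp * qp ^ (n - i - 1)" by (metis power_Suc)
    thus "[:Polynomial.coeff g i:] * np ^ i * qp ^ (n - i) = qp * ([:Polynomial.coeff g i:] * np ^ i * qp ^ (n - i - 1))"
      by (simp only: mult_ac)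
  qed
  finally show ?thesis by blast
qed

text \<open>
  Clear denominators and reduce modulo the prime \<open>q\<close>, where \<open>y\<close> and \<open>z\<close> have the
  numerators \<open>-sL\<close> and \<open>-L\<close>. The top coefficients \<open>c\<close> of \<open>g\<^sub>0\<close> and
  \<open>c'\<close> of \<open>g\<^sub>1\<close> satisfy \<open>q dvd (cs + c')L\<close>, so they vanish, because
  \<open>q\<close> is prime to \<open>L\<close> and of degree two in \<open>s\<close>; descend on the degree.
\<close>

lemma no_linear_relation:
  assumes eq: "ev1 xi1 yy g0 + ev1 xi1 yy g1 * zz = 0"
  shows "g0 = 0 \<and> g1 = 0"
proof -
  have qp_lp: "\<not> qp dvd lp"
  proof
    assume "qp dvd lp"
    hence "lp = 0" by (rule qp_dvd_small) (simp add: lp_def)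
    thus False by simp
  qed
  \<comment> \<open>The degree bounds differ by one because the second summand carries the factor \<open>z\<close>, which also
      contributes a denominator \<open>q\<close>.\<close>
  have step: "Polynomial.coeff g0 (Suc n) = 0 \<and> Polynomial.coeff g1 n = 0"
    if d: "Polynomial.degree g0 \<le> Suc n" "Polynomial.degree g1 \<le> n" for n
  proof -
    define c where "c = Polynomial.coeff g0 (Suc n)"
    define c' where "c' = Polynomial.coeff g1 n"
    obtain w where w: "ev1 xi1 yy g0 * qq ^ Suc n = to_fract ([:c:] * np ^ Suc n + qp * w)"
      using homogenise[OF d(1)] by (auto simp: c_def)
    obtain w' where w': "ev1 xi1 yy g1 * qq ^ n = to_fract ([:c':] * np ^ n + qp * w')"
      using homogenise[OF d(2)] by (auto simp: c'_def)
    have "to_fract ([:c:] * np ^ Suc n + qp * w + ([:c':] * np ^ n + qp * w') * mp)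
        = ev1 xi1 yy g0 * qq ^ Suc n + ev1 xi1 yy g1 * qq ^ n * to_fract mp"
      unfolding w w' by simp
    also have "to_fract mp = zz * qq" by (simp add: zz_mp)
    also have "ev1 xi1 yy g0 * qq ^ Suc n + ev1 xi1 yy g1 * qq ^ n * (zz * qq) =
       (ev1 xi1 yy g0 + ev1 xi1 yy g1 * zz) * qq ^ Suc n" by (simp add: algebra_simps)
    finally have "[:c:] * np ^ Suc n + qp * w + ([:c':] * np ^ n + qp * w') * mp = 0"
      unfolding eq by (simp only: to_fract_eq_0_iff mult_zero_left)
    hence "np ^ n * ([:c:] * np + [:c':] * mp) = qp * (- w - w' * mp)" by (simp add: algebra_simps add_eq_0_iff)
    hence "qp dvd np ^ n * ([:c:] * np + [:c':] * mp)" by (metis dvd_triv_left)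
    hence "qp dvd np ^ n \<or> qp dvd [:c:] * np + [:c':] * mp"
      using prime_qp prime_elem_dvd_mult_iff by blast
    moreover have "\<not> qp dvd np ^ n"
    proof
      assume "qp dvd np ^ n"
      hence "qp dvd np" using prime_elem_dvd_power[OF prime_qp] by blast
      hence "qp dvd [:[:0, r1:]:] * qp - np" by (rule dvd_diff[OF dvd_triv_right])
      also have "[:[:0, r1:]:] * qp - np = [:0,1:] * lp" by (simp only: np_def) (rule diff_diff_eq2[THEN trans], simp)
      finally have "qp dvd [:0,1:] \<or> qp dvd lp" using prime_qp prime_elem_dvd_mult_iff by blast
      thus False using qp_lp qp_dvd_small[of "[:0,1:]"] by auto
    qed
    ultimately have "qp dvd [:c:] * np + [:c':] * mp" by blast
    hence "qp dvd ([:c:] * [:[:0, r1:]:] + [:c':] * [:[:mu:]:]) * qp - ([:c:] * np + [:c':] * mp)"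
      by (rule dvd_diff[OF dvd_triv_right])
    also have "([:c:] * [:[:0, r1:]:] + [:c':] * [:[:mu:]:]) * qp - ([:c:] * np + [:c':] * mp) = ([:c:] * [:0,1:] + [:c':]) * lp"
      unfolding np_def mp_def by (simp only: algebra_simps)
    finally have "qp dvd [:c:] * [:0,1:] + [:c':]"
      using prime_qp prime_elem_dvd_mult_iff qp_lp by blast
    hence "qp dvd [:c', c:]" by simp
    hence "[:c', c:] = 0" by (rule qp_dvd_small) simp
    thus ?thesis by (simp add: c_def c'_def)
  qed
  have "Polynomial.degree g0 \<le> Suc n \<Longrightarrow> Polynomial.degree g1 \<le> n \<Longrightarrow> Polynomial.degree g0 = 0 \<and> g1 = 0" for n
  proof (induction n)
    case 0
    from step[OF 0] have "Polynomial.coeff g0 1 = 0" "Polynomial.coeff g1 0 = 0" by auto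
    moreover have "g1 = [:Polynomial.coeff g1 0:]" using 0 by (metis degree_eq_zeroE coeff_pCons_0 le_zero_eq)
    moreover have "Polynomial.degree g0 \<noteq> 1" using \<open>Polynomial.coeff g0 1 = 0\<close> by (metis degree_0 leading_coeff_0_iff zero_neq_one)
    ultimately show ?case using 0 by simp
  next
    case (Suc n)
    from step[OF Suc.prems] have "Polynomial.coeff g0 (Suc (Suc n)) = 0" "Polynomial.coeff g1 (Suc n) = 0" by auto
    hence "Polynomial.degree g0 \<noteq> Suc (Suc n)" "Polynomial.degree g1 \<noteq> Suc n"
      by (metis degree_0 leading_coeff_0_iff nat.distinct(1))+
    thus ?case using Suc by simp
  qed
  from this[of "max (Polynomial.degree g0) (Polynomial.degree g1)"]
  have *: "Polynomial.degree g0 = 0" "g1 = 0" by auto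
  then obtain c where c: "g0 = [:c:]" using degree_eq_zeroE by blast
  have "xi1 c = 0" using eq by (simp add: c * ev1_const[OF ringhom_xi1])
  thus ?thesis using c * by simp
qed

text \<open>
  Modulo the equation every polynomial has the form \<open>g\<^sub>0(x,y) + g\<^sub>1(x,y) z\<close>, and such a polynomial
  vanishes on the surface only if it is zero.
\<close>

lemma phi3_eq_0_iff: "phi3 G = 0 \<longleftrightarrow> fpoly dvd G"
proof
  assume "fpoly dvd G"
  thus "phi3 G = 0" using phi3_fpoly by (auto simp: phi3_hom)
next
  assume 0: "phi3 G = 0"
  obtain H g0 g1 where G: "G = fpoly * H + [:g0, g1:]" using divide_by_fpoly by blast
  have hom: "ringhom (ev1 (ev1 kap xx) yy)" by (intro ringhom_ev1 ringhom_kap)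
  have "phi3 [:g0, g1:] = 0" using 0 phi3_fpoly by (simp add: G phi3_hom)
  moreover have "phi3 [:g0, g1:] = ev1 xi1 yy g0 + ev1 xi1 yy g1 * zz"
    unfolding phi3_def ev3_def using hom by (simp add: ev1_pCons ev1_kap mult.commute)
  ultimately have "g0 = 0 \<and> g1 = 0" using no_linear_relation by simp
  thus "fpoly dvd G" using G by simp
qed

end

section \<open>The lines on the surface\<close>

lemma fibre1_identity:
  fixes x y z a c d d' t t' m :: "'a::idom"
  assumes "a * x^2 + y^2 + z^2 - x * y * z = m" "t + t' = c" "t * t' = 1" "d + d' = 0"
    "t * d' + t' * d = 0" "d * d' = a * c^2 - m"
  shows "(x - c) * (y * z - a * (x + c)) = (y - t * z - d) * (y - t' * z - d')"
proof -
  have "(y - t * z - d) * (y - t' * z - d') =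
      y^2 - (t + t') * (y * z) + (t * t') * z^2 - (d + d') * y + (t * d' + t' * d) * z + d * d'"
    by (simp add: algebra_simps power2_eq_square)
  also have "\<dots> = y^2 - c * (y * z) + z^2 + (a * c^2 - m)" unfolding assms(2-6) by simp
  also have "\<dots> = (x - c) * (y * z - a * (x + c))"
    unfolding assms(1)[symmetric] by (simp add: algebra_simps power2_eq_square)
  finally show ?thesis by (rule sym)
qed

text \<open>
  Cofactors for the unit ideal in \<open>ideal2_pair\<close>, for two lines in the plane \<open>x = c\<close> that meet in
  the point \<open>y = z = 0\<close>.
\<close>

lemma fibre1_unit_identity:
  fixes x y z a c e f t t' :: "'a::idom"
  assumes "(t' - t) * e = 1" "2 * a * c * f = 1"
  shows "(x - c) * (- (a * f)) + (y - t * z) * (f * (z + t * z * e)) + (y - t' * z) * (- (f * t * z * e))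
     + (y * z - a * (x + c)) * (- f) = 1" (is "?l = 1")
proof -
  have "?l = 2 * a * c * f + f * t * z^2 * ((t' - t) * e - 1)"
    by (simp add: algebra_simps power2_eq_square)
  thus ?thesis unfolding assms by simp
qed

lemma fibre2_identity:
  fixes x y z a c t t' m :: "'a::idom"
  assumes "a * x^2 + y^2 + z^2 - x * y * z = m" "t + t' = c" "t * t' = a" "c^2 = m"
  shows "(z - c) * (x * y - z - c) = (y - t * x) * (y - t' * x)"
proof -
  have "(y - t * x) * (y - t' * x) = y^2 - (t + t') * (x * y) + (t * t') * x^2"
    by (simp add: algebra_simps power2_eq_square)
  also have "\<dots> = y^2 - c * (x * y) + a * x^2 + (c^2 - m)" unfolding assms(2-4) by simp
  also have "\<dots> = (z - c) * (x * y - z - c)"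
    unfolding assms(1)[symmetric] by (simp add: algebra_simps power2_eq_square)
  finally show ?thesis by (rule sym)
qed

text \<open>
  The same for two lines in the plane \<open>z = c\<close> that meet in the point \<open>x = y = 0\<close>.
\<close>

lemma fibre2_unit_identity:
  fixes x y z c e f t t' :: "'a::idom"
  assumes "(t' - t) * e = 1" "2 * c * f = 1"
  shows "(z - c) * (- f) + (y - t * x) * (f * (x + t * x * e)) + (y - t' * x) * (- (f * t * x * e))
     + (x * y - z - c) * (- f) = 1" (is "?l = 1")
proof -
  have "?l = 2 * c * f + f * t * x^2 * ((t' - t) * e - 1)"
    by (simp add: algebra_simps power2_eq_square)
  thus ?thesis unfolding assms by simp
qed

context markoff
begin

text \<open>
  The coordinate ring of the surface, inside the field \<open>c(x,s)\<close>.
\<close>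

definition SS :: "'c poly poly fract set" where "SS = range phi3"

sublocale subring_of_field SS
proof
  show "1 \<in> SS" unfolding SS_def using phi3_hom(1) by (metis rangeI)
  show "x + y \<in> SS" if "x \<in> SS" "y \<in> SS" for x y
    using that unfolding SS_def by (auto simp flip: phi3_hom)
  show "x * y \<in> SS" if "x \<in> SS" "y \<in> SS" for x y
    using that unfolding SS_def by (auto simp flip: phi3_hom)
  show "- x \<in> SS" if "x \<in> SS" for x
    using that unfolding SS_def by (auto simp flip: phi3_hom)
qed

lemma SS_phi3 [simp]: "phi3 G \<in> SS"
  by (simp add: SS_def)

lemma SS_gens [simp]: "kap c \<in> SS" "xx \<in> SS" "yy \<in> SS" "zz \<in> SS"
  unfolding SS_def using phi3_gens by (metis rangeI)+

lemma scale_const: assumes "c \<noteq> 0" shows "scale (kap c) SS = SS"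
proof
  show "scale (kap c) SS \<subseteq> SS" unfolding scale_def by auto
  show "SS \<subseteq> scale (kap c) SS"
  proof
    fix x assume "x \<in> SS"
    hence "kap (1 / c) * x \<in> SS" by auto
    moreover have "x = kap c * (kap (1 / c) * x)"
      using assms kap_simps(3)[of c "1 / c"] by (simp flip: mult.assoc)
    ultimately show "x \<in> scale (kap c) SS" unfolding scale_def by blast
  qed
qed

text \<open>
  A triple of polynomials in one variable is a curve in affine space; the curves used below are lines.
\<close>

definition on_surface :: "'c poly \<times> 'c poly \<times> 'c poly \<Rightarrow> bool" where
  "on_surface = (\<lambda>(p, q, r). [:al^2:] * p^2 + q^2 + r^2 - p * q * r = [:mu^2:])"

text \<open>
  Restriction of a function to a parametrised curve.
\<close>

definition lam :: "'c poly \<times> 'c poly \<times> 'c poly \<Rightarrow> 'c poly poly poly \<Rightarrow> 'c poly" where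
  "lam = (\<lambda>(p, q, r). ev3 (\<lambda>c. [:c:]) p q r)"

lemma ringhom_lam: "ringhom (lam t)"
  unfolding lam_def by (cases t) (auto intro: ringhom_ev3 ringhom_const)

lemmas lam_hom = ringhomD[OF ringhom_lam]

lemma lam_gens: "lam (p, q, r) (C3 c) = [:c:]" "lam (p, q, r) X3 = p" "lam (p, q, r) Y3 = q" "lam (p, q, r) Z3 = r"
  unfolding lam_def by (simp_all only: prod.case ev3_gens[OF ringhom_const])

lemma lam_fpoly: "on_surface t \<Longrightarrow> lam t fpoly = 0"
  unfolding fpoly_eq by (cases t) (simp only: on_surface_def prod.case lam_hom lam_gens diff_self)

definition line :: "'c poly \<times> 'c poly \<times> 'c poly \<Rightarrow> 'c poly poly fract set" where
  "line t = phi3 ` {G. lam t G = 0}"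

text \<open>
  The membership depends only on the function on the surface, because the curve lies on the surface.
\<close>

lemma phi3_mem_line: assumes "on_surface t" shows "phi3 G \<in> line t \<longleftrightarrow> lam t G = 0"
proof
  assume "phi3 G \<in> line t"
  then obtain H where H: "lam t H = 0" "phi3 G = phi3 H" by (auto simp: line_def)
  hence "phi3 (G - H) = 0" by (simp add: phi3_hom)
  then obtain K where "G - H = fpoly * K" unfolding phi3_eq_0_iff by auto
  hence "lam t (G - H) = 0" using lam_fpoly[OF assms] by (simp add: lam_hom)
  thus "lam t G = 0" using H by (simp add: lam_hom)
qed (auto simp: line_def)

lemma line_subset: "line t \<subseteq> SS"
  by (auto simp: line_def SS_def)

lemma submod_line: "submod (line t)"
proof (rule submodI)
  show "0 \<in> line t" unfolding line_def by (rule image_eqI[of _ _ 0]) (auto simp: phi3_hom lam_hom)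
  show "x + y \<in> line t" if xy: "x \<in> line t" "y \<in> line t" for x y
  proof -
    obtain G H where "x = phi3 G" "y = phi3 H" "lam t G = 0" "lam t H = 0" using xy by (auto simp: line_def)
    thus ?thesis unfolding line_def by (intro image_eqI[of _ _ "G + H"]) (auto simp: phi3_hom lam_hom)
  qed
  show "x * y \<in> line t" if xy: "x \<in> SS" "y \<in> line t" for x y
  proof -
    obtain G H where "x = phi3 G" "y = phi3 H" "lam t H = 0" using xy by (auto simp: line_def SS_def)
    thus ?thesis unfolding line_def by (intro image_eqI[of _ _ "G * H"]) (auto simp: phi3_hom lam_hom)
  qed
qed

lemma prin_subset_line:
  assumes "on_surface t" shows "scale (phi3 G) SS \<subseteq> line t \<longleftrightarrow> lam t G = 0"
  using prin_mem[of "phi3 G"] prin_least[OF submod_line, of "phi3 G" t] phi3_mem_line[OF assms] by blast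

text \<open>
  The residue ring is a subring of the polynomial ring in the parameter.
\<close>

lemma iprime_line:
  assumes "on_surface t" "line t \<in> carrier Inv" shows "iprime (line t)"
proof -
  have "phi3 1 \<notin> line t" unfolding phi3_mem_line[OF assms(1)] by (simp add: lam_hom)
  moreover have "x \<in> line t \<or> y \<in> line t" if xy: "x \<in> SS" "y \<in> SS" "x * y \<in> line t" for x y
  proof -
    obtain G H where "x = phi3 G" "y = phi3 H" using xy by (auto simp: SS_def)
    thus ?thesis using \<open>x * y \<in> line t\<close> phi3_mem_line[OF assms(1)] by (simp add: lam_hom flip: phi3_hom)
  qed
  ultimately show ?thesis unfolding iprime_def using assms(2) line_subset SS_phi3 by blast
qed

definition ideal2 :: "'c poly poly fract \<Rightarrow> 'c poly poly fract \<Rightarrow> 'c poly poly fract set" where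
  "ideal2 A B = {A * u + B * v | u v. u \<in> SS \<and> v \<in> SS}"

lemma ideal2I: "u \<in> SS \<Longrightarrow> v \<in> SS \<Longrightarrow> A * u + B * v \<in> ideal2 A B"
  unfolding ideal2_def by blast

lemma ideal2_gens: "A \<in> ideal2 A B" "B \<in> ideal2 A B"
  using ideal2I[of 1 0 A B] ideal2I[of 0 1 A B] by simp_all

lemma submod_ideal2: "submod (ideal2 A B)"
proof (rule submodI)
  show "0 \<in> ideal2 A B" using ideal2I[of 0 0 A B] by simp
  show "x + y \<in> ideal2 A B" if xy: "x \<in> ideal2 A B" "y \<in> ideal2 A B" for x y
  proof -
    obtain u v u' v' where "x = A * u + B * v" "y = A * u' + B * v'" "u \<in> SS" "v \<in> SS" "u' \<in> SS" "v' \<in> SS"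
      using xy unfolding ideal2_def by blast
    thus ?thesis using ideal2I[of "u + u'" "v + v'" A B] by (simp add: S_add algebra_simps)
  qed
  show "r * x \<in> ideal2 A B" if xy: "r \<in> SS" "x \<in> ideal2 A B" for r x
  proof -
    obtain u v where "x = A * u + B * v" "u \<in> SS" "v \<in> SS" using xy unfolding ideal2_def by blast
    thus ?thesis using ideal2I[of "r * u" "r * v" A B] xy by (simp add: S_mult algebra_simps)
  qed
qed

lemma ev1_SS: "w \<in> SS \<Longrightarrow> ev1 kap w p \<in> SS"
  by (induction p) (auto simp: ev1_pCons[OF ringhom_kap])

text \<open>
  On a line one of the coordinates is a parameter \<open>w\<close>, and modulo the equations of the line every
  function is the corresponding polynomial in \<open>w\<close>.
\<close>

lemma line_eq_ideal2:
  assumes t: "on_surface (p, q, r)" and w: "w \<in> SS"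
    and mem: "A \<in> line (p, q, r)" "B \<in> line (p, q, r)"
    and x: "xx - ev1 kap w p \<in> ideal2 A B" and y: "yy - ev1 kap w q \<in> ideal2 A B"
    and z: "zz - ev1 kap w r \<in> ideal2 A B"
  shows "line (p, q, r) = ideal2 A B"
proof
  note s = submod_ideal2[of A B]
  note eh = ringhomD[OF ringhom_ev1[OF ringhom_kap], of w]
  have *: "phi3 G - ev1 kap w (lam (p, q, r) G) \<in> ideal2 A B" for G
  proof (induction G rule: poly3_induct)
    case (const c)
    thus ?case using s by (simp only: phi3_gens lam_gens ev1_const[OF ringhom_kap] diff_self submod_0)
  next
    case (add P Q)
    have "phi3 (P + Q) - ev1 kap w (lam (p, q, r) (P + Q)) =
        (phi3 P - ev1 kap w (lam (p, q, r) P)) + (phi3 Q - ev1 kap w (lam (p, q, r) Q))"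
      by (simp add: phi3_hom lam_hom eh)
    thus ?case using submod_add[OF s add.IH] by simp
  next
    case (mult P Q)
    have "phi3 (P * Q) - ev1 kap w (lam (p, q, r) (P * Q)) =
        phi3 P * (phi3 Q - ev1 kap w (lam (p, q, r) Q)) +
        ev1 kap w (lam (p, q, r) Q) * (phi3 P - ev1 kap w (lam (p, q, r) P))"
      by (simp add: phi3_hom lam_hom eh algebra_simps)
    thus ?case using submod_add[OF s submod_smult[OF s SS_phi3 mult.IH(2)] submod_smult[OF s ev1_SS[OF w] mult.IH(1)]] by simp
  qed (use x y z in \<open>simp_all only: phi3_gens lam_gens\<close>)
  show "line (p, q, r) \<subseteq> ideal2 A B"
  proof
    fix u assume "u \<in> line (p, q, r)"
    then obtain G where "u = phi3 G" "lam (p, q, r) G = 0" by (auto simp: line_def)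
    thus "u \<in> ideal2 A B" using *[of G] by simp
  qed
  show "ideal2 A B \<subseteq> line (p, q, r)"
  proof
    fix u assume "u \<in> ideal2 A B"
    then obtain a b where "u = A * a + B * b" "a \<in> SS" "b \<in> SS" unfolding ideal2_def by blast
    thus "u \<in> line (p, q, r)"
      using submod_add[OF submod_line submod_smult'[OF submod_line _ mem(1)] submod_smult'[OF submod_line _ mem(2)]] by simp
  qed
qed

text \<open>
  The plane \<open>A = 0\<close> meets the surface in \<open>B C = 0\<close>, two curves. Their ideals have the product
  \<open>(A\<^sup>2, AB, AC, BC) = A (A, B, C, D)\<close>.
\<close>

lemma ideal2_pair:
  assumes AD: "A * D = B * C" and D: "D \<in> SS"
    and unit: "A * u1 + B * u2 + C * u3 + D * u4 = 1" "u1 \<in> SS" "u2 \<in> SS" "u3 \<in> SS" "u4 \<in> SS"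
    and ABC: "A \<in> SS" "B \<in> SS" "C \<in> SS"
  shows "iprod (ideal2 A B) (ideal2 A C) = scale A SS"
proof
  show "iprod (ideal2 A B) (ideal2 A C) \<subseteq> scale A SS"
  proof (rule iprod_least)
    show "submod (scale A SS)" by auto
    fix x y assume "x \<in> ideal2 A B" "y \<in> ideal2 A C"
    then obtain u v u' v' where *: "x = A * u + B * v" "y = A * u' + C * v'" "u \<in> SS" "v \<in> SS" "u' \<in> SS" "v' \<in> SS"
      unfolding ideal2_def by blast
    have "x * y = A * (A * u * u' + B * v * u' + C * u * v') + (B * C) * v * v'"
      unfolding * by (simp add: algebra_simps)
    also have "\<dots> = A * (A * u * u' + B * v * u' + C * u * v' + D * v * v')"
      unfolding AD[symmetric] by (simp add: algebra_simps)
    finally show "x * y \<in> scale A SS"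
      using * ABC D unfolding scale_def by (auto intro!: S_add S_mult)
  qed
  show "scale A SS \<subseteq> iprod (ideal2 A B) (ideal2 A C)"
  proof (rule prin_least)
    have s: "submod (iprod (ideal2 A B) (ideal2 A C))" using submod_ideal2 by auto
    have "A = A * (A * u1 + B * u2 + C * u3 + D * u4)" unfolding unit(1) by simp
    also have "\<dots> = u1 * (A * A) + u2 * (B * A) + u3 * (A * C) + u4 * (A * D)" by (simp add: algebra_simps)
    also have "\<dots> = u1 * (A * A) + u2 * (B * A) + u3 * (A * C) + u4 * (B * C)" by (simp add: AD)
    also have "\<dots> \<in> iprod (ideal2 A B) (ideal2 A C)"
      using unit by (intro submod_add[OF s] submod_smult[OF s] iprod_mult ideal2_gens)
    finally show "A \<in> iprod (ideal2 A B) (ideal2 A C)" .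
    show "submod (iprod (ideal2 A B) (ideal2 A C))" by (rule s)
  qed
qed

text \<open>
  The line \<open>x = c, y = tz + d\<close> with parameter \<open>z\<close>, and the line \<open>z = c, y = tx\<close> with
  parameter \<open>x\<close>.
\<close>

definition line1 :: "'c \<Rightarrow> 'c \<Rightarrow> 'c \<Rightarrow> 'c poly \<times> 'c poly \<times> 'c poly" where
  "line1 c t d = ([:c:], [:d, t:], [:0, 1:])"
definition line2 :: "'c \<Rightarrow> 'c \<Rightarrow> 'c poly \<times> 'c poly \<times> 'c poly" where
  "line2 c t = ([:0, 1:], [:0, t:], [:c:])"

lemma on_surface_line1:
  assumes "al^2 * c^2 + d^2 = mu^2" "2 * t * d = c * d" "t^2 + 1 = c * t"
  shows "on_surface (line1 c t d)"
  using assms unfolding on_surface_def line1_def by (simp add: power2_eq_square algebra_simps)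

lemma on_surface_line2:
  assumes "c^2 = mu^2" "al^2 + t^2 = c * t"
  shows "on_surface (line2 c t)"
  using assms unfolding on_surface_def line2_def by (simp add: power2_eq_square algebra_simps)

lemma line1_eq:
  assumes "on_surface (line1 c t d)"
  shows "line (line1 c t d) = ideal2 (xx - kap c) (yy - kap t * zz - kap d)"
proof -
  have "phi3 (X3 - C3 c) \<in> line (line1 c t d)" "phi3 (Y3 - C3 t * Z3 - C3 d) \<in> line (line1 c t d)"
    unfolding phi3_mem_line[OF assms] unfolding line1_def by (simp_all only: lam_hom lam_gens) simp_all
  moreover have "phi3 (X3 - C3 c) = xx - kap c" "phi3 (Y3 - C3 t * Z3 - C3 d) = yy - kap t * zz - kap d"
    by (simp_all only: phi3_hom phi3_gens)
  ultimately have mem: "xx - kap c \<in> line (line1 c t d)" "yy - kap t * zz - kap d \<in> line (line1 c t d)" by simp_all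
  show ?thesis
    using assms mem unfolding line1_def
    by (intro line_eq_ideal2[where w = zz])
       (use ideal2_gens submod_0[OF submod_ideal2] in \<open>simp_all add: ev1_pCons[OF ringhom_kap] mult.commute diff_diff_eq add.commute\<close>)
qed

lemma line2_eq:
  assumes "on_surface (line2 c t)"
  shows "line (line2 c t) = ideal2 (zz - kap c) (yy - kap t * xx)"
proof -
  have "phi3 (Z3 - C3 c) \<in> line (line2 c t)" "phi3 (Y3 - C3 t * X3) \<in> line (line2 c t)"
    unfolding phi3_mem_line[OF assms] unfolding line2_def by (simp_all only: lam_hom lam_gens) simp_all
  moreover have "phi3 (Z3 - C3 c) = zz - kap c" "phi3 (Y3 - C3 t * X3) = yy - kap t * xx"
    by (simp_all only: phi3_hom phi3_gens)
  ultimately have mem: "zz - kap c \<in> line (line2 c t)" "yy - kap t * xx \<in> line (line2 c t)" by simp_all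
  show ?thesis
    using assms mem unfolding line2_def
    by (intro line_eq_ideal2[where w = xx])
       (use ideal2_gens submod_0[OF submod_ideal2] in \<open>simp_all add: ev1_pCons[OF ringhom_kap] mult.commute\<close>)
qed

text \<open>
  A fibre of \<open>x\<close> that splits into two lines, either parallel (\<open>c = \<plusminus>2\<close>, equal slopes) or
  meeting in a point (\<open>c = \<plusminus>\<mu>/\<alpha>\<close>).
\<close>

lemma fibre1_pair:
  assumes os: "on_surface (line1 c t d)" "on_surface (line1 c t' d')"
    and rel: "t + t' = c" "t * t' = 1" "d + d' = 0" "t * d' + t' * d = 0" "d * d' = al^2 * c^2 - mu^2"
    and nd: "(t = t' \<and> d \<noteq> 0) \<or> (d = 0 \<and> t \<noteq> t' \<and> c \<noteq> 0)"
  shows "iprod (line (line1 c t d)) (line (line1 c t' d')) = scale (xx - kap c) SS"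
proof -
  define A where "A = xx - kap c"
  define B where "B = yy - kap t * zz - kap d"
  define C where "C = yy - kap t' * zz - kap d'"
  define D where "D = yy * zz - kap (al^2) * (xx + kap c)"
  have "kap t + kap t' = kap c" "kap t * kap t' = 1" "kap d + kap d' = 0" "kap t * kap d' + kap t' * kap d = 0"
     "kap d * kap d' = kap al^2 * kap c^2 - kap mu^2"
    using arg_cong[OF rel(1), of kap] arg_cong[OF rel(2), of kap] arg_cong[OF rel(3), of kap]
      arg_cong[OF rel(4), of kap] arg_cong[OF rel(5), of kap] by simp_all
  hence AD: "A * D = B * C"
    unfolding A_def B_def C_def D_def kap_simps by (intro fibre1_identity[OF surface_eq])
  have cl: "A \<in> SS" "B \<in> SS" "C \<in> SS" "D \<in> SS"
    unfolding A_def B_def C_def D_def by (auto intro!: S_add S_mult S_diff)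
  from nd have "\<exists>u1\<in>SS. \<exists>u2\<in>SS. \<exists>u3\<in>SS. \<exists>u4\<in>SS. A * u1 + B * u2 + C * u3 + D * u4 = 1"
  proof
    assume *: "t = t' \<and> d \<noteq> 0"
    have d': "d' = - d" using rel(3) by (simp add: eq_neg_iff_add_eq_0 add.commute)
    have "C - B = kap (2 * d)" unfolding B_def C_def using * d' by simp
    hence "(C - B) * kap (1 / (2 * d)) = 1" using * by (simp flip: kap_simps(3) kap_simps(1) del: kap_simps)
    hence "A * 0 + B * kap (- (1 / (2 * d))) + C * kap (1 / (2 * d)) + D * 0 = 1"
      by (simp only: kap_simps(5)) (simp add: algebra_simps del: kap_simps)
    thus ?thesis using SS_gens S_zero by blast
  next
    assume *: "d = 0 \<and> t \<noteq> t' \<and> c \<noteq> 0"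
    hence d': "d = 0" "d' = 0" using rel(3) by auto
    define e where "e = kap (1 / (t' - t))"
    define f where "f = kap (1 / (2 * al^2 * c))"
    have e: "(kap t' - kap t) * e = 1"
    proof -
      have "t' - t \<noteq> 0" using * by auto
      thus ?thesis unfolding e_def by (simp flip: kap_simps(3) kap_simps(1) kap_simps(6) del: kap_simps)
    qed
    have "kap (2 * al^2 * c) * f = 1" using * al unfolding f_def by (simp flip: kap_simps(3) kap_simps(1) del: kap_simps)
    hence f: "2 * kap al ^ 2 * kap c * f = 1" by simp
    have "A * (- (kap al ^ 2 * f)) + B * (f * (zz + kap t * zz * e)) + C * (- (f * kap t * zz * e)) + D * (- f) = 1"
      unfolding A_def B_def C_def D_def d' kap_simps diff_0_right by (rule fibre1_unit_identity[OF e f])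
    moreover have "- (kap al ^ 2 * f) \<in> SS" "f * (zz + kap t * zz * e) \<in> SS" "- (f * kap t * zz * e) \<in> SS" "- f \<in> SS"
      unfolding e_def f_def kap_simps(7)[symmetric] by (auto intro!: S_add S_mult S_uminus simp del: kap_simps)
    ultimately show ?thesis by blast
  qed
  then obtain u1 u2 u3 u4 where u: "A * u1 + B * u2 + C * u3 + D * u4 = 1" "u1 \<in> SS" "u2 \<in> SS" "u3 \<in> SS" "u4 \<in> SS" by blast
  show ?thesis unfolding line1_eq[OF os(1)] line1_eq[OF os(2)]
    using ideal2_pair[OF AD cl(4) u cl(1-3)] unfolding A_def B_def C_def .
qed

text \<open>
  A fibre of \<open>z\<close> that splits into two lines, which happens over \<open>z = \<plusminus>\<mu>\<close>.
\<close>

lemma fibre2_pair: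
  assumes os: "on_surface (line2 c t)" "on_surface (line2 c t')"
    and rel: "t + t' = c" "t * t' = al^2" "c^2 = mu^2" and nd: "t \<noteq> t'" "c \<noteq> 0"
  shows "iprod (line (line2 c t)) (line (line2 c t')) = scale (zz - kap c) SS"
proof -
  define A where "A = zz - kap c"
  define B where "B = yy - kap t * xx"
  define C where "C = yy - kap t' * xx"
  define D where "D = xx * yy - zz - kap c"
  have "kap t + kap t' = kap c" "kap t * kap t' = kap al^2" "kap c^2 = kap mu^2"
    using arg_cong[OF rel(1), of kap] arg_cong[OF rel(2), of kap] arg_cong[OF rel(3), of kap] by simp_all
  hence AD: "A * D = B * C"
    unfolding A_def B_def C_def D_def by (intro fibre2_identity[OF surface_eq])
  have cl: "A \<in> SS" "B \<in> SS" "C \<in> SS" "D \<in> SS"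
    unfolding A_def B_def C_def D_def by (auto intro!: S_add S_mult S_diff)
  define e where "e = kap (1 / (t' - t))"
  define f where "f = kap (1 / (2 * c))"
  have e: "(kap t' - kap t) * e = 1"
  proof -
    have "t' - t \<noteq> 0" using nd by auto
    thus ?thesis unfolding e_def by (simp flip: kap_simps(3) kap_simps(1) kap_simps(6) del: kap_simps)
  qed
  have "kap (2 * c) * f = 1" using nd unfolding f_def by (simp flip: kap_simps(3) kap_simps(1) del: kap_simps)
  hence f: "2 * kap c * f = 1" by simp
  have u: "A * (- f) + B * (f * (xx + kap t * xx * e)) + C * (- (f * kap t * xx * e)) + D * (- f) = 1"
    unfolding A_def B_def C_def D_def by (rule fibre2_unit_identity[OF e f])
  have "- f \<in> SS" "f * (xx + kap t * xx * e) \<in> SS" "- (f * kap t * xx * e) \<in> SS"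
    unfolding e_def f_def by (auto intro!: S_add S_mult S_uminus simp del: kap_simps)
  hence "iprod (ideal2 A B) (ideal2 A C) = scale A SS"
    by (intro ideal2_pair[OF AD cl(4) u _ _ _ _ cl(1-3)])
  thus ?thesis unfolding line2_eq[OF os(1)] line2_eq[OF os(2)] A_def B_def C_def .
qed

lemma pair_Inv:
  assumes "iprod I J = scale u SS" "u \<noteq> 0" "submod I" "submod J"
  shows "I \<in> carrier Inv"
proof (rule InvI[of _ "scale (1 / u) J"])
  show "iprod I (scale (1 / u) J) = SS"
    using assms by (simp add: scale_prod2 scale_scale)
qed (use assms in auto)

text \<open>
  The lines in the fibres \<open>z = \<mu>\<close> and \<open>z = -\<mu>\<close>, and those in the fibres over
  \<open>x = 2, -2, \<mu>/\<alpha>, -\<mu>/\<alpha>\<close>; a prime marks the second line of a fibre.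
\<close>

definition P0 where "P0 = line (line2 mu r1)"
definition P1 where "P1 = line (line2 mu r2)"
definition P2 where "P2 = line (line2 (- mu) (- r1))"
definition P3 where "P3 = line (line2 (- mu) (- r2))"
definition LA where "LA = line (line1 2 1 de)"
definition LA' where "LA' = line (line1 2 1 (- de))"
definition LB where "LB = line (line1 (- 2) (- 1) (- de))"
definition LB' where "LB' = line (line1 (- 2) (- 1) de)"
definition LC where "LC = line (line1 (mu / al) (r1 / al) 0)"
definition LC' where "LC' = line (line1 (mu / al) (r2 / al) 0)"
definition LD where "LD = line (line1 (- (mu / al)) (- (r1 / al)) 0)"
definition LD' where "LD' = line (line1 (- (mu / al)) (- (r2 / al)) 0)"

lemmas line_defs = P0_def P1_def P2_def P3_def LA_def LA'_def LB_def LB'_def LC_def LC'_def LD_def LD'_def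

lemma r_quad: "al^2 + r1^2 = mu * r1" "al^2 + r2^2 = mu * r2"
proof -
  have "(r1 + r2) * r1 = r1 * r2 + r1^2" "(r1 + r2) * r2 = r1 * r2 + r2^2"
    by (simp_all add: algebra_simps power2_eq_square)
  thus "al^2 + r1^2 = mu * r1" "al^2 + r2^2 = mu * r2"
    unfolding r_sum r_prod by simp_all
qed

lemma on_surface_lines:
  "on_surface (line2 mu r1)" "on_surface (line2 mu r2)" "on_surface (line2 (- mu) (- r1))" "on_surface (line2 (- mu) (- r2))"
  "on_surface (line1 2 1 de)" "on_surface (line1 2 1 (- de))" "on_surface (line1 (- 2) (- 1) (- de))" "on_surface (line1 (- 2) (- 1) de)"
  "on_surface (line1 (mu / al) (r1 / al) 0)" "on_surface (line1 (mu / al) (r2 / al) 0)"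
  "on_surface (line1 (- (mu / al)) (- (r1 / al)) 0)" "on_surface (line1 (- (mu / al)) (- (r2 / al)) 0)"
proof -
  have q: "(r / al)^2 + 1 = mu / al * (r / al)" if "al^2 + r^2 = mu * r" for r
  proof -
    have "mu / al * (r / al) = (al^2 + r^2) / al^2" unfolding that by (simp add: power2_eq_square)
    also have "\<dots> = (r / al)^2 + 1" using al by (simp add: add_divide_distrib power_divide add.commute)
    finally show ?thesis by (rule sym)
  qed
  have m: "al^2 * (mu / al)^2 + 0^2 = mu^2" using al by (simp add: power_divide)
  show "on_surface (line2 mu r1)" "on_surface (line2 mu r2)" "on_surface (line2 (- mu) (- r1))" "on_surface (line2 (- mu) (- r2))"
    by (rule on_surface_line2; simp add: r_quad)+
  show "on_surface (line1 2 1 de)" "on_surface (line1 2 1 (- de))" "on_surface (line1 (- 2) (- 1) (- de))" "on_surface (line1 (- 2) (- 1) de)"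
    by (rule on_surface_line1; simp add: de2)+
  have m': "al^2 * (- (mu / al))^2 + 0^2 = mu^2" by (simp only: power2_minus m)
  have q': "(- (r / al))^2 + 1 = - (mu / al) * - (r / al)" if "al^2 + r^2 = mu * r" for r
    by (simp only: power2_minus minus_mult_minus q[OF that])
  show "on_surface (line1 (mu / al) (r1 / al) 0)"
    by (rule on_surface_line1[OF m _ q[OF r_quad(1)]]) (simp only: mult_zero_right)
  show "on_surface (line1 (mu / al) (r2 / al) 0)"
    by (rule on_surface_line1[OF m _ q[OF r_quad(2)]]) (simp only: mult_zero_right)
  show "on_surface (line1 (- (mu / al)) (- (r1 / al)) 0)"
    by (rule on_surface_line1[OF m' _ q'[OF r_quad(1)]]) (simp only: mult_zero_right)
  show "on_surface (line1 (- (mu / al)) (- (r2 / al)) 0)"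
    by (rule on_surface_line1[OF m' _ q'[OF r_quad(2)]]) (simp only: mult_zero_right)
qed

lemma r_ne: "r1 \<noteq> r2"
proof
  assume "r1 = r2"
  hence "r1 - r2 = 0" by (simp only: diff_self)
  thus False using de unfolding r_diff by simp
qed

end

context markoff
begin

lemma pairs:
  "iprod P0 P1 = scale (zz - kap mu) SS" "iprod P2 P3 = scale (zz - kap (- mu)) SS"
  "iprod LA LA' = scale (xx - kap 2) SS" "iprod LB LB' = scale (xx - kap (- 2)) SS"
  "iprod LC LC' = scale (xx - kap (mu / al)) SS" "iprod LD LD' = scale (xx - kap (- (mu / al))) SS"
proof -
  have sum: "r1 / al + r2 / al = mu / al" by (simp only: add_divide_distrib[symmetric] r_sum)
  have prod: "r1 / al * (r2 / al) = 1" using al unfolding times_divide_times_eq r_prod power2_eq_square by simp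
  note os = on_surface_lines
  show "iprod P0 P1 = scale (zz - kap mu) SS" unfolding line_defs
    by (rule fibre2_pair[OF os(1,2)]) (use r_sum r_prod r_ne mu in simp_all)
  show "iprod P2 P3 = scale (zz - kap (- mu)) SS" unfolding line_defs
  proof (rule fibre2_pair[OF os(3,4)])
    have "- (r1 + r2) = - mu" by (simp only: r_sum)
    thus "- r1 + - r2 = - mu" by simp
  qed (use r_prod r_ne mu in simp_all)
  have dd: "de * - de = al^2 * 2^2 - mu^2" "- de * de = al^2 * (- 2)^2 - mu^2"
    using de2 by (simp_all add: power2_eq_square)
  show "iprod LA LA' = scale (xx - kap 2) SS" unfolding line_defs
    by (rule fibre1_pair[OF os(5,6) _ _ _ _ dd(1)]) (use de in simp_all)
  show "iprod LB LB' = scale (xx - kap (- 2)) SS" unfolding line_defs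
    by (rule fibre1_pair[OF os(7,8) _ _ _ _ dd(2)]) (use de in simp_all)
  have dm: "0 * 0 = al^2 * (mu / al)^2 - mu^2" "0 * 0 = al^2 * (- (mu / al))^2 - mu^2"
    using al by (simp_all add: power_divide)
  show "iprod LC LC' = scale (xx - kap (mu / al)) SS" unfolding line_defs
    by (rule fibre1_pair[OF os(9,10) sum prod _ _ dm(1)]) (use r_ne al mu in simp_all)
  have sum': "- (r1 / al) + - (r2 / al) = - (mu / al)" by (simp only: minus_add_distrib[symmetric] sum)
  have prod': "- (r1 / al) * - (r2 / al) = 1" using prod by (simp only: minus_mult_minus)
  show "iprod LD LD' = scale (xx - kap (- (mu / al))) SS" unfolding line_defs
    by (rule fibre1_pair[OF os(11,12) sum' prod' _ _ dm(2)]) (use r_ne al mu in simp_all)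
qed

lemma coord_nz: "zz - kap c \<noteq> 0" "xx - kap c \<noteq> 0"
proof -
  have "phi3 (Z3 - C3 c) \<notin> LA" "phi3 (X3 - C3 c) \<notin> P0"
    unfolding line_defs phi3_mem_line[OF on_surface_lines(1)] phi3_mem_line[OF on_surface_lines(5)]
    unfolding line1_def line2_def
    by (simp_all only: lam_hom lam_gens) simp_all
  moreover have "0 \<in> LA" "0 \<in> P0" unfolding line_defs using submod_line by auto
  moreover have "phi3 (Z3 - C3 c) = zz - kap c" "phi3 (X3 - C3 c) = xx - kap c" by (simp_all only: phi3_hom phi3_gens)
  ultimately show "zz - kap c \<noteq> 0" "xx - kap c \<noteq> 0" by auto
qed

lemma lines_Inv:
  "P0 \<in> carrier Inv" "P1 \<in> carrier Inv" "P2 \<in> carrier Inv" "P3 \<in> carrier Inv"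
  "LA \<in> carrier Inv" "LA' \<in> carrier Inv" "LB \<in> carrier Inv" "LB' \<in> carrier Inv"
  "LC \<in> carrier Inv" "LC' \<in> carrier Inv" "LD \<in> carrier Inv" "LD' \<in> carrier Inv"
proof -
  have sub: "submod P0" "submod P1" "submod P2" "submod P3" "submod LA" "submod LA'" "submod LB" "submod LB'"
    "submod LC" "submod LC'" "submod LD" "submod LD'"
    unfolding line_defs by (rule submod_line)+
  have both: "I \<in> carrier Inv \<and> J \<in> carrier Inv" if "iprod I J = scale u SS" "u \<noteq> 0" "submod I" "submod J" for I J u
    using pair_Inv[OF that] pair_Inv[OF _ that(2,4,3)] that(1)[unfolded iprod_commute[of I]] by blast
  show "P0 \<in> carrier Inv" "P1 \<in> carrier Inv" "P2 \<in> carrier Inv" "P3 \<in> carrier Inv"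
    "LA \<in> carrier Inv" "LA' \<in> carrier Inv" "LB \<in> carrier Inv" "LB' \<in> carrier Inv"
    "LC \<in> carrier Inv" "LC' \<in> carrier Inv" "LD \<in> carrier Inv" "LD' \<in> carrier Inv"
    using both[OF pairs(1) coord_nz(1) sub(1,2)] both[OF pairs(2) coord_nz(1) sub(3,4)]
      both[OF pairs(3) coord_nz(2) sub(5,6)] both[OF pairs(4) coord_nz(2) sub(7,8)]
      both[OF pairs(5) coord_nz(2) sub(9,10)] both[OF pairs(6) coord_nz(2) sub(11,12)] by simp_all
qed

lemma lines_prime:
  "iprime P0" "iprime P1" "iprime P2" "iprime P3" "iprime LA" "iprime LA'" "iprime LB" "iprime LB'"
  "iprime LC" "iprime LC'" "iprime LD" "iprime LD'"
  using lines_Inv unfolding line_defs by (auto intro: iprime_line on_surface_lines)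

end

section \<open>Relations between the lines\<close>

lemma h_identity:
  fixes x y z a t t' m :: "'a::idom"
  assumes "a * x^2 + y^2 + z^2 - x * y * z = m^2" "t + t' = m" "t * t' = a"
  shows "(m * y - t * x * z) * (m * y - t' * x * z) = (z^2 - m^2) * (a * x^2 - m^2)"
proof -
  have yy: "y^2 - x * y * z = m^2 - a * x^2 - z^2" using assms(1) by (simp add: algebra_simps)
  have "(m * y - t * x * z) * (m * y - t' * x * z) = m^2 * y^2 - m * (t + t') * (x * y * z) + (t * t') * (x^2 * z^2)"
    by (simp add: algebra_simps power2_eq_square)
  also have "\<dots> = m^2 * (y^2 - x * y * z) + a * (x^2 * z^2)"
    unfolding assms(2,3) by (simp add: algebra_simps power2_eq_square)
  also have "\<dots> = (z^2 - m^2) * (a * x^2 - m^2)"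
    unfolding yy by (simp add: algebra_simps power2_eq_square)
  finally show ?thesis .
qed

lemma h2_identity:
  fixes x y z a d m :: "'a::idom"
  assumes "a * x^2 + y^2 + z^2 - x * y * z = m^2" "d^2 = m^2 - 4 * a"
  shows "(x * z - 2 * y + d * x) * (x * z - 2 * y - d * x) = (z^2 - m^2) * (x^2 - 4)"
proof -
  have yy: "y^2 - x * y * z = m^2 - a * x^2 - z^2" using assms(1) by (simp add: algebra_simps)
  have "(x * z - 2 * y + d * x) * (x * z - 2 * y - d * x) = x^2 * z^2 + 4 * (y^2 - x * y * z) - d^2 * x^2"
    by (simp add: algebra_simps power2_eq_square)
  also have "\<dots> = (z^2 - m^2) * (x^2 - 4)"
    unfolding yy assms(2) by (simp add: algebra_simps power2_eq_square)
  finally show ?thesis .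
qed

context markoff
begin

text \<open>
  Two pairs of conjugate functions. Their products
  \<open>(\<mu>y - \<rho>\<^sub>1xz)(\<mu>y - \<rho>\<^sub>2xz) = (z\<^sup>2 - \<mu>\<^sup>2)(\<alpha>\<^sup>2x\<^sup>2 - \<mu>\<^sup>2)\<close>
  and \<open>(xz - 2y + \<delta>x)(xz - 2y - \<delta>x) = (z\<^sup>2 - \<mu>\<^sup>2)(x\<^sup>2 - 4)\<close> vanish only on
  fibres of \<open>x\<close> and \<open>z\<close> that consist of lines. The factor \<open>1/\<alpha>\<^sup>2\<close> turns
  \<open>\<alpha>\<^sup>2x\<^sup>2 - \<mu>\<^sup>2\<close> into a product of linear functions \<open>x - c\<close>.
\<close>

definition hp1 where "hp1 = C3 mu * Y3 - C3 r1 * X3 * Z3"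
definition hp2 where "hp2 = C3 (1 / al^2) * (C3 mu * Y3 - C3 r2 * X3 * Z3)"
definition kp1 where "kp1 = X3 * Z3 - C3 2 * Y3 + C3 de * X3"
definition kp2 where "kp2 = X3 * Z3 - C3 2 * Y3 - C3 de * X3"

lemma phi3_hk:
  "phi3 hp1 = kap mu * yy - kap r1 * xx * zz" "phi3 hp2 = kap (1 / al^2) * (kap mu * yy - kap r2 * xx * zz)"
  "phi3 kp1 = xx * zz - 2 * yy + kap de * xx" "phi3 kp2 = xx * zz - 2 * yy - kap de * xx"
  unfolding hp1_def hp2_def kp1_def kp2_def by (simp_all only: phi3_hom phi3_gens kap_simps(8))

lemma hp_prod: "phi3 hp1 * phi3 hp2 =
    (zz - kap mu) * ((zz - kap (- mu)) * ((xx - kap (mu / al)) * (xx - kap (- (mu / al)))))"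
proof -
  define e where "e = kap (1 / al^2)"
  define xi where "xi = kap (mu / al)"
  have e: "e * kap al ^ 2 = 1" using al unfolding e_def kap_simps(7)[symmetric] by (simp flip: kap_simps(3) del: kap_simps(7))
  have xi: "xi ^ 2 = e * kap mu ^ 2"
    unfolding e_def xi_def kap_simps(7)[symmetric] kap_simps(3)[symmetric] by (simp add: power_divide del: kap_simps)
  have "phi3 hp1 * phi3 hp2 = e * ((kap mu * yy - kap r1 * xx * zz) * (kap mu * yy - kap r2 * xx * zz))"
    unfolding phi3_hk e_def by (simp only: mult_ac)
  also have "\<dots> = e * ((zz^2 - kap mu^2) * (kap al^2 * xx^2 - kap mu^2))"
    unfolding h_identity[OF surface_eq kap_rel(1,2)] ..
  also have "\<dots> = (zz^2 - kap mu^2) * (e * kap al^2 * xx^2 - e * kap mu^2)" by (simp add: algebra_simps)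
  also have "\<dots> = (zz^2 - kap mu^2) * (xx^2 - xi^2)" unfolding e xi by simp
  also have "\<dots> = (zz - kap mu) * ((zz - (- kap mu)) * ((xx - xi) * (xx - (- xi))))"
    by (simp add: algebra_simps power2_eq_square)
  finally show ?thesis unfolding xi_def by simp
qed

lemma kp_prod: "phi3 kp1 * phi3 kp2 =
    (zz - kap mu) * ((zz - kap (- mu)) * ((xx - kap 2) * (xx - kap (- 2))))"
proof -
  have d: "kap de ^ 2 = kap mu ^ 2 - 4 * kap al ^ 2" using arg_cong[OF de2, of kap] by simp
  have "phi3 kp1 * phi3 kp2 = (zz^2 - kap mu^2) * (xx^2 - 4)"
    unfolding phi3_hk by (rule h2_identity[OF surface_eq d])
  thus ?thesis by (simp add: algebra_simps power2_eq_square)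
qed

lemma lprod_pair:
  assumes "iprod I J = scale u SS" "I \<in> carrier Inv" "J \<in> carrier Inv" "set Rs \<subseteq> carrier Inv"
  shows "lprod (I # J # Rs) = scale u (lprod Rs)"
proof -
  have R: "lprod Rs \<in> carrier Inv" using assms(4) by auto
  have "lprod (I # J # Rs) = iprod (iprod I J) (lprod Rs)"
    using Inv.m_assoc[OF assms(2,3) R] by simp
  also have "\<dots> = scale u (lprod Rs)" unfolding assms(1) by (rule prin_prod[OF InvD[OF R]])
  finally show ?thesis .
qed

lemma lprod_hp: "lprod [P0, P1, P2, P3, LC, LC', LD, LD'] = scale (phi3 hp1 * phi3 hp2) SS"
  unfolding hp_prod
  using lprod_pair[OF pairs(1), of "[P2, P3, LC, LC', LD, LD']"] lprod_pair[OF pairs(2), of "[LC, LC', LD, LD']"]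
    lprod_pair[OF pairs(5), of "[LD, LD']"] lprod_pair[OF pairs(6), of "[]"]
  by (simp add: lines_Inv scale_scale del: lprod_simps(2) kap_simps)

lemma lprod_kp: "lprod [P0, P1, P2, P3, LA, LA', LB, LB'] = scale (phi3 kp1 * phi3 kp2) SS"
  unfolding kp_prod
  using lprod_pair[OF pairs(1), of "[P2, P3, LA, LA', LB, LB']"] lprod_pair[OF pairs(2), of "[LA, LA', LB, LB']"]
    lprod_pair[OF pairs(3), of "[LB, LB']"] lprod_pair[OF pairs(4), of "[]"]
  by (simp add: lines_Inv scale_scale del: lprod_simps(2) kap_simps)

lemma prin_subset_lines:
  "scale (phi3 G) SS \<subseteq> P0 \<longleftrightarrow> lam (line2 mu r1) G = 0" "scale (phi3 G) SS \<subseteq> P1 \<longleftrightarrow> lam (line2 mu r2) G = 0"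
  "scale (phi3 G) SS \<subseteq> P2 \<longleftrightarrow> lam (line2 (- mu) (- r1)) G = 0" "scale (phi3 G) SS \<subseteq> P3 \<longleftrightarrow> lam (line2 (- mu) (- r2)) G = 0"
  "scale (phi3 G) SS \<subseteq> LA \<longleftrightarrow> lam (line1 2 1 de) G = 0" "scale (phi3 G) SS \<subseteq> LA' \<longleftrightarrow> lam (line1 2 1 (- de)) G = 0"
  "scale (phi3 G) SS \<subseteq> LB \<longleftrightarrow> lam (line1 (- 2) (- 1) (- de)) G = 0" "scale (phi3 G) SS \<subseteq> LB' \<longleftrightarrow> lam (line1 (- 2) (- 1) de) G = 0"
  "scale (phi3 G) SS \<subseteq> LC \<longleftrightarrow> lam (line1 (mu / al) (r1 / al) 0) G = 0" "scale (phi3 G) SS \<subseteq> LC' \<longleftrightarrow> lam (line1 (mu / al) (r2 / al) 0) G = 0"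
  "scale (phi3 G) SS \<subseteq> LD \<longleftrightarrow> lam (line1 (- (mu / al)) (- (r1 / al)) 0) G = 0"
  "scale (phi3 G) SS \<subseteq> LD' \<longleftrightarrow> lam (line1 (- (mu / al)) (- (r2 / al)) 0) G = 0"
  unfolding line_defs by (rule prin_subset_line; rule on_surface_lines)+

lemma lam_hp1: "lam (line2 c t) hp1 = [:0, mu * t - r1 * c:]" "lam (line1 c t 0) hp1 = [:0, mu * t - r1 * c:]"
  unfolding hp1_def line1_def line2_def by (simp_all only: lam_hom lam_gens) (simp_all add: mult_ac)

lemma lam_hp2: "lam (line2 c t) hp2 = [:0, (mu * t - r2 * c) / al^2:]" "lam (line1 c t 0) hp2 = [:0, (mu * t - r2 * c) / al^2:]"
  unfolding hp2_def line1_def line2_def by (simp_all only: lam_hom lam_gens) (simp_all add: mult_ac)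

lemma lam_kp1: "lam (line2 c t) kp1 = [:0, c - 2 * t + de:]" "lam (line1 c t d) kp1 = [:- 2 * d + de * c, c - 2 * t:]"
  unfolding kp1_def line1_def line2_def by (simp_all only: lam_hom lam_gens) (simp_all add: mult_ac)

lemma lam_kp2: "lam (line2 c t) kp2 = [:0, c - 2 * t - de:]" "lam (line1 c t d) kp2 = [:- 2 * d - de * c, c - 2 * t:]"
  unfolding kp2_def line1_def line2_def by (simp_all only: lam_hom lam_gens) (simp_all add: mult_ac)

lemma prin_SS: "scale (phi3 G) SS \<subseteq> SS"
  by (rule prin_least[OF submod_S SS_phi3])

lemma split_prin:
  assumes "lprod Ps = scale (phi3 G * phi3 H) SS" "phi3 G * phi3 H \<noteq> 0" "\<forall>P\<in>set Ps. iprime P"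
    "\<forall>P\<in>set Ps. \<not> scale (phi3 G) SS \<subseteq> P \<or> \<not> scale (phi3 H) SS \<subseteq> P"
  shows "scale (phi3 G) SS = lprod (filter (\<lambda>P. \<not> scale (phi3 H) SS \<subseteq> P) Ps)"
  using assms(2,3,4) by (intro split_primes prin_SS prin_Inv) (simp_all add: prin_mult assms(1))

lemma hp_nz: "phi3 hp1 * phi3 hp2 \<noteq> 0" and kp_nz: "phi3 kp1 * phi3 kp2 \<noteq> 0"
  unfolding hp_prod kp_prod by (simp_all only: mult_eq_0_iff de_Morgan_disj, intro conjI coord_nz, intro conjI coord_nz)

lemma r_cross: "mu * r2 - r1 * mu \<noteq> 0" "mu * r1 - r2 * mu \<noteq> 0"
proof -
  have "mu * r2 - r1 * mu = mu * (r2 - r1)" "mu * r1 - r2 * mu = mu * (r1 - r2)" by (simp_all add: algebra_simps)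
  thus "mu * r2 - r1 * mu \<noteq> 0" "mu * r1 - r2 * mu \<noteq> 0" using mu r_ne by auto
qed

lemma r_cross': "mu * - r2 - r1 * - mu \<noteq> 0" "mu * - r1 - r2 * - mu \<noteq> 0"
    "mu * (r2 / al) - r1 * (mu / al) \<noteq> 0" "mu * (r1 / al) - r2 * (mu / al) \<noteq> 0"
    "mu * - (r2 / al) - r1 * - (mu / al) \<noteq> 0" "mu * - (r1 / al) - r2 * - (mu / al) \<noteq> 0"
proof -
  have "mu * - r2 - r1 * - mu = - (mu * r2 - r1 * mu)" "mu * - r1 - r2 * - mu = - (mu * r1 - r2 * mu)"
    "mu * (r2 / al) - r1 * (mu / al) = (mu * r2 - r1 * mu) / al" "mu * (r1 / al) - r2 * (mu / al) = (mu * r1 - r2 * mu) / al"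
    "mu * - (r2 / al) - r1 * - (mu / al) = - ((mu * r2 - r1 * mu) / al)"
    "mu * - (r1 / al) - r2 * - (mu / al) = - ((mu * r1 - r2 * mu) / al)"
    by (simp_all add: diff_divide_distrib)
  thus "mu * - r2 - r1 * - mu \<noteq> 0" "mu * - r1 - r2 * - mu \<noteq> 0"
    "mu * (r2 / al) - r1 * (mu / al) \<noteq> 0" "mu * (r1 / al) - r2 * (mu / al) \<noteq> 0"
    "mu * - (r2 / al) - r1 * - (mu / al) \<noteq> 0" "mu * - (r1 / al) - r2 * - (mu / al) \<noteq> 0"
    using r_cross al by (simp_all only: neg_equal_0_iff_equal divide_eq_0_iff) simp_all
qed

text \<open>
  The product of the two conjugate functions is the product of eight lines, on none of which both functions vanish;
  evaluation on the lines decides which of them belong to the first function.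
\<close>

lemma rel_h: "scale (phi3 hp1) SS = lprod [P0, P2, LC, LD]"
proof -
  have 1: "\<not> scale (phi3 hp1) SS \<subseteq> P1" "\<not> scale (phi3 hp1) SS \<subseteq> P3"
    "\<not> scale (phi3 hp1) SS \<subseteq> LC'" "\<not> scale (phi3 hp1) SS \<subseteq> LD'"
    unfolding prin_subset_lines lam_hp1 using r_cross r_cross' by (simp_all only: pCons_eq_0_iff) simp_all
  have 2: "\<not> scale (phi3 hp2) SS \<subseteq> P0" "\<not> scale (phi3 hp2) SS \<subseteq> P2"
    "\<not> scale (phi3 hp2) SS \<subseteq> LC" "\<not> scale (phi3 hp2) SS \<subseteq> LD"
    unfolding prin_subset_lines lam_hp2 using r_cross r_cross' al by (simp_all only: pCons_eq_0_iff divide_eq_0_iff) simp_all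
  have 3: "scale (phi3 hp2) SS \<subseteq> P1" "scale (phi3 hp2) SS \<subseteq> P3"
    "scale (phi3 hp2) SS \<subseteq> LC'" "scale (phi3 hp2) SS \<subseteq> LD'"
    unfolding prin_subset_lines lam_hp2 by (simp_all add: mult.commute)
  show ?thesis
    using split_prin[OF lprod_hp hp_nz] lines_prime 1 2 3 by (simp del: lprod_simps)
qed

lemma r_double: "mu - 2 * r1 = - de" "mu - 2 * r2 = de"
  unfolding r1_def r2_def by (simp_all add: field_simps)

lemma rel_k: "scale (phi3 kp1) SS = lprod [P0, P3, LA, LB]"
proof -
  have r: "- mu - 2 * - r1 = de" "- mu - 2 * - r2 = - de"
    using r_double by (simp_all add: algebra_simps)
  have d4: "- 2 * de - de * 2 = - 4 * de" "- 2 * - de + de * 2 = 4 * de" "- 2 * - de - de * - 2 = 4 * de" "- 2 * de + de * - 2 = - 4 * de"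
    by simp_all
  have 1: "\<not> scale (phi3 kp1) SS \<subseteq> P1" "\<not> scale (phi3 kp1) SS \<subseteq> P2"
    "\<not> scale (phi3 kp1) SS \<subseteq> LA'" "\<not> scale (phi3 kp1) SS \<subseteq> LB'"
    unfolding prin_subset_lines lam_kp1 r r_double d4 using de by simp_all
  have 2: "\<not> scale (phi3 kp2) SS \<subseteq> P0" "\<not> scale (phi3 kp2) SS \<subseteq> P3"
    "\<not> scale (phi3 kp2) SS \<subseteq> LA" "\<not> scale (phi3 kp2) SS \<subseteq> LB"
    unfolding prin_subset_lines lam_kp2 r r_double d4 using de by simp_all
  have 3: "scale (phi3 kp2) SS \<subseteq> P1" "scale (phi3 kp2) SS \<subseteq> P2"
    "scale (phi3 kp2) SS \<subseteq> LA'" "scale (phi3 kp2) SS \<subseteq> LB'"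
    unfolding prin_subset_lines lam_kp2 r r_double by simp_all
  show ?thesis
    using split_prin[OF lprod_kp kp_nz] lines_prime 1 2 3 by (simp del: lprod_simps)
qed

section \<open>A localisation that is factorial\<close>

text \<open>
  \<open>TT\<close> is the localisation of the coordinate ring at \<open>G = ZQ\<close>, and \<open>TP\<close> the
  localisation of the polynomial ring \<open>c[x,s]\<close> at \<open>qL\<close>.
\<close>

definition QQ where "QQ = ZZ^2 * qq"
definition GG where "GG = ZZ * QQ"
definition TT where "TT = {u. \<exists>n. GG ^ n * u \<in> SS}"
definition hh where "hh = to_fract (qp * lp)"
definition TP where "TP = {u. \<exists>n p. u * hh ^ n = to_fract p}"

lemma hh_eq: "hh = qq * ll" by (simp add: hh_def qq_def ll_def)

lemma hh_nz [simp]: "hh \<noteq> 0" by (simp add: hh_eq)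

lemma hh_power: "hh ^ n = to_fract ((qp * lp) ^ n)"
  by (induction n) (auto simp: hh_def simp flip: to_fract_mult)

lemma QQ_nz [simp]: "QQ \<noteq> 0" and GG_nz [simp]: "GG \<noteq> 0"
  by (simp_all add: QQ_def GG_def)

lemma ZZ_SS: "ZZ \<in> SS" and YY_SS: "YY \<in> SS"
proof -
  have "ZZ = zz - kap mu" "YY = yy - kap r1 * xx" by (simp_all add: zz_def yy_def)
  thus "ZZ \<in> SS" "YY \<in> SS" by (simp_all add: S_diff S_mult)
qed

lemma QQ_SS: "QQ \<in> SS"
proof -
  have "QQ = YY^2 - xx * YY * ZZ + ZZ^2"
    by (simp add: QQ_def qq_eq YY_def algebra_simps power2_eq_square)
  thus ?thesis using ZZ_SS YY_SS by (auto intro!: S_add S_diff S_mult)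
qed

lemma GG_SS: "GG \<in> SS" unfolding GG_def using ZZ_SS QQ_SS by auto

lemma qq_Q: "qq = QQ / ZZ^2" and ll_Q: "ll = - (QQ / ZZ)"
proof -
  show "qq = QQ / ZZ^2" by (simp add: QQ_def)
  have "ll = - (ZZ * qq)" by (simp add: ZZ_def)
  thus "ll = - (QQ / ZZ)" by (simp add: QQ_def power2_eq_square)
qed

lemma TT_SS: "SS \<subseteq> TT"
proof
  fix u assume "u \<in> SS" thus "u \<in> TT" unfolding TT_def by (intro CollectI exI[of _ 0]) simp
qed

lemma TT_add: assumes "u \<in> TT" "v \<in> TT" shows "u + v \<in> TT"
proof -
  obtain n m where nm: "GG ^ n * u \<in> SS" "GG ^ m * v \<in> SS" using assms by (auto simp: TT_def)
  have "GG ^ (n + m) * (u + v) = GG ^ m * (GG ^ n * u) + GG ^ n * (GG ^ m * v)"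
    by (simp add: power_add algebra_simps)
  also have "\<dots> \<in> SS" by (rule S_add[OF S_mult[OF S_power[OF GG_SS] nm(1)] S_mult[OF S_power[OF GG_SS] nm(2)]])
  finally show ?thesis unfolding TT_def by blast
qed

lemma TT_mult: assumes "u \<in> TT" "v \<in> TT" shows "u * v \<in> TT"
proof -
  obtain n m where nm: "GG ^ n * u \<in> SS" "GG ^ m * v \<in> SS" using assms by (auto simp: TT_def)
  have "GG ^ (n + m) * (u * v) = (GG ^ n * u) * (GG ^ m * v)" by (simp add: power_add algebra_simps)
  also have "\<dots> \<in> SS" by (rule S_mult[OF nm])
  finally show ?thesis unfolding TT_def by blast
qed

lemma TT_power: "u \<in> TT \<Longrightarrow> u ^ n \<in> TT"
  by (induction n) (use TT_SS S_one TT_mult in auto)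

text \<open>
  The variable \<open>s\<close> is \<open>YY/ZZ\<close>.
\<close>

lemma TT_to_fract: "to_fract p \<in> TT"
proof (induction p rule: poly_gen_induct)
  case (1 a)
  show ?case
  proof (induction a rule: poly_gen_induct)
    case (1 a) thus ?case using TT_SS SS_gens(1)[of a] by (auto simp: kap_def)
  next
    case 2 thus ?case using TT_SS SS_gens(2) by (auto simp: xx_def)
  next
    case (3 p q) thus ?case using TT_add[of "xi1 p" "xi1 q"] by (simp flip: to_fract_add)
  next
    case (4 p q) thus ?case using TT_mult[of "xi1 p" "xi1 q"] by (simp add: mult.commute flip: to_fract_mult)
  qed
next
  case 2
  have "GG ^ 1 * ss = QQ * YY" by (simp add: GG_def YY_def)
  also have "\<dots> \<in> SS" using QQ_SS YY_SS by auto
  finally show ?case unfolding TT_def ss_def by blast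
next
  case (3 p q) thus ?case using TT_add by simp
next
  case (4 p q) thus ?case using TT_mult by simp
qed

lemma TT_inv_hh: "1 / hh \<in> TT"
proof -
  have "1 / hh = - (ZZ ^ 3 / QQ ^ 2)"
    by (simp add: hh_eq qq_Q ll_Q power2_eq_square power3_eq_cube)
  hence "GG ^ 2 * (1 / hh) = - (ZZ ^ 5)"
    by (simp add: GG_def power2_eq_square power3_eq_cube numeral_eq_Suc)
  also have "\<dots> \<in> SS" using ZZ_SS by auto
  finally show ?thesis unfolding TT_def by blast
qed

lemma TP_add: assumes "u \<in> TP" "v \<in> TP" shows "u + v \<in> TP"
proof -
  obtain n p m q where *: "u * hh ^ n = to_fract p" "v * hh ^ m = to_fract q" using assms by (auto simp: TP_def)
  have "(u + v) * hh ^ (n + m) = (u * hh ^ n) * hh ^ m + (v * hh ^ m) * hh ^ n" by (simp add: power_add algebra_simps)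
  also have "\<dots> = to_fract (p * (qp * lp) ^ m + q * (qp * lp) ^ n)" unfolding * by (simp only: hh_power to_fract_add to_fract_mult)
  finally show ?thesis unfolding TP_def by blast
qed

lemma TP_mult: assumes "u \<in> TP" "v \<in> TP" shows "u * v \<in> TP"
proof -
  obtain n p m q where *: "u * hh ^ n = to_fract p" "v * hh ^ m = to_fract q" using assms by (auto simp: TP_def)
  have "(u * v) * hh ^ (n + m) = (u * hh ^ n) * (v * hh ^ m)" by (simp add: power_add algebra_simps)
  also have "\<dots> = to_fract (p * q)" unfolding * by simp
  finally show ?thesis unfolding TP_def by blast
qed

lemma TP_to_fract: "to_fract p \<in> TP"
  unfolding TP_def by (intro CollectI exI[of _ 0] exI[of _ p]) simp

lemma TP_inv_qq: "1 / qq \<in> TP" and TP_inv_ll: "1 / ll \<in> TP"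
proof -
  have "1 / qq * hh ^ 1 = to_fract lp" "1 / ll * hh ^ 1 = to_fract qp" by (simp_all add: hh_eq) (simp_all add: qq_def ll_def)
  thus "1 / qq \<in> TP" "1 / ll \<in> TP" unfolding TP_def by blast+
qed

lemma SS_TP: "SS \<subseteq> TP"
proof
  fix u assume "u \<in> SS"
  then obtain G where u: "u = phi3 G" by (auto simp: SS_def)
  have "phi3 G \<in> TP"
  proof (induction G rule: poly3_induct)
    case (const c) thus ?case unfolding phi3_gens kap_def by (rule TP_to_fract)
  next
    case x thus ?case unfolding phi3_gens xx_def by (rule TP_to_fract)
  next
    case y
    have "yy = to_fract np * (1 / qq)" by (simp add: yy_np)
    thus ?case unfolding phi3_gens using TP_mult[OF TP_to_fract TP_inv_qq] by simp
  next
    case z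
    have "zz = to_fract mp * (1 / qq)" by (simp add: zz_mp)
    thus ?case unfolding phi3_gens using TP_mult[OF TP_to_fract TP_inv_qq] by simp
  qed (simp_all add: phi3_hom TP_add TP_mult)
  thus "u \<in> TP" unfolding u .
qed

text \<open>
  Both rings contain \<open>x\<close>, \<open>s\<close> and the inverses of \<open>q\<close> and \<open>L\<close>: up to sign
  \<open>G\<close> is \<open>L\<^sup>3/q\<^sup>2\<close>, and conversely \<open>q = Q/Z\<^sup>2\<close> and
  \<open>L = -Q/Z\<close>.
\<close>

lemma TT_eq_TP: "TT = TP"
proof
  show "TP \<subseteq> TT"
  proof
    fix u assume "u \<in> TP"
    then obtain n p where "u * hh ^ n = to_fract p" by (auto simp: TP_def)
    hence "u = to_fract p * (1 / hh) ^ n" by (simp add: power_divide field_simps)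
    thus "u \<in> TT" using TT_mult[OF TT_to_fract TT_power[OF TT_inv_hh]] by simp
  qed
  have "GG = - (ll ^ 3 / qq ^ 2)"
    by (simp add: GG_def QQ_def ZZ_def power2_eq_square power3_eq_cube)
  hence "1 / GG = - (to_fract qp * to_fract qp) * ((1 / ll) * (1 / ll) * (1 / ll))"
    by (simp add: power2_eq_square power3_eq_cube flip: qq_def)
  also have "\<dots> = to_fract (- (qp * qp)) * ((1 / ll) * (1 / ll) * (1 / ll))" by simp
  also have "\<dots> \<in> TP" by (intro TP_mult TP_to_fract TP_inv_ll)
  finally have inv: "1 / GG \<in> TP" .
  have pow: "(1 / GG) ^ n \<in> TP" for n
    by (induction n) (use TP_to_fract[of 1] TP_mult[OF inv] in auto)
  show "TT \<subseteq> TP"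
  proof
    fix u assume "u \<in> TT"
    then obtain n where n: "GG ^ n * u \<in> SS" by (auto simp: TT_def)
    have "u = (1 / GG) ^ n * (GG ^ n * u)" by (simp add: power_divide)
    thus "u \<in> TP" using TP_mult[OF pow[of n]] SS_TP n by (metis subsetD)
  qed
qed

text \<open>
  A unit of the localised polynomial ring is \<open>c q\<^sup>iL\<^sup>j/(qL)\<^sup>n\<close>; it is rewritten in terms of
  \<open>Q\<close> and \<open>Z\<close> with nonnegative exponents, so that both sides generate products of lines.
\<close>

lemma TT_units:
  assumes "u \<in> TT" "1 / u \<in> TT" "u \<noteq> 0"
  shows "\<exists>c i j n. c \<noteq> 0 \<and> u * QQ ^ (2 * n) * ZZ ^ (2 * i + j) = kap c * QQ ^ (i + j) * ZZ ^ (3 * n)"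
proof -
  obtain n p where p: "u * hh ^ n = to_fract p" using assms TT_eq_TP by (auto simp: TP_def)
  obtain m r where r: "1 / u * hh ^ m = to_fract r" using assms TT_eq_TP by (auto simp: TP_def)
  have "to_fract (p * r) = to_fract ((qp * lp) ^ (n + m))"
    unfolding to_fract_mult p[symmetric] r[symmetric] hh_power[symmetric] using assms(3) by (simp add: power_add)
  hence "p dvd qp ^ (n + m) * lp ^ (n + m)" by (metis dvd_triv_left power_mult_distrib to_fract_eq_iff)
  then obtain w i j where w: "is_unit w" "p = w * qp ^ i * lp ^ j"
    using dvd_prime_powers[OF prime_qp prime_lp] by blast
  obtain w0 where w0: "w = [:w0:]" "is_unit w0" using w(1) is_unit_poly_iff by blast
  obtain c where c: "w0 = [:c:]" "is_unit c" using w0(2) is_unit_poly_iff by blast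
  have c0: "c \<noteq> 0" using c(2) by auto
  have pw: "to_fract (q ^ k) = to_fract q ^ k" for q :: "'c poly poly" and k by (induction k) auto
  have eq: "u * (qq * ll) ^ n = kap c * qq ^ i * ll ^ j"
    using p unfolding w(2) hh_eq by (simp only: to_fract_mult pw w0 c kap_def qq_def ll_def)
  have "QQ ^ 2 = qq * ll * (- 1) * ZZ ^ 3"
    by (simp add: qq_Q ll_Q power2_eq_square power3_eq_cube)
  hence Q2: "QQ ^ (2 * n) = (qq * ll) ^ n * (- 1) ^ n * ZZ ^ (3 * n)"
    by (simp only: power_mult power_mult_distrib)
  have "qq * ZZ ^ 2 = QQ" by (simp add: qq_Q)
  hence Qi: "qq ^ i * ZZ ^ (2 * i) = QQ ^ i" by (metis power_mult power_mult_distrib)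
  have "ll * ZZ = (- 1) * QQ" by (simp add: ll_Q)
  hence Qj: "ll ^ j * ZZ ^ j = (- 1) ^ j * QQ ^ j" by (metis power_mult_distrib)
  have "u * QQ ^ (2 * n) * ZZ ^ (2 * i + j) = (u * (qq * ll) ^ n) * (- 1) ^ n * ZZ ^ (3 * n) * (ZZ ^ (2 * i) * ZZ ^ j)"
    unfolding Q2 power_add by (simp only: mult_ac)
  also have "\<dots> = kap c * (qq ^ i * ZZ ^ (2 * i)) * (ll ^ j * ZZ ^ j) * (- 1) ^ n * ZZ ^ (3 * n)"
    unfolding eq by (simp only: mult_ac)
  also have "\<dots> = (kap c * ((- 1) ^ j * (- 1) ^ n)) * QQ ^ (i + j) * ZZ ^ (3 * n)"
    unfolding Qi Qj power_add by (simp only: mult_ac)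
  also have "kap c * ((- 1) ^ j * (- 1) ^ n) = kap (c * ((- 1) ^ j * (- 1) ^ n))" by simp
  finally show ?thesis using c0
    by (intro exI[of _ "c * ((- 1) ^ j * (- 1) ^ n)"] exI[of _ i] exI[of _ j] exI[of _ n]) simp
qed

subsection \<open>The factorisation of the denominator\<close>

text \<open>
  This identity is what makes the divisor of \<open>Q\<close> accessible: \<open>(hp1) = P\<^sub>0P\<^sub>2CD\<close> and
  \<open>(kp1) = P\<^sub>0P\<^sub>3AB\<close>, while \<open>(z + \<mu>) = P\<^sub>2P\<^sub>3\<close>.
\<close>

lemma QQ_eq: "QQ * (zz - kap (- mu)) = - (phi3 hp1 * phi3 kp1)"
proof -
  have d: "2 * kap r1 = kap mu + kap de" using arg_cong[OF r_double(1), of kap] by (simp add: algebra_simps)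
  have id: "q * (Z + 2 * m) = - ((m * s - r * x) * (x - 2 * s))"
    if "q = s^2 - x * s + 1" "q * Z = - (d * x * s + 2 * m - r * x^2)" "2 * r = m + d" for q Z m s r x d :: "'c poly poly fract"
  proof -
    have "q * (Z + 2 * m) = q * Z + 2 * m * q" by (simp add: algebra_simps)
    also have "\<dots> = - (d * x * s + 2 * m - r * x^2) + 2 * m * (s^2 - x * s + 1)"
      unfolding that(2) unfolding that(1) ..
    also have "\<dots> = - ((m * s - r * x) * (x - 2 * s)) + (2 * r - (m + d)) * (x * s)"
      by (simp add: algebra_simps power2_eq_square)
    finally show ?thesis unfolding that(3) by simp
  qed
  have qZ: "qq * ZZ = - (kap de * xx * ss + 2 * kap mu - kap r1 * xx^2)" by (simp add: ZZ_def ll_eq)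
  have h: "phi3 hp1 = ZZ * (kap mu * ss - kap r1 * xx)"
    unfolding phi3_hk yy_def zz_def YY_def by (simp add: algebra_simps)
  have k: "phi3 kp1 = ZZ * (xx - 2 * ss)"
  proof -
    have "phi3 kp1 = ZZ * (xx - 2 * ss) + (kap mu + kap de - 2 * kap r1) * xx"
      unfolding phi3_hk yy_def zz_def YY_def by (simp add: algebra_simps)
    thus ?thesis unfolding d by simp
  qed
  have "QQ * (zz - kap (- mu)) = ZZ^2 * (qq * (ZZ + 2 * kap mu))"
    by (simp add: QQ_def zz_def algebra_simps)
  also have "\<dots> = ZZ^2 * (- ((kap mu * ss - kap r1 * xx) * (xx - 2 * ss)))"
    unfolding id[OF qq_eq qZ d] ..
  also have "\<dots> = - (phi3 hp1 * phi3 kp1)"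
    unfolding h k by (simp add: power2_eq_square mult_ac)
  finally show ?thesis .
qed

lemma rel_Q: "scale QQ SS = lprod [P0, P0, LA, LB, LC, LD]"
proof -
  note cl = lines_Inv
  have Q: "scale QQ SS \<in> carrier Inv" by (rule prin_Inv) simp
  have "scale QQ SS \<otimes>\<^bsub>Inv\<^esub> (P2 \<otimes>\<^bsub>Inv\<^esub> P3) = scale (- 1) (scale (phi3 hp1) SS \<otimes>\<^bsub>Inv\<^esub> scale (phi3 kp1) SS)"
    by (simp add: pairs(2) prin_mult scale_scale QQ_eq del: kap_simps)
  also have "\<dots> = scale (phi3 hp1) SS \<otimes>\<^bsub>Inv\<^esub> scale (phi3 kp1) SS"
  proof -
    have "scale (- 1) SS = SS" using scale_const[of "- 1"] by simp
    hence "scale (u * - 1) SS = scale u SS" for u using scale_scale[of u "- 1" SS] by simp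
    from this[of "phi3 hp1 * phi3 kp1"] show ?thesis by (simp add: prin_mult scale_scale)
  qed
  also have "\<dots> = (P2 \<otimes>\<^bsub>Inv\<^esub> P3) \<otimes>\<^bsub>Inv\<^esub> lprod [P0, P0, LA, LB, LC, LD]"
  proof -
    have l4: "lprod [I, J, K, L] = I \<otimes>\<^bsub>Inv\<^esub> (J \<otimes>\<^bsub>Inv\<^esub> (K \<otimes>\<^bsub>Inv\<^esub> L))" if "L \<in> carrier Inv" for I J K L
      using that by (simp add: iprod_S InvD)
    have l6: "lprod [I, J, K, L, M, N] = I \<otimes>\<^bsub>Inv\<^esub> (J \<otimes>\<^bsub>Inv\<^esub> (K \<otimes>\<^bsub>Inv\<^esub> (L \<otimes>\<^bsub>Inv\<^esub> (M \<otimes>\<^bsub>Inv\<^esub> N))))"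
      if "N \<in> carrier Inv" for I J K L M N
      using that by (simp add: iprod_S InvD)
    show ?thesis unfolding rel_h rel_k l4[OF cl(11)] l4[OF cl(7)] l6[OF cl(11)]
      by (simp only: cl Inv.m_closed Inv.m_ac)
  qed
  finally have "(P2 \<otimes>\<^bsub>Inv\<^esub> P3) \<otimes>\<^bsub>Inv\<^esub> scale QQ SS = (P2 \<otimes>\<^bsub>Inv\<^esub> P3) \<otimes>\<^bsub>Inv\<^esub> lprod [P0, P0, LA, LB, LC, LD]"
    using Inv.m_comm[OF Q, of "P2 \<otimes>\<^bsub>Inv\<^esub> P3"] Inv.m_closed[OF cl(3,4)] by simp
  moreover have L: "lprod [P0, P0, LA, LB, LC, LD] \<in> carrier Inv" using cl by (intro lprod_Inv) simp
  ultimately show ?thesis using Inv.l_cancel[OF _ Q L Inv.m_closed[OF cl(3,4)]] by simp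
qed

lemma rel_Z: "scale ZZ SS = iprod P0 P1"
  unfolding pairs(1) by (simp add: zz_def)

subsection \<open>Every invertible ideal is a product of lines, up to scaling\<close>

text \<open>
  Write \<open>1 = \<Sum> p\<^sub>i q\<^sub>i / c\<close> with \<open>p\<^sub>i \<in> K1\<close>,
  \<open>q\<^sub>i \<in> K2\<close>. Then \<open>y = \<Sum> p\<^sub>i (q\<^sub>i y / c)\<close> with
  \<open>q\<^sub>i y / c \<in> S\<close>, so a power of \<open>G\<close> clearing the denominators of the
  \<open>p\<^sub>i\<close> clears that of every \<open>y \<in> K1\<close>.
\<close>

lemma uniform_denominator:
  assumes K: "submod K1" "submod K2" "K1 \<subseteq> TT" "iprod K1 K2 = scale c SS" "c \<noteq> 0"
  shows "\<exists>n. \<forall>y\<in>K1. GG ^ n * y \<in> SS"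
proof -
  have "\<exists>n. \<forall>y\<in>K1. GG ^ n * (z / c * y) \<in> SS" if "z \<in> iprod K1 K2" for z
    using that
  proof induction
    case iprod_zero show ?case by (intro exI[of _ 0]) simp
  next
    case (iprod_step p q z)
    then obtain n where n: "\<forall>y\<in>K1. GG ^ n * (z / c * y) \<in> SS" by blast
    obtain m where m: "GG ^ m * p \<in> SS" using iprod_step K(3) by (auto simp: TT_def)
    have "GG ^ (n + m) * ((p * q + z) / c * y) \<in> SS" if y: "y \<in> K1" for y
    proof -
      have "y * q \<in> scale c SS" using iprod_mult[OF y iprod_step(2)] K(4) by simp
      hence yq: "y * q / c \<in> SS" using K(5) by (simp add: scale_mem_iff)
      have "GG ^ (n + m) * ((p * q + z) / c * y) = GG ^ n * ((GG ^ m * p) * (y * q / c)) + GG ^ m * (GG ^ n * (z / c * y))"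
        by (simp add: power_add add_divide_distrib algebra_simps)
      also have "\<dots> \<in> SS"
        by (rule S_add[OF S_mult[OF S_power[OF GG_SS] S_mult[OF m yq]] S_mult[OF S_power[OF GG_SS] n[rule_format, OF y]]])
      finally show ?thesis .
    qed
    thus ?case by blast
  qed
  from this[of c] show ?thesis using K(4,5) prin_mem[of c] by simp
qed

end

context markoff
begin

text \<open>
  In the factorial ring \<open>TT\<close> an invertible ideal is generated by the greatest common divisor of its elements.
  Here \<open>d\<close> and \<open>e\<close> are these divisors for two complementary ideals, and the point is that the
  generator \<open>w\<close> of the product divides \<open>d e\<close>. A prime other than \<open>q\<close> and
  \<open>L\<close> in the reduced denominator of \<open>d e / w\<close> would divide \<open>f' h'\<close> for all elements
  \<open>d f'\<close> and \<open>e h'\<close> of the ideals, although neither the cofactors \<open>f'\<close> nor the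
  cofactors \<open>h'\<close> have it in common.
\<close>

lemma Inv_principal_in_localisation:
  assumes I: "I \<in> carrier Inv" "I \<subseteq> SS" and J: "J \<in> carrier Inv" "J \<subseteq> SS"
    and w: "iprod I J = scale w SS" "w \<noteq> 0"
  shows "\<exists>d e. d \<noteq> 0 \<and> e \<noteq> 0 \<and> scale (1 / to_fract d) I \<subseteq> TT \<and> scale (1 / to_fract e) J \<subseteq> TT \<and>
     to_fract (d * e) / w \<in> TT"
proof -
  \<comment> \<open>The polynomials in the extension of an ideal to the localisation.\<close>
  define cl where "cl I = {p. \<exists>n. \<exists>i\<in>I. to_fract p = hh ^ n * i}" for I :: "'c poly poly fract set"
  have cl: "Gcd (cl K) \<noteq> 0 \<and> scale (1 / to_fract (Gcd (cl K))) K \<subseteq> TT" if K: "K \<in> carrier Inv" "K \<subseteq> SS" for K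
  proof -
    have ex: "\<exists>n p. p \<in> cl K \<and> to_fract p = hh ^ n * i" if i: "i \<in> K" for i
    proof -
      have "i \<in> TP" using i K SS_TP by blast
      then obtain n p where "i * hh ^ n = to_fract p" by (auto simp: TP_def)
      hence "to_fract p = hh ^ n * i" by (simp add: mult.commute)
      thus ?thesis using i unfolding cl_def by blast
    qed
    obtain i where i: "i \<in> K" "i \<noteq> 0" using Inv_nonzero[OF K(1)] .
    obtain n p where p: "p \<in> cl K" "to_fract p = hh ^ n * i" using ex[OF i(1)] by blast
    have "to_fract p \<noteq> 0" using p(2) i(2) by simp
    hence "p \<noteq> 0" by auto
    moreover have "Gcd (cl K) dvd p" by (rule Gcd_dvd[OF p(1)])
    ultimately have nz: "Gcd (cl K) \<noteq> 0" by auto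
    have "1 / to_fract (Gcd (cl K)) * i \<in> TT" if i: "i \<in> K" for i
    proof -
      obtain n p where p: "p \<in> cl K" "to_fract p = hh ^ n * i" using ex[OF i] by blast
      obtain p' where p': "p = Gcd (cl K) * p'" using Gcd_dvd[OF p(1)] by (rule dvdE)
      have "1 / to_fract (Gcd (cl K)) * i * hh ^ n = 1 / to_fract (Gcd (cl K)) * to_fract p" unfolding p(2) by simp
      also have "\<dots> = to_fract p'" using nz by (subst p') simp
      finally show ?thesis unfolding TT_eq_TP TP_def by blast
    qed
    thus ?thesis using nz by (auto simp: scale_def)
  qed
  define d where "d = Gcd (cl I)"
  define e where "e = Gcd (cl J)"
  have d: "d \<noteq> 0" "scale (1 / to_fract d) I \<subseteq> TT" using cl[OF I] by (auto simp: d_def)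
  have e: "e \<noteq> 0" "scale (1 / to_fract e) J \<subseteq> TT" using cl[OF J] by (auto simp: e_def)
  have "w \<in> scale w SS" by (rule prin_mem)
  hence "w \<in> iprod I J" using w by simp
  moreover have "iprod I J \<subseteq> SS" using iprod_subset'[of I J] I J InvD by blast
  ultimately have "w \<in> TP" using SS_TP by blast
  then obtain k w1 where w1: "w * hh ^ k = to_fract w1" by (auto simp: TP_def)
  have w1_nz: "w1 \<noteq> 0" using w1 w(2) by auto
  define D where "D = d * e * (qp * lp) ^ k"
  have v: "to_fract (d * e) / w = to_fract D / to_fract w1"
    unfolding w1[symmetric] D_def using w(2) by (simp add: to_fract_mult hh_power[symmetric])
  have D_nz: "D \<noteq> 0" using d(1) e(1) by (simp add: D_def)
  define g where "g = gcd D w1"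
  have g_nz: "g \<noteq> 0" using w1_nz by (simp add: g_def)
  obtain D2 w2 where Dw: "D = g * D2" "w1 = g * w2" "coprime D2 w2"
    using gcd_coprime_exists[of D w1] g_nz unfolding g_def by (metis mult.commute)
  have w2_nz: "w2 \<noteq> 0" using w1_nz Dw by auto
  have "p dvd qp * lp" if p: "prime p" "p dvd w2" for p
  proof (rule ccontr)
    assume np: "\<not> p dvd qp * lp"
    have not_all: "\<exists>f\<in>cl K. \<exists>f'. f = Gcd (cl K) * f' \<and> \<not> p dvd f'" if K: "Gcd (cl K) \<noteq> 0" for K
    proof (rule ccontr)
      assume *: "\<not> ?thesis"
      have "Gcd (cl K) * p dvd f" if f: "f \<in> cl K" for f
      proof -
        obtain f' where f': "f = Gcd (cl K) * f'" using Gcd_dvd[OF f] by (rule dvdE)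
        hence "p dvd f'" using * f by blast
        thus ?thesis by (subst f') (rule mult_dvd_mono[OF dvd_refl])
      qed
      hence "Gcd (cl K) * p dvd Gcd (cl K)" by (rule Gcd_greatest)
      hence "is_unit p" using K by (simp add: dvd_mult_cancel_left[of _ p 1, simplified])
      thus False using p(1) by (simp add: prime_def prime_elem_def)
    qed
    obtain f f' where f: "f \<in> cl I" "f = d * f'" "\<not> p dvd f'" using not_all[of I] d(1) unfolding d_def by blast
    obtain h h' where h: "h \<in> cl J" "h = e * h'" "\<not> p dvd h'" using not_all[of J] e(1) unfolding e_def by blast
    obtain n i where i: "i \<in> I" "to_fract f = hh ^ n * i" using f(1) unfolding cl_def by blast
    obtain m j where j: "j \<in> J" "to_fract h = hh ^ m * j" using h(1) unfolding cl_def by blast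
    have "i * j \<in> scale w SS" using iprod_mult[OF i(1) j(1)] w by simp
    then obtain s where s: "s \<in> SS" "i * j = w * s" by (auto simp: scale_def)
    obtain l t where t: "s * hh ^ l = to_fract t" using s(1) SS_TP by (auto simp: TP_def)
    have "to_fract (f * h * (qp * lp) ^ (k + l)) = hh ^ n * hh ^ m * (i * j) * hh ^ k * hh ^ l"
      by (simp add: i(2) j(2) to_fract_mult hh_power[symmetric] power_add)
    also have "\<dots> = hh ^ (n + m) * (w * hh ^ k) * (s * hh ^ l)" unfolding s(2) by (simp add: power_add)
    also have "\<dots> = to_fract ((qp * lp) ^ (n + m) * w1 * t)" unfolding w1 t by (simp add: to_fract_mult hh_power)
    finally have "f * h * (qp * lp) ^ (k + l) = (qp * lp) ^ (n + m) * w1 * t" by (simp only: to_fract_eq_iff)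
    hence "D * (f' * h' * (qp * lp) ^ l) = w1 * ((qp * lp) ^ (n + m) * t)"
      unfolding f(2) h(2) D_def by (simp only: power_add mult_ac)
    hence "g * (D2 * (f' * h' * (qp * lp) ^ l)) = g * (w2 * ((qp * lp) ^ (n + m) * t))"
      unfolding Dw(1,2) by (simp only: mult_ac)
    hence "D2 * (f' * h' * (qp * lp) ^ l) = w2 * ((qp * lp) ^ (n + m) * t)" using mult_left_cancel[OF g_nz] by blast
    hence "p dvd D2 * (f' * h' * (qp * lp) ^ l)" using p(2) by (metis dvd_mult2)
    hence "p dvd D2 \<or> p dvd f' \<or> p dvd h' \<or> p dvd (qp * lp) ^ l"
      using p(1) by (simp only: prime_dvd_mult_iff) blast
    moreover have "\<not> p dvd D2"
      using Dw(3) p by (meson coprime_common_divisor not_prime_unit)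
    moreover have "\<not> p dvd (qp * lp) ^ l" using np p(1) prime_dvd_power by blast
    ultimately show False using f(3) h(3) by blast
  qed
  then obtain N where "w2 dvd (qp * lp) ^ N" using dvd_power_of_primes[OF w2_nz] by blast
  then obtain y where y: "(qp * lp) ^ N = w2 * y" by (rule dvdE)
  have "to_fract (d * e) / w = to_fract D2 / to_fract w2" unfolding v Dw using g_nz by simp
  hence "to_fract (d * e) / w * hh ^ N = to_fract (D2 * y)" unfolding hh_power y using w2_nz by simp
  hence "to_fract (d * e) / w \<in> TT" unfolding TT_eq_TP TP_def by blast
  thus ?thesis using d e by blast
qed

text \<open>
  After division by the greatest common divisors \<open>I\<close> becomes the unit ideal in the localisation at
  \<open>G\<close>, so that \<open>I\<close> and its inverse have a power of \<open>G\<close> as denominator.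
\<close>

lemma Inv_divides_power:
  assumes "I \<in> carrier Inv"
  shows "\<exists>u J N. u \<noteq> 0 \<and> scale u I \<subseteq> SS \<and> J \<in> carrier Inv \<and> J \<subseteq> SS \<and> iprod (scale u I) J = scale (GG ^ N) SS"
proof -
  obtain u0 where u0: "u0 \<noteq> 0" "scale u0 I \<subseteq> SS" using Inv_integral[OF assms] .
  define I0 where "I0 = scale u0 I"
  have I0: "I0 \<in> carrier Inv" "I0 \<subseteq> SS" using assms u0 by (auto simp: I0_def)
  obtain J' where J': "J' \<in> carrier Inv" "iprod I0 J' = SS" using Inv_obtain[OF I0(1)] .
  obtain w where w: "w \<noteq> 0" "scale w J' \<subseteq> SS" using Inv_integral[OF J'(1)] .
  define J0 where "J0 = scale w J'"
  have J0: "J0 \<in> carrier Inv" "J0 \<subseteq> SS" using J' w by (auto simp: J0_def)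
  have IJ: "iprod I0 J0 = scale w SS" using J' by (simp add: J0_def scale_prod2)
  obtain d e where de': "d \<noteq> 0" "e \<noteq> 0" "scale (1 / to_fract d) I0 \<subseteq> TT" "scale (1 / to_fract e) J0 \<subseteq> TT"
     "to_fract (d * e) / w \<in> TT"
    using Inv_principal_in_localisation[OF I0 J0 IJ w(1)] by blast
  define I1 where "I1 = scale (1 / to_fract d) I0"
  define J1 where "J1 = scale (1 / to_fract e) J0"
  define v where "v = to_fract (d * e) / w"
  have v: "v \<noteq> 0" "v \<in> TT" using de' w by (auto simp: v_def)
  have I1: "I1 \<in> carrier Inv" "I1 \<subseteq> TT" and J1: "J1 \<in> carrier Inv" "J1 \<subseteq> TT"
    using I0 J0 de' by (auto simp: I1_def J1_def)
  have IJ1: "iprod I1 J1 = scale (1 / v) SS"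
    unfolding I1_def J1_def by (simp add: scale_prod1 scale_prod2 scale_scale IJ v_def mult.commute)
  hence JI1: "iprod J1 I1 = scale (1 / v) SS" by (metis iprod_commute)
  obtain n where n: "\<forall>y\<in>I1. GG ^ n * y \<in> SS"
    using uniform_denominator[OF InvD[OF I1(1)] InvD[OF J1(1)] I1(2) IJ1] v by auto
  obtain m where m: "\<forall>y\<in>J1. GG ^ m * y \<in> SS"
    using uniform_denominator[OF InvD[OF J1(1)] InvD[OF I1(1)] J1(2) JI1] v by auto
  obtain l where l: "GG ^ l * v \<in> SS" using v(2) by (auto simp: TT_def)
  define u where "u = GG ^ n * (1 / to_fract d) * u0"
  define J where "J = scale (GG ^ l * v) (scale (GG ^ m) J1)"
  have eq: "scale u I = scale (GG ^ n) I1" by (simp add: u_def I1_def I0_def scale_scale)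
  have Jm: "scale (GG ^ m) J1 \<subseteq> SS" using m by (auto simp: scale_def)
  show ?thesis
  proof (intro exI conjI)
    show "u \<noteq> 0" using u0 de' by (simp add: u_def)
    show "scale u I \<subseteq> SS" unfolding eq using n by (auto simp: scale_def)
    show "J \<in> carrier Inv" unfolding J_def using J1 v by (intro scale_Inv) auto
    show "J \<subseteq> SS" unfolding J_def scale_def[of "GG ^ l * v"] using Jm l S_mult by blast
    show "iprod (scale u I) J = scale (GG ^ (n + m + l)) SS"
      unfolding eq J_def using v by (simp add: scale_prod1 scale_prod2 scale_scale IJ1 power_add mult_ac)
  qed
qed

text \<open>
  The prime factors of \<open>G = ZQ\<close> with multiplicity.
\<close>

definition GL where "GL = [P0, P1, P0, P0, LA, LB, LC, LD]"

lemma GL_prime: "P \<in> set GL \<Longrightarrow> iprime P"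
  unfolding GL_def using lines_prime by auto

lemma scale_GG: "scale GG SS = lprod GL"
proof -
  have L: "lprod [P0, P0, LA, LB, LC, LD] \<in> carrier Inv" using lines_Inv by (intro lprod_Inv) simp
  have "scale GG SS = iprod (scale ZZ SS) (scale QQ SS)" by (simp add: GG_def prin_mult)
  also have "\<dots> = lprod GL"
    unfolding rel_Z rel_Q GL_def using Inv.m_assoc[OF lines_Inv(1,2) L] by simp
  finally show ?thesis .
qed

lemma scale_GG_power: "scale (GG ^ N) SS = lprod (concat (replicate N GL))"
proof (induction N)
  case (Suc N)
  have c: "set GL \<subseteq> carrier Inv" "set (concat (replicate N GL)) \<subseteq> carrier Inv"
    using GL_prime iprimeD(1) by (auto split: if_splits)
  have "scale (GG ^ Suc N) SS = iprod (scale GG SS) (scale (GG ^ N) SS)" by (simp add: prin_mult)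
  also have "\<dots> = lprod (GL @ concat (replicate N GL))" unfolding Suc scale_GG lprod_append[OF c] ..
  finally show ?case by simp
qed simp

lemma Inv_product_of_lines:
  assumes "I \<in> carrier Inv"
  shows "\<exists>u Qs. u \<noteq> 0 \<and> set Qs \<subseteq> {P0, P1, LA, LB, LC, LD} \<and> scale u I = lprod Qs"
proof -
  obtain u J N where u: "u \<noteq> 0" "scale u I \<subseteq> SS" "J \<in> carrier Inv" "J \<subseteq> SS" "iprod (scale u I) J = scale (GG ^ N) SS"
    using Inv_divides_power[OF assms] by blast
  have GLs: "set (concat (replicate N GL)) \<subseteq> set GL" by (auto split: if_splits)
  have "\<exists>Qs. set Qs \<subseteq> set (concat (replicate N GL)) \<and> scale u I = lprod Qs"
    using u assms GLs GL_prime by (intro divisor_of_primes[where J = J]) (auto simp: scale_GG_power)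
  then obtain Qs where Qs: "set Qs \<subseteq> set GL" "scale u I = lprod Qs" using GLs by blast
  moreover have "set GL = {P0, P1, LA, LB, LC, LD}" unfolding GL_def by auto
  ultimately show ?thesis using u(1) by blast
qed

end

context markoff
begin

section \<open>The class group of the surface\<close>

abbreviation gZ where "gZ \<equiv> Z3 - C3 mu"
abbreviation gX where "gX c \<equiv> X3 - C3 c"
abbreviation gY where "gY r \<equiv> Y3 - C3 r * X3"

lemma lam_gZ: "lam (line2 c t) gZ = [:c - mu:]" "lam (line1 c t d) gZ = [:- mu, 1:]"
  unfolding line1_def line2_def by (simp_all only: lam_hom lam_gens) simp_all

lemma lam_gX: "lam (line2 c t) (gX k) = [:- k, 1:]" "lam (line1 c t d) (gX k) = [:c - k:]"
  unfolding line1_def line2_def by (simp_all only: lam_hom lam_gens) simp_all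

lemma lam_gY: "lam (line2 c t) (gY r) = [:0, t - r:]"
  unfolding line2_def by (simp_all only: lam_hom lam_gens) simp_all

lemma xi_ne: "mu / al \<noteq> 2" "mu / al \<noteq> - 2" "mu / al \<noteq> - (mu / al)" "- (mu / al) \<noteq> mu / al" "- (mu / al) \<noteq> 2" "- (mu / al) \<noteq> - 2"
    "2 \<noteq> mu / al" "- 2 \<noteq> mu / al" "2 \<noteq> - (mu / al)" "- 2 \<noteq> - (mu / al)"
proof -
  have "de^2 \<noteq> 0" using de by simp
  hence sq: "mu^2 \<noteq> 4 * al^2" unfolding de2 by simp
  have "(mu / al)^2 \<noteq> 4" using sq al by (simp add: power_divide divide_eq_eq)
  hence 1: "mu / al \<noteq> 2" "mu / al \<noteq> - 2" by auto
  have 2: "- (mu / al) \<noteq> 2" using 1(2) by (metis minus_minus)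
  have 3: "mu / al \<noteq> 0" using mu al by simp
  have 4: "mu / al \<noteq> - (mu / al)"
  proof
    assume "mu / al = - (mu / al)"
    hence "2 * (mu / al) = 0" by (metis add.right_inverse mult_2)
    thus False using 3 by simp
  qed
  show "mu / al \<noteq> 2" "mu / al \<noteq> - 2" "2 \<noteq> mu / al" "- 2 \<noteq> mu / al" using 1 by metis+
  show "mu / al \<noteq> - (mu / al)" "- (mu / al) \<noteq> mu / al" using 4 by metis+
  show "- (mu / al) \<noteq> 2" "2 \<noteq> - (mu / al)" using 2 by metis+
  show "- (mu / al) \<noteq> - 2" "- 2 \<noteq> - (mu / al)" using 1(1) by (metis minus_minus)+
qed

text \<open>
  For each pair of lines some plane contains the first line and not the second one.
\<close>

lemma no_containment:
  shows "\<not> P0 \<subseteq> P1" "\<not> P0 \<subseteq> LA" "\<not> P0 \<subseteq> LB" "\<not> P0 \<subseteq> LC" "\<not> P0 \<subseteq> LD" "\<not> P1 \<subseteq> P0"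
    "\<not> P1 \<subseteq> LA" "\<not> P1 \<subseteq> LB" "\<not> P1 \<subseteq> LC" "\<not> P1 \<subseteq> LD" "\<not> LA \<subseteq> P0" "\<not> LA \<subseteq> P1"
    "\<not> LA \<subseteq> LB" "\<not> LA \<subseteq> LC" "\<not> LA \<subseteq> LD" "\<not> LB \<subseteq> P0" "\<not> LB \<subseteq> P1" "\<not> LB \<subseteq> LA"
    "\<not> LB \<subseteq> LC" "\<not> LB \<subseteq> LD" "\<not> LC \<subseteq> P0" "\<not> LC \<subseteq> P1" "\<not> LC \<subseteq> LA" "\<not> LC \<subseteq> LB"
    "\<not> LC \<subseteq> LD" "\<not> LD \<subseteq> P0" "\<not> LD \<subseteq> P1" "\<not> LD \<subseteq> LA" "\<not> LD \<subseteq> LB" "\<not> LD \<subseteq> LC"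
proof -
  have T: "scale (phi3 (gZ)) SS \<subseteq> P0" "scale (phi3 (gY r1)) SS \<subseteq> P0"
    "scale (phi3 (gZ)) SS \<subseteq> P1" "scale (phi3 (gY r2)) SS \<subseteq> P1"
    "scale (phi3 (gX 2)) SS \<subseteq> LA" "scale (phi3 (gX (- 2))) SS \<subseteq> LB"
    "scale (phi3 (gX (mu / al))) SS \<subseteq> LC" "scale (phi3 (gX (- (mu / al)))) SS \<subseteq> LD"
    unfolding prin_subset_lines lam_gZ lam_gX lam_gY by simp_all
  have r: "r2 - r1 \<noteq> 0" "r1 - r2 \<noteq> 0" using r_ne by simp_all
  have two: "(2::'c) \<noteq> - 2" "- 2 \<noteq> (2::'c)" by (simp_all add: eq_neg_iff_add_eq_0)
  have F: "\<not> scale (phi3 (gY r1)) SS \<subseteq> P1" "\<not> scale (phi3 (gZ)) SS \<subseteq> LA"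
    "\<not> scale (phi3 (gZ)) SS \<subseteq> LB" "\<not> scale (phi3 (gZ)) SS \<subseteq> LC"
    "\<not> scale (phi3 (gZ)) SS \<subseteq> LD" "\<not> scale (phi3 (gY r2)) SS \<subseteq> P0"
    "\<not> scale (phi3 (gZ)) SS \<subseteq> LA" "\<not> scale (phi3 (gZ)) SS \<subseteq> LB"
    "\<not> scale (phi3 (gZ)) SS \<subseteq> LC" "\<not> scale (phi3 (gZ)) SS \<subseteq> LD"
    "\<not> scale (phi3 (gX 2)) SS \<subseteq> P0" "\<not> scale (phi3 (gX 2)) SS \<subseteq> P1"
    "\<not> scale (phi3 (gX 2)) SS \<subseteq> LB" "\<not> scale (phi3 (gX 2)) SS \<subseteq> LC"
    "\<not> scale (phi3 (gX 2)) SS \<subseteq> LD" "\<not> scale (phi3 (gX (- 2))) SS \<subseteq> P0"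
    "\<not> scale (phi3 (gX (- 2))) SS \<subseteq> P1" "\<not> scale (phi3 (gX (- 2))) SS \<subseteq> LA"
    "\<not> scale (phi3 (gX (- 2))) SS \<subseteq> LC" "\<not> scale (phi3 (gX (- 2))) SS \<subseteq> LD"
    "\<not> scale (phi3 (gX (mu / al))) SS \<subseteq> P0" "\<not> scale (phi3 (gX (mu / al))) SS \<subseteq> P1"
    "\<not> scale (phi3 (gX (mu / al))) SS \<subseteq> LA" "\<not> scale (phi3 (gX (mu / al))) SS \<subseteq> LB"
    "\<not> scale (phi3 (gX (mu / al))) SS \<subseteq> LD" "\<not> scale (phi3 (gX (- (mu / al)))) SS \<subseteq> P0"
    "\<not> scale (phi3 (gX (- (mu / al)))) SS \<subseteq> P1" "\<not> scale (phi3 (gX (- (mu / al)))) SS \<subseteq> LA"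
    "\<not> scale (phi3 (gX (- (mu / al)))) SS \<subseteq> LB" "\<not> scale (phi3 (gX (- (mu / al)))) SS \<subseteq> LC"
    unfolding prin_subset_lines lam_gZ lam_gX lam_gY using xi_ne r two by (simp_all only: pCons_eq_0_iff right_minus_eq) simp_all
  have n: "\<not> P \<subseteq> Q" if "U \<subseteq> P" "\<not> U \<subseteq> Q" for P Q U :: "'c poly poly fract set"
    using that by blast
  show "\<not> P0 \<subseteq> P1" "\<not> P0 \<subseteq> LA" "\<not> P0 \<subseteq> LB" "\<not> P0 \<subseteq> LC" "\<not> P0 \<subseteq> LD" "\<not> P1 \<subseteq> P0"
    "\<not> P1 \<subseteq> LA" "\<not> P1 \<subseteq> LB" "\<not> P1 \<subseteq> LC" "\<not> P1 \<subseteq> LD" "\<not> LA \<subseteq> P0" "\<not> LA \<subseteq> P1"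
    "\<not> LA \<subseteq> LB" "\<not> LA \<subseteq> LC" "\<not> LA \<subseteq> LD" "\<not> LB \<subseteq> P0" "\<not> LB \<subseteq> P1" "\<not> LB \<subseteq> LA"
    "\<not> LB \<subseteq> LC" "\<not> LB \<subseteq> LD" "\<not> LC \<subseteq> P0" "\<not> LC \<subseteq> P1" "\<not> LC \<subseteq> LA" "\<not> LC \<subseteq> LB"
    "\<not> LC \<subseteq> LD" "\<not> LD \<subseteq> P0" "\<not> LD \<subseteq> P1" "\<not> LD \<subseteq> LA" "\<not> LD \<subseteq> LB" "\<not> LD \<subseteq> LC"
    by (rule n[OF T(1)] n[OF T(2)] n[OF T(3)] n[OF T(4)] n[OF T(5)] n[OF T(6)] n[OF T(7)] n[OF T(8)]; rule F)+
qed

text \<open>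
  The ideals supported on the six prime divisors of \<open>G\<close>.
\<close>

definition six_lines :: "int \<Rightarrow> int \<Rightarrow> int \<Rightarrow> int \<Rightarrow> int \<Rightarrow> int \<Rightarrow> 'c poly poly fract set" where
  "six_lines n0 n1 na nb nc nd = P0 [^]\<^bsub>Inv\<^esub> n0 \<otimes>\<^bsub>Inv\<^esub> (P1 [^]\<^bsub>Inv\<^esub> n1 \<otimes>\<^bsub>Inv\<^esub> (LA [^]\<^bsub>Inv\<^esub> na \<otimes>\<^bsub>Inv\<^esub>
     (LB [^]\<^bsub>Inv\<^esub> nb \<otimes>\<^bsub>Inv\<^esub> (LC [^]\<^bsub>Inv\<^esub> nc \<otimes>\<^bsub>Inv\<^esub> LD [^]\<^bsub>Inv\<^esub> nd))))"

lemma int_pow_Inv: "I \<in> carrier Inv \<Longrightarrow> I [^]\<^bsub>Inv\<^esub> (n::int) \<in> carrier Inv"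
  by (rule Inv.int_pow_closed)

lemma six_lines_add: "six_lines n0 n1 na nb nc nd \<otimes>\<^bsub>Inv\<^esub> six_lines m0 m1 ma mb mc md = six_lines (n0 + m0) (n1 + m1) (na + ma) (nb + mb) (nc + mc) (nd + md)"
  unfolding six_lines_def by (simp only: Inv.int_pow_mult lines_Inv int_pow_Inv Inv.m_closed Inv.m_ac)

lemma six_lines_0: "six_lines 0 0 0 0 0 0 = \<one>\<^bsub>Inv\<^esub>"
  unfolding six_lines_def by (simp only: int_pow_0 Inv.l_one Inv.one_closed)

lemma six_lines_nat_pow: "six_lines n0 n1 na nb nc nd [^]\<^bsub>Inv\<^esub> k =
    six_lines (int k * n0) (int k * n1) (int k * na) (int k * nb) (int k * nc) (int k * nd)"
proof (induction k)
  case 0 show ?case by (simp only: Inv.nat_pow_0 of_nat_0 mult_zero_left six_lines_0)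
next
  case (Suc k)
  have *: "int (Suc k) * n = int k * n + n" for n by (simp add: algebra_simps)
  show ?case by (simp only: Inv.nat_pow_Suc Suc.IH six_lines_add *)
qed

lemma six_lines_eq_one:
  assumes "six_lines n0 n1 na nb nc nd = \<one>\<^bsub>Inv\<^esub>"
  shows "n0 = 0 \<and> n1 = 0 \<and> na = 0 \<and> nb = 0 \<and> nc = 0 \<and> nd = 0"
proof -
  define n where "n P = (if P = P0 then n0 else if P = P1 then n1 else if P = LA then na else
      if P = LB then nb else if P = LC then nc else nd)" for P
  have ne: "P1 \<noteq> P0" "LA \<noteq> P0" "LA \<noteq> P1" "LB \<noteq> P0" "LB \<noteq> P1" "LB \<noteq> LA" "LC \<noteq> P0" "LC \<noteq> P1" "LC \<noteq> LA" "LC \<noteq> LB"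
    "LD \<noteq> P0" "LD \<noteq> P1" "LD \<noteq> LA" "LD \<noteq> LB" "LD \<noteq> LC"
    using no_containment by blast+
  define A where "A = {P0, P1, LA, LB, LC, LD}"
  have n: "n P0 = n0" "n P1 = n1" "n LA = na" "n LB = nb" "n LC = nc" "n LD = nd"
    unfolding n_def using ne by simp_all
  have pw: "(\<lambda>P. P [^]\<^bsub>Inv\<^esub> n P) \<in> B \<rightarrow> carrier Inv" "P [^]\<^bsub>Inv\<^esub> n P \<in> carrier Inv" if "B \<subseteq> A" "P \<in> A" for B P
    using that lines_Inv int_pow_Inv unfolding A_def by auto
  have "finprod Inv (\<lambda>P. P [^]\<^bsub>Inv\<^esub> n P) A = six_lines n0 n1 na nb nc nd"
  proof -
    have i: "finprod Inv (\<lambda>P. P [^]\<^bsub>Inv\<^esub> n P) (insert P B) = P [^]\<^bsub>Inv\<^esub> n P \<otimes>\<^bsub>Inv\<^esub> finprod Inv (\<lambda>P. P [^]\<^bsub>Inv\<^esub> n P) B"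
      if "B \<subseteq> A" "P \<in> A" "P \<notin> B" for P B
    proof (rule Inv.finprod_insert)
      show "finite B" using that(1) finite_subset unfolding A_def by blast
    qed (use that pw in auto)
    have "A = insert P0 (insert P1 (insert LA (insert LB (insert LC (insert LD {})))))" unfolding A_def ..
    hence "finprod Inv (\<lambda>P. P [^]\<^bsub>Inv\<^esub> n P) A = P0 [^]\<^bsub>Inv\<^esub> n P0 \<otimes>\<^bsub>Inv\<^esub> (P1 [^]\<^bsub>Inv\<^esub> n P1 \<otimes>\<^bsub>Inv\<^esub> (LA [^]\<^bsub>Inv\<^esub> n LA \<otimes>\<^bsub>Inv\<^esub>
     (LB [^]\<^bsub>Inv\<^esub> n LB \<otimes>\<^bsub>Inv\<^esub> (LC [^]\<^bsub>Inv\<^esub> n LC \<otimes>\<^bsub>Inv\<^esub> (LD [^]\<^bsub>Inv\<^esub> n LD \<otimes>\<^bsub>Inv\<^esub> finprod Inv (\<lambda>P. P [^]\<^bsub>Inv\<^esub> n P) {})))))"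
      using ne by (simp only: i) (subst i, simp_all add: A_def)+
    also have "\<dots> = six_lines n0 n1 na nb nc nd"
      unfolding six_lines_def n Inv.finprod_empty using Inv.r_one[OF int_pow_Inv[OF lines_Inv(11)]] by (simp only:)
    finally show ?thesis .
  qed
  hence one: "finprod Inv (\<lambda>P. P [^]\<^bsub>Inv\<^esub> n P) A = SS" using assms by simp
  have pr: "iprime P" if "P \<in> A" for P using that lines_prime unfolding A_def by blast
  have inc: "P = Q" if "P \<in> A" "Q \<in> A" "P \<subseteq> Q" for P Q
    using that no_containment unfolding A_def by (elim insertE emptyE) (simp_all (no_asm_use))
  have "n P = 0" if "P \<in> A" for P
    by (rule prime_powers_independent[OF _ pr inc one that]) (simp_all add: A_def)
  from this[of P0] this[of P1] this[of LA] this[of LB] this[of LC] this[of LD]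
  show ?thesis unfolding n by (simp add: A_def)
qed

lemma scale_nat_pow: "scale (u ^ k) SS = scale u SS [^]\<^bsub>Inv\<^esub> k"
proof (induction k)
  case (Suc k)
  have "scale (u ^ Suc k) SS = iprod (scale (u ^ k) SS) (scale u SS)" by (simp add: prin_mult mult.commute)
  thus ?case using Suc by simp
qed simp

lemma Z_six_lines: "scale ZZ SS = six_lines 1 1 0 0 0 0"
  unfolding rel_Z six_lines_def using lines_Inv
  by (simp add: Inv.int_pow_1 iprod_S InvD)

lemma Q_six_lines: "scale QQ SS = six_lines 2 0 1 1 1 1"
proof -
  have "P0 [^]\<^bsub>Inv\<^esub> (2::int) = P0 \<otimes>\<^bsub>Inv\<^esub> P0"
    using Inv.int_pow_mult[OF lines_Inv(1), of 1 1] Inv.int_pow_1[OF lines_Inv(1)] by simp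
  moreover have "lprod [P0, P0, LA, LB, LC, LD] = P0 \<otimes>\<^bsub>Inv\<^esub> P0 \<otimes>\<^bsub>Inv\<^esub> (LA \<otimes>\<^bsub>Inv\<^esub> (LB \<otimes>\<^bsub>Inv\<^esub> (LC \<otimes>\<^bsub>Inv\<^esub> LD)))"
    using lines_Inv Inv.m_assoc[OF lines_Inv(1,1), of "iprod LA (iprod LB (iprod LC LD))"] Inv.m_closed
    by (simp add: iprod_S InvD)
  ultimately show ?thesis
    unfolding rel_Q six_lines_def using lines_Inv Inv.m_closed
    by (simp add: Inv.int_pow_1 iprod_S InvD)
qed

text \<open>
  Ideals that become the unit ideal when \<open>G\<close> is inverted.
\<close>

definition unit_away :: "'c poly poly fract set \<Rightarrow> bool" where
  "unit_away I \<longleftrightarrow> I \<in> carrier Inv \<and> (\<exists>n. \<forall>y\<in>I. GG ^ n * y \<in> SS) \<and> (\<exists>n. GG ^ n \<in> I)"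

lemma unit_away_mult: assumes "unit_away I" "unit_away J" shows "unit_away (I \<otimes>\<^bsub>Inv\<^esub> J)"
proof -
  obtain n n' where n: "\<forall>y\<in>I. GG ^ n * y \<in> SS" "GG ^ n' \<in> I" using assms by (auto simp: unit_away_def)
  obtain m m' where m: "\<forall>y\<in>J. GG ^ m * y \<in> SS" "GG ^ m' \<in> J" using assms by (auto simp: unit_away_def)
  have "iprod I J \<subseteq> {y. GG ^ (n + m) * y \<in> SS}"
  proof (rule iprod_least)
    show "submod {y. GG ^ (n + m) * y \<in> SS}"
      by (rule submodI) (auto simp: distrib_left mult.left_commute[of "GG ^ (n + m)"])
    fix x y assume xy: "x \<in> I" "y \<in> J"
    have "(GG ^ n * x) * (GG ^ m * y) \<in> SS"
      by (rule S_mult[OF n(1)[rule_format, OF xy(1)] m(1)[rule_format, OF xy(2)]])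
    thus "x * y \<in> {y. GG ^ (n + m) * y \<in> SS}" by (simp add: power_add mult_ac)
  qed
  moreover have "GG ^ (n' + m') \<in> iprod I J" unfolding power_add using n m by (intro iprod_mult)
  ultimately show ?thesis using assms Inv.m_closed[of I J] unfolding unit_away_def by auto
qed

lemma unit_away_inv: assumes "unit_away I" shows "unit_away (inv\<^bsub>Inv\<^esub> I)"
proof -
  obtain n n' where n: "\<forall>y\<in>I. GG ^ n * y \<in> SS" "GG ^ n' \<in> I" and I: "I \<in> carrier Inv"
    using assms by (auto simp: unit_away_def)
  define J where "J = inv\<^bsub>Inv\<^esub> I"
  have J: "J \<in> carrier Inv" "iprod I J = SS" using I Inv.inv_closed Inv.r_inv[OF I] by (simp_all add: J_def)
  have "\<forall>y\<in>J. GG ^ n' * y \<in> SS" using iprod_mult[OF n(2), of _ J] J(2) by auto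
  moreover have "iprod I J \<subseteq> {y. GG ^ n * y \<in> J}"
  proof (rule iprod_least)
    show "submod {y. GG ^ n * y \<in> J}"
      using InvD[OF J(1)] by (intro submodI) (auto simp: distrib_left mult.left_commute[of "GG ^ n"] submod_add submod_smult)
    fix x y assume xy: "x \<in> I" "y \<in> J"
    have "(GG ^ n * x) * y \<in> J" by (rule submod_smult[OF InvD[OF J(1)] n(1)[rule_format, OF xy(1)] xy(2)])
    thus "x * y \<in> {y. GG ^ n * y \<in> J}" by (simp add: mult_ac)
  qed
  hence "GG ^ n * 1 \<in> J" using J(2) S_one by blast
  ultimately show ?thesis using J(1) unfolding unit_away_def J_def[symmetric] by auto
qed

lemma unit_away_int_pow: assumes "unit_away I" shows "unit_away (I [^]\<^bsub>Inv\<^esub> (n::int))"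
proof -
  have "unit_away \<one>\<^bsub>Inv\<^esub>" unfolding unit_away_def
  proof (intro conjI)
    show "\<exists>n. \<forall>y\<in>\<one>\<^bsub>Inv\<^esub>. GG ^ n * y \<in> SS" by (intro exI[of _ 0]) simp
    show "\<exists>n. GG ^ n \<in> \<one>\<^bsub>Inv\<^esub>" by (intro exI[of _ 0]) simp
  qed (rule Inv.one_closed)
  hence nat: "unit_away (I [^]\<^bsub>Inv\<^esub> (k::nat))" for k
    by (induction k) (simp_all only: Inv.nat_pow_0 Inv.nat_pow_Suc unit_away_mult assms)
  show ?thesis unfolding int_pow_def2
    by (cases "n < 0") (simp_all only: if_True if_False nat unit_away_inv)
qed

lemma unit_away_lines: "unit_away P0" "unit_away LA" "unit_away LB" "unit_away LC"
proof -
  have "unit_away P" if P: "P \<in> set GL" for P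
  proof -
    have "scale GG SS \<subseteq> P" unfolding scale_GG using P GL_prime iprimeD(1,2) by (intro lprod_subset) auto
    hence "GG ^ 1 \<in> P" using prin_mem[of GG] by auto
    moreover have "\<forall>y\<in>P. GG ^ 0 * y \<in> SS" using iprimeD(2)[OF GL_prime[OF P]] by auto
    ultimately show ?thesis using iprimeD(1)[OF GL_prime[OF P]] unfolding unit_away_def by blast
  qed
  thus "unit_away P0" "unit_away LA" "unit_away LB" "unit_away LC" by (simp_all add: GL_def)
qed

text \<open>
  The ideals supported on the four lines that form a basis of the Picard group.
\<close>

definition basis_ideal :: "int \<Rightarrow> int \<Rightarrow> int \<Rightarrow> int \<Rightarrow> 'c poly poly fract set" where
  "basis_ideal p a b c = P0 [^]\<^bsub>Inv\<^esub> p \<otimes>\<^bsub>Inv\<^esub> (LA [^]\<^bsub>Inv\<^esub> a \<otimes>\<^bsub>Inv\<^esub> (LB [^]\<^bsub>Inv\<^esub> b \<otimes>\<^bsub>Inv\<^esub> LC [^]\<^bsub>Inv\<^esub> c))"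

lemma basis_ideal_closed: "basis_ideal p a b c \<in> carrier Inv"
  unfolding basis_ideal_def by (intro Inv.m_closed int_pow_Inv lines_Inv)

lemma basis_ideal_add: "basis_ideal p a b c \<otimes>\<^bsub>Inv\<^esub> basis_ideal p' a' b' c' = basis_ideal (p + p') (a + a') (b + b') (c + c')"
  unfolding basis_ideal_def by (simp only: Inv.int_pow_mult lines_Inv int_pow_Inv Inv.m_closed Inv.m_ac)

lemma basis_ideal_0: "basis_ideal 0 0 0 0 = \<one>\<^bsub>Inv\<^esub>"
  unfolding basis_ideal_def by (simp only: int_pow_0 Inv.l_one Inv.one_closed)

lemma basis_ideal_six_lines: "basis_ideal p a b c = six_lines p 0 a b c 0"
  unfolding basis_ideal_def six_lines_def
  by (simp only: int_pow_0 Inv.l_one Inv.r_one Inv.m_closed int_pow_Inv lines_Inv)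

text \<open>
  A generator is a unit of the localisation, so up to a constant it is a product of powers of \<open>Z\<close> and
  \<open>Q\<close>. Its divisor is then a combination of \<open>P\<^sub>0 + P\<^sub>1\<close> and
  \<open>2P\<^sub>0 + A + B + C + D\<close>, and such a combination involves neither \<open>P\<^sub>1\<close> nor
  \<open>D\<close> only if it is zero.
\<close>

lemma basis_ideal_principal:
  assumes eq: "basis_ideal p a b c = scale u SS" and u: "u \<noteq> 0"
  shows "p = 0 \<and> a = 0 \<and> b = 0 \<and> c = 0"
proof -
  have "unit_away (basis_ideal p a b c)" unfolding basis_ideal_def by (intro unit_away_mult unit_away_int_pow unit_away_lines)
  then obtain n n' where n: "\<forall>y\<in>scale u SS. GG ^ n * y \<in> SS" "GG ^ n' \<in> scale u SS"
    unfolding eq unit_away_def by blast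
  have "u \<in> TT" using n(1) prin_mem[of u] unfolding TT_def by blast
  moreover have "1 / u \<in> TT"
  proof -
    have "GG ^ n' * (1 / u) \<in> SS" using n(2) u by (simp add: scale_mem_iff)
    thus ?thesis unfolding TT_def by blast
  qed
  ultimately obtain k i j n where k: "k \<noteq> 0" "u * QQ ^ (2 * n) * ZZ ^ (2 * i + j) = kap k * QQ ^ (i + j) * ZZ ^ (3 * n)"
    using TT_units u by blast
  have "scale (u * QQ ^ (2 * n) * ZZ ^ (2 * i + j)) SS = scale (QQ ^ (i + j) * ZZ ^ (3 * n)) SS"
  proof -
    have "scale (kap k * QQ ^ (i + j) * ZZ ^ (3 * n)) SS = scale (QQ ^ (i + j) * ZZ ^ (3 * n)) (scale (kap k) SS)"
      by (simp add: scale_scale mult_ac)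
    thus ?thesis unfolding k(2) scale_const[OF k(1)] .
  qed
  hence "six_lines p 0 a b c 0 \<otimes>\<^bsub>Inv\<^esub> six_lines 2 0 1 1 1 1 [^]\<^bsub>Inv\<^esub> (2 * n) \<otimes>\<^bsub>Inv\<^esub> six_lines 1 1 0 0 0 0 [^]\<^bsub>Inv\<^esub> (2 * i + j)
      = six_lines 2 0 1 1 1 1 [^]\<^bsub>Inv\<^esub> (i + j) \<otimes>\<^bsub>Inv\<^esub> six_lines 1 1 0 0 0 0 [^]\<^bsub>Inv\<^esub> (3 * n)"
    unfolding prin_mult[symmetric] scale_nat_pow eq[symmetric] basis_ideal_six_lines Z_six_lines Q_six_lines by (simp only: Inv_simps)
  hence "(six_lines p 0 a b c 0 \<otimes>\<^bsub>Inv\<^esub> six_lines 2 0 1 1 1 1 [^]\<^bsub>Inv\<^esub> (2 * n) \<otimes>\<^bsub>Inv\<^esub> six_lines 1 1 0 0 0 0 [^]\<^bsub>Inv\<^esub> (2 * i + j))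
      \<otimes>\<^bsub>Inv\<^esub> six_lines (- int (2 * (i + j) + 3 * n)) (- int (3 * n)) (- int (i + j)) (- int (i + j)) (- int (i + j)) (- int (i + j))
      = (six_lines 2 0 1 1 1 1 [^]\<^bsub>Inv\<^esub> (i + j) \<otimes>\<^bsub>Inv\<^esub> six_lines 1 1 0 0 0 0 [^]\<^bsub>Inv\<^esub> (3 * n))
      \<otimes>\<^bsub>Inv\<^esub> six_lines (- int (2 * (i + j) + 3 * n)) (- int (3 * n)) (- int (i + j)) (- int (i + j)) (- int (i + j)) (- int (i + j))"
    by (simp only:)
  also have "\<dots> = six_lines 0 0 0 0 0 0" unfolding six_lines_nat_pow six_lines_add by (simp add: algebra_simps)
  finally have "six_lines (p + int (2 * n) * 2 + int (2 * i + j) - int (2 * (i + j) + 3 * n)) (int (2 * i + j) - int (3 * n))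
      (a + int (2 * n) - int (i + j)) (b + int (2 * n) - int (i + j)) (c + int (2 * n) - int (i + j)) (int (2 * n) - int (i + j)) = \<one>\<^bsub>Inv\<^esub>"
    unfolding six_lines_nat_pow six_lines_add six_lines_0[symmetric] by (simp add: algebra_simps)
  from six_lines_eq_one[OF this] show ?thesis by auto
qed

definition has_class :: "'c poly poly fract set \<Rightarrow> int \<Rightarrow> int \<Rightarrow> int \<Rightarrow> int \<Rightarrow> bool" where
  "has_class I p a b c \<longleftrightarrow> I \<in> carrier Inv \<and> (\<exists>u. u \<noteq> 0 \<and> scale u I = basis_ideal p a b c)"

lemma has_class_mult:
  assumes "has_class I p a b c" "has_class J p' a' b' c'"
  shows "has_class (iprod I J) (p + p') (a + a') (b + b') (c + c')"
proof -
  obtain u where u: "u \<noteq> 0" "scale u I = basis_ideal p a b c" using assms by (auto simp: has_class_def)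
  obtain v where v: "v \<noteq> 0" "scale v J = basis_ideal p' a' b' c'" using assms by (auto simp: has_class_def)
  have "scale (u * v) (iprod I J) = iprod (scale u I) (scale v J)"
    by (simp add: scale_prod1 scale_prod2 scale_scale mult.commute)
  also have "\<dots> = basis_ideal (p + p') (a + a') (b + b') (c + c')" unfolding u v using basis_ideal_add by simp
  finally have "scale (u * v) (iprod I J) = basis_ideal (p + p') (a + a') (b + b') (c + c')" .
  moreover have "iprod I J \<in> carrier Inv" using Inv.m_closed[of I J] assms by (simp add: has_class_def)
  ultimately show ?thesis using u v unfolding has_class_def by (metis mult_eq_0_iff)
qed

text \<open>
  This is used for the two components of a fibre, which is principal as a whole.
\<close>

lemma has_class_partner:
  assumes "has_class I p a b c" "J \<in> carrier Inv" "iprod I J = scale w SS" "w \<noteq> 0"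
  shows "has_class J (- p) (- a) (- b) (- c)"
proof -
  obtain u where u: "u \<noteq> 0" "scale u I = basis_ideal p a b c" and I: "I \<in> carrier Inv" using assms by (auto simp: has_class_def)
  have "iprod (basis_ideal p a b c) (scale (1 / (u * w)) J) = SS"
    unfolding u(2)[symmetric] using u(1) assms(3,4) by (simp add: scale_prod1 scale_prod2 scale_scale)
  moreover have "iprod (basis_ideal p a b c) (basis_ideal (- p) (- a) (- b) (- c)) = SS"
    using basis_ideal_add[of p a b c "- p" "- a" "- b" "- c"] basis_ideal_0 by simp
  moreover have c: "scale (1 / (u * w)) J \<in> carrier Inv" using assms u by auto
  ultimately have "scale (1 / (u * w)) J = basis_ideal (- p) (- a) (- b) (- c)"
    using Inv_cancel[OF basis_ideal_closed c basis_ideal_closed] by metis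
  thus ?thesis using assms u unfolding has_class_def by (intro conjI exI[of _ "1 / (u * w)"]) auto
qed

lemma has_class_basis: "has_class P0 1 0 0 0" "has_class LA 0 1 0 0" "has_class LB 0 0 1 0" "has_class LC 0 0 0 1"
proof -
  have "basis_ideal 1 0 0 0 = P0" "basis_ideal 0 1 0 0 = LA" "basis_ideal 0 0 1 0 = LB" "basis_ideal 0 0 0 1 = LC"
    unfolding basis_ideal_def
    by (simp_all only: int_pow_0 Inv.int_pow_1 Inv.l_one Inv.r_one Inv.one_closed lines_Inv)
  thus "has_class P0 1 0 0 0" "has_class LA 0 1 0 0" "has_class LB 0 0 1 0" "has_class LC 0 0 0 1"
    unfolding has_class_def using lines_Inv by (auto intro!: exI[of _ 1])
qed

lemma has_class_conjugates: "has_class P1 (- 1) 0 0 0" "has_class LA' 0 (- 1) 0 0" "has_class LB' 0 0 (- 1) 0" "has_class LC' 0 0 0 (- 1)"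
  using has_class_partner[OF has_class_basis(1) lines_Inv(2) pairs(1) coord_nz(1)] has_class_partner[OF has_class_basis(2) lines_Inv(6) pairs(3) coord_nz(2)]
    has_class_partner[OF has_class_basis(3) lines_Inv(8) pairs(4) coord_nz(2)] has_class_partner[OF has_class_basis(4) lines_Inv(10) pairs(5) coord_nz(2)]
  by simp_all

text \<open>
  This is the relation \<open>(Q) = P\<^sub>0\<^sup>2 A B C D\<close>.
\<close>

lemma has_class_LD: "has_class LD (- 2) (- 1) (- 1) (- 1)"
proof -
  define I where "I = iprod P0 (iprod P0 (iprod LA (iprod LB LC)))"
  have I: "has_class I 2 1 1 1" unfolding I_def
    using has_class_mult[OF has_class_basis(1) has_class_mult[OF has_class_basis(1) has_class_mult[OF has_class_basis(2) has_class_mult[OF has_class_basis(3,4)]]]] by simp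
  have "iprod I LD = lprod [P0, P0, LA, LB, LC, LD]"
    unfolding I_def using Inv.m_assoc Inv.m_closed lines_Inv by (simp add: iprod_S InvD)
  hence "iprod I LD = scale QQ SS" unfolding rel_Q .
  from has_class_partner[OF I lines_Inv(11) this] show ?thesis by simp
qed

lemma has_class_LD': "has_class LD' 2 1 1 1"
  using has_class_partner[OF has_class_LD lines_Inv(12) pairs(6) coord_nz(2)] by simp

text \<open>
  This is the relation \<open>(hp1) = P\<^sub>0P\<^sub>2CD\<close>.
\<close>

lemma has_class_P2: "has_class P2 1 1 1 0"
proof -
  define I where "I = iprod P0 (iprod LC LD)"
  have I: "has_class I (- 1) (- 1) (- 1) 0" unfolding I_def
    using has_class_mult[OF has_class_basis(1) has_class_mult[OF has_class_basis(4) has_class_LD]] by simp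
  have "iprod I P2 = lprod [P0, P2, LC, LD]"
    unfolding I_def using Inv.m_assoc Inv.m_closed Inv.m_comm lines_Inv Inv.m_lcomm[of P2 LC LD] by (simp add: iprod_S InvD)
  hence "iprod I P2 = scale (phi3 hp1) SS" unfolding rel_h .
  moreover have "phi3 hp1 \<noteq> 0" using hp_nz by auto
  ultimately show ?thesis using has_class_partner[OF I lines_Inv(3)] by simp
qed

lemma has_class_P3: "has_class P3 (- 1) (- 1) (- 1) 0"
  using has_class_partner[OF has_class_P2 lines_Inv(4) pairs(2) coord_nz(1)] by simp

lemma has_class_exists:
  assumes "I \<in> carrier Inv" shows "\<exists>p a b c. has_class I p a b c"
proof -
  obtain u Qs where u: "u \<noteq> 0" "set Qs \<subseteq> {P0, P1, LA, LB, LC, LD}" "scale u I = lprod Qs"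
    using Inv_product_of_lines[OF assms] by blast
  have "\<exists>p a b c. has_class (lprod Qs) p a b c" using u(2)
  proof (induction Qs)
    case Nil
    have "scale 1 SS = basis_ideal 0 0 0 0" unfolding basis_ideal_0 scale_1 Inv_simps ..
    hence "has_class SS 0 0 0 0" unfolding has_class_def using S_Inv zero_neq_one by metis
    thus ?case unfolding lprod_simps by blast
  next
    case (Cons Q Qs)
    have "Q \<in> {P0, P1, LA, LB, LC, LD}" using Cons.prems by simp
    then obtain p a b c where Q: "has_class Q p a b c"
      using has_class_basis has_class_conjugates(1) has_class_LD by (elim insertE emptyE) blast+
    obtain p' a' b' c' where "has_class (lprod Qs) p' a' b' c'" using Cons by auto
    from has_class_mult[OF Q this] show ?case unfolding lprod_simps by blast
  qed
  then obtain p a b c v where v: "v \<noteq> 0" "scale v (scale u I) = basis_ideal p a b c" unfolding u(3)[symmetric] has_class_def by blast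
  have "v * u \<noteq> 0" "scale (v * u) I = basis_ideal p a b c" using u(1) v by (simp_all add: scale_scale)
  thus ?thesis using assms unfolding has_class_def by blast
qed

end

section \<open>The absolute Galois group\<close>

subsection \<open>Partial isomorphisms\<close>

text \<open>
  The graph of an isomorphism between two subrings of a field. Graphs are convenient for Zorn's lemma, where unions of chains
  have to be taken.
\<close>

definition partial_iso :: "('c::field \<times> 'c) set \<Rightarrow> bool" where
  "partial_iso S \<longleftrightarrow> (1, 1) \<in> S \<and>
     (\<forall>x x' y y'. (x, x') \<in> S \<longrightarrow> (y, y') \<in> S \<longrightarrow> (x + y, x' + y') \<in> S \<and> (x * y, x' * y') \<in> S) \<and>
     (\<forall>x x'. (x, x') \<in> S \<longrightarrow> (- x, - x') \<in> S \<and> (x = 0 \<longleftrightarrow> x' = 0))"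

lemma partial_isoI:
  assumes "(1, 1) \<in> S" "\<And>x x' y y'. (x, x') \<in> S \<Longrightarrow> (y, y') \<in> S \<Longrightarrow> (x + y, x' + y') \<in> S"
    "\<And>x x' y y'. (x, x') \<in> S \<Longrightarrow> (y, y') \<in> S \<Longrightarrow> (x * y, x' * y') \<in> S"
    "\<And>x x'. (x, x') \<in> S \<Longrightarrow> (- x, - x') \<in> S" "\<And>x x'. (x, x') \<in> S \<Longrightarrow> x = 0 \<longleftrightarrow> x' = 0"
  shows "partial_iso S"
  using assms unfolding partial_iso_def by blast

lemma partial_isoD:
  assumes "partial_iso S"
  shows "(1, 1) \<in> S" "(x, x') \<in> S \<Longrightarrow> (y, y') \<in> S \<Longrightarrow> (x + y, x' + y') \<in> S"
    "(x, x') \<in> S \<Longrightarrow> (y, y') \<in> S \<Longrightarrow> (x * y, x' * y') \<in> S"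
    "(x, x') \<in> S \<Longrightarrow> (- x, - x') \<in> S" "(x, x') \<in> S \<Longrightarrow> x = 0 \<longleftrightarrow> x' = 0" "(0, 0) \<in> S"
    "(x, x') \<in> S \<Longrightarrow> (y, y') \<in> S \<Longrightarrow> (x - y, x' - y') \<in> S"
    "(x, x') \<in> S \<Longrightarrow> (x, x'') \<in> S \<Longrightarrow> x' = x''"
proof -
  show 1: "(1, 1) \<in> S" using assms by (simp add: partial_iso_def)
  show 2: "(x + y, x' + y') \<in> S" if "(x, x') \<in> S" "(y, y') \<in> S" for x x' y y'
    using assms that unfolding partial_iso_def by blast
  show "(x * y, x' * y') \<in> S" if "(x, x') \<in> S" "(y, y') \<in> S"
    using assms that unfolding partial_iso_def by blast
  show 4: "(- x, - x') \<in> S" if "(x, x') \<in> S" for x x'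
    using assms that unfolding partial_iso_def by blast
  show 5: "x = 0 \<longleftrightarrow> x' = 0" if "(x, x') \<in> S" for x x'
    using assms that unfolding partial_iso_def by blast
  show "(0, 0) \<in> S" using 2[OF 1 4[OF 1]] by simp
  show 7: "(x - y, x' - y') \<in> S" if "(x, x') \<in> S" "(y, y') \<in> S" for x x' y y'
    using 2[OF that(1) 4[OF that(2)]] by simp
  show "x' = x''" if "(x, x') \<in> S" "(x, x'') \<in> S"
    using 5[OF 7[OF that]] by simp
qed

lemma partial_iso_converse: assumes "partial_iso S" shows "partial_iso (S\<inverse>)"
proof (rule partial_isoI)
  show "(1, 1) \<in> S\<inverse>" using partial_isoD(1)[OF assms] by simp
  show "(x + y, x' + y') \<in> S\<inverse>" if "(x, x') \<in> S\<inverse>" "(y, y') \<in> S\<inverse>" for x x' y y'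
    using partial_isoD(2)[OF assms, of x' x y' y] that by simp
  show "(x * y, x' * y') \<in> S\<inverse>" if "(x, x') \<in> S\<inverse>" "(y, y') \<in> S\<inverse>" for x x' y y'
    using partial_isoD(3)[OF assms, of x' x y' y] that by simp
  show "(- x, - x') \<in> S\<inverse>" if "(x, x') \<in> S\<inverse>" for x x'
    using partial_isoD(4)[OF assms, of x' x] that by simp
  show "x = 0 \<longleftrightarrow> x' = 0" if "(x, x') \<in> S\<inverse>" for x x'
    using partial_isoD(5)[OF assms, of x' x] that by simp
qed

text \<open>
  The extension of a partial isomorphism to the fraction fields; a maximal one equals it.
\<close>

definition fractions :: "('c::field \<times> 'c) set \<Rightarrow> ('c \<times> 'c) set" where
  "fractions S = {(x / u, x' / u') | x x' u u'. (x, x') \<in> S \<and> (u, u') \<in> S \<and> u \<noteq> 0}"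

lemma partial_iso_fractions:
  assumes S: "partial_iso S"
  shows "partial_iso (fractions S)" and "S \<subseteq> fractions S"
proof -
  let ?T = "fractions S"
  note D = partial_isoD[OF S]
  have TI: "(x / u, x' / u') \<in> ?T" if "(x, x') \<in> S" "(u, u') \<in> S" "u \<noteq> 0" for x x' u u'
    using that unfolding fractions_def by blast
  show "partial_iso ?T"
  proof (rule partial_isoI)
    show "(1, 1) \<in> ?T" using TI[OF D(1) D(1)] by simp
    fix x x' assume "(x, x') \<in> ?T"
    then obtain a a' u u' where *: "x = a / u" "x' = a' / u'" "(a, a') \<in> S" "(u, u') \<in> S" "u \<noteq> 0"
      unfolding fractions_def by blast
    have u': "u' \<noteq> 0" using D(5)[OF *(4)] *(5) by simp
    show "(- x, - x') \<in> ?T" using TI[OF D(4)[OF *(3)] *(4,5)] * by simp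
    show "x = 0 \<longleftrightarrow> x' = 0" using D(5)[OF *(3)] *(1,2,5) u' by simp
    fix y y' assume "(y, y') \<in> ?T"
    then obtain b b' v v' where **: "y = b / v" "y' = b' / v'" "(b, b') \<in> S" "(v, v') \<in> S" "v \<noteq> 0"
      unfolding fractions_def by blast
    have v': "v' \<noteq> 0" using D(5)[OF **(4)] **(5) by simp
    have "x + y = (a * v + b * u) / (u * v)" "x' + y' = (a' * v' + b' * u') / (u' * v')"
      using * ** u' v' by (simp_all add: add_frac_eq)
    moreover have "(a * v + b * u, a' * v' + b' * u') \<in> S" "(u * v, u' * v') \<in> S" "u * v \<noteq> 0"
      using * ** by (auto intro: D(2,3))
    ultimately show "(x + y, x' + y') \<in> ?T" using TI by metis
    have "x * y = (a * b) / (u * v)" "x' * y' = (a' * b') / (u' * v')" using * ** by simp_all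
    moreover have "(a * b, a' * b') \<in> S" "(u * v, u' * v') \<in> S" "u * v \<noteq> 0"
      using * ** by (auto intro: D(3))
    ultimately show "(x * y, x' * y') \<in> ?T" using TI by metis
  qed
  show "S \<subseteq> ?T"
  proof
    fix z assume "z \<in> S"
    then obtain x x' where "z = (x, x')" "(x, x') \<in> S" by (cases z) auto
    thus "z \<in> ?T" using TI[OF _ D(1), of x x'] by simp
  qed
qed

definition pair_poly :: "('c::field \<times> 'c) set \<Rightarrow> 'c poly \<Rightarrow> 'c poly \<Rightarrow> bool" where
  "pair_poly S p q \<longleftrightarrow> (\<forall>i. (Polynomial.coeff p i, Polynomial.coeff q i) \<in> S)"

definition adjoin :: "('c::field \<times> 'c) set \<Rightarrow> 'c \<Rightarrow> 'c \<Rightarrow> ('c \<times> 'c) set" where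
  "adjoin S \<alpha> \<beta> = {(poly p \<alpha>, poly q \<beta>) | p q. pair_poly S p q}"

context
  fixes S :: "('c::field \<times> 'c) set"
  assumes S: "partial_iso S"
begin

lemma pair_poly_add: "pair_poly S p q \<Longrightarrow> pair_poly S p' q' \<Longrightarrow> pair_poly S (p + p') (q + q')"
  unfolding pair_poly_def coeff_add by (intro allI partial_isoD(2)[OF S]) simp_all

lemma pair_poly_diff: "pair_poly S p q \<Longrightarrow> pair_poly S p' q' \<Longrightarrow> pair_poly S (p - p') (q - q')"
  unfolding pair_poly_def coeff_diff by (intro allI partial_isoD(7)[OF S]) simp_all

lemma pair_poly_uminus: "pair_poly S p q \<Longrightarrow> pair_poly S (- p) (- q)"
  unfolding pair_poly_def coeff_minus by (intro allI partial_isoD(4)[OF S]) simp_all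

lemma partial_iso_sum:
  "(\<And>i. i \<in> A \<Longrightarrow> (f i, g i) \<in> S) \<Longrightarrow> (sum f A, sum g A) \<in> S"
proof (induction A rule: infinite_finite_induct)
  case (insert x A)
  have "(f x, g x) \<in> S" "(sum f A, sum g A) \<in> S" using insert by simp_all
  thus ?case unfolding sum.insert[OF insert(1,2)] by (rule partial_isoD(2)[OF S])
qed (simp_all add: partial_isoD(6)[OF S])

lemma pair_poly_mult: "pair_poly S p q \<Longrightarrow> pair_poly S p' q' \<Longrightarrow> pair_poly S (p * p') (q * q')"
  unfolding pair_poly_def coeff_mult by (intro allI partial_iso_sum partial_isoD(3)[OF S]) simp_all

lemma pair_poly_monom: "(c, c') \<in> S \<Longrightarrow> pair_poly S (Polynomial.monom c n) (Polynomial.monom c' n)"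
  unfolding pair_poly_def coeff_monom by (simp add: partial_isoD(6)[OF S])

lemma pair_poly_const: "(c, c') \<in> S \<Longrightarrow> pair_poly S [:c:] [:c':]"
  using pair_poly_monom[of c c' 0] by (simp add: monom_0)

lemma pair_poly_degree:
  assumes "pair_poly S p q" shows "Polynomial.degree p = Polynomial.degree q" "p = 0 \<longleftrightarrow> q = 0"
proof -
  have *: "Polynomial.coeff p i = 0 \<longleftrightarrow> Polynomial.coeff q i = 0" for i
    by (rule partial_isoD(5)[OF S]) (use assms in \<open>simp add: pair_poly_def\<close>)
  show "p = 0 \<longleftrightarrow> q = 0" using * by (auto simp: poly_eq_iff)
  have "Polynomial.degree p \<le> Polynomial.degree q" by (rule degree_le) (simp add: * coeff_eq_0)
  moreover have "Polynomial.degree q \<le> Polynomial.degree p" by (rule degree_le) (simp add: *[symmetric] coeff_eq_0)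
  ultimately show "Polynomial.degree p = Polynomial.degree q" by simp
qed

text \<open>
  Division with remainder carried out in parallel over both subrings, which are fields by the first assumption.
\<close>

lemma pair_poly_divide:
  assumes inv: "\<And>x x' u u'. (x, x') \<in> S \<Longrightarrow> (u, u') \<in> S \<Longrightarrow> u \<noteq> 0 \<Longrightarrow> (x / u, x' / u') \<in> S"
    and b: "pair_poly S b b'" "b \<noteq> 0"
  shows "pair_poly S a a' \<Longrightarrow> \<exists>d d' r r'. pair_poly S d d' \<and> pair_poly S r r' \<and> a = b * d + r \<and> a' = b' * d' + r' \<and>
     (r = 0 \<or> Polynomial.degree r < Polynomial.degree b)"
proof (induction "Polynomial.degree a" arbitrary: a a' rule: less_induct)
  case less
  have zero: "pair_poly S 0 0" using partial_isoD(6)[OF S] by (simp add: pair_poly_def)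
  show ?case
  proof (cases "a = 0 \<or> Polynomial.degree a < Polynomial.degree b")
    case True
    thus ?thesis using less.prems zero by (intro exI[of _ 0] exI[of _ a] exI[of _ a']) auto
  next
    case False
    define n where "n = Polynomial.degree a - Polynomial.degree b"
    define c where "c = Polynomial.lead_coeff a / Polynomial.lead_coeff b"
    define c' where "c' = Polynomial.lead_coeff a' / Polynomial.lead_coeff b'"
    have deg: "Polynomial.degree a' = Polynomial.degree a" "Polynomial.degree b' = Polynomial.degree b"
      using pair_poly_degree less.prems b by metis+
    have cc: "(c, c') \<in> S" unfolding c_def c'_def deg
      using less.prems b by (intro inv) (auto simp: pair_poly_def)
    define m where "m = Polynomial.monom c n"
    define m' where "m' = Polynomial.monom c' n"
    have m: "pair_poly S m m'" unfolding m_def m'_def by (rule pair_poly_monom[OF cc])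
    have a1: "pair_poly S (a - b * m) (a' - b' * m')" by (intro pair_poly_diff pair_poly_mult less.prems b m)
    have c_nz: "c \<noteq> 0" using False b by (simp add: c_def)
    have "Polynomial.degree (b * m) = Polynomial.degree a"
      using False b c_nz by (simp add: m_def degree_mult_eq degree_monom_eq n_def)
    moreover have "Polynomial.coeff (b * m) (Polynomial.degree a) = Polynomial.lead_coeff a"
    proof -
      have "Polynomial.lead_coeff (b * m) = Polynomial.lead_coeff b * c"
        using c_nz by (simp add: lead_coeff_mult m_def degree_monom_eq)
      thus ?thesis using calculation b by (simp add: c_def)
    qed
    ultimately have small: "a - b * m = 0 \<or> Polynomial.degree (a - b * m) < Polynomial.degree a"
      by (metis coeff_diff degree_diff_le eq_iff_diff_eq_0 leading_coeff_0_iff le_neq_implies_less order_refl)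
    show ?thesis
    proof (cases "a - b * m = 0")
      case True
      hence "a' - b' * m' = 0" using pair_poly_degree(2)[OF a1] by simp
      thus ?thesis using True m zero by (intro exI[of _ m] exI[of _ m'] exI[of _ 0]) auto
    next
      case False
      hence "Polynomial.degree (a - b * m) < Polynomial.degree a" using small by blast
      from less.hyps[OF this a1] obtain d d' r r' where *: "pair_poly S d d'" "pair_poly S r r'"
        "a - b * m = b * d + r" "a' - b' * m' = b' * d' + r'" "r = 0 \<or> Polynomial.degree r < Polynomial.degree b" by blast
      have "a = b * (m + d) + r" "a' = b' * (m' + d') + r'" using *(3,4) by (simp_all add: algebra_simps)
      thus ?thesis using *(1,2,5) pair_poly_add[OF m *(1)] by blast
    qed
  qed
qed

lemma partial_iso_adjoin:
  assumes "\<And>p q. pair_poly S p q \<Longrightarrow> poly p \<alpha> = 0 \<longleftrightarrow> poly q \<beta> = 0"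
  shows "partial_iso (adjoin S \<alpha> \<beta>)" "S \<subseteq> adjoin S \<alpha> \<beta>" "(\<alpha>, \<beta>) \<in> adjoin S \<alpha> \<beta>"
proof -
  let ?T = "adjoin S \<alpha> \<beta>"
  have TI: "(poly p \<alpha>, poly q \<beta>) \<in> ?T" if "pair_poly S p q" for p q using that unfolding adjoin_def by blast
  have one: "pair_poly S 1 1" using pair_poly_const[OF partial_isoD(1)[OF S]] by (simp add: one_pCons)
  show "partial_iso ?T"
  proof (rule partial_isoI)
    show "(1, 1) \<in> ?T" using TI[OF one] by simp
    fix x x' assume "(x, x') \<in> ?T"
    then obtain p q where *: "x = poly p \<alpha>" "x' = poly q \<beta>" "pair_poly S p q" unfolding adjoin_def by blast
    show "(- x, - x') \<in> ?T" using TI[OF pair_poly_uminus[OF *(3)]] * by simp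
    show "x = 0 \<longleftrightarrow> x' = 0" using assms[OF *(3)] * by simp
    fix y y' assume "(y, y') \<in> ?T"
    then obtain p' q' where **: "y = poly p' \<alpha>" "y' = poly q' \<beta>" "pair_poly S p' q'" unfolding adjoin_def by blast
    show "(x + y, x' + y') \<in> ?T" using TI[OF pair_poly_add[OF *(3) **(3)]] * ** by simp
    show "(x * y, x' * y') \<in> ?T" using TI[OF pair_poly_mult[OF *(3) **(3)]] * ** by simp
  qed
  show "S \<subseteq> ?T"
  proof
    fix z assume "z \<in> S"
    then obtain x x' where "z = (x, x')" "(x, x') \<in> S" by (cases z) auto
    thus "z \<in> ?T" using TI[OF pair_poly_const, of x x'] by simp
  qed
  show "(\<alpha>, \<beta>) \<in> ?T"
    using TI[OF pair_poly_monom[OF partial_isoD(1)[OF S], of 1]] by (simp add: poly_monom)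
qed

end

text \<open>
  The image of \<open>\<alpha>\<close> is a root of the polynomial corresponding to the minimal polynomial of
  \<open>\<alpha>\<close>; division with remainder shows that this polynomial is minimal for the root.
\<close>

lemma partial_iso_extend:
  fixes S :: "('c::alg_closed_field \<times> 'c) set"
  assumes S: "partial_iso S"
    and inv: "\<And>x x' u u'. (x, x') \<in> S \<Longrightarrow> (u, u') \<in> S \<Longrightarrow> u \<noteq> 0 \<Longrightarrow> (x / u, x' / u') \<in> S"
    and alg: "pair_poly S p0 q0" "p0 \<noteq> 0" "poly p0 \<alpha> = 0"
  shows "\<exists>T \<beta>. partial_iso T \<and> S \<subseteq> T \<and> (\<alpha>, \<beta>) \<in> T"
proof -
  define A where "A = {Polynomial.degree p | p q. pair_poly S p q \<and> p \<noteq> 0 \<and> poly p \<alpha> = 0}"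
  have "A \<noteq> {}" using alg unfolding A_def by blast
  hence "(LEAST n. n \<in> A) \<in> A" by (metis LeastI ex_in_conv)
  then obtain p q where p: "pair_poly S p q" "p \<noteq> 0" "poly p \<alpha> = 0" "Polynomial.degree p = (LEAST n. n \<in> A)"
    unfolding A_def by force
  have min: "Polynomial.degree p \<le> Polynomial.degree r" if "pair_poly S r r'" "r \<noteq> 0" "poly r \<alpha> = 0" for r r'
    unfolding p(4) by (rule Least_le) (use that in \<open>auto simp: A_def\<close>)
  have dq: "Polynomial.degree q = Polynomial.degree p" "q \<noteq> 0" using pair_poly_degree[OF S p(1)] p(2) by auto
  have "Polynomial.degree p > 0"
  proof (rule ccontr)
    assume "\<not> ?thesis"
    then obtain c where "p = [:c:]" by (metis degree_eq_zeroE neq0_conv)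
    thus False using p by simp
  qed
  then obtain \<beta> where \<beta>: "poly q \<beta> = 0" using alg_closed_imp_poly_has_root[of q] dq by auto
  have small1: "r = 0" if "pair_poly S r r'" "poly r \<alpha> = 0" "r = 0 \<or> Polynomial.degree r < Polynomial.degree p" for r r'
    using min[OF that(1) _ that(2)] that(3) by linarith
  have small2: "r = 0" if "pair_poly S r r'" "poly r' \<beta> = 0" "r = 0 \<or> Polynomial.degree r < Polynomial.degree p" for r r'
    using that
  proof (induction "Polynomial.degree r" arbitrary: r r' rule: less_induct)
    case less
    show ?case
    proof (rule ccontr)
      assume r: "r \<noteq> 0"
      obtain d d' e e' where *: "pair_poly S d d'" "pair_poly S e e'" "p = r * d + e" "q = r' * d' + e'"
        "e = 0 \<or> Polynomial.degree e < Polynomial.degree r"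
        using pair_poly_divide[OF S inv less.prems(1) r p(1)] by blast
      have "poly e' \<beta> = 0" using \<beta> *(4) less.prems(2) by simp
      hence "e = 0" using less.hyps[of e e'] *(2,5) less.prems(3) r by force
      hence pd: "p = r * d" using *(3) by simp
      have d: "d \<noteq> 0" using pd p(2) by auto
      have "Polynomial.degree p = Polynomial.degree r + Polynomial.degree d" using pd r d by (simp add: degree_mult_eq)
      moreover have "Polynomial.degree r > 0"
      proof (rule ccontr)
        assume "\<not> ?thesis"
        hence "Polynomial.degree r' = 0" using pair_poly_degree(1)[OF S less.prems(1)] by simp
        then obtain c where "r' = [:c:]" by (metis degree_eq_zeroE)
        thus False using less.prems(1,2) r pair_poly_degree(2)[OF S less.prems(1)] by simp
      qed
      ultimately have "Polynomial.degree d < Polynomial.degree p" by simp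
      moreover have "poly r \<alpha> = 0 \<or> poly d \<alpha> = 0" using p(3) pd by simp
      ultimately show False using small1[OF less.prems(1)] small1[OF *(1)] r d less.prems(3) by blast
    qed
  qed
  have "poly a \<alpha> = 0 \<longleftrightarrow> poly a' \<beta> = 0" if a: "pair_poly S a a'" for a a'
  proof -
    obtain d d' r r' where *: "pair_poly S d d'" "pair_poly S r r'" "a = p * d + r" "a' = q * d' + r'"
      "r = 0 \<or> Polynomial.degree r < Polynomial.degree p"
      using pair_poly_divide[OF S inv p(1,2) a] by blast
    have "poly a \<alpha> = poly r \<alpha>" "poly a' \<beta> = poly r' \<beta>" using * p(3) \<beta> by simp_all
    moreover have "poly r \<alpha> = 0 \<longleftrightarrow> r = 0" using small1[OF *(2) _ *(5)] by auto
    moreover have "poly r' \<beta> = 0 \<longleftrightarrow> r = 0" using small2[OF *(2) _ *(5)] pair_poly_degree(2)[OF S *(2)] by auto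
    ultimately show ?thesis by simp
  qed
  from partial_iso_adjoin[OF S this] show ?thesis by blast
qed

text \<open>
  A quadratic extension is done by hand: unlike in \<open>partial_iso_extend\<close>, the image of the square root is
  prescribed.
\<close>

definition adjoin_sqrt :: "('c::field \<times> 'c) set \<Rightarrow> 'c \<Rightarrow> 'c \<Rightarrow> ('c \<times> 'c) set" where
  "adjoin_sqrt S \<alpha> \<beta> = {(x + u * \<alpha>, x' + u' * \<beta>) | x x' u u'. (x, x') \<in> S \<and> (u, u') \<in> S}"

lemma partial_iso_adjoin_sqrt:
  assumes S: "partial_iso S" and sq: "(\<alpha>^2, \<beta>^2) \<in> S"
    and ind: "\<And>x x' u u'. (x, x') \<in> S \<Longrightarrow> (u, u') \<in> S \<Longrightarrow> x + u * \<alpha> = 0 \<Longrightarrow> u = 0"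
    and ind': "\<And>x x' u u'. (x, x') \<in> S \<Longrightarrow> (u, u') \<in> S \<Longrightarrow> x' + u' * \<beta> = 0 \<Longrightarrow> u = 0"
  shows "partial_iso (adjoin_sqrt S \<alpha> \<beta>)" "S \<subseteq> adjoin_sqrt S \<alpha> \<beta>" "(\<alpha>, \<beta>) \<in> adjoin_sqrt S \<alpha> \<beta>"
proof -
  let ?T = "adjoin_sqrt S \<alpha> \<beta>"
  note D = partial_isoD[OF S]
  have TI: "(x + u * \<alpha>, x' + u' * \<beta>) \<in> ?T" if "(x, x') \<in> S" "(u, u') \<in> S" for x x' u u'
    using that unfolding adjoin_sqrt_def by blast
  show "partial_iso ?T"
  proof (rule partial_isoI)
    show "(1, 1) \<in> ?T" using TI[OF D(1) D(6)] by simp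
    fix x x' assume "(x, x') \<in> ?T"
    then obtain a a' u u' where *: "x = a + u * \<alpha>" "x' = a' + u' * \<beta>" "(a, a') \<in> S" "(u, u') \<in> S"
      unfolding adjoin_sqrt_def by blast
    show "(- x, - x') \<in> ?T" using TI[OF D(4)[OF *(3)] D(4)[OF *(4)]] * by simp
    show "x = 0 \<longleftrightarrow> x' = 0"
    proof
      assume "x = 0"
      hence "u = 0" using ind[OF *(3,4)] *(1) by simp
      thus "x' = 0" using * \<open>x = 0\<close> D(5)[OF *(3)] D(5)[OF *(4)] by simp
    next
      assume "x' = 0"
      hence "u = 0" using ind'[OF *(3,4)] *(2) by simp
      thus "x = 0" using * \<open>x' = 0\<close> D(5)[OF *(3)] D(5)[OF *(4)] by simp
    qed
    fix y y' assume "(y, y') \<in> ?T"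
    then obtain b b' v v' where **: "y = b + v * \<alpha>" "y' = b' + v' * \<beta>" "(b, b') \<in> S" "(v, v') \<in> S"
      unfolding adjoin_sqrt_def by blast
    have "x + y = (a + b) + (u + v) * \<alpha>" "x' + y' = (a' + b') + (u' + v') * \<beta>" using * ** by (simp_all add: algebra_simps)
    thus "(x + y, x' + y') \<in> ?T" using TI[OF D(2)[OF *(3) **(3)] D(2)[OF *(4) **(4)]] by simp
    have "x * y = (a * b + u * v * \<alpha>^2) + (a * v + u * b) * \<alpha>" "x' * y' = (a' * b' + u' * v' * \<beta>^2) + (a' * v' + u' * b') * \<beta>"
      using * ** by (simp_all add: algebra_simps power2_eq_square)
    thus "(x * y, x' * y') \<in> ?T"
      using TI[OF D(2)[OF D(3)[OF *(3) **(3)] D(3)[OF D(3)[OF *(4) **(4)] sq]] D(2)[OF D(3)[OF *(3) **(4)] D(3)[OF *(4) **(3)]]] by simp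
  qed
  show "S \<subseteq> ?T"
  proof
    fix z assume "z \<in> S"
    then obtain x x' where "z = (x, x')" "(x, x') \<in> S" by (cases z) auto
    thus "z \<in> ?T" using TI[OF _ D(6), of x x'] by simp
  qed
  show "(\<alpha>, \<beta>) \<in> ?T" using TI[OF D(6) D(1)] by simp
qed

subsection \<open>Extension of partial isomorphisms\<close>

lemma absolute_galois_group_iff:
  "\<sigma> \<in> carrier absolute_galois_group \<longleftrightarrow>
     bij \<sigma> \<and> (\<forall>x y. \<sigma> (x + y) = \<sigma> x + \<sigma> y) \<and> (\<forall>x y. \<sigma> (x * y) = \<sigma> x * \<sigma> y) \<and> \<sigma> 1 = 1 \<and> (\<forall>c. \<sigma> (to_ac c) = to_ac c)"
  by (auto simp: absolute_galois_group_def ring_iso_def ring_hom_def ring_of_type_algebra_def)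

definition base_iso :: "('k::field alg_closure \<times> 'k alg_closure) set" where
  "base_iso = {(to_ac c, to_ac c) | c. True}"

lemma partial_iso_base: "partial_iso (base_iso :: ('k::field alg_closure \<times> 'k alg_closure) set)"
proof (rule partial_isoI)
  have I: "(to_ac c, to_ac c) \<in> base_iso" for c :: 'k unfolding base_iso_def by blast
  show "(1 :: 'k alg_closure, 1) \<in> base_iso" using I[of 1] by simp
  fix x x' :: "'k alg_closure" assume "(x, x') \<in> base_iso"
  then obtain c where c: "x = to_ac c" "x' = to_ac c" unfolding base_iso_def by blast
  show "(- x, - x') \<in> base_iso" using I[of "- c"] c by simp
  show "x = 0 \<longleftrightarrow> x' = 0" using c by simp
  fix y y' :: "'k alg_closure" assume "(y, y') \<in> base_iso"
  then obtain d where d: "y = to_ac d" "y' = to_ac d" unfolding base_iso_def by blast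
  show "(x + y, x' + y') \<in> base_iso" using I[of "c + d"] c d by simp
  show "(x * y, x' * y') \<in> base_iso" using I[of "c * d"] c d by simp
qed

text \<open>
  Zorn's lemma gives a maximal extension. Its domain and its range are subfields over which everything is algebraic, so both
  are the whole field; for the range the extension step is applied to the converse.
\<close>

lemma extend_to_automorphism:
  fixes S :: "('k::field alg_closure \<times> 'k alg_closure) set"
  assumes S: "partial_iso S" "base_iso \<subseteq> S"
  shows "\<exists>\<sigma>\<in>carrier absolute_galois_group. \<forall>(x, y)\<in>S. \<sigma> x = y"
proof -
  define A where "A = {T. partial_iso T \<and> S \<subseteq> T}"
  have "\<exists>M\<in>A. \<forall>T\<in>A. M \<subseteq> T \<longrightarrow> T = M"
  proof (rule subset_Zorn_nonempty)
    show "A \<noteq> {}" using S unfolding A_def by blast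
    fix C assume C: "C \<noteq> {}" "subset.chain A C"
    have CA: "T \<in> C \<Longrightarrow> partial_iso T \<and> S \<subseteq> T" for T using C(2) unfolding subset_chain_def A_def by auto
    have two: "\<exists>T\<in>C. u \<in> T \<and> v \<in> T" if uv: "u \<in> \<Union>C" "v \<in> \<Union>C" for u v
    proof -
      obtain T1 T2 where T: "T1 \<in> C" "u \<in> T1" "T2 \<in> C" "v \<in> T2" using uv by blast
      hence "T1 \<subseteq> T2 \<or> T2 \<subseteq> T1" using C(2) unfolding subset_chain_def by blast
      thus ?thesis using T by blast
    qed
    have "partial_iso (\<Union>C)"
    proof (rule partial_isoI)
      obtain T where T: "T \<in> C" using C(1) by blast
      thus "(1, 1) \<in> \<Union>C" using partial_isoD(1) CA by blast
      fix x x' assume x: "(x, x') \<in> \<Union>C"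
      then obtain T where T: "T \<in> C" "(x, x') \<in> T" by blast
      show "(- x, - x') \<in> \<Union>C" using partial_isoD(4) CA T by blast
      show "x = 0 \<longleftrightarrow> x' = 0" using partial_isoD(5)[OF _ T(2)] CA[OF T(1)] by blast
      fix y y' assume y: "(y, y') \<in> \<Union>C"
      obtain T where T: "T \<in> C" "(x, x') \<in> T" "(y, y') \<in> T" using two[OF x y] by blast
      show "(x + y, x' + y') \<in> \<Union>C" using partial_isoD(2)[OF _ T(2,3)] CA[OF T(1)] T(1) by blast
      show "(x * y, x' * y') \<in> \<Union>C" using partial_isoD(3)[OF _ T(2,3)] CA[OF T(1)] T(1) by blast
    qed
    moreover have "S \<subseteq> \<Union>C" using C(1) CA by blast
    ultimately show "\<Union>C \<in> A" unfolding A_def by blast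
  qed
  then obtain M where M: "partial_iso M" "S \<subseteq> M" and max: "\<And>T. partial_iso T \<Longrightarrow> M \<subseteq> T \<Longrightarrow> T = M"
    unfolding A_def by (metis (mono_tags, lifting) mem_Collect_eq order_trans)
  have inv: "(x / u, x' / u') \<in> M" if "(x, x') \<in> M" "(u, u') \<in> M" "u \<noteq> 0" for x x' u u'
    using max[OF partial_iso_fractions[OF M(1)]] that unfolding fractions_def by blast
  have alg: "\<exists>p. pair_poly M p p \<and> p \<noteq> 0 \<and> poly p \<alpha> = 0" for \<alpha>
  proof -
    obtain p where p: "p \<noteq> 0" "poly (map_poly to_ac p) \<alpha> = 0" by (rule alg_closure_algebraic)
    have "pair_poly M (map_poly to_ac p) (map_poly to_ac p)"
      using S(2) M(2) unfolding pair_poly_def base_iso_def by (auto simp: coeff_map_poly)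
    moreover have "map_poly to_ac p \<noteq> 0" using p(1) by (simp add: map_poly_eq_0_iff)
    ultimately show ?thesis using p(2) by blast
  qed
  have dom: "\<exists>\<beta>. (\<alpha>, \<beta>) \<in> M" for \<alpha>
  proof -
    obtain p where p: "pair_poly M p p" "p \<noteq> 0" "poly p \<alpha> = 0" using alg by blast
    obtain T \<beta> where "partial_iso T" "M \<subseteq> T" "(\<alpha>, \<beta>) \<in> T"
      using partial_iso_extend[OF M(1) inv p] by blast
    thus ?thesis using max by blast
  qed
  have ran: "\<exists>\<alpha>. (\<alpha>, \<beta>) \<in> M" for \<beta>
  proof -
    obtain p where p: "pair_poly M p p" "p \<noteq> 0" "poly p \<beta> = 0" using alg by blast
    have p': "pair_poly (M\<inverse>) p p" using p(1) by (simp add: pair_poly_def)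
    have inv': "(x / u, x' / u') \<in> M\<inverse>" if "(x, x') \<in> M\<inverse>" "(u, u') \<in> M\<inverse>" "u \<noteq> 0" for x x' u u'
      using inv[of x' x u' u] that partial_isoD(5)[OF M(1), of u' u] by simp
    obtain T \<alpha> where T: "partial_iso T" "M\<inverse> \<subseteq> T" "(\<beta>, \<alpha>) \<in> T"
      using partial_iso_extend[OF partial_iso_converse[OF M(1)] inv' p' p(2,3)] by blast
    have "T\<inverse> = M" using T by (intro max partial_iso_converse) auto
    thus ?thesis using T(3) by blast
  qed
  define \<tau> where "\<tau> x = (SOME y. (x, y) \<in> M)" for x
  have \<tau>: "(x, \<tau> x) \<in> M" for x unfolding \<tau>_def using someI_ex[OF dom] .
  have \<tau>_eq: "\<tau> x = y" if "(x, y) \<in> M" for x y using partial_isoD(8)[OF M(1) \<tau> that] .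
  have "bij \<tau>"
  proof (rule bijI)
    show "inj \<tau>"
    proof (rule injI)
      fix x y assume "\<tau> x = \<tau> y"
      hence "(x - y, 0) \<in> M" using partial_isoD(7)[OF M(1) \<tau> \<tau>, of x y] by simp
      thus "x = y" using partial_isoD(5)[OF M(1)] by fastforce
    qed
    show "surj \<tau>" using ran \<tau>_eq by (metis surjI surj_def)
  qed
  moreover have "\<tau> (x + y) = \<tau> x + \<tau> y" for x y by (rule \<tau>_eq[OF partial_isoD(2)[OF M(1) \<tau> \<tau>]])
  moreover have "\<tau> (x * y) = \<tau> x * \<tau> y" for x y by (rule \<tau>_eq[OF partial_isoD(3)[OF M(1) \<tau> \<tau>]])
  moreover have "\<tau> 1 = 1" by (rule \<tau>_eq[OF partial_isoD(1)[OF M(1)]])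
  moreover have "\<tau> (to_ac c) = to_ac c" for c
    using S(2) M(2) unfolding base_iso_def by (intro \<tau>_eq) blast
  ultimately have "\<tau> \<in> carrier absolute_galois_group" unfolding absolute_galois_group_iff by blast
  moreover have "\<forall>(x, y)\<in>S. \<tau> x = y" using \<tau>_eq M(2) by auto
  ultimately show ?thesis by blast
qed

subsection \<open>Group structure and topology\<close>

lemma galois_auto:
  assumes "\<sigma> \<in> carrier absolute_galois_group"
  shows "bij \<sigma>" "\<sigma> (x + y) = \<sigma> x + \<sigma> y" "\<sigma> (x * y) = \<sigma> x * \<sigma> y" "\<sigma> 1 = 1" "\<sigma> 0 = 0"
    "\<sigma> (to_ac c) = to_ac c" "\<sigma> (- x) = - \<sigma> x" "\<sigma> (x - y) = \<sigma> x - \<sigma> y"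
proof -
  have 1: "bij \<sigma> \<and> (\<forall>x y. \<sigma> (x + y) = \<sigma> x + \<sigma> y) \<and> (\<forall>x y. \<sigma> (x * y) = \<sigma> x * \<sigma> y) \<and> \<sigma> 1 = 1
    \<and> (\<forall>c. \<sigma> (to_ac c) = to_ac c)"
    using assms unfolding absolute_galois_group_iff .
  show "bij \<sigma>" "\<sigma> (x * y) = \<sigma> x * \<sigma> y" "\<sigma> 1 = 1" "\<sigma> (to_ac c) = to_ac c" using 1 by blast+
  show add: "\<sigma> (x + y) = \<sigma> x + \<sigma> y" for x y using 1 by blast
  show zero: "\<sigma> 0 = 0" using add[of 0 0] by (metis add_0_left add_cancel_right_right)
  show neg: "\<sigma> (- x) = - \<sigma> x" for x using add[of x "- x"] zero by (simp add: eq_neg_iff_add_eq_0 add.commute)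
  show "\<sigma> (x - y) = \<sigma> x - \<sigma> y" using add[of x "- y"] neg by simp
qed

lemma galois_simps [simp]: "monoid.mult absolute_galois_group = (\<circ>)" "\<one>\<^bsub>absolute_galois_group\<^esub> = id"
  by (simp_all add: absolute_galois_group_def)

lemma galois_inv:
  assumes \<sigma>: "\<sigma> \<in> carrier absolute_galois_group"
  shows "inv_into UNIV \<sigma> \<in> carrier absolute_galois_group"
proof -
  note g = galois_auto[OF \<sigma>]
  have inj: "inj \<sigma>" and surj: "surj \<sigma>" using g(1) by (auto simp: bij_def)
  have *: "inv_into UNIV \<sigma> y = x" if "\<sigma> x = y" for x y using inv_f_f[OF inj] that by blast
  have e: "\<sigma> (inv_into UNIV \<sigma> x) = x" for x by (rule surj_f_inv_f[OF surj])
  show ?thesis unfolding absolute_galois_group_iff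
    by (intro conjI allI bij_imp_bij_inv g(1) *) (simp_all add: g e)
qed

lemma absolute_galois_group: "group absolute_galois_group"
proof (rule groupI)
  fix \<sigma> \<tau> :: "'a alg_closure \<Rightarrow> 'a alg_closure"
  assume \<sigma>: "\<sigma> \<in> carrier absolute_galois_group"
  show "\<exists>\<tau>\<in>carrier absolute_galois_group. \<tau> \<otimes>\<^bsub>absolute_galois_group\<^esub> \<sigma> = \<one>\<^bsub>absolute_galois_group\<^esub>"
    using galois_inv[OF \<sigma>] galois_auto(1)[OF \<sigma>] by (intro bexI[of _ "inv_into UNIV \<sigma>"]) (auto simp: bij_def)
  assume \<tau>: "\<tau> \<in> carrier absolute_galois_group"
  show "\<sigma> \<otimes>\<^bsub>absolute_galois_group\<^esub> \<tau> \<in> carrier absolute_galois_group"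
    unfolding absolute_galois_group_iff galois_simps
    by (intro conjI bij_comp galois_auto(1) \<sigma> \<tau>) (simp_all add: galois_auto[OF \<sigma>] galois_auto[OF \<tau>])
qed (auto simp: absolute_galois_group_iff)

lemma galois_pow: "\<sigma> [^]\<^bsub>absolute_galois_group\<^esub> (n :: nat) = \<sigma> ^^ n"
proof (induction n)
  case (Suc n)
  have "\<sigma> [^]\<^bsub>absolute_galois_group\<^esub> Suc n = (\<sigma> [^]\<^bsub>absolute_galois_group\<^esub> n) \<circ> \<sigma>"
    by (simp add: nat_pow_def)
  thus ?case using Suc by (simp add: funpow_Suc_right del: funpow.simps)
qed (simp add: nat_pow_def)

lemma krull_basic_open:
  assumes "\<sigma> \<in> carrier absolute_galois_group" "finite F"
  shows "openin krull_topology {\<tau> \<in> carrier absolute_galois_group. \<forall>x\<in>F. \<tau> x = \<sigma> x}"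
  unfolding krull_topology_def by (rule topology_generated_by_Basis) (use assms in blast)

lemma topspace_krull: "topspace krull_topology = carrier absolute_galois_group"
proof -
  have "\<sigma> \<in> topspace krull_topology" if "\<sigma> \<in> carrier absolute_galois_group" for \<sigma> :: "'a alg_closure \<Rightarrow> 'a alg_closure"
    using openin_subset[OF krull_basic_open[OF that, of "{}"]] that by blast
  moreover have "topspace krull_topology \<subseteq> carrier absolute_galois_group"
    unfolding krull_topology_def topology_generated_by_topspace by blast
  ultimately show ?thesis by blast
qed

text \<open>
  The cosets of the pointwise stabilisers of finite sets are not only a subbasis but a basis.
\<close>

lemma krull_neighbourhood:
  assumes "openin krull_topology U" "\<sigma> \<in> U"
  shows "\<exists>F. finite F \<and> {\<tau> \<in> carrier absolute_galois_group. \<forall>x\<in>F. \<tau> x = \<sigma> x} \<subseteq> U"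
proof -
  have "generate_topology_on {{\<tau> \<in> carrier absolute_galois_group. \<forall>x\<in>F. \<tau> x = \<sigma> x} | \<sigma> F.
       \<sigma> \<in> carrier absolute_galois_group \<and> finite F} U"
    using assms(1) unfolding krull_topology_def by (rule openin_topology_generated_by)
  thus ?thesis using assms(2)
  proof (induction rule: generate_topology_on.induct)
    case (Int A B)
    then obtain F1 F2 where F: "finite F1" "{\<tau> \<in> carrier absolute_galois_group. \<forall>x\<in>F1. \<tau> x = \<sigma> x} \<subseteq> A"
      "finite F2" "{\<tau> \<in> carrier absolute_galois_group. \<forall>x\<in>F2. \<tau> x = \<sigma> x} \<subseteq> B" by blast
    hence "{\<tau> \<in> carrier absolute_galois_group. \<forall>x\<in>F1 \<union> F2. \<tau> x = \<sigma> x} \<subseteq> A \<inter> B" by blast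
    thus ?case using F(1,3) by (meson finite_UnI)
  next
    case (UN K)
    then obtain k where k: "k \<in> K" "\<sigma> \<in> k" by blast
    from UN.IH[OF this] obtain F where "finite F" "{\<tau> \<in> carrier absolute_galois_group. \<forall>x\<in>F. \<tau> x = \<sigma> x} \<subseteq> k" by blast
    thus ?case using k(1) by (meson Union_upper order_trans)
  next
    case (Basis s)
    then obtain \<sigma>' F where F: "s = {\<tau> \<in> carrier absolute_galois_group. \<forall>x\<in>F. \<tau> x = \<sigma>' x}" "finite F" by blast
    have "\<forall>x\<in>F. \<sigma>' x = \<sigma> x" using Basis(2) unfolding F(1) by simp
    thus ?case using F by (intro exI[of _ F]) auto
  qed simp
qed

text \<open>
  All images \<open>\<sigma>\<^sup>n x\<close> are roots of one polynomial over the base field.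
\<close>

lemma galois_periodic:
  assumes \<sigma>: "\<sigma> \<in> carrier absolute_galois_group"
  shows "\<exists>n\<ge>1. (\<sigma> ^^ n) x = x"
proof -
  obtain p where p: "p \<noteq> 0" "poly (map_poly to_ac p) x = 0" by (rule alg_closure_algebraic)
  define q where "q = map_poly to_ac p"
  have q0: "q \<noteq> 0" using p(1) by (simp add: q_def map_poly_eq_0_iff)
  note g = galois_auto[OF \<sigma>]
  have pow: "\<sigma> (y ^ n) = \<sigma> y ^ n" for y n by (induction n) (simp_all add: g)
  have sum: "\<sigma> (\<Sum>i\<in>A. f i) = (\<Sum>i\<in>A. \<sigma> (f i))" for f and A :: "nat set"
    by (induction A rule: infinite_finite_induct) (simp_all add: g)
  have step: "poly q (\<sigma> y) = \<sigma> (poly q y)" for y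
    by (simp add: poly_altdef q_def coeff_map_poly sum pow g)
  have "poly q ((\<sigma> ^^ n) x) = 0" for n
    by (induction n) (use p(2) in \<open>simp_all add: step g flip: q_def\<close>)
  hence "range (\<lambda>n. (\<sigma> ^^ n) x) \<subseteq> {y. poly q y = 0}" by blast
  hence "finite (range (\<lambda>n. (\<sigma> ^^ n) x))" using poly_roots_finite[OF q0] finite_subset by blast
  hence "\<not> inj (\<lambda>n. (\<sigma> ^^ n) x)" using finite_imageD infinite_UNIV_nat by blast
  then obtain i j where ij: "(\<sigma> ^^ i) x = (\<sigma> ^^ j) x" "i < j" by (metis injI linorder_neqE_nat)
  have "(\<sigma> ^^ i) ((\<sigma> ^^ (j - i)) x) = (\<sigma> ^^ i) x"
    using ij by (simp flip: funpow_add comp_apply[of "\<sigma> ^^ i" "\<sigma> ^^ (j - i)"])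
  moreover have "inj (\<sigma> ^^ i)" using g(1) by (intro inj_fn) (simp add: bij_def)
  ultimately have "(\<sigma> ^^ (j - i)) x = x" by (meson injD)
  thus ?thesis using ij(2) by (intro exI[of _ "j - i"]) simp
qed

text \<open>
  The group is profinite: some power of an element lies in a given neighbourhood of the identity. The exponent is a product
  of the orbit lengths.
\<close>

lemma galois_torsion:
  assumes \<sigma>: "\<sigma> \<in> carrier absolute_galois_group" and F: "finite F"
  shows "\<exists>n\<ge>1. \<forall>x\<in>F. (\<sigma> ^^ n) x = x"
  using F
proof (induction F)
  case (insert x F)
  then obtain n where n: "n \<ge> 1" "\<forall>x\<in>F. (\<sigma> ^^ n) x = x" by blast
  obtain k where k: "k \<ge> 1" "(\<sigma> ^^ k) x = x" using galois_periodic[OF \<sigma>] by blast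
  have fixed: "(f ^^ i) y = y" if "f y = y" for f :: "'a alg_closure \<Rightarrow> 'a alg_closure" and y i
    by (induction i) (simp_all add: that)
  have "(\<sigma> ^^ (n * k)) y = y" if "y \<in> insert x F" for y
  proof (cases "y = x")
    case True
    have "((\<sigma> ^^ k) ^^ n) x = x" by (rule fixed) (rule k(2))
    thus ?thesis using True by (simp add: funpow_mult mult.commute)
  next
    case False
    have "((\<sigma> ^^ n) ^^ k) y = y" by (rule fixed) (use n(2) that False in blast)
    thus ?thesis by (simp add: funpow_mult mult.commute)
  qed
  moreover have "n * k \<ge> 1" using n(1) k(1) by simp
  ultimately show ?case by blast
qed auto

subsection \<open>A biquadratic extension\<close>

lemma sqrt_independent:
  fixes a c d :: "'k::field"
  assumes "\<nexists>b. a = b^2" "\<alpha>^2 = to_ac a" "to_ac c + to_ac d * \<alpha> = 0"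
  shows "c = 0 \<and> d = 0"
proof (cases "d = 0")
  case True thus ?thesis using assms(3) by simp
next
  case False
  have "\<alpha> = to_ac (- c / d)" using assms(3) False by (simp add: field_simps eq_neg_iff_add_eq_0)
  hence "to_ac a = to_ac ((- c / d)^2)" using assms(2) by (metis to_ac_power)
  hence "a = (- c / d)^2" by (simp only: to_ac_eq_iff)
  thus ?thesis using assms(1) by blast
qed

text \<open>
  If \<open>\<beta> = \<surd>m\<close> were in the field generated by \<open>\<alpha> = \<surd>a\<close>, say
  \<open>\<beta> = e + f\<alpha>\<close>, then \<open>2ef = 0\<close>, so \<open>m = e\<^sup>2\<close> or
  \<open>am = (fa)\<^sup>2\<close>.
\<close>

lemma biquadratic_independent:
  fixes a m :: "'k::field_char_0"
  assumes a: "\<nexists>b. a = b^2" and m: "\<nexists>b. m = b^2" and am: "\<nexists>b. a * m = b^2"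
    and \<alpha>: "\<alpha>^2 = to_ac a" and \<beta>: "\<beta>^2 = to_ac m"
    and eq: "to_ac c1 + to_ac d1 * \<alpha> + (to_ac c2 + to_ac d2 * \<alpha>) * \<beta> = 0"
  shows "to_ac c2 + to_ac d2 * \<alpha> = 0"
proof (rule ccontr)
  assume w: "\<not> ?thesis"
  define N where "N = c2^2 - d2^2 * a"
  have \<alpha>2: "\<alpha> * \<alpha> = to_ac a" using \<alpha> by (simp add: power2_eq_square)
  have N: "N \<noteq> 0"
  proof
    assume "N = 0"
    hence 1: "c2^2 = d2^2 * a" by (simp add: N_def)
    show False
    proof (cases "d2 = 0")
      case True thus ?thesis using 1 w by simp
    next
      case False
      hence "a = (c2 / d2)^2" using 1 by (simp add: power_divide)
      thus ?thesis using a by blast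
    qed
  qed
  define e where "e = - (c1 * c2 - d1 * d2 * a) / N"
  define f where "f = - (d1 * c2 - c1 * d2) / N"
  have "0 = (to_ac c1 + to_ac d1 * \<alpha> + (to_ac c2 + to_ac d2 * \<alpha>) * \<beta>) * (to_ac c2 - to_ac d2 * \<alpha>)"
    using eq by simp
  also have "\<dots> = to_ac c1 * to_ac c2 - to_ac d1 * to_ac d2 * (\<alpha> * \<alpha>) + (to_ac d1 * to_ac c2 - to_ac c1 * to_ac d2) * \<alpha>
      + (to_ac c2 * to_ac c2 - to_ac d2 * to_ac d2 * (\<alpha> * \<alpha>)) * \<beta>" by (simp add: algebra_simps)
  also have "\<dots> = to_ac (c1 * c2 - d1 * d2 * a) + to_ac (d1 * c2 - c1 * d2) * \<alpha> + to_ac N * \<beta>"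
    by (simp add: \<alpha>2 N_def power2_eq_square)
  finally have "to_ac N * \<beta> = - to_ac (c1 * c2 - d1 * d2 * a) - to_ac (d1 * c2 - c1 * d2) * \<alpha>"
    by (simp add: algebra_simps eq_neg_iff_add_eq_0)
  hence "\<beta> = (to_ac (- (c1 * c2 - d1 * d2 * a)) + to_ac (- (d1 * c2 - c1 * d2)) * \<alpha>) / to_ac N"
    using N by (simp add: field_simps)
  hence \<beta>_eq: "\<beta> = to_ac e + to_ac f * \<alpha>"
    unfolding e_def f_def to_ac_divide by (simp only: add_divide_distrib times_divide_eq_left)
  have "to_ac m = to_ac e * to_ac e + to_ac f * to_ac f * (\<alpha> * \<alpha>) + 2 * to_ac e * to_ac f * \<alpha>"
    unfolding \<beta>[symmetric] \<beta>_eq by (simp add: power2_eq_square algebra_simps)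
  hence "to_ac (e * e + f * f * a - m) + to_ac (2 * e * f) * \<alpha> = 0" by (simp add: \<alpha>2)
  from sqrt_independent[OF a \<alpha> this] have *: "e * e + f * f * a = m" "e = 0 \<or> f = 0" by auto
  show False
  proof (cases "f = 0")
    case True
    hence "m = e^2" using * by (simp add: power2_eq_square)
    thus False using m by blast
  next
    case False
    hence "m = f * f * a" using * by simp
    hence "a * m = (f * a)^2" by (simp add: power2_eq_square)
    thus False using am by blast
  qed
qed

lemma sign_automorphism:
  fixes a m :: "'k::field_char_0"
  assumes a: "\<nexists>b. a = b^2" and m: "\<nexists>b. m = b^2" and am: "\<nexists>b. a * m = b^2"
    and \<alpha>: "\<alpha>^2 = to_ac a" "\<alpha>'^2 = to_ac a" and \<beta>: "\<beta>^2 = to_ac m" "\<beta>'^2 = to_ac m"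
  shows "\<exists>\<sigma>\<in>carrier absolute_galois_group. \<sigma> \<alpha> = \<alpha>' \<and> \<sigma> \<beta> = \<beta>'"
proof -
  have base: "(to_ac c, to_ac c) \<in> base_iso" for c :: 'k unfolding base_iso_def by blast
  have baseE: "\<exists>c. x = to_ac c \<and> x' = to_ac c" if "(x, x') \<in> base_iso" for x x' :: "'k alg_closure"
    using that unfolding base_iso_def by blast
  let ?T = "adjoin_sqrt base_iso \<alpha> \<alpha>'"
  have ind1: "u = 0" if "(x, x') \<in> base_iso" "(u, u') \<in> base_iso" "x + u * \<alpha> = 0" for x x' u u'
    using baseE[OF that(1)] baseE[OF that(2)] that(3) sqrt_independent[OF a \<alpha>(1)] by auto
  have ind2: "u = 0" if "(x, x') \<in> base_iso" "(u, u') \<in> base_iso" "x' + u' * \<alpha>' = 0" for x x' u u'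
    using baseE[OF that(1)] baseE[OF that(2)] that(3) sqrt_independent[OF a \<alpha>(2)] by auto
  have \<alpha>T: "(\<alpha>^2, \<alpha>'^2) \<in> base_iso" unfolding \<alpha> by (rule base)
  have T: "partial_iso ?T" "base_iso \<subseteq> ?T" "(\<alpha>, \<alpha>') \<in> ?T"
    by (rule partial_iso_adjoin_sqrt[OF partial_iso_base \<alpha>T], (rule ind1; assumption), (rule ind2; assumption))+
  have TE: "\<exists>c d. x = to_ac c + to_ac d * \<alpha> \<and> x' = to_ac c + to_ac d * \<alpha>'" if "(x, x') \<in> ?T" for x x'
    using that unfolding adjoin_sqrt_def base_iso_def by blast
  have ind3: "u = 0" if "(x, x') \<in> ?T" "(u, u') \<in> ?T" "x + u * \<beta> = 0" for x x' u u'
    using TE[OF that(1)] TE[OF that(2)] that(3) biquadratic_independent[OF a m am \<alpha>(1) \<beta>(1)] by blast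
  have ind4: "u = 0" if "(x, x') \<in> ?T" "(u, u') \<in> ?T" "x' + u' * \<beta>' = 0" for x x' u u'
  proof -
    have "u' = 0"
      using TE[OF that(1)] TE[OF that(2)] that(3) biquadratic_independent[OF a m am \<alpha>(2) \<beta>(2)] by blast
    thus ?thesis using partial_isoD(5)[OF T(1) that(2)] by simp
  qed
  have \<beta>T: "(\<beta>^2, \<beta>'^2) \<in> ?T" unfolding \<beta> using T(2) base by blast
  let ?U = "adjoin_sqrt ?T \<beta> \<beta>'"
  have U: "partial_iso ?U" "?T \<subseteq> ?U" "(\<beta>, \<beta>') \<in> ?U"
    by (rule partial_iso_adjoin_sqrt[OF T(1) \<beta>T], (rule ind3; assumption), (rule ind4; assumption))+
  have "base_iso \<subseteq> ?U" using T(2) U(2) by (rule order_trans)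
  from extend_to_automorphism[OF U(1) this] obtain \<sigma> where
    \<sigma>: "\<sigma> \<in> carrier absolute_galois_group" "\<forall>(x, y)\<in>?U. \<sigma> x = y" by blast
  have "\<sigma> \<alpha> = \<alpha>'" "\<sigma> \<beta> = \<beta>'" using \<sigma>(2) U(2,3) T(3) by auto
  thus ?thesis using \<sigma>(1) by blast
qed

subsection \<open>The degree of the biquadratic extension\<close>

text \<open>
  The space \<open>W\<close> spanned by \<open>1\<close> and \<open>\<alpha>\<close> over the base field is a subfield, so it
  contains the generated field.
\<close>

lemma quadratic_degree:
  fixes a :: "'k::field_char_0"
  assumes a: "\<nexists>b. a = b^2" and \<alpha>: "\<alpha>^2 = to_ac a"
    and H: "H \<subseteq> {to_ac c + to_ac d * \<alpha> | c d. True}"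
    and dim: "ring.dimension ring_of_type_algebra n (range to_ac)
           (generate_field ring_of_type_algebra (range to_ac \<union> H))"
  shows "n \<le> 2"
proof -
  let ?R = "ring_of_type_algebra :: 'k alg_closure ring"
  define W where "W = {to_ac c + to_ac d * \<alpha> | c d. True}"
  interpret R: field ?R by (rule field_from_type_algebra)
  have R: "carrier ?R = UNIV" "monoid.mult ?R = (*)" "add ?R = (+)" "\<one>\<^bsub>?R\<^esub> = 1" "\<zero>\<^bsub>?R\<^esub> = 0"
    by (simp_all add: ring_of_type_algebra_def)
  have neg: "\<ominus>\<^bsub>?R\<^esub> x = - x" for x by (rule R.minus_equality) (simp_all add: R)
  have inv: "inv\<^bsub>?R\<^esub> x = inverse x" if "x \<noteq> 0" for x
    by (rule R.comm_inv_char) (simp_all add: R that)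
  have WI: "to_ac c + to_ac d * \<alpha> \<in> W" for c d unfolding W_def by blast
  have \<alpha>2: "\<alpha> * \<alpha> = to_ac a" using \<alpha> by (simp add: power2_eq_square)
  have K: "subfield (range to_ac) ?R"
  proof (rule R.subfieldI')
    show "subring (range to_ac) ?R"
      by (rule R.subringI) (auto simp: R neg simp flip: to_ac_1 to_ac_minus to_ac_mult to_ac_add)
    show "inv\<^bsub>?R\<^esub> k \<in> range to_ac" if "k \<in> range to_ac - {\<zero>\<^bsub>?R\<^esub>}" for k
      using that by (auto simp: R inv simp flip: to_ac_inverse)
  qed
  have W: "subfield W ?R"
  proof (rule R.subfieldI')
    show "subring W ?R"
    proof (rule R.subringI)
      show "\<one>\<^bsub>?R\<^esub> \<in> W" using WI[of 1 0] by (simp add: R)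
      fix h assume "h \<in> W"
      then obtain c d where h: "h = to_ac c + to_ac d * \<alpha>" unfolding W_def by blast
      show "\<ominus>\<^bsub>?R\<^esub> h \<in> W" using WI[of "- c" "- d"] by (simp add: neg h)
      fix h' assume "h' \<in> W"
      then obtain c' d' where h': "h' = to_ac c' + to_ac d' * \<alpha>" unfolding W_def by blast
      have "h * h' = to_ac c * to_ac c' + to_ac d * to_ac d' * (\<alpha> * \<alpha>) + (to_ac c * to_ac d' + to_ac d * to_ac c') * \<alpha>"
        by (simp add: h h' algebra_simps)
      thus "h \<otimes>\<^bsub>?R\<^esub> h' \<in> W" using WI[of "c * c' + d * d' * a" "c * d' + d * c'"] by (simp add: R \<alpha>2)
      have "h + h' = (to_ac c + to_ac c') + (to_ac d + to_ac d') * \<alpha>" by (simp add: h h' algebra_simps)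
      thus "h \<oplus>\<^bsub>?R\<^esub> h' \<in> W" using WI[of "c + c'" "d + d'"] by (simp add: R)
    qed (simp add: R)
    fix k assume "k \<in> W - {\<zero>\<^bsub>?R\<^esub>}"
    then obtain c d where k: "k = to_ac c + to_ac d * \<alpha>" "k \<noteq> 0" unfolding W_def by (auto simp: R)
    have k': "to_ac c + to_ac (- d) * \<alpha> \<noteq> 0"
    proof
      assume "to_ac c + to_ac (- d) * \<alpha> = 0"
      from sqrt_independent[OF a \<alpha> this] show False using k by simp
    qed
    have "k * (to_ac c + to_ac (- d) * \<alpha>) = to_ac c * to_ac c - to_ac d * to_ac d * (\<alpha> * \<alpha>)"
      by (simp add: k(1) algebra_simps)
    hence *: "k * (to_ac c + to_ac (- d) * \<alpha>) = to_ac (c * c - d * d * a)" by (simp add: \<alpha>2)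
    hence N: "c * c - d * d * a \<noteq> 0" using k(2) k' by (metis mult_eq_0_iff to_ac_0)
    have "inverse k = (to_ac c + to_ac (- d) * \<alpha>) / to_ac (c * c - d * d * a)"
      unfolding *[symmetric] using k(2) k' by (simp add: field_simps)
    also have "\<dots> = to_ac (c / (c * c - d * d * a)) + to_ac (- d / (c * c - d * d * a)) * \<alpha>"
      unfolding to_ac_divide by (simp only: add_divide_distrib times_divide_eq_left)
    finally show "inv\<^bsub>?R\<^esub> k \<in> W" unfolding inv[OF k(2)] by (simp only: WI)
  qed
  have "range to_ac \<subseteq> W" using WI[of _ 0] by auto
  hence E: "generate_field ?R (range to_ac \<union> H) \<subseteq> W"
    using H by (intro R.generate_field_min_subfield1 W) (simp_all add: R W_def)
  have "R.independent (range to_ac) [1, \<alpha>]"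
  proof -
    have \<alpha>_in: "\<alpha> \<in> carrier ?R" and one_in: "1 \<in> carrier ?R" by (simp_all add: R)
    have "\<alpha> \<notin> R.Span (range to_ac) []"
      using a \<alpha> by (auto simp: R)
    hence 1: "R.independent (range to_ac) [\<alpha>]" by (intro R.li_Cons R.li_Nil) (simp_all add: R)
    have "1 \<notin> R.Span (range to_ac) [\<alpha>]"
    proof
      assume "1 \<in> R.Span (range to_ac) [\<alpha>]"
      then obtain d where "1 = to_ac d * \<alpha>" by (auto simp: R.line_extension_mem_iff R)
      hence "to_ac (-1) + to_ac d * \<alpha> = 0" by simp
      from sqrt_independent[OF a \<alpha> this] show False by simp
    qed
    from R.li_Cons[OF one_in this 1] show ?thesis .
  qed
  moreover have "R.Span (range to_ac) [1, \<alpha>] = W"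
  proof -
    have "x \<in> R.Span (range to_ac) [1, \<alpha>] \<longleftrightarrow> (\<exists>c d. x = to_ac c + to_ac d * \<alpha>)" for x
      by (simp add: R.line_extension_mem_iff R Bex_def image_iff) blast
    thus ?thesis unfolding W_def by blast
  qed
  ultimately have W2: "R.dimension (length [1, \<alpha>]) (range to_ac) W" by (rule R.dimensionI[OF K])
  obtain Vs where Vs: "R.independent (range to_ac) Vs" "length Vs = n"
    "R.Span (range to_ac) Vs = generate_field ?R (range to_ac \<union> H)"
    using R.exists_base[OF K dim] by blast
  have "set Vs \<subseteq> R.Span (range to_ac) Vs"
    using R.Span_base_incl[OF K] by (simp add: R)
  hence "set Vs \<subseteq> W" using E Vs(3) by blast
  from R.independent_length_le_dimension[OF K W2 Vs(1) this] show ?thesis using Vs(2) by simp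
qed

text \<open>
  If \<open>m\<close> or \<open>am\<close> were a square, then \<open>\<beta> = \<surd>m\<close>, and with it
  \<open>\<delta>\<close>, would lie in the quadratic extension generated by \<open>\<alpha>\<close>.
\<close>

lemma degree_four_nonsquare:
  fixes a m r :: "'k::field_char_0"
  assumes a: "\<nexists>b. a = b^2" "a \<noteq> 0" and \<alpha>: "\<alpha>^2 = to_ac a" and \<beta>: "\<beta>^2 = to_ac m"
    and \<delta>: "\<delta> = to_ac r * \<gamma>" "\<gamma>^2 = to_ac (m * a)"
    and dim: "ring.dimension ring_of_type_algebra 4 (range to_ac)
           (generate_field ring_of_type_algebra (range to_ac \<union> {\<alpha>, \<beta>, \<delta>}))"
  shows "(\<nexists>b. m = b^2) \<and> (\<nexists>b. a * m = b^2)"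
proof -
  have False if c: "\<beta> = to_ac c \<or> \<beta> = to_ac c * \<alpha>" for c
  proof -
    have WI: "to_ac c + to_ac d * \<alpha> \<in> {to_ac c + to_ac d * \<alpha> | c d. True}" for c d by blast
    have \<alpha>2: "\<alpha> * \<alpha> = to_ac a" using \<alpha> by (simp add: power2_eq_square)
    have "\<gamma>^2 = (\<alpha> * \<beta>)^2" using \<alpha> \<beta> \<delta>(2) by (simp add: power_mult_distrib mult.commute)
    then obtain e :: 'k where e: "\<gamma> = to_ac e * (\<alpha> * \<beta>)"
      unfolding power2_eq_iff by (metis mult_1 mult_minus1 to_ac_1 to_ac_minus)
    have "\<alpha> \<in> {to_ac c + to_ac d * \<alpha> | c d. True}" using WI[of 0 1] by simp
    moreover have "\<beta> \<in> {to_ac c + to_ac d * \<alpha> | c d. True}" using c WI[of c 0] WI[of 0 c] by auto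
    moreover have "\<delta> \<in> {to_ac c + to_ac d * \<alpha> | c d. True}"
      using c
    proof
      assume "\<beta> = to_ac c"
      hence "\<delta> = to_ac 0 + to_ac (r * e * c) * \<alpha>" by (simp add: \<delta>(1) e)
      thus ?thesis by blast
    next
      assume "\<beta> = to_ac c * \<alpha>"
      hence "\<delta> = to_ac r * to_ac e * to_ac c * (\<alpha> * \<alpha>)" by (simp add: \<delta>(1) e)
      hence "\<delta> = to_ac (r * e * c * a) + to_ac 0 * \<alpha>" by (simp add: \<alpha>2)
      thus ?thesis by blast
    qed
    ultimately have "{\<alpha>, \<beta>, \<delta>} \<subseteq> {to_ac c + to_ac d * \<alpha> | c d. True}" by blast
    from quadratic_degree[OF a(1) \<alpha> this dim] show False by simp
  qed
  note * = this
  show ?thesis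
  proof (intro conjI notI)
    assume "\<exists>b. m = b^2"
    then obtain b where "m = b^2" by blast
    hence "\<beta>^2 = (to_ac b)^2" using \<beta> by simp
    hence "\<beta> = to_ac b \<or> \<beta> = to_ac (- b)" by (simp add: power2_eq_iff)
    thus False using * by blast
  next
    assume "\<exists>b. a * m = b^2"
    then obtain b where "a * m = b^2" by blast
    hence m: "m = a * (b / a)^2" using a(2) by (simp add: field_simps power2_eq_square)
    have "\<beta>^2 = (to_ac (b / a) * \<alpha>)^2" unfolding \<beta> power_mult_distrib \<alpha> by (subst m) (simp add: mult.commute)
    hence "\<beta> = to_ac (b / a) * \<alpha> \<or> \<beta> = to_ac (- (b / a)) * \<alpha>" by (simp add: power2_eq_iff)
    thus False using * by blast
  qed
qed

section \<open>First cohomology of a lattice with an action through the Klein four-group\<close>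

text \<open>
  The action on the Picard group, in the basis \<open>P\<^sub>0, A, B, C\<close>, of an automorphism that fixes
  \<open>\<alpha>\<close> if and only if \<open>x\<close> holds and \<open>\<mu>\<close> if and only if \<open>y\<close>
  holds.
\<close>

definition twist :: "bool \<Rightarrow> bool \<Rightarrow> int \<times> int \<times> int \<times> int \<Rightarrow> int \<times> int \<times> int \<times> int" where
  "twist x y = (\<lambda>(p, a, b, c).
     if x then (if y then (p, a, b, c) else (p - 2 * c, p - a - c, p - b - c, - c))
     else (if y then (2 * c - p, c - a, c - b, c) else (- p, a - p, b - p, - c)))"

lemma twist_add: "twist x y (u + v) = twist x y u + twist x y v"
  by (cases u; cases v) (simp add: twist_def)

text \<open>
  The cochain on the four-group with value \<open>v\<close> at \<open>s\<close> and \<open>w\<close> at \<open>t\<close>,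
  where \<open>s\<close> has the signs \<open>(False, True)\<close> and \<open>t\<close> the signs
  \<open>(True, False)\<close>; its value at \<open>st\<close> is the one required by the cocycle condition.
\<close>

definition klein_cocycle :: "int \<times> int \<times> int \<times> int \<Rightarrow> int \<times> int \<times> int \<times> int \<Rightarrow> bool \<Rightarrow> bool \<Rightarrow> int \<times> int \<times> int \<times> int" where
  "klein_cocycle v w x y =
     (if x then (if y then 0 else w) else (if y then v else v + twist False True w))"

definition coordinate_a :: "int \<times> int \<times> int \<times> int \<Rightarrow> int" where "coordinate_a = (\<lambda>(p, a, b, c). a)"
definition coordinate_ab :: "int \<times> int \<times> int \<times> int \<Rightarrow> int" where "coordinate_ab = (\<lambda>(p, a, b, c). a + b)"

text \<open>
  The three assumptions are the cocycle condition for the relations \<open>s\<^sup>2 = 1\<close>,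
  \<open>t\<^sup>2 = 1\<close> and \<open>st = ts\<close>.
\<close>

lemma klein_cocycle_relations:
  assumes "v + twist False True v = 0" "w + twist True False w = 0"
    "v + twist False True w = w + twist True False v"
  obtains P A B d where "v = (P, A, B, 0)" "w = (P + 2 * d, A + d, B + d, P + 2 * d)"
proof -
  obtain p a b c where v: "v = (p, a, b, c)" by (cases v)
  obtain p' a' b' c' where w: "w = (p', a', b', c')" by (cases w)
  have "c = 0" using assms(1) by (simp add: v twist_def zero_prod_def)
  moreover have "c' = p'" using assms(2) by (simp add: w twist_def zero_prod_def)
  moreover have "p' = p + 2 * (a' - a)" "b' = b + (a' - a)"
    using assms(3) calculation by (simp_all add: v w twist_def)
  ultimately show ?thesis using that[of p a b "a' - a"] by (simp add: v w)
qed

text \<open>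
  The coboundary of \<open>(p,a,b,c)\<close> is given by \<open>P = 2c - 2p\<close>, \<open>A = c - 2a\<close>,
  \<open>B = c - 2b\<close>, \<open>d = p - 2c\<close>. The first and the last equation determine
  \<open>c = - P/2 - d\<close>, and the others require \<open>c\<close> to be congruent to \<open>A\<close> and to
  \<open>B\<close> modulo two.
\<close>

lemma klein_coboundary_iff:
  fixes P A B d :: int
  assumes "v = (P, A, B, 0)" "w = (P + 2 * d, A + d, B + d, P + 2 * d)"
  shows "(\<exists>u. v = twist False True u - u \<and> w = twist True False u - u) \<longleftrightarrow>
    2 dvd A + B \<and> 4 dvd P + 2 * A + 2 * d"
proof
  assume "\<exists>u. v = twist False True u - u \<and> w = twist True False u - u"
  then obtain p a b c where "v = twist False True (p, a, b, c) - (p, a, b, c)"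
    "w = twist True False (p, a, b, c) - (p, a, b, c)" by (metis prod_cases4)
  hence "P = 2 * c - 2 * p" "A = c - 2 * a" "B = c - 2 * b" "d = p - 2 * c"
    using assms by (simp_all add: twist_def)
  moreover from this have "A + B = 2 * (c - a - b)" "P + 2 * A + 2 * d = 4 * (- a)" by simp_all
  ultimately show "2 dvd A + B \<and> 4 dvd P + 2 * A + 2 * d" by (metis dvd_triv_left)
next
  assume *: "2 dvd A + B \<and> 4 dvd P + 2 * A + 2 * d"
  then obtain k l where kl: "A + B = 2 * k" "P + 2 * A + 2 * d = 4 * l" by (metis dvdE)
  \<comment> \<open>The integer \<open>c = - P/2 - d\<close> in a form without division.\<close>
  define c where "c = A - 2 * l"
  have P: "P = 2 * c - 2 * (d + 2 * c)" using kl by (simp add: c_def)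
  have A: "A = c - 2 * (- l)" by (simp add: c_def)
  have B: "B = c - 2 * (A - l - k)" using kl by (simp add: c_def)
  show "\<exists>u. v = twist False True u - u \<and> w = twist True False u - u"
    by (rule exI[of _ "(d + 2 * c, - l, A - l - k, c)"]) (use assms P A B in \<open>simp add: twist_def\<close>)
qed

lemma klein_cocycle_cocycle:
  assumes "v = (P, A, B, 0)" "w = (P + 2 * d, A + d, B + d, P + 2 * d)"
  shows "klein_cocycle v w (x = x') (y = y') = klein_cocycle v w x y + twist x y (klein_cocycle v w x' y')"
  by (cases x; cases y; cases x'; cases y')
    (simp_all add: assms klein_cocycle_def twist_def zero_prod_def)

text \<open>
  A topological group acting on a lattice through the two signs \<open>e1\<close> and \<open>e2\<close>, in coordinates
  \<open>E\<close>. The assumption \<open>torsion\<close> is the property of profinite groups that excludes nonzero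
  continuous homomorphisms to a lattice.
\<close>

locale klein_module =
  fixes G :: "('g, 'x) monoid_scheme" (structure) and T :: "'g topology"
    and A :: "('a, 'y) monoid_scheme" and act :: "'g \<Rightarrow> 'a \<Rightarrow> 'a"
    and E :: "int \<times> int \<times> int \<times> int \<Rightarrow> 'a" and e1 e2 :: "'g \<Rightarrow> bool"
  assumes G: "group G" and A: "comm_group A"
    and E_bij: "bij_betw E UNIV (carrier A)" and E_add: "E (u + v) = E u \<otimes>\<^bsub>A\<^esub> E v"
    and act_E: "g \<in> carrier G \<Longrightarrow> act g (E u) = E (twist (e1 g) (e2 g) u)"
    and signs: "g \<in> carrier G \<Longrightarrow> h \<in> carrier G \<Longrightarrow> e1 (g \<otimes> h) = (e1 g = e1 h)"
       "g \<in> carrier G \<Longrightarrow> h \<in> carrier G \<Longrightarrow> e2 (g \<otimes> h) = (e2 g = e2 h)"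
    and signs_surj: "\<exists>s\<in>carrier G. \<not> e1 s \<and> e2 s" "\<exists>t\<in>carrier G. e1 t \<and> \<not> e2 t"
    and space: "topspace T = carrier G"
    and signs_open: "openin T {g \<in> carrier G. e1 g = x \<and> e2 g = y}"
    and torsion: "openin T U \<Longrightarrow> \<one> \<in> U \<Longrightarrow> g \<in> carrier G \<Longrightarrow> \<exists>n\<ge>1. g [^] (n :: nat) \<in> U"
begin

interpretation G: group G by (rule G)
interpretation A: comm_group A by (rule A)

definition coords :: "'a \<Rightarrow> int \<times> int \<times> int \<times> int" where "coords = the_inv E"

lemma E_eq_iff: "E u = E v \<longleftrightarrow> u = v"
  using E_bij inj_eq unfolding bij_betw_def by metis

lemma E_closed [simp]: "E u \<in> carrier A"
  using E_bij by (auto simp: bij_betw_def)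

lemma coords_E [simp]: "coords (E u) = u"
  unfolding coords_def using E_bij by (simp add: bij_betw_def the_inv_f_f)

lemma E_coords [simp]: "z \<in> carrier A \<Longrightarrow> E (coords z) = z"
  unfolding coords_def using E_bij by (auto simp: bij_betw_def f_the_inv_into_f)

lemma coords_mult: "x \<in> carrier A \<Longrightarrow> y \<in> carrier A \<Longrightarrow> coords (x \<otimes>\<^bsub>A\<^esub> y) = coords x + coords y"
  by (metis E_add E_coords coords_E)

lemma E_0: "E 0 = \<one>\<^bsub>A\<^esub>"
  by (metis A.l_cancel_one E_add E_closed add.right_neutral)

lemma E_diff: "E u \<otimes>\<^bsub>A\<^esub> inv\<^bsub>A\<^esub> E v = E (u - v)"
  by (metis A.inv_solve_right E_add E_closed diff_add_cancel)

lemma signs_one: "e1 \<one>" "e2 \<one>"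
  using signs[OF G.one_closed G.one_closed] by simp_all

lemma cocycleD:
  assumes "f \<in> carrier (cocycles G T A act)"
  shows "g \<in> carrier G \<Longrightarrow> f g \<in> carrier A" "f \<in> extensional (carrier G)"
    "g \<in> carrier G \<Longrightarrow> h \<in> carrier G \<Longrightarrow>
       coords (f (g \<otimes> h)) = coords (f g) + twist (e1 g) (e2 g) (coords (f h))"
    "openin T {g \<in> carrier G. f g \<in> U}"
proof -
  have f: "f \<in> carrier G \<rightarrow>\<^sub>E carrier A" "continuous_map T (discrete_topology (carrier A)) f"
    "\<And>g h. g \<in> carrier G \<Longrightarrow> h \<in> carrier G \<Longrightarrow> f (g \<otimes> h) = f g \<otimes>\<^bsub>A\<^esub> act g (f h)"
    using assms by (auto simp: cocycles_def)
  show c: "f g \<in> carrier A" if "g \<in> carrier G" for g using f(1) that by blast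
  show "f \<in> extensional (carrier G)" using f(1) by (simp add: PiE_def)
  show "coords (f (g \<otimes> h)) = coords (f g) + twist (e1 g) (e2 g) (coords (f h))"
    if "g \<in> carrier G" "h \<in> carrier G"
  proof -
    have "f (g \<otimes> h) = E (coords (f g)) \<otimes>\<^bsub>A\<^esub> act g (E (coords (f h)))" using f(3) c that by simp
    thus ?thesis by (simp add: act_E that E_add[symmetric])
  qed
  have "openin T {g \<in> topspace T. f g \<in> U \<inter> carrier A}"
    by (rule openin_continuous_map_preimage[OF f(2)]) simp
  moreover have "{g \<in> topspace T. f g \<in> U \<inter> carrier A} = {g \<in> carrier G. f g \<in> U}"
    using c space by auto
  ultimately show "openin T {g \<in> carrier G. f g \<in> U}" by simp
qed

text \<open>
  On the powers of an element acting trivially a cocycle is additive. One of these powers lies in the open set on which the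
  cocycle vanishes, and the lattice is torsion-free.
\<close>

lemma cocycle_trivial:
  assumes f: "f \<in> carrier (cocycles G T A act)" and h: "h \<in> carrier G" "e1 h" "e2 h"
  shows "coords (f h) = 0"
proof -
  note c = cocycleD[OF f]
  have tr: "twist True True u = u" for u by (cases u) (simp add: twist_def)
  have f1: "coords (f \<one>) = 0" using c(3)[OF G.one_closed G.one_closed] by (simp add: signs_one tr)
  have hn: "coords (f (h [^] n)) = (of_nat n * fst (coords (f h)), of_nat n * fst (snd (coords (f h))),
      of_nat n * fst (snd (snd (coords (f h)))), of_nat n * snd (snd (snd (coords (f h)))))
      \<and> e1 (h [^] n) \<and> e2 (h [^] n)" for n :: nat
  proof (induction n)
    case 0 thus ?case by (simp add: f1 signs_one zero_prod_def)
  next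
    case (Suc n)
    have "coords (f (h [^] Suc n)) = coords (f (h [^] n)) + coords (f h)"
      using c(3)[of "h [^] n" h] Suc h by (simp add: tr)
    thus ?case using Suc h by (cases "coords (f h)") (simp add: signs algebra_simps)
  qed
  have "openin T {g \<in> carrier G. f g \<in> {\<one>\<^bsub>A\<^esub>}}" by (rule c(4))
  moreover have "f \<one> = \<one>\<^bsub>A\<^esub>" using E_coords[OF c(1)[OF G.one_closed]] by (simp add: f1 E_0)
  hence "\<one> \<in> {g \<in> carrier G. f g \<in> {\<one>\<^bsub>A\<^esub>}}" by simp
  ultimately obtain n :: nat where n: "n \<ge> 1" "f (h [^] n) = \<one>\<^bsub>A\<^esub>" using torsion h(1) by blast
  have "coords (f (h [^] n)) = 0" using n(2) coords_E[of 0] by (simp add: E_0)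
  thus ?thesis using hn[of n] n(1) by (cases "coords (f h)") (simp add: zero_prod_def)
qed

text \<open>
  Representatives of the two generators of the four-group.
\<close>

definition sg :: 'g where "sg = (SOME s. s \<in> carrier G \<and> \<not> e1 s \<and> e2 s)"
definition tg :: 'g where "tg = (SOME t. t \<in> carrier G \<and> e1 t \<and> \<not> e2 t)"

lemma sg: "sg \<in> carrier G" "\<not> e1 sg" "e2 sg"
  using someI_ex[of "\<lambda>s. s \<in> carrier G \<and> \<not> e1 s \<and> e2 s"] signs_surj(1) unfolding sg_def by blast+

lemma tg: "tg \<in> carrier G" "e1 tg" "\<not> e2 tg"
  using someI_ex[of "\<lambda>s. s \<in> carrier G \<and> e1 s \<and> \<not> e2 s"] signs_surj(2) unfolding tg_def by blast+

lemma cocycle_eq: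
  assumes f: "f \<in> carrier (cocycles G T A act)" and gh: "g \<in> carrier G" "h \<in> carrier G" "e1 g = e1 h" "e2 g = e2 h"
  shows "f g = f h"
proof -
  note c = cocycleD[OF f]
  let ?k = "inv g \<otimes> h"
  have k: "?k \<in> carrier G" "g \<otimes> ?k = h" using gh by (simp_all add: G.m_assoc[symmetric])
  have "e1 ?k" "e2 ?k" using signs[OF gh(1) k(1)] gh k(2) by auto
  hence "coords (f ?k) = 0" using cocycle_trivial[OF f k(1)] by simp
  moreover have "twist x y 0 = 0" for x y by (simp add: twist_def zero_prod_def)
  ultimately have "coords (f h) = coords (f g)" using c(3)[OF gh(1) k(1)] k(2) by simp
  thus ?thesis using c(1) gh E_coords by metis
qed

lemma cocycle_form:
  assumes f: "f \<in> carrier (cocycles G T A act)"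
  obtains P A' B d where "coords (f sg) = (P, A', B, 0)" "coords (f tg) = (P + 2 * d, A' + d, B + d, P + 2 * d)"
proof -
  note c = cocycleD[OF f]
  have 1: "coords (f (sg \<otimes> sg)) = 0" "coords (f (tg \<otimes> tg)) = 0"
    by (rule cocycle_trivial[OF f]; simp add: sg tg signs)+
  have 2: "f (sg \<otimes> tg) = f (tg \<otimes> sg)" by (rule cocycle_eq[OF f]; simp add: sg tg signs)
  have 3: "coords (f sg) + twist False True (coords (f sg)) = 0"
    using c(3)[OF sg(1) sg(1)] by (simp add: 1 sg)
  have 4: "coords (f tg) + twist True False (coords (f tg)) = 0"
    using c(3)[OF tg(1) tg(1)] by (simp add: 1 tg)
  have 5: "coords (f sg) + twist False True (coords (f tg)) = coords (f tg) + twist True False (coords (f sg))"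
    using c(3)[OF sg(1) tg(1)] c(3)[OF tg(1) sg(1)] by (simp add: 2 sg tg)
  from klein_cocycle_relations[OF 3 4 5] show ?thesis using that by blast
qed

lemma cocycle_determined:
  assumes f: "f \<in> carrier (cocycles G T A act)" and g: "g \<in> carrier G"
  shows "f g = E (klein_cocycle (coords (f sg)) (coords (f tg)) (e1 g) (e2 g))"
proof -
  note c = cocycleD[OF f]
  have "coords (f g) = klein_cocycle (coords (f sg)) (coords (f tg)) (e1 g) (e2 g)"
  proof (cases "e1 g"; cases "e2 g")
    assume "e1 g" "e2 g" thus ?thesis using cocycle_trivial[OF f g] by (simp add: klein_cocycle_def)
  next
    assume "e1 g" "\<not> e2 g" thus ?thesis using cocycle_eq[OF f g tg(1)] by (simp add: klein_cocycle_def tg)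
  next
    assume "\<not> e1 g" "e2 g" thus ?thesis using cocycle_eq[OF f g sg(1)] by (simp add: klein_cocycle_def sg)
  next
    assume a: "\<not> e1 g" "\<not> e2 g"
    have "f g = f (sg \<otimes> tg)" by (rule cocycle_eq[OF f g]; simp add: a sg tg signs)
    thus ?thesis using c(3)[OF sg(1) tg(1)] a by (simp add: klein_cocycle_def sg)
  qed
  thus ?thesis using c(1)[OF g] E_coords by metis
qed

lemma cocycleI:
  assumes v: "v = (P, A', B, 0)" "w = (P + 2 * d, A' + d, B + d, P + 2 * d)"
  shows "(\<lambda>g\<in>carrier G. E (klein_cocycle v w (e1 g) (e2 g))) \<in> carrier (cocycles G T A act)"
proof -
  let ?f = "\<lambda>g\<in>carrier G. E (klein_cocycle v w (e1 g) (e2 g))"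
  have "continuous_map T (discrete_topology (carrier A)) ?f"
    unfolding continuous_map
  proof (intro conjI allI impI)
    show "?f ` topspace T \<subseteq> topspace (discrete_topology (carrier A))" by (auto simp: space)
    fix U assume "openin (discrete_topology (carrier A)) U"
    have "{g \<in> topspace T. ?f g \<in> U} =
        \<Union>{{g \<in> carrier G. e1 g = x \<and> e2 g = y} | x y. E (klein_cocycle v w x y) \<in> U}"
      by (auto simp: space)
    moreover have "openin T \<dots>" by (rule openin_Union) (auto intro: signs_open)
    ultimately show "openin T {g \<in> topspace T. ?f g \<in> U}" by simp
  qed
  moreover have "?f (g \<otimes> h) = ?f g \<otimes>\<^bsub>A\<^esub> act g (?f h)" if "g \<in> carrier G" "h \<in> carrier G" for g h
    using that by (simp add: signs klein_cocycle_cocycle[OF v] E_add act_E)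
  ultimately show ?thesis by (auto simp: cocycles_def)
qed

lemma cocycles_group: "group (cocycles G T A act)"
proof (rule groupI)
  let ?Z = "cocycles G T A act"
  have one: "\<one>\<^bsub>?Z\<^esub> = (\<lambda>g\<in>carrier G. E 0)" by (simp add: cocycles_def E_0)
  have mult: "f \<otimes>\<^bsub>?Z\<^esub> f' = (\<lambda>g\<in>carrier G. f g \<otimes>\<^bsub>A\<^esub> f' g)" for f f' by (simp add: cocycles_def)
  have rep: "\<exists>P A' B d. f = (\<lambda>g\<in>carrier G. E (klein_cocycle (P, A', B, 0) (P + 2 * d, A' + d, B + d, P + 2 * d) (e1 g) (e2 g)))"
    if f: "f \<in> carrier ?Z" for f
  proof -
    obtain P A' B d where c: "coords (f sg) = (P, A', B, 0)" "coords (f tg) = (P + 2 * d, A' + d, B + d, P + 2 * d)"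
      using cocycle_form[OF f] by blast
    have "f = (\<lambda>g\<in>carrier G. E (klein_cocycle (P, A', B, 0) (P + 2 * d, A' + d, B + d, P + 2 * d) (e1 g) (e2 g)))"
      by (rule extensionalityI[OF cocycleD(2)[OF f]]) (simp, simp add: cocycle_determined[OF f, unfolded c])
    thus ?thesis by blast
  qed
  have kadd: "klein_cocycle v w x y + klein_cocycle v' w' x y = klein_cocycle (v + v') (w + w') x y" for v w v' w' x y
    by (simp add: klein_cocycle_def twist_add)
  have k0: "klein_cocycle (0, 0, 0, 0) (0, 0, 0, 0) x y = 0" for x y
    by (simp add: klein_cocycle_def twist_def zero_prod_def)
  show "\<one>\<^bsub>?Z\<^esub> \<in> carrier ?Z"
  proof -
    have "(\<lambda>g\<in>carrier G. E (klein_cocycle (0, 0, 0, 0) (0, 0, 0, 0) (e1 g) (e2 g))) \<in> carrier ?Z"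
      by (rule cocycleI[where P = 0 and A' = 0 and B = 0 and d = 0]) simp_all
    thus ?thesis by (simp only: one k0)
  qed
  fix f assume f: "f \<in> carrier ?Z"
  note cf = cocycleD(1,2)[OF f]
  show "\<one>\<^bsub>?Z\<^esub> \<otimes>\<^bsub>?Z\<^esub> f = f"
    by (rule extensionalityI[OF _ cf(2)]) (use cf in \<open>auto simp: mult one E_0\<close>)
  obtain P A' B d where ff: "f = (\<lambda>g\<in>carrier G. E (klein_cocycle (P, A', B, 0) (P + 2 * d, A' + d, B + d, P + 2 * d) (e1 g) (e2 g)))"
    using rep[OF f] by blast
  show "\<exists>f'\<in>carrier ?Z. f' \<otimes>\<^bsub>?Z\<^esub> f = \<one>\<^bsub>?Z\<^esub>"
  proof
    show "(\<lambda>g\<in>carrier G. E (klein_cocycle (- P, - A', - B, 0) (- P + 2 * - d, - A' + - d, - B + - d, - P + 2 * - d) (e1 g) (e2 g))) \<in> carrier ?Z"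
      by (rule cocycleI[OF refl refl])
    show "(\<lambda>g\<in>carrier G. E (klein_cocycle (- P, - A', - B, 0) (- P + 2 * - d, - A' + - d, - B + - d, - P + 2 * - d) (e1 g) (e2 g))) \<otimes>\<^bsub>?Z\<^esub> f = \<one>\<^bsub>?Z\<^esub>"
      unfolding mult one ff by (rule restrict_ext)
        (simp add: E_add[symmetric] kadd, simp add: klein_cocycle_def twist_def zero_prod_def)
  qed
  fix f' assume f': "f' \<in> carrier ?Z"
  note cf' = cocycleD(1,2)[OF f']
  obtain P' A'' B' d' where ff': "f' = (\<lambda>g\<in>carrier G. E (klein_cocycle (P', A'', B', 0) (P' + 2 * d', A'' + d', B' + d', P' + 2 * d') (e1 g) (e2 g)))"
    using rep[OF f'] by blast
  have "f \<otimes>\<^bsub>?Z\<^esub> f' = (\<lambda>g\<in>carrier G. E (klein_cocycle (P + P', A' + A'', B + B', 0)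
     (P + P' + 2 * (d + d'), A' + A'' + (d + d'), B + B' + (d + d'), P + P' + 2 * (d + d')) (e1 g) (e2 g)))"
    unfolding mult ff ff' by (rule restrict_ext) (simp add: E_add[symmetric] kadd algebra_simps)
  also have "\<dots> \<in> carrier ?Z" by (rule cocycleI[OF refl refl])
  finally show "f \<otimes>\<^bsub>?Z\<^esub> f' \<in> carrier ?Z" .
  fix f'' assume f'': "f'' \<in> carrier ?Z"
  show "f \<otimes>\<^bsub>?Z\<^esub> f' \<otimes>\<^bsub>?Z\<^esub> f'' = f \<otimes>\<^bsub>?Z\<^esub> (f' \<otimes>\<^bsub>?Z\<^esub> f'')"
    unfolding mult by (rule restrict_ext) (simp add: cf cf' cocycleD(1)[OF f''] A.m_assoc)
qed

text \<open>
  In the notation of \<open>klein_cocycle_relations\<close> these are \<open>A + B\<close> modulo \<open>2\<close> and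
  \<open>P + 2(A + d)\<close> modulo \<open>4\<close>, where \<open>A + d\<close> is a coordinate of the value at
  \<open>t\<close>.
\<close>

definition invariant :: "('g \<Rightarrow> 'a) \<Rightarrow> int \<times> int" where
  "invariant f = (coordinate_ab (coords (f sg)) mod 2,
     (fst (coords (f sg)) + 2 * coordinate_a (coords (f tg))) mod 4)"

lemma invariant_hom: "invariant \<in> hom (cocycles G T A act) (integer_mod_group 2 \<times>\<times> integer_mod_group 4)"
proof (rule homI)
  let ?Z = "cocycles G T A act"
  fix f f' assume f: "f \<in> carrier ?Z" and f': "f' \<in> carrier ?Z"
  show "invariant f \<in> carrier (integer_mod_group 2 \<times>\<times> integer_mod_group 4)"
    by (simp add: invariant_def carrier_integer_mod_group)
  have "coords ((f \<otimes>\<^bsub>?Z\<^esub> f') g) = coords (f g) + coords (f' g)" if "g \<in> carrier G" for g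
    using cocycleD(1)[OF f that] cocycleD(1)[OF f' that] that coords_mult by (simp add: cocycles_def)
  note this[OF sg(1)] this[OF tg(1)]
  moreover have "coordinate_a (u + v) = coordinate_a u + coordinate_a v" "coordinate_ab (u + v) = coordinate_ab u + coordinate_ab v" for u v
    by (cases u; cases v; simp add: coordinate_a_def coordinate_ab_def)+
  ultimately show "invariant (f \<otimes>\<^bsub>?Z\<^esub> f') = invariant f \<otimes>\<^bsub>integer_mod_group 2 \<times>\<times> integer_mod_group 4\<^esub> invariant f'"
    by (simp add: invariant_def mod_add_eq algebra_simps)
qed

lemma invariant_surj: "invariant ` carrier (cocycles G T A act) = carrier (integer_mod_group 2 \<times>\<times> integer_mod_group 4)"
proof
  show "invariant ` carrier (cocycles G T A act) \<subseteq> carrier (integer_mod_group 2 \<times>\<times> integer_mod_group 4)"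
    using invariant_hom unfolding hom_def by blast
  show "carrier (integer_mod_group 2 \<times>\<times> integer_mod_group 4) \<subseteq> invariant ` carrier (cocycles G T A act)"
  proof
    fix z assume "z \<in> carrier (integer_mod_group 2 \<times>\<times> integer_mod_group 4)"
    then obtain i j where z: "z = (i, j)" "0 \<le> i" "i < 2" "0 \<le> j" "j < 4"
      by (auto simp: carrier_integer_mod_group)
    let ?f = "\<lambda>g\<in>carrier G. E (klein_cocycle (j, 0, i, 0) (j + 2 * 0, 0 + 0, i + 0, j + 2 * 0) (e1 g) (e2 g))"
    have "?f \<in> carrier (cocycles G T A act)" by (rule cocycleI[OF refl refl])
    moreover have "invariant ?f = z"
      by (simp add: invariant_def sg tg klein_cocycle_def coordinate_a_def coordinate_ab_def z)
    ultimately show "z \<in> invariant ` carrier (cocycles G T A act)" by blast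
  qed
qed

lemma invariant_kernel:
  "kernel (cocycles G T A act) (integer_mod_group 2 \<times>\<times> integer_mod_group 4) invariant = coboundaries G A act"
proof -
  let ?Z = "cocycles G T A act"
  have ker: "invariant f = (0, 0) \<longleftrightarrow> (\<exists>u. coords (f sg) = twist False True u - u \<and> coords (f tg) = twist True False u - u)"
    if f: "f \<in> carrier ?Z" for f
  proof -
    obtain P A' B d where c: "coords (f sg) = (P, A', B, 0)" "coords (f tg) = (P + 2 * d, A' + d, B + d, P + 2 * d)"
      using cocycle_form[OF f] by blast
    show ?thesis unfolding klein_coboundary_iff[OF c]
      by (simp add: invariant_def c coordinate_a_def coordinate_ab_def dvd_eq_mod_eq_0 algebra_simps)
  qed
  have cob: "(\<lambda>g\<in>carrier G. act g a \<otimes>\<^bsub>A\<^esub> inv\<^bsub>A\<^esub> a) =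
      (\<lambda>g\<in>carrier G. E (klein_cocycle (twist False True u - u) (twist True False u - u) (e1 g) (e2 g)))"
    if "a = E u" for a u
    unfolding that by (rule restrict_ext)
      (cases u, simp add: act_E E_diff klein_cocycle_def twist_def E_eq_iff zero_prod_def)
  have form: "\<exists>P A' B d. twist False True u - u = (P, A', B, 0) \<and>
      twist True False u - u = (P + 2 * d, A' + d, B + d, P + 2 * d)" for u
    by (cases u) (simp add: twist_def, presburger)
  show ?thesis
  proof (intro equalityI subsetI)
    fix f assume "f \<in> kernel ?Z (integer_mod_group 2 \<times>\<times> integer_mod_group 4) invariant"
    hence f: "f \<in> carrier ?Z" "invariant f = (0, 0)" by (simp_all add: kernel_def)
    then obtain u where u: "coords (f sg) = twist False True u - u" "coords (f tg) = twist True False u - u"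
      using ker by blast
    have "f = (\<lambda>g\<in>carrier G. act g (E u) \<otimes>\<^bsub>A\<^esub> inv\<^bsub>A\<^esub> E u)"
      unfolding cob[OF refl]
      by (rule extensionalityI[OF cocycleD(2)[OF f(1)]]) (simp, simp add: cocycle_determined[OF f(1), unfolded u])
    thus "f \<in> coboundaries G A act" unfolding coboundaries_def using E_closed by (rule image_eqI)
  next
    fix f assume "f \<in> coboundaries G A act"
    then obtain a where a: "a \<in> carrier A" "f = (\<lambda>g\<in>carrier G. act g a \<otimes>\<^bsub>A\<^esub> inv\<^bsub>A\<^esub> a)"
      unfolding coboundaries_def by blast
    define u where "u = coords a"
    have au: "a = E u" using a(1) by (simp add: u_def)
    obtain P A' B d where c: "twist False True u - u = (P, A', B, 0)"
      "twist True False u - u = (P + 2 * d, A' + d, B + d, P + 2 * d)" using form by blast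
    have f: "f \<in> carrier ?Z" unfolding a(2) cob[OF au] by (rule cocycleI[OF c])
    have "coords (f sg) = twist False True u - u" "coords (f tg) = twist True False u - u"
      unfolding a(2) cob[OF au] by (simp_all add: sg tg klein_cocycle_def)
    hence "invariant f = (0, 0)" using ker[OF f] by blast
    thus "f \<in> kernel ?Z (integer_mod_group 2 \<times>\<times> integer_mod_group 4) invariant"
      using f by (simp add: kernel_def)
  qed
qed

theorem H1_klein_module: "H1 G T A act \<cong> integer_mod_group 2 \<times>\<times> integer_mod_group 4"
proof -
  have "group_hom (cocycles G T A act) (integer_mod_group 2 \<times>\<times> integer_mod_group 4) invariant"
    by (intro group_hom.intro group_hom_axioms.intro cocycles_group DirProd_group invariant_hom) simp_all
  from group_hom.FactGroup_iso[OF this invariant_surj] show ?thesis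
    by (simp add: H1_def invariant_kernel)
qed

end

section \<open>The Picard group of the surface and its Galois action\<close>

subsection \<open>The coordinate ring\<close>

lemma ring_of_type_simps:
  "carrier ring_of_type_algebra = UNIV" "monoid.mult ring_of_type_algebra = (*)"
  "add ring_of_type_algebra = (+)" "\<one>\<^bsub>ring_of_type_algebra\<^esub> = 1" "\<zero>\<^bsub>ring_of_type_algebra\<^esub> = 0"
  by (simp_all add: ring_of_type_algebra_def)

definition map3 :: "('a::comm_ring_1 \<Rightarrow> 'b::comm_ring_1) \<Rightarrow> 'a poly poly poly \<Rightarrow> 'b poly poly poly" where
  "map3 f = map_poly (map_poly (map_poly f))"

text \<open>
  Written as an evaluation, the map is seen to be a ring homomorphism.
\<close>

lemma map_poly_ev1: "ringhom f \<Longrightarrow> map_poly f = ev1 (\<lambda>c. [:f c:]) [:0, 1:]"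
proof
  fix p :: "'a poly" assume f: "ringhom f"
  have g: "ringhom (\<lambda>c. [:f c:])" using ringhom_comp[OF f ringhom_const] .
  show "map_poly f p = ev1 (\<lambda>c. [:f c:]) [:0, 1:] p"
    by (induction p) (simp_all add: ev1_pCons[OF g] map_poly_pCons ringhomD(4)[OF f])
qed

lemma ringhom_map_poly: "ringhom f \<Longrightarrow> ringhom (map_poly f)"
  by (simp add: map_poly_ev1 ringhom_ev1 ringhom_comp[OF _ ringhom_const])

lemma ringhom_map3: "ringhom f \<Longrightarrow> ringhom (map3 f)"
  unfolding map3_def by (intro ringhom_map_poly)

lemma map3_gens:
  assumes "ringhom f"
  shows "map3 f (C3 c) = C3 (f c)" "map3 f X3 = X3" "map3 f Y3 = Y3" "map3 f Z3 = Z3"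
  using ringhomD(1,4)[OF assms] ringhomD(1,4)[OF ringhom_map_poly[OF assms]]
    ringhomD(1,4)[OF ringhom_map_poly[OF ringhom_map_poly[OF assms]]]
  unfolding map3_def by (simp_all add: map_poly_pCons)

lemma map3_inverse:
  assumes "ringhom f" "ringhom g" "\<And>c. f (g c) = c"
  shows "map3 f (map3 g p) = p"
proof -
  have "(\<lambda>p. map3 f (map3 g p)) p = (\<lambda>p. p) p"
    by (rule ringhom_unique3[of "\<lambda>p. map3 f (map3 g p)" "\<lambda>p. p"])
      (simp_all only: ringhom_comp[OF ringhom_map3[OF assms(2)] ringhom_map3[OF assms(1)]]
        map3_gens[OF assms(1)] map3_gens[OF assms(2)] assms(3), simp add: ringhom_def)
  thus ?thesis by simp
qed

context markoff
begin

definition RR :: "'c poly poly poly set ring" where "RR = coordinate_ring (al^2) (mu^2)"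

text \<open>
  The class of a polynomial in the coordinate ring, described by divisibility.
\<close>

definition coset :: "'c poly poly poly \<Rightarrow> 'c poly poly poly set" where
  "coset G = {H. fpoly dvd H - G}"

text \<open>
  The map induced by \<open>phi3\<close> on the coordinate ring.
\<close>

definition psi :: "'c poly poly poly set \<Rightarrow> 'c poly poly fract" where
  "psi C = the_elem (phi3 ` C)"

lemma ring_hom_phi3: "ring_hom_ring (ring_of_type_algebra :: 'c poly poly poly ring) ring_of_type_algebra phi3"
  by (rule ring_hom_ringI)
    (auto simp: ring_of_type_simps phi3_hom intro: comm_ring_1_class.ring_from_type_algebra)

lemma principal_ideal: "PIdl\<^bsub>ring_of_type_algebra\<^esub> fpoly = a_kernel ring_of_type_algebra ring_of_type_algebra phi3"
proof -
  have "PIdl\<^bsub>ring_of_type_algebra\<^esub> fpoly = {H * fpoly | H. True}"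
    unfolding cgenideal_def by (simp add: ring_of_type_simps)
  also have "\<dots> = {G. phi3 G = 0}" unfolding phi3_eq_0_iff by (auto simp: dvd_def mult.commute)
  finally show ?thesis by (simp add: a_kernel_def kernel_def ring_of_type_simps)
qed

lemma RR_eq: "RR = ring_of_type_algebra Quot (a_kernel ring_of_type_algebra ring_of_type_algebra phi3)"
  unfolding RR_def coordinate_ring_def fpoly_def[symmetric] principal_ideal ..

lemma psi_iso: "psi \<in> ring_iso RR (ring_of_type_algebra\<lparr>carrier := SS\<rparr>)"
proof -
  interpret ring_hom_ring "ring_of_type_algebra :: 'c poly poly poly ring" ring_of_type_algebra phi3
    by (rule ring_hom_phi3)
  show ?thesis using FactRing_iso_set_aux by (simp add: RR_eq psi_def[abs_def] SS_def ring_of_type_simps)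
qed

lemma carrier_RR: "carrier RR = range coset"
proof -
  have "a_r_coset ring_of_type_algebra (PIdl\<^bsub>ring_of_type_algebra\<^esub> fpoly) G = coset G" for G
    unfolding principal_ideal
    by (auto simp: a_r_coset_def' a_kernel_def kernel_def ring_of_type_simps phi3_eq_0_iff coset_def)
  thus ?thesis
    unfolding RR_def coordinate_ring_def fpoly_def[symmetric] FactRing_def
    by (auto simp: A_RCOSETS_def' ring_of_type_simps)
qed

lemma psi_coset: "psi (coset G) = phi3 G"
proof -
  have "phi3 H = phi3 G" if "H \<in> coset G" for H
  proof -
    have "phi3 (H - G) = 0" using that unfolding coset_def phi3_eq_0_iff by simp
    thus ?thesis by (simp add: phi3_hom)
  qed
  moreover have "G \<in> coset G" by (simp add: coset_def)
  ultimately have "phi3 ` coset G = {phi3 G}" by blast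
  thus ?thesis by (simp add: psi_def)
qed

lemma psi_image: "psi ` carrier RR = SS"
  unfolding carrier_RR SS_def by (auto simp: psi_coset image_image)

lemma psi_ring_in_field: "ring_in_field RR psi"
proof -
  interpret ring_hom_ring "ring_of_type_algebra :: 'c poly poly poly ring" ring_of_type_algebra phi3
    by (rule ring_hom_phi3)
  interpret Q: ideal "a_kernel ring_of_type_algebra ring_of_type_algebra phi3" "ring_of_type_algebra :: 'c poly poly poly ring"
    by (rule kernel_is_ideal)
  have "cring RR" unfolding RR_eq
    by (rule Q.quotient_is_cring) (rule comm_ring_1_class.cring_from_type_algebra)
  thus ?thesis
  proof (rule ring_in_field.intro, unfold_locales)
    show "inj_on psi (carrier RR)" using psi_iso by (auto simp: ring_iso_def bij_betw_def)
  qed (use psi_iso in \<open>auto simp: ring_iso_def ring_hom_def ring_of_type_simps\<close>)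
qed

sublocale pic: ring_in_field RR psi
  rewrites "psi ` carrier RR = SS"
  by (rule psi_ring_in_field) (rule psi_image)

lemma coset_ops:
  "coset G \<in> carrier RR" "coset G \<oplus>\<^bsub>RR\<^esub> coset H = coset (G + H)" "coset G \<otimes>\<^bsub>RR\<^esub> coset H = coset (G * H)"
  "\<one>\<^bsub>RR\<^esub> = coset 1"
proof -
  have c: "coset G \<in> carrier RR" for G unfolding carrier_RR by simp
  show "coset G \<in> carrier RR" by (rule c)
  note inj = inj_onD[OF pic.psi_inj]
  show "coset G \<oplus>\<^bsub>RR\<^esub> coset H = coset (G + H)"
    by (rule inj) (simp_all add: c pic.a_closed psi_coset phi3_hom)
  show "coset G \<otimes>\<^bsub>RR\<^esub> coset H = coset (G * H)"
    by (rule inj) (simp_all add: c pic.m_closed psi_coset phi3_hom)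
  show "\<one>\<^bsub>RR\<^esub> = coset 1"
    by (rule inj) (simp_all add: c psi_coset phi3_hom)
qed


subsection \<open>Classes of ideals\<close>

text \<open>
  The isomorphism of \<open>\<int>\<^sup>4\<close> with the Picard group.
\<close>

definition lattice_class :: "int \<times> int \<times> int \<times> int \<Rightarrow> ('c poly poly poly set, 'c poly poly poly set list) module set" where
  "lattice_class = (\<lambda>(p, a, b, c). pic.Phi (basis_ideal p a b c))"

lemma Phi_has_class: assumes "has_class I p a b c" shows "pic.Phi I = lattice_class (p, a, b, c)"
proof -
  obtain u where "u \<noteq> 0" "scale u I = basis_ideal p a b c" "I \<in> carrier Inv" using assms by (auto simp: has_class_def)
  thus ?thesis using pic.Phi_eq_iff[OF _ basis_ideal_closed, of I p a b c] by (simp add: lattice_class_def) metis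
qed

lemma lattice_class_add: "lattice_class (u + v) = lattice_class u \<otimes>\<^bsub>Pic RR\<^esub> lattice_class v"
proof -
  obtain p a b c where u: "u = (p, a, b, c)" by (cases u)
  obtain p' a' b' c' where v: "v = (p', a', b', c')" by (cases v)
  have "pic.Phi (basis_ideal p a b c) \<otimes>\<^bsub>Pic RR\<^esub> pic.Phi (basis_ideal p' a' b' c') = pic.Phi (iprod (basis_ideal p a b c) (basis_ideal p' a' b' c'))"
    by (rule pic.Pic_mult[OF basis_ideal_closed basis_ideal_closed])
  also have "iprod (basis_ideal p a b c) (basis_ideal p' a' b' c') = basis_ideal (p + p') (a + a') (b + b') (c + c')"
    using basis_ideal_add[of p a b c p' a' b' c'] by simp
  finally show ?thesis by (simp add: u v lattice_class_def)
qed

lemma lattice_class_bij: "bij_betw lattice_class UNIV (carrier (Pic RR))"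
  unfolding bij_betw_def
proof
  have ker: "v = 0" if "lattice_class v = \<one>\<^bsub>Pic RR\<^esub>" for v
  proof -
    obtain p a b c where v: "v = (p, a, b, c)" by (cases v)
    have "pic.Phi SS = pic.Phi (basis_ideal p a b c)" using that by (simp add: v lattice_class_def pic.Pic_one)
    then obtain u where "u \<noteq> 0" "basis_ideal p a b c = scale u SS"
      using pic.Phi_eq_iff[OF S_Inv basis_ideal_closed] by blast
    thus ?thesis using basis_ideal_principal[of p a b c u] by (simp add: v zero_prod_def)
  qed
  interpret P: comm_group "Pic RR" by (rule pic.Pic_comm_group)
  have cl: "lattice_class v \<in> carrier (Pic RR)" for v
    by (cases v) (simp add: lattice_class_def pic.Pic_carrier basis_ideal_closed)
  have E0: "lattice_class 0 = \<one>\<^bsub>Pic RR\<^esub>"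
    using lattice_class_add[of 0 0] cl[of 0] by (metis P.l_cancel_one add.right_neutral)
  show "inj lattice_class"
  proof (rule injI)
    fix u v assume "lattice_class u = lattice_class v"
    hence "lattice_class (u - v) \<otimes>\<^bsub>Pic RR\<^esub> lattice_class v = lattice_class v" using lattice_class_add[of "u - v" v] by simp
    hence "lattice_class (u - v) = \<one>\<^bsub>Pic RR\<^esub>" using cl P.r_cancel_one by metis
    thus "u = v" using ker by fastforce
  qed
  show "range lattice_class = carrier (Pic RR)"
  proof
    show "range lattice_class \<subseteq> carrier (Pic RR)" using cl by blast
    show "carrier (Pic RR) \<subseteq> range lattice_class"
    proof
      fix C assume "C \<in> carrier (Pic RR)"
      then obtain I where I: "I \<in> carrier Inv" "C = pic.Phi I" unfolding pic.Pic_carrier by blast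
      obtain p a b c where "has_class I p a b c" using has_class_exists[OF I(1)] by blast
      thus "C \<in> range lattice_class" unfolding I(2) by (simp add: Phi_has_class)
    qed
  qed
qed

text \<open>
  Conjugation of ideals is only meaningful for integral ideals; every class contains one.
\<close>

lemma integral_representative:
  assumes "C \<in> carrier (Pic RR)"
  obtains I where "I \<in> carrier Inv" "I \<subseteq> SS" "C = pic.Phi I"
proof -
  obtain I where I: "I \<in> carrier Inv" "C = pic.Phi I" using assms unfolding pic.Pic_carrier by blast
  obtain u where u: "u \<noteq> 0" "scale u I \<subseteq> SS" using Inv_integral[OF I(1)] .
  have "scale u I \<in> carrier Inv" by (rule scale_Inv) (use I u in auto)
  moreover have "C = pic.Phi (scale u I)"
    unfolding I(2) using pic.Phi_eq_iff[OF I(1) calculation] u(1) by blast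
  ultimately show ?thesis using that u(2) by blast
qed

end

subsection \<open>The Galois action on the Picard group\<close>

text \<open>
  An automorphism of the constants that changes the signs of \<open>\<alpha>\<close> and \<open>\<mu>\<close> as given by
  \<open>x\<close> and \<open>y\<close>; the sign of \<open>\<delta>\<close> is the product of both.
\<close>

locale markoff_auto = markoff al mu de
  for al mu de :: "'c::{field_char_0, factorial_ring_gcd, semiring_gcd_mult_normalize}" +
  fixes f :: "'c \<Rightarrow> 'c" and x y :: bool
  assumes f_hom: "ringhom f" and f_bij: "bij f"
    and f_al: "f al = (if x then al else - al)" and f_mu: "f mu = (if y then mu else - mu)"
    and f_de: "f de = (if x = y then de else - de)"
begin

abbreviation "sg \<equiv> galois_coordinate_ring f"
abbreviation "th \<equiv> galois_coordinate_ring (inv_into UNIV f)"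

lemma f_inv: "f (inv_into UNIV f c) = c" "inv_into UNIV f (f c) = c"
  using f_bij by (simp_all add: bij_def surj_f_inv_f)

lemma ringhom_f_inv: "ringhom (inv_into UNIV f)"
  unfolding ringhom_def using f_inv ringhomD(1,2,3)[OF f_hom] by (metis (mono_tags))

lemma galois_image: "galois_coordinate_ring g C = map3 g ` C"
  by (simp add: galois_coordinate_ring_def map3_def)

lemma map3_f_inv: "map3 f (map3 (inv_into UNIV f) p) = p" "map3 (inv_into UNIV f) (map3 f p) = p"
  by (rule map3_inverse[OF f_hom ringhom_f_inv f_inv(1)], rule map3_inverse[OF ringhom_f_inv f_hom f_inv(2)])

lemma f_squares: "f (al^2) = al^2" "f (mu^2) = mu^2"
  by (simp_all add: ringhomD[OF f_hom] f_al f_mu)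

lemma map3_fpoly: "map3 f fpoly = fpoly"
  unfolding fpoly_eq by (simp only: ringhomD[OF ringhom_map3[OF f_hom]] map3_gens[OF f_hom] f_squares)

lemma map3_inv_fpoly: "map3 (inv_into UNIV f) fpoly = fpoly"
  using map3_f_inv(2)[of fpoly] by (simp add: map3_fpoly)

lemma sg_coset: "sg (coset G) = coset (map3 f G)"
proof -
  have dv: "map3 g p dvd map3 g q" if g: "ringhom g" and pq: "p dvd q" for g :: "'c \<Rightarrow> 'c" and p q
  proof -
    obtain r where "q = p * r" using pq by (rule dvdE)
    thus ?thesis by (simp add: ringhomD(3)[OF ringhom_map3[OF g]])
  qed
  note d = ringhomD(6)[OF ringhom_map3]
  have "map3 f H \<in> coset (map3 f G)" if "H \<in> coset G" for H
  proof -
    have "map3 f fpoly dvd map3 f (H - G)" by (rule dv[OF f_hom]) (use that in \<open>simp add: coset_def\<close>)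
    thus ?thesis by (simp add: coset_def map3_fpoly d[OF f_hom])
  qed
  hence "map3 f ` coset G \<subseteq> coset (map3 f G)" by blast
  moreover have "H \<in> map3 f ` coset G" if "H \<in> coset (map3 f G)" for H
  proof (rule image_eqI)
    show "H = map3 f (map3 (inv_into UNIV f) H)" by (simp add: map3_f_inv)
    show "map3 (inv_into UNIV f) H \<in> coset G"
    proof -
      have "map3 (inv_into UNIV f) fpoly dvd map3 (inv_into UNIV f) (H - map3 f G)"
        by (rule dv[OF ringhom_f_inv]) (use that in \<open>simp add: coset_def\<close>)
      thus ?thesis by (simp add: coset_def map3_inv_fpoly d[OF ringhom_f_inv] map3_f_inv)
    qed
  qed
  ultimately show ?thesis unfolding galois_image by blast
qed

lemma th_coset: "th (coset G) = coset (map3 (inv_into UNIV f) G)"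
proof -
  have "th (sg (coset (map3 (inv_into UNIV f) G))) = coset (map3 (inv_into UNIV f) G)"
    unfolding galois_image by (simp add: image_image map3_f_inv)
  thus ?thesis by (simp add: sg_coset map3_f_inv)
qed

sublocale ga: ring_in_field_auto RR psi sg th
  rewrites "psi ` carrier RR = SS"
proof -
  have c: "\<exists>G. C = coset G" if "C \<in> carrier RR" for C using that unfolding carrier_RR by blast
  note h = ringhomD[OF ringhom_map3[OF f_hom]]
  show "ring_in_field_auto RR psi sg th"
  proof (rule ring_in_field_auto.intro[OF psi_ring_in_field], unfold_locales)
    fix C assume "C \<in> carrier RR"
    then obtain G where C: "C = coset G" using c by blast
    show "sg C \<in> carrier RR" "th C \<in> carrier RR" by (simp_all add: C sg_coset th_coset coset_ops(1))
    fix D assume "D \<in> carrier RR"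
    then obtain H where D: "D = coset H" using c by blast
    show "sg (C \<oplus>\<^bsub>RR\<^esub> D) = sg C \<oplus>\<^bsub>RR\<^esub> sg D" "sg (C \<otimes>\<^bsub>RR\<^esub> D) = sg C \<otimes>\<^bsub>RR\<^esub> sg D"
      by (simp_all add: C D sg_coset coset_ops h)
  next
    show "sg \<one>\<^bsub>RR\<^esub> = \<one>\<^bsub>RR\<^esub>" by (simp only: coset_ops sg_coset h)
    show "sg (th C) = C" "th (sg C) = C" for C unfolding galois_image by (simp_all add: image_image map3_f_inv)
  qed
  show "psi ` carrier RR = SS" by (rule psi_image)
qed

lemma galois_Phi:
  assumes "I \<in> carrier Inv" "I \<subseteq> SS"
  shows "galois_Pic f (pic.Phi I) = pic.Phi (pic.conj_ideal sg I)"
  unfolding galois_Pic_def by (rule ga.restrict_Phi[OF assms])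

lemma galois_closed: assumes "C \<in> carrier (Pic RR)" shows "galois_Pic f C \<in> carrier (Pic RR)"
proof -
  obtain I where I: "I \<in> carrier Inv" "I \<subseteq> SS" "C = pic.Phi I" using assms by (rule integral_representative)
  show ?thesis unfolding I(3) galois_Phi[OF I(1,2)] pic.Pic_carrier
    by (rule imageI) (rule ga.conj_Inv[OF I(1,2)])
qed

text \<open>
  Integral representatives reduce this to the compatibility of conjugation with products of ideals.
\<close>

lemma galois_mult:
  assumes "C \<in> carrier (Pic RR)" "D \<in> carrier (Pic RR)"
  shows "galois_Pic f (C \<otimes>\<^bsub>Pic RR\<^esub> D) = galois_Pic f C \<otimes>\<^bsub>Pic RR\<^esub> galois_Pic f D"
proof -
  obtain I where I: "I \<in> carrier Inv" "I \<subseteq> SS" "C = pic.Phi I" using assms(1) by (rule integral_representative)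
  obtain J where J: "J \<in> carrier Inv" "J \<subseteq> SS" "D = pic.Phi J" using assms(2) by (rule integral_representative)
  have IJ: "iprod I J \<in> carrier Inv" using Inv.m_closed[OF I(1) J(1)] by simp
  have IJ_sub: "iprod I J \<subseteq> SS" using iprod_subset'[of I J] I J InvD by blast
  have sub: "submod I" "submod J" using I J InvD by blast+
  show ?thesis
    unfolding I(3) J(3) pic.Pic_mult[OF I(1) J(1)] galois_Phi[OF IJ IJ_sub] galois_Phi[OF I(1,2)] galois_Phi[OF J(1,2)]
      pic.Pic_mult[OF ga.conj_Inv[OF I(1,2)] ga.conj_Inv[OF J(1,2)]] ga.conj_iprod[OF I(2) J(2) sub] ..
qed

lemma lam_map3:
  "lam (map_poly f p, map_poly f q, map_poly f r) (map3 f G) = map_poly f (lam (p, q, r) G)"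
proof -
  note h = ringhom_map3[OF f_hom] and m = ringhom_map_poly[OF f_hom]
  have c: "map_poly f [:c:] = [:f c:]" for c using ringhomD(4)[OF f_hom] by (simp add: map_poly_pCons)
  show ?thesis
    by (rule ringhom_unique3[OF ringhom_comp[OF h ringhom_lam] ringhom_comp[OF ringhom_lam m]])
      (simp_all only: map3_gens[OF f_hom] lam_gens c)
qed

lemma map_poly_f_eq_0: "map_poly f p = 0 \<longleftrightarrow> p = 0"
proof -
  have "f c = 0 \<longleftrightarrow> c = 0" for c using f_inv(2) ringhomD(4)[OF f_hom] by metis
  thus ?thesis by (simp add: map_poly_eq_0_iff ringhomD(4)[OF f_hom])
qed

text \<open>
  Restriction to the conjugate line of the conjugate function is the conjugate of the restriction.
\<close>

lemma conj_line:
  assumes "on_surface (p, q, r)"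
  shows "pic.conj_ideal sg (line (p, q, r)) = line (map_poly f p, map_poly f q, map_poly f r)"
proof -
  have "pic.conj_ideal sg (line (p, q, r)) = {phi3 (map3 f G) | G. lam (p, q, r) G = 0}"
    unfolding pic.conj_ideal_def carrier_RR
    by (simp add: sg_coset psi_coset phi3_mem_line[OF assms] conj_commute image_iff Bex_def)
      (metis (no_types, lifting) sg_coset psi_coset phi3_mem_line[OF assms])
  also have "\<dots> = line (map_poly f p, map_poly f q, map_poly f r)"
  proof (intro equalityI subsetI)
    fix z assume "z \<in> {phi3 (map3 f G) | G. lam (p, q, r) G = 0}"
    then obtain G where G: "z = phi3 (map3 f G)" "lam (p, q, r) G = 0" by blast
    have "lam (map_poly f p, map_poly f q, map_poly f r) (map3 f G) = 0" by (simp add: lam_map3 G(2))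
    thus "z \<in> line (map_poly f p, map_poly f q, map_poly f r)" unfolding line_def G(1) by blast
  next
    fix z assume "z \<in> line (map_poly f p, map_poly f q, map_poly f r)"
    then obtain H where H: "z = phi3 H" "lam (map_poly f p, map_poly f q, map_poly f r) H = 0"
      unfolding line_def by blast
    define G where "G = map3 (inv_into UNIV f) H"
    have HG: "H = map3 f G" by (simp add: G_def map3_f_inv)
    have "lam (p, q, r) G = 0" using H(2) unfolding HG lam_map3 map_poly_f_eq_0 .
    thus "z \<in> {phi3 (map3 f G) | G. lam (p, q, r) G = 0}" unfolding H(1) HG by blast
  qed
  finally show ?thesis .
qed

lemma map_line: "map_poly f [:c:] = [:f c:]" "map_poly f [:c, d:] = [:f c, f d:]"
  using ringhomD(4)[OF f_hom] by (auto simp: map_poly_pCons)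

lemma conj_line1:
  assumes "on_surface (line1 c t d)"
  shows "pic.conj_ideal sg (line (line1 c t d)) = line (line1 (f c) (f t) (f d))"
  using conj_line[OF assms[unfolded line1_def]] unfolding line1_def map_line
  by (simp add: ringhomD(1,4)[OF f_hom])

lemma conj_line2:
  assumes "on_surface (line2 c t)"
  shows "pic.conj_ideal sg (line (line2 c t)) = line (line2 (f c) (f t))"
  using conj_line[OF assms[unfolded line2_def]] unfolding line2_def map_line
  by (simp add: ringhomD(1,4)[OF f_hom])

lemma f_divide: "f (c / d) = f c / f d"
proof (cases "d = 0")
  case False
  have "f (c / d) * f d = f c" using False by (simp flip: ringhomD(3)[OF f_hom])
  moreover have "f d \<noteq> 0" using False f_inv(2) ringhomD(4)[OF f_hom] by metis
  ultimately show ?thesis by (simp add: eq_divide_eq)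
qed (simp add: ringhomD[OF f_hom])

lemma f_r1: "f r1 = (if y then (if x then r1 else r2) else (if x then - r1 else - r2))"
  unfolding r1_def r2_def f_divide using f_mu f_de
  by (auto simp: ringhomD[OF f_hom] minus_divide_left)

text \<open>
  The lines \<open>P\<^sub>0, A, B, C\<close> are mapped to lines whose classes are known from the relations between the
  lines.
\<close>

lemma galois_basis:
  "galois_Pic f (lattice_class (1, 0, 0, 0)) = lattice_class (twist x y (1, 0, 0, 0))"
  "galois_Pic f (lattice_class (0, 1, 0, 0)) = lattice_class (twist x y (0, 1, 0, 0))"
  "galois_Pic f (lattice_class (0, 0, 1, 0)) = lattice_class (twist x y (0, 0, 1, 0))"
  "galois_Pic f (lattice_class (0, 0, 0, 1)) = lattice_class (twist x y (0, 0, 0, 1))"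
proof -
  have sub: "P0 \<subseteq> SS" "LA \<subseteq> SS" "LB \<subseteq> SS" "LC \<subseteq> SS"
    unfolding P0_def LA_def LB_def LC_def by (rule line_subset)+
  have c: "galois_Pic f (lattice_class (1, 0, 0, 0)) = pic.Phi (pic.conj_ideal sg P0)"
    "galois_Pic f (lattice_class (0, 1, 0, 0)) = pic.Phi (pic.conj_ideal sg LA)"
    "galois_Pic f (lattice_class (0, 0, 1, 0)) = pic.Phi (pic.conj_ideal sg LB)"
    "galois_Pic f (lattice_class (0, 0, 0, 1)) = pic.Phi (pic.conj_ideal sg LC)"
    by (simp_all only: Phi_has_class[OF has_class_basis(1), symmetric] Phi_has_class[OF has_class_basis(2), symmetric]
      Phi_has_class[OF has_class_basis(3), symmetric] Phi_has_class[OF has_class_basis(4), symmetric] galois_Phi lines_Inv sub)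
  have "pic.conj_ideal sg P0 = (if y then (if x then P0 else P1) else (if x then P2 else P3))"
    unfolding P0_def P1_def P2_def P3_def conj_line2[OF on_surface_lines(1)] by (simp add: f_mu f_r1)
  thus "galois_Pic f (lattice_class (1, 0, 0, 0)) = lattice_class (twist x y (1, 0, 0, 0))"
    unfolding c using Phi_has_class[OF has_class_basis(1)] Phi_has_class[OF has_class_conjugates(1)] Phi_has_class[OF has_class_P2] Phi_has_class[OF has_class_P3]
    by (simp add: twist_def)
  have num: "f 2 = 2" "f (- 2) = - 2" "f 1 = 1" "f (- 1) = - 1" "f 0 = 0" by (simp_all add: ringhomD[OF f_hom])
  have "pic.conj_ideal sg LA = (if x = y then LA else LA')"
    unfolding LA_def LA'_def conj_line1[OF on_surface_lines(5)] by (simp add: f_de num)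
  thus "galois_Pic f (lattice_class (0, 1, 0, 0)) = lattice_class (twist x y (0, 1, 0, 0))"
    unfolding c using Phi_has_class[OF has_class_basis(2)] Phi_has_class[OF has_class_conjugates(2)]
    by (simp add: twist_def)
  have "pic.conj_ideal sg LB = (if x = y then LB else LB')"
    unfolding LB_def LB'_def conj_line1[OF on_surface_lines(7)] by (simp add: f_de num ringhomD(5)[OF f_hom])
  thus "galois_Pic f (lattice_class (0, 0, 1, 0)) = lattice_class (twist x y (0, 0, 1, 0))"
    unfolding c using Phi_has_class[OF has_class_basis(3)] Phi_has_class[OF has_class_conjugates(3)]
    by (simp add: twist_def)
  have "pic.conj_ideal sg LC = (if y then (if x then LC else LD') else (if x then LD else LC'))"
    unfolding LC_def LC'_def LD_def LD'_def conj_line1[OF on_surface_lines(9)]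
    by (simp add: f_mu f_r1 f_al f_divide num)
  thus "galois_Pic f (lattice_class (0, 0, 0, 1)) = lattice_class (twist x y (0, 0, 0, 1))"
    unfolding c using Phi_has_class[OF has_class_basis(4)] Phi_has_class[OF has_class_conjugates(4)] Phi_has_class[OF has_class_LD] Phi_has_class[OF has_class_LD']
    by (simp add: twist_def)
qed

text \<open>
  Both sides are homomorphisms of the lattice, so they agree if they agree on the basis.
\<close>

lemma galois_lattice_class: "galois_Pic f (lattice_class v) = lattice_class (twist x y v)"
proof -
  interpret P: comm_group "Pic RR" by (rule pic.Pic_comm_group)
  have cl: "lattice_class v \<in> carrier (Pic RR)" for v using lattice_class_bij by (auto simp: bij_betw_def)
  define D where "D = {v. galois_Pic f (lattice_class v) = lattice_class (twist x y v)}"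
  have add: "u + v \<in> D" if "u \<in> D" "v \<in> D" for u v
    using that unfolding D_def by (simp add: lattice_class_add galois_mult cl twist_add)
  have E0: "lattice_class 0 = \<one>\<^bsub>Pic RR\<^esub>"
    using lattice_class_add[of 0 0] cl[of 0] by (metis P.l_cancel_one add.right_neutral)
  have neg: "- v \<in> D" if "v \<in> D" for v
  proof -
    have g1: "galois_Pic f \<one>\<^bsub>Pic RR\<^esub> = \<one>\<^bsub>Pic RR\<^esub>"
      using galois_mult[OF P.one_closed P.one_closed] galois_closed[OF P.one_closed]
      by (metis P.l_cancel_one P.l_one P.one_closed)
    have "galois_Pic f (lattice_class (- v)) \<otimes>\<^bsub>Pic RR\<^esub> lattice_class (twist x y v) = galois_Pic f (lattice_class (- v + v))"
      using that unfolding D_def by (simp only: lattice_class_add galois_mult cl mem_Collect_eq)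
    also have "\<dots> = lattice_class (twist x y (- v) + twist x y v)"
      unfolding twist_add[symmetric] by (simp add: E0 g1) (simp add: twist_def zero_prod_def flip: E0)
    finally have "galois_Pic f (lattice_class (- v)) \<otimes>\<^bsub>Pic RR\<^esub> lattice_class (twist x y v) = lattice_class (twist x y (- v)) \<otimes>\<^bsub>Pic RR\<^esub> lattice_class (twist x y v)"
      unfolding lattice_class_add .
    hence "galois_Pic f (lattice_class (- v)) = lattice_class (twist x y (- v))"
      using P.r_cancel cl galois_closed by metis
    thus ?thesis by (simp add: D_def)
  qed
  have mult: "(k * p, k * a, k * b, k * c) \<in> D" if "(p, a, b, c) \<in> D" for k p a b c
  proof (induction k rule: int_induct[of _ 1])
    case base thus ?case using that by simp
  next
    case (step1 i)
    thus ?case using add[OF _ that, of "(i * p, i * a, i * b, i * c)"] by (simp add: algebra_simps)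
  next
    case (step2 i)
    thus ?case using add[OF _ neg[OF that], of "(i * p, i * a, i * b, i * c)"] by (simp add: algebra_simps)
  qed
  obtain p a b c where v: "v = (p, a, b, c)" by (cases v)
  have "(p, 0, 0, 0) \<in> D" "(0, a, 0, 0) \<in> D" "(0, 0, b, 0) \<in> D" "(0, 0, 0, c) \<in> D"
    using mult[of 1 0 0 0 p] mult[of 0 1 0 0 a] mult[of 0 0 1 0 b] mult[of 0 0 0 1 c] galois_basis
    by (simp_all add: D_def)
  from add[OF this(1) add[OF this(2) add[OF this(3,4)]]] show ?thesis by (simp add: v D_def)
qed

end

section \<open>The cohomology of the Picard group\<close>

theorem lemma5p1:
  fixes a m :: "'k::field_char_0"
    and sqrt_a sqrt_m sqrt_m4a sqrt_ma :: "'k alg_closure"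
  assumes "a \<noteq> 0" and "\<nexists>b. a = b^2" and "m \<noteq> 0" and "m \<noteq> 4 * a"
    and "sqrt_a^2 = to_ac a" and "sqrt_m^2 = to_ac m"
    and "sqrt_m4a^2 = to_ac (m - 4 * a)" and "sqrt_ma^2 = to_ac (m * a)"
    and "ring.dimension ring_of_type_algebra 4 (range to_ac)
           (generate_field ring_of_type_algebra (range to_ac \<union> {sqrt_a, sqrt_m, sqrt_m4a}))"
    and "sqrt_m4a / sqrt_ma \<in> range to_ac"
  shows "H1_Pic_surface a m \<cong> integer_mod_group 2 \<times>\<times> integer_mod_group 4"
proof -
  note a0 = assms(1) and a_nonsquare = assms(2) and m0 = assms(3)
  have sq: "sqrt_a * sqrt_a = to_ac a" "sqrt_m * sqrt_m = to_ac m"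
    using assms(5,6) by (simp_all add: power2_eq_square)
  have nz: "sqrt_a \<noteq> 0" "sqrt_m \<noteq> 0" "sqrt_ma \<noteq> 0" "sqrt_m4a \<noteq> 0"
  proof -
    have "a \<noteq> 0" "m \<noteq> 0" "m * a \<noteq> 0" "m - 4 * a \<noteq> 0" using assms(1,3,4) by auto
    hence "sqrt_a^2 \<noteq> 0" "sqrt_m^2 \<noteq> 0" "sqrt_ma^2 \<noteq> 0" "sqrt_m4a^2 \<noteq> 0"
      unfolding assms(5-8) to_ac_eq_0_iff by blast+
    thus "sqrt_a \<noteq> 0" "sqrt_m \<noteq> 0" "sqrt_ma \<noteq> 0" "sqrt_m4a \<noteq> 0" by auto
  qed
  obtain r where "sqrt_m4a / sqrt_ma = to_ac r" using assms(10) by blast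
  hence r: "sqrt_m4a = to_ac r * sqrt_ma" using nz(3) by (simp add: divide_eq_eq)
  have nonsquare: "\<nexists>b. m = b^2" "\<nexists>b. a * m = b^2"
    using degree_four_nonsquare[OF a_nonsquare a0 assms(5,6) r assms(8,9)] by blast+
  interpret markoff sqrt_a sqrt_m sqrt_m4a
    by unfold_locales (use nz assms(5-7) in simp_all)
  have RR: "RR = coordinate_ring (to_ac a) (to_ac m)" by (simp only: RR_def assms(5,6))

  let ?G = "absolute_galois_group :: ('k alg_closure \<Rightarrow> 'k alg_closure) monoid"
  define e1 :: "('k alg_closure \<Rightarrow> 'k alg_closure) \<Rightarrow> bool" where "e1 f \<longleftrightarrow> f sqrt_a = sqrt_a" for f
  define e2 :: "('k alg_closure \<Rightarrow> 'k alg_closure) \<Rightarrow> bool" where "e2 f \<longleftrightarrow> f sqrt_m = sqrt_m" for f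
  have ne: "- sqrt_a \<noteq> sqrt_a" "- sqrt_m \<noteq> sqrt_m" using nz(1,2) by (simp_all add: equation_minus_iff)
  have sgn: "f sqrt_a = (if e1 f then sqrt_a else - sqrt_a)" "f sqrt_m = (if e2 f then sqrt_m else - sqrt_m)"
    if f: "f \<in> carrier ?G" for f
  proof -
    have "(f sqrt_a)^2 = sqrt_a^2" "(f sqrt_m)^2 = sqrt_m^2"
      unfolding power2_eq_square galois_auto(3)[OF f, symmetric] sq galois_auto(6)[OF f] by simp_all
    thus "f sqrt_a = (if e1 f then sqrt_a else - sqrt_a)" "f sqrt_m = (if e2 f then sqrt_m else - sqrt_m)"
      unfolding power2_eq_iff by (auto simp: e1_def e2_def)
  qed
  have act: "markoff_auto sqrt_a sqrt_m sqrt_m4a f (e1 f) (e2 f)" if f: "f \<in> carrier ?G" for f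
  proof (unfold_locales)
    note g = galois_auto[OF f]
    show "ringhom f" by (simp add: ringhom_def g)
    show "bij f" by (rule g(1))
    show "f sqrt_a = (if e1 f then sqrt_a else - sqrt_a)" "f sqrt_m = (if e2 f then sqrt_m else - sqrt_m)"
      by (rule sgn[OF f])+
    have "sqrt_ma^2 = (sqrt_a * sqrt_m)^2" by (simp add: assms(5,6,8) power_mult_distrib mult.commute)
    hence "sqrt_ma = sqrt_a * sqrt_m \<or> sqrt_ma = - (sqrt_a * sqrt_m)" by (simp add: power2_eq_iff)
    thus "f sqrt_m4a = (if e1 f = e2 f then sqrt_m4a else - sqrt_m4a)"
      unfolding r by (auto simp: g sgn[OF f])
  qed
  have sign_comp: "e1 (f \<circ> g) = (e1 f = e1 g)" "e2 (f \<circ> g) = (e2 f = e2 g)"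
    if f: "f \<in> carrier ?G" and g: "g \<in> carrier ?G" for f g
    using sgn[OF f] sgn[OF g] galois_auto(7)[OF f] ne
    by (auto simp: e1_def e2_def split: if_splits)
  have "klein_module ?G krull_topology (Pic RR) galois_Pic lattice_class e1 e2"
  proof (rule klein_module.intro)
    show "group ?G" by (rule absolute_galois_group)
    show "comm_group (Pic RR)" by (rule pic.Pic_comm_group)
    show "bij_betw lattice_class UNIV (carrier (Pic RR))" by (rule lattice_class_bij)
    show "lattice_class (u + v) = lattice_class u \<otimes>\<^bsub>Pic RR\<^esub> lattice_class v" for u v by (rule lattice_class_add)
    show "galois_Pic f (lattice_class u) = lattice_class (twist (e1 f) (e2 f) u)" if "f \<in> carrier ?G" for f u
      by (rule markoff_auto.galois_lattice_class[OF act[OF that]])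
    show "e1 (f \<otimes>\<^bsub>?G\<^esub> g) = (e1 f = e1 g)" "e2 (f \<otimes>\<^bsub>?G\<^esub> g) = (e2 f = e2 g)"
      if "f \<in> carrier ?G" "g \<in> carrier ?G" for f g
      using sign_comp[OF that] by simp_all
    obtain s where "s \<in> carrier ?G" "s sqrt_a = - sqrt_a" "s sqrt_m = sqrt_m"
      using sign_automorphism[OF a_nonsquare nonsquare, of sqrt_a "- sqrt_a" sqrt_m sqrt_m] assms(5,6) by auto
    thus "\<exists>s\<in>carrier ?G. \<not> e1 s \<and> e2 s" by (intro bexI[of _ s]) (simp_all add: e1_def e2_def ne)
    obtain t where "t \<in> carrier ?G" "t sqrt_a = sqrt_a" "t sqrt_m = - sqrt_m"
      using sign_automorphism[OF a_nonsquare nonsquare, of sqrt_a sqrt_a sqrt_m "- sqrt_m"] assms(5,6) by auto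
    thus "\<exists>t\<in>carrier ?G. e1 t \<and> \<not> e2 t" by (intro bexI[of _ t]) (simp_all add: e1_def e2_def ne)
    show "topspace krull_topology = carrier ?G" by (rule topspace_krull)
    show "openin krull_topology {f \<in> carrier ?G. e1 f = x \<and> e2 f = y}" for x y
    proof (subst openin_subopen, intro ballI)
      fix f assume f: "f \<in> {f \<in> carrier ?G. e1 f = x \<and> e2 f = y}"
      let ?B = "{g \<in> carrier ?G. \<forall>z\<in>{sqrt_a, sqrt_m}. g z = f z}"
      have "openin krull_topology ?B" by (rule krull_basic_open) (use f in auto)
      moreover have "f \<in> ?B" "?B \<subseteq> {f \<in> carrier ?G. e1 f = x \<and> e2 f = y}" using f by (auto simp: e1_def e2_def)
      ultimately show "\<exists>B. openin krull_topology B \<and> f \<in> B \<and> B \<subseteq> {f \<in> carrier ?G. e1 f = x \<and> e2 f = y}" by blast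
    qed
    fix U f assume U: "openin krull_topology U" "\<one>\<^bsub>?G\<^esub> \<in> U" and f: "f \<in> carrier ?G"
    obtain F where F: "finite F" "{\<tau> \<in> carrier ?G. \<forall>x\<in>F. \<tau> x = \<one>\<^bsub>?G\<^esub> x} \<subseteq> U"
      using krull_neighbourhood[OF U] by blast
    obtain n where n: "n \<ge> 1" "\<forall>x\<in>F. (f ^^ n) x = x" using galois_torsion[OF f F(1)] by blast
    have "f [^]\<^bsub>?G\<^esub> n \<in> carrier ?G"
      by (rule monoid.nat_pow_closed[OF group.is_monoid[OF absolute_galois_group] f])
    hence "f [^]\<^bsub>?G\<^esub> n \<in> U" using F(2) n(2) by (auto simp: galois_pow)
    thus "\<exists>n\<ge>1. f [^]\<^bsub>?G\<^esub> (n :: nat) \<in> U" using n(1) by blast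
  qed
  from klein_module.H1_klein_module[OF this] show ?thesis
    unfolding H1_Pic_surface_def RR .
qed

end
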